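(* Offline All-or-One Paging is $\mathbb{NP}$-complete; that is, the problem of deciding, given a cache size $k$, a request sequence $\sigma$ of All-or-One Paging requests, and an integer $F$, whether $\sigma$ has a solution of cost at most $F$, is $\mathbb{NP}$-complete.
   Context: All-or-One Paging with $k$ slots: each request is either general, $(p,\ast)$, satisfied by a configuration holding page $p$ in any slot, or specific, $(p,j)$ with $j\in[k]$, satisfied only if slot $j$ holds $p$. A configuration assigns to each slot one page or nothing; a solution is a sequence of configurations $C_1,\dots,C_T$ with $C_t$ satisfying the $t$-th request; its cost is the number of retrievals (page $p$ retrieved in slot $s$ at time $t$ if $C_t$ assigns $p$ to $s$ but $C_{t-1}$ does not, or $t=1$). *)

theory Defs
  imports "HOL-Computational_Algebra.Polynomial"
begin

section \<open>Deterministic multi-tape Turing machines\<close>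

text \<open>
  States and tape symbols are initial segments of the naturals, so that machines can be quantified
  over in a definition. Symbol 0 is the blank; the bits 0 and 1 are the symbols 1 and 2.
  A transition maps a state and the scanned symbols to the new state and, for each tape, the symbol
  written and the head movement.
\<close>

record tm =
  num_tapes :: nat
  num_states :: nat
  num_symbols :: nat
  start_state :: nat
  halt_state :: nat
  delta :: "nat \<Rightarrow> nat list \<Rightarrow> nat \<times> (nat \<times> int) list"

definition wf_tm :: "tm \<Rightarrow> bool" where
  "wf_tm M \<longleftrightarrow>
     num_tapes M \<ge> 1 \<and> num_symbols M \<ge> 3 \<and>
     start_state M < num_states M \<and> halt_state M < num_states M \<and>
     (\<forall>q ss. q < num_states M \<longrightarrow> length ss = num_tapes M \<longrightarrow> set ss \<subseteq> {..<num_symbols M} \<longrightarrow>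
        (case delta M q ss of (q', acts) \<Rightarrow>
           q' < num_states M \<and> length acts = num_tapes M \<and>
           set acts \<subseteq> {..<num_symbols M} \<times> {-1, 0, 1}))"

text \<open>A tape is two-way infinite: head position and cell contents.\<close>

type_synonym tape = "int \<times> (int \<Rightarrow> nat)"
type_synonym tm_config = "nat \<times> tape list"

definition read_tape :: "tape \<Rightarrow> nat" where
  "read_tape tp = snd tp (fst tp)"

definition act_tape :: "nat \<times> int \<Rightarrow> tape \<Rightarrow> tape" where
  "act_tape a tp = (fst tp + snd a, (snd tp)(fst tp := fst a))"

definition tm_step :: "tm \<Rightarrow> tm_config \<Rightarrow> tm_config" where
  "tm_step M c = (case c of (q, tps) \<Rightarrow>
     if q = halt_state M then c
     else case delta M q (map read_tape tps) of (q', acts) \<Rightarrow> (q', map2 act_tape acts tps))"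

definition bit_symbol :: "bool \<Rightarrow> nat" where
  "bit_symbol b = (if b then 2 else 1)"

definition string_contents :: "bool list \<Rightarrow> int \<Rightarrow> nat" where
  "string_contents w i = (if 0 \<le> i \<and> i < int (length w) then bit_symbol (w ! nat i) else 0)"

text \<open>The input strings are on the first tapes, in order; all other tapes are blank.\<close>

definition tm_init :: "tm \<Rightarrow> bool list list \<Rightarrow> tm_config" where
  "tm_init M ws = (start_state M,
     map (\<lambda>i. (0, string_contents (if i < length ws then ws ! i else []))) [0..<num_tapes M])"

text \<open>The output is the whole contents of the last tape.\<close>

definition computes_within :: "tm \<Rightarrow> bool list list \<Rightarrow> bool list \<Rightarrow> nat \<Rightarrow> bool" where
  "computes_within M ws w t \<longleftrightarrow>
     (case (tm_step M ^^ t) (tm_init M ws) of (q, tps) \<Rightarrow>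
        q = halt_state M \<and> snd (last tps) = string_contents w)"

section \<open>NP-completeness\<close>

definition polytime_computable :: "nat \<Rightarrow> (bool list list \<Rightarrow> bool list) \<Rightarrow> bool" where
  "polytime_computable m f \<longleftrightarrow>
     (\<exists>M (p :: nat poly). wf_tm M \<and> m \<le> num_tapes M \<and>
        (\<forall>ws. length ws = m \<longrightarrow>
           computes_within M ws (f ws) (poly p (sum_list (map length ws)))))"

text \<open>Polynomial-time verifier for certificates of polynomially bounded length.\<close>

definition in_NP :: "bool list set \<Rightarrow> bool" where
  "in_NP L \<longleftrightarrow>
     (\<exists>v (p :: nat poly). polytime_computable 2 v \<and>
        (\<forall>x. x \<in> L \<longleftrightarrow> (\<exists>u. length u \<le> poly p (length x) \<and> v [x, u] = [True])))"

definition polytime_reducible :: "bool list set \<Rightarrow> bool list set \<Rightarrow> bool" where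
  "polytime_reducible L L' \<longleftrightarrow>
     (\<exists>f. polytime_computable 1 (\<lambda>ws. f (ws ! 0)) \<and> (\<forall>x. x \<in> L \<longleftrightarrow> f x \<in> L'))"

definition NP_hard :: "bool list set \<Rightarrow> bool" where
  "NP_hard L \<longleftrightarrow> (\<forall>L'. in_NP L' \<longrightarrow> polytime_reducible L' L)"

definition NP_complete :: "bool list set \<Rightarrow> bool" where
  "NP_complete L \<longleftrightarrow> in_NP L \<and> NP_hard L"

section \<open>All-or-One Paging\<close>

type_synonym page = nat
type_synonym slot = nat

datatype request = General page | Specific page slot

type_synonym cache = "slot \<rightharpoonup> page"

fun valid_request :: "nat \<Rightarrow> request \<Rightarrow> bool" where
  "valid_request k (General p) \<longleftrightarrow> True"
| "valid_request k (Specific p j) \<longleftrightarrow> j \<in> {1..k}"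

definition is_cache :: "nat \<Rightarrow> cache \<Rightarrow> bool" where
  "is_cache k C \<longleftrightarrow> dom C \<subseteq> {1..k}"

fun satisfies :: "nat \<Rightarrow> cache \<Rightarrow> request \<Rightarrow> bool" where
  "satisfies k C (General p) \<longleftrightarrow> (\<exists>s\<in>{1..k}. C s = Some p)"
| "satisfies k C (Specific p j) \<longleftrightarrow> C j = Some p"

definition is_solution :: "nat \<Rightarrow> request list \<Rightarrow> cache list \<Rightarrow> bool" where
  "is_solution k \<sigma> Cs \<longleftrightarrow>
     length Cs = length \<sigma> \<and>
     (\<forall>t < length \<sigma>. is_cache k (Cs ! t) \<and> satisfies k (Cs ! t) (\<sigma> ! t))"

text \<open>Times are counted from 0.\<close>

definition retrievals :: "cache list \<Rightarrow> (page \<times> slot \<times> nat) set" where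
  "retrievals Cs = {(p, s, t). t < length Cs \<and> (Cs ! t) s = Some p \<and>
                               (t = 0 \<or> (Cs ! (t - 1)) s \<noteq> Some p)}"

definition cost :: "cache list \<Rightarrow> nat" where
  "cost Cs = card (retrievals Cs)"

lemma finite_retrievals:
  assumes "is_solution k \<sigma> Cs"
  shows "finite (retrievals Cs)"
proof (rule finite_subset)
  let ?f = "\<lambda>(s, t). (the ((Cs ! t) s), s, t)"
  show "retrievals Cs \<subseteq> ?f ` ({1..k} \<times> {..<length Cs})"
  proof
    fix x assume "x \<in> retrievals Cs"
    then obtain p s t where x: "x = (p, s, t)" "t < length Cs" "(Cs ! t) s = Some p"
      by (auto simp: retrievals_def)
    with assms have "s \<in> {1..k}" unfolding is_solution_def is_cache_def by (metis domI subsetD)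
    with x have "x = ?f (s, t)" "(s, t) \<in> {1..k} \<times> {..<length Cs}" by auto
    then show "x \<in> ?f ` ({1..k} \<times> {..<length Cs})" by (rule image_eqI)
  qed
qed auto

section \<open>Encoding of instances as bit strings\<close>

text \<open>
  All numbers are written in binary, least significant bit first. Each bit of a number, and each
  request of a sequence, is preceded by 1, and the end is marked by 0; this makes the code
  prefix-free.
\<close>

fun binary :: "nat \<Rightarrow> bool list" where
  "binary n = (if n = 0 then [] else odd n # binary (n div 2))"

declare binary.simps [simp del]

definition encode_nat :: "nat \<Rightarrow> bool list" where
  "encode_nat n = concat (map (\<lambda>b. [True, b]) (binary n)) @ [False]"

definition encode_int :: "int \<Rightarrow> bool list" where
  "encode_int i = (i < 0) # encode_nat (nat \<bar>i\<bar>)"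

fun encode_request :: "request \<Rightarrow> bool list" where
  "encode_request (General p) = False # encode_nat p"
| "encode_request (Specific p j) = True # encode_nat p @ encode_nat j"

definition encode_requests :: "request list \<Rightarrow> bool list" where
  "encode_requests \<sigma> = concat (map (\<lambda>r. True # encode_request r) \<sigma>) @ [False]"

definition encode_instance :: "nat \<Rightarrow> request list \<Rightarrow> int \<Rightarrow> bool list" where
  "encode_instance k \<sigma> F = encode_nat k @ encode_int F @ encode_requests \<sigma>"

lemma binary_inj: "binary m = binary n \<Longrightarrow> m = n"
proof (induction m arbitrary: n rule: less_induct)
  case (less m)
  show ?case
  proof (cases "m = 0 \<or> n = 0")
    case True
    then show ?thesis using less.prems
      by (auto simp: binary.simps[of m] binary.simps[of n] binary.simps[of 0] split: if_splits)
  next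
    case False
    then have eq: "odd m = odd n" "binary (m div 2) = binary (n div 2)"
      using less.prems by (auto simp: binary.simps[of m] binary.simps[of n])
    then have "m div 2 = n div 2" using less.IH[of "m div 2"] False by auto
    with eq(1) show ?thesis by presburger
  qed
qed

lemma encode_nat_append_eq_iff: "encode_nat m @ xs = encode_nat n @ ys \<longleftrightarrow> m = n \<and> xs = ys"
proof -
  have "bs = cs \<and> xs = ys"
    if "concat (map (\<lambda>b. [True, b]) bs) @ False # xs = concat (map (\<lambda>b. [True, b]) cs) @ False # ys"
    for bs cs
    using that
  proof (induction bs arbitrary: cs)
    case Nil
    then show ?case by (cases cs) auto
  next
    case (Cons b bs)
    then show ?case by (cases cs) auto
  qed
  from this[of "binary m" "binary n"] show ?thesis
    using binary_inj[of m n] unfolding encode_nat_def by auto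
qed

lemma encode_int_append_eq_iff: "encode_int i @ xs = encode_int j @ ys \<longleftrightarrow> i = j \<and> xs = ys"
  by (auto simp: encode_int_def encode_nat_append_eq_iff)

lemma encode_request_append_eq_iff:
  "encode_request r @ xs = encode_request s @ ys \<longleftrightarrow> r = s \<and> xs = ys"
  by (cases r; cases s) (auto simp: encode_nat_append_eq_iff)

lemma encode_requests_inj: "encode_requests \<sigma> = encode_requests \<tau> \<Longrightarrow> \<sigma> = \<tau>"
proof (induction \<sigma> arbitrary: \<tau>)
  case Nil
  then show ?case by (cases \<tau>) (auto simp: encode_requests_def)
next
  case (Cons r \<sigma>)
  then show ?case
    by (cases \<tau>) (auto simp: encode_requests_def encode_request_append_eq_iff)
qed

lemma encode_instance_inj:
  "encode_instance k \<sigma> F = encode_instance k' \<sigma>' F' \<longleftrightarrow> k = k' \<and> \<sigma> = \<sigma>' \<and> F = F'"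
  by (auto simp: encode_instance_def encode_nat_append_eq_iff encode_int_append_eq_iff
      dest: encode_requests_inj)

definition All_or_One_Paging :: "bool list set" where
  "All_or_One_Paging =
     {encode_instance k \<sigma> F | k \<sigma> F.
        (\<forall>r \<in> set \<sigma>. valid_request k r) \<and>
        (\<exists>Cs. is_solution k \<sigma> Cs \<and> int (cost Cs) \<le> F)}"

end

theory Submission
  imports Defs "HOL-Library.Nat_Bijection"
begin

text \<open>
  Membership in NP: the cost of a solution is minimal if it is lazy, that is, determined by the slot
  in which each request is served. A certificate encodes these slots as the choices of a
  nondeterministic stack program, which a Turing machine executes in linear time.

  Hardness: the run of a verifier is a tiling in which every constraint involves four neighbouring
  cells, hence a constraint satisfaction problem. It is translated into a paging instance whose budget
  equals the number of pages, so that every page has to stay in its slot from its first to its last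
  request. As all slots are always occupied, the slots are tokens that move through a network: whenever
  two pages end and two others start, the two slots can optionally be swapped. Specific requests to
  slot 1 force its token to mark the value of each variable, and a specific request for each constraint
  at the end requires that its token could pass at a value that is not marked. The instance is written
  by a program of nested loops over strings of polynomial length.
\<close>

section \<open>Structured programs for Turing machines\<close>

text \<open>Two obstacles shape the proof. The number \<open>k\<close> is written in binary and may
  be exponential in the length of the input, so a certificate can list only the slots that are used.
  And the reduction must be computed by an explicit machine. This is why it starts from an arbitrary
  verifier: a tiling has the same constraints everywhere and is described by two strings of letters,
  one for the rows and one for the columns. Loops over these strings, with comparisons of loop
  positions, suffice to write the instance, provided that the names of the pages can be copied digit
  by digit from unary positions and one counter. Every page costs at least one retrieval, so a
  budget equal to their number forbids any second one; what remains is the distribution of slots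
  over pages. General requests then give freedom and specific requests are tests. Slot 1 cannot
  escape its role: a gate that takes it off the chains is the only gate of its constraint for the
  current variable, hence cannot bring it back before the next test asks for it.\<close>

datatype com =
    Wr nat nat
  | Mv nat int
  | Seq com com (infixr ";;" 61)
  | Cond nat "nat set" com com
  | While nat "nat set" com
  | Halt

type_synonym mem = "nat \<Rightarrow> tape"

text \<open>The control depends on the memory only through the scanned symbols, as a transition
  function must. The action \<open>(r j, 0)\<close> writes back what is scanned and so leaves tape
  \<open>j\<close> alone.\<close>

fun cnext :: "com list \<Rightarrow> (nat \<Rightarrow> nat) \<Rightarrow> com list \<times> (nat \<Rightarrow> nat \<times> int)" where
  "cnext [] r = ([], \<lambda>j. (r j, 0))"
| "cnext (Wr i a # K) r = (K, (\<lambda>j. (r j, 0))(i := (a, 0)))"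
| "cnext (Mv i d # K) r = (K, (\<lambda>j. (r j, 0))(i := (r i, d)))"
| "cnext ((a ;; b) # K) r = (a # b # K, \<lambda>j. (r j, 0))"
| "cnext (Cond i A a b # K) r = ((if r i \<in> A then a else b) # K, \<lambda>j. (r j, 0))"
| "cnext (While i A a # K) r = (if r i \<in> A then a # While i A a # K else K, \<lambda>j. (r j, 0))"
| "cnext (Halt # K) r = ([], \<lambda>j. (r j, 0))"

definition cstep :: "com list \<times> mem \<Rightarrow> com list \<times> mem" where
  "cstep s = (fst (cnext (fst s) (\<lambda>j. read_tape (snd s j))),
     \<lambda>j. act_tape (snd (cnext (fst s) (\<lambda>j. read_tape (snd s j))) j) (snd s j))"

lemma act_tape_id [simp]: "act_tape (read_tape tp, 0) tp = tp"
  by (simp add: act_tape_def read_tape_def)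

definition wr :: "nat \<Rightarrow> tape \<Rightarrow> tape" where
  "wr a tp = (fst tp, (snd tp)(fst tp := a))"

definition mv :: "int \<Rightarrow> tape \<Rightarrow> tape" where
  "mv d tp = (fst tp + d, snd tp)"

lemma cstep_simps [simp]:
  "cstep ([], m) = ([], m)"
  "cstep (Wr i x # K, m) = (K, m(i := wr x (m i)))"
  "cstep (Mv i d # K, m) = (K, m(i := mv d (m i)))"
  "cstep ((a ;; b) # K, m) = (a # b # K, m)"
  "cstep (Cond i A a b # K, m) = ((if read_tape (m i) \<in> A then a else b) # K, m)"
  "cstep (While i A a # K, m) =
     (if read_tape (m i) \<in> A then a # While i A a # K else K, m)"
  "cstep (Halt # K, m) = ([], m)"
  by (auto simp: cstep_def fun_eq_iff act_tape_def read_tape_def wr_def mv_def)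

text \<open>The Boolean of an execution is \<open>False\<close> if it was ended by \<^const>\<open>Halt\<close>.\<close>

inductive exec :: "com \<Rightarrow> mem \<Rightarrow> nat \<Rightarrow> bool \<Rightarrow> mem \<Rightarrow> bool" where
  Wr: "exec (Wr i a) m 1 True (m(i := wr a (m i)))"
| Mv: "exec (Mv i d) m 1 True (m(i := mv d (m i)))"
| Seq: "exec a m t True m1 \<Longrightarrow> exec b m1 t' f m2 \<Longrightarrow> exec (a ;; b) m (Suc (t + t')) f m2"
| SeqH: "exec a m t False m1 \<Longrightarrow> exec (a ;; b) m (Suc t) False m1"
| CondT: "read_tape (m i) \<in> A \<Longrightarrow> exec a m t f m' \<Longrightarrow> exec (Cond i A a b) m (Suc t) f m'"
| CondF: "read_tape (m i) \<notin> A \<Longrightarrow> exec b m t f m' \<Longrightarrow> exec (Cond i A a b) m (Suc t) f m'"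
| WhileF: "read_tape (m i) \<notin> A \<Longrightarrow> exec (While i A a) m 1 True m"
| WhileT: "read_tape (m i) \<in> A \<Longrightarrow> exec a m t True m1 \<Longrightarrow> exec (While i A a) m1 t' f m2 \<Longrightarrow>
    exec (While i A a) m (Suc (t + t')) f m2"
| WhileH: "read_tape (m i) \<in> A \<Longrightarrow> exec a m t False m1 \<Longrightarrow> exec (While i A a) m (Suc t) False m1"
| Halt: "exec Halt m 1 False m"

lemma funpow_Suc_add: "(f ^^ Suc (t + t')) x = (f ^^ t') ((f ^^ t) (f x))"
  by (metis add.commute comp_apply funpow_Suc_right funpow_add)

text \<open>The times of \<open>exec\<close> are exact because every construct costs one step of its
  own and never inspects the stack below it; only \<open>Halt\<close> discards that stack.\<close>

lemma exec_cstep: "exec c m t f m' \<Longrightarrow> (cstep ^^ t) (c # K, m) = (if f then K else [], m')"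
proof (induction arbitrary: K rule: exec.induct)
  case (SeqH a m t m1 b)
  then show ?case by (simp add: funpow_swap1)
next
  case (CondT m i A a t f m' b)
  then show ?case by (simp add: funpow_swap1)
next
  case (CondF m i A b t f m' a)
  then show ?case by (simp add: funpow_swap1)
next
  case (WhileH m i A a t m1)
  then show ?case by (simp add: funpow_swap1)
next
  case (Seq a m t m1 b t' f m2)
  then show ?case by (simp add: funpow_Suc_add del: funpow.simps)
next
  case (WhileT m i A a t m1 t' f m2)
  then show ?case by (simp add: funpow_Suc_add del: funpow.simps)
qed simp_all

section \<open>Compilation of programs to Turing machines\<close>

fun wfc :: "nat \<Rightarrow> nat \<Rightarrow> com \<Rightarrow> bool" where
  "wfc k G (Wr i a) \<longleftrightarrow> i < k \<and> a < G"
| "wfc k G (Mv i d) \<longleftrightarrow> i < k \<and> d \<in> {-1, 0, 1}"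
| "wfc k G (a ;; b) \<longleftrightarrow> wfc k G a \<and> wfc k G b"
| "wfc k G (Cond i A a b) \<longleftrightarrow> i < k \<and> wfc k G a \<and> wfc k G b"
| "wfc k G (While i A a) \<longleftrightarrow> i < k \<and> wfc k G a"
| "wfc k G Halt \<longleftrightarrow> True"

text \<open>The continuations that occur when \<open>c # K\<close> is run until \<open>K\<close> is reached; they serve as the
  states of the machine.\<close>

fun conts :: "com \<Rightarrow> com list \<Rightarrow> com list set" where
  "conts (a ;; b) K = insert ((a ;; b) # K) (conts a (b # K) \<union> conts b K)"
| "conts (Cond i A a b) K = insert (Cond i A a b # K) (conts a K \<union> conts b K)"
| "conts (While i A a) K = insert (While i A a # K) (conts a (While i A a # K))"
| "conts c K = {c # K}"

lemma finite_conts: "finite (conts c K)"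
  by (induction c arbitrary: K) auto

lemma conts_start: "c # K \<in> conts c K"
  by (cases c) auto

text \<open>The body of a loop runs on top of the loop itself, so the stack does not grow with the
  number of iterations. This is what makes finitely many states possible.\<close>

lemma conts_closed: "L \<in> conts c K \<Longrightarrow> fst (cnext L r) \<in> insert [] (insert K (conts c K))"
proof (induction c arbitrary: K)
  case (Seq a b)
  from Seq.prems consider "L = (a ;; b) # K" | "L \<in> conts a (b # K)" | "L \<in> conts b K" by auto
  then show ?case
  proof cases
    case 1
    then show ?thesis using conts_start[of a "b # K"] by simp
  next
    case 2
    from Seq.IH(1)[OF this] show ?thesis using conts_start[of b K] by auto
  next
    case 3
    from Seq.IH(2)[OF this] show ?thesis by auto
  qed
next
  case (Cond i A a b)
  from Cond.prems consider "L = Cond i A a b # K" | "L \<in> conts a K" | "L \<in> conts b K" by auto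
  then show ?case
  proof cases
    case 1
    then show ?thesis using conts_start[of a K] conts_start[of b K] by simp
  next
    case 2
    from Cond.IH(1)[OF this] show ?thesis by auto
  next
    case 3
    from Cond.IH(2)[OF this] show ?thesis by auto
  qed
next
  case (While i A a)
  from While.prems consider "L = While i A a # K" | "L \<in> conts a (While i A a # K)" by auto
  then show ?case
  proof cases
    case 1
    then show ?thesis using conts_start[of a "While i A a # K"] by simp
  next
    case 2
    from While.IH[OF this] show ?thesis by auto
  qed
qed auto

lemma conts_wfc:
  "L \<in> conts c K \<Longrightarrow> wfc k G c \<Longrightarrow> \<forall>a\<in>set K. wfc k G a \<Longrightarrow> \<forall>a\<in>set L. wfc k G a"
proof (induction c arbitrary: K)
  case (Seq a b)
  from Seq.prems(1) consider "L = (a ;; b) # K" | "L \<in> conts a (b # K)" | "L \<in> conts b K" by auto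
  then show ?case
  proof cases
    case 1
    then show ?thesis using Seq.prems by simp
  next
    case 2
    from Seq.IH(1)[OF this] show ?thesis using Seq.prems by simp
  next
    case 3
    from Seq.IH(2)[OF this] show ?thesis using Seq.prems by simp
  qed
next
  case (Cond i A a b)
  from Cond.prems(1) consider "L = Cond i A a b # K" | "L \<in> conts a K" | "L \<in> conts b K" by auto
  then show ?case
  proof cases
    case 1
    then show ?thesis using Cond.prems by simp
  next
    case 2
    from Cond.IH(1)[OF this] show ?thesis using Cond.prems by simp
  next
    case 3
    from Cond.IH(2)[OF this] show ?thesis using Cond.prems by simp
  qed
next
  case (While i A a)
  from While.prems(1) consider "L = While i A a # K" | "L \<in> conts a (While i A a # K)" by auto
  then show ?case
  proof cases
    case 1
    then show ?thesis using While.prems by simp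
  next
    case 2
    from While.IH[OF this] show ?thesis using While.prems by simp
  qed
qed auto

text \<open>A machine hands over a list of \<open>k\<close> symbols, whose entries from
  \<open>k\<close> on are unspecified, whereas a memory has infinitely many tapes. A program that
  mentions only tapes below \<open>k\<close> cannot see the difference.\<close>

lemma cnext_cong:
  assumes "\<forall>a\<in>set L. wfc k G a" "\<forall>j<k. r j = r' j"
  shows "fst (cnext L r) = fst (cnext L r')" "j < k \<Longrightarrow> snd (cnext L r) j = snd (cnext L r') j"
  using assms by (cases "(L, r)" rule: cnext.cases; simp)+

lemma cnext_wf:
  assumes "\<forall>a\<in>set L. wfc k G a" "\<forall>j<k. r j < G" "j < k"
  shows "snd (cnext L r) j \<in> {..<G} \<times> {-1, 0, 1}"
  using assms by (cases "(L, r)" rule: cnext.cases) (auto split: if_splits)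

definition cstates :: "com \<Rightarrow> com list set" where
  "cstates c = insert [] (conts c [])"

text \<open>Any numbering of the finitely many stacks will do, as the states of a machine carry no
  structure.\<close>

definition cenc :: "com \<Rightarrow> com list \<Rightarrow> nat" where
  "cenc c = (SOME f. bij_betw f (cstates c) {..<card (cstates c)})"

definition cdec :: "com \<Rightarrow> nat \<Rightarrow> com list" where
  "cdec c = inv_into (cstates c) (cenc c)"

lemma finite_cstates: "finite (cstates c)"
  by (simp add: cstates_def finite_conts)

lemma cenc_bij: "bij_betw (cenc c) (cstates c) {..<card (cstates c)}"
  using someI_ex[OF ex_bij_betw_finite_nat[OF finite_cstates[of c]]]
  by (simp add: cenc_def lessThan_atLeast0)

lemma cdec_cenc: "L \<in> cstates c \<Longrightarrow> cdec c (cenc c L) = L"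
  by (metis bij_betw_imp_inj_on cdec_def cenc_bij inv_into_f_f)

lemma cdec_in: "q < card (cstates c) \<Longrightarrow> cdec c q \<in> cstates c"
  by (metis bij_betw_imp_surj_on cdec_def cenc_bij inv_into_into lessThan_iff)

lemma cenc_less: "L \<in> cstates c \<Longrightarrow> cenc c L < card (cstates c)"
  by (metis bij_betwE cenc_bij lessThan_iff)

lemma cstates_closed: "L \<in> cstates c \<Longrightarrow> fst (cnext L r) \<in> cstates c"
  using conts_closed[of L c "[]" r] by (auto simp: cstates_def)

definition tm_of :: "nat \<Rightarrow> nat \<Rightarrow> com \<Rightarrow> tm" where
  "tm_of k G c = \<lparr>num_tapes = k, num_states = card (cstates c), num_symbols = G,
     start_state = cenc c [c], halt_state = cenc c [],
     delta = (\<lambda>q ss. (cenc c (fst (cnext (cdec c q) (\<lambda>j. ss ! j))),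
        map (snd (cnext (cdec c q) (\<lambda>j. ss ! j))) [0..<k]))\<rparr>"

lemma cstates_wfc: "wfc k G c \<Longrightarrow> L \<in> cstates c \<Longrightarrow> \<forall>a\<in>set L. wfc k G a"
  using conts_wfc[of L c "[]"] by (auto simp: cstates_def)

lemma wf_tm_of:
  assumes "wfc k G c" "k \<ge> 1" "G \<ge> 3"
  shows "wf_tm (tm_of k G c)"
  unfolding wf_tm_def
proof (intro conjI allI impI)
  fix q ss
  assume q: "q < num_states (tm_of k G c)" and ss: "length ss = num_tapes (tm_of k G c)"
    "set ss \<subseteq> {..<num_symbols (tm_of k G c)}"
  let ?L = "cdec c q" and ?r = "\<lambda>j. ss ! j"
  have L: "?L \<in> cstates c" using q by (simp add: tm_of_def cdec_in)
  have r: "\<forall>j<k. ?r j < G" using ss by (auto simp: tm_of_def subset_iff)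
  have "snd (cnext ?L ?r) j \<in> {..<G} \<times> {-1, 0, 1}" if "j < k" for j
    using cnext_wf[OF cstates_wfc[OF assms(1) L] r that] .
  then show "case delta (tm_of k G c) q ss of (q', acts) \<Rightarrow>
     q' < num_states (tm_of k G c) \<and> length acts = num_tapes (tm_of k G c) \<and>
     set acts \<subseteq> {..<num_symbols (tm_of k G c)} \<times> {-1, 0, 1}"
    using cenc_less[OF cstates_closed[OF L, of ?r]]
    by (simp add: tm_of_def image_subset_iff)
qed (use assms in \<open>auto simp: tm_of_def cstates_def intro!: cenc_less[unfolded cstates_def] conts_start\<close>)

lemma map2_upt: "map2 h (map f [0..<k]) (map m [0..<k]) = map (\<lambda>j. h (f j) (m j)) [0..<k]"
  by (simp add: list_eq_iff_nth_eq)

lemma tm_step_tm_of: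
  assumes "wfc k G c" "L \<in> cstates c"
  shows "tm_step (tm_of k G c) (cenc c L, map m [0..<k]) =
    (cenc c (fst (cstep (L, m))), map (snd (cstep (L, m))) [0..<k])"
proof (cases "L = []")
  case True
  then show ?thesis by (simp add: tm_step_def tm_of_def)
next
  case False
  have "cenc c L \<noteq> cenc c []"
    using cdec_cenc[OF assms(2)] cdec_cenc[of "[]" c] False by (auto simp: cstates_def)
  moreover have "fst (cnext L (\<lambda>j. map (read_tape \<circ> m) [0..<k] ! j)) =
      fst (cnext L (\<lambda>j. read_tape (m j)))"
    "j < k \<Longrightarrow> snd (cnext L (\<lambda>j. map (read_tape \<circ> m) [0..<k] ! j)) j =
      snd (cnext L (\<lambda>j. read_tape (m j))) j" for j
    by (rule cnext_cong[OF cstates_wfc[OF assms]]; simp)+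
  ultimately show ?thesis
    by (simp add: tm_step_def tm_of_def cdec_cenc[OF assms(2)] cstep_def map2_upt comp_def)
qed

text \<open>The second conjunct keeps the stack among the states, which the simulation of the next
  step presupposes.\<close>

lemma funpow_tm_of:
  assumes "wfc k G c" "L \<in> cstates c"
  shows "(tm_step (tm_of k G c) ^^ t) (cenc c L, map m [0..<k]) =
      (cenc c (fst ((cstep ^^ t) (L, m))), map (snd ((cstep ^^ t) (L, m))) [0..<k]) \<and>
    fst ((cstep ^^ t) (L, m)) \<in> cstates c"
proof (induction t)
  case 0
  then show ?case using assms by simp
next
  case (Suc t)
  obtain L' m' where LM: "(cstep ^^ t) (L, m) = (L', m')" by fastforce
  have "L' \<in> cstates c" using Suc by (simp add: LM)
  then have "fst (cstep (L', m')) \<in> cstates c"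
    using cstates_closed[of L' c] by (simp add: cstep_def)
  then show ?case using Suc tm_step_tm_of[OF assms(1), of L' m'] by (simp add: LM)
qed

text \<open>Exact times are awkward to compose; an upper bound can be weakened at every
  composition.\<close>

definition runs :: "com \<Rightarrow> mem \<Rightarrow> nat \<Rightarrow> bool \<Rightarrow> mem \<Rightarrow> bool" where
  "runs c m T f m' \<longleftrightarrow> (\<exists>t\<le>T. exec c m t f m')"

definition initial_mem :: "bool list list \<Rightarrow> mem" where
  "initial_mem ws i = (0, string_contents (if i < length ws then ws ! i else []))"

lemma polytime_computableI:
  fixes p :: "nat poly"
  assumes wf: "wfc k G c" "k \<ge> 1" "n \<le> k" "G \<ge> 3"
    and run: "\<And>ws. length ws = n \<Longrightarrow> \<exists>T f m. runs c (initial_mem ws) T f m \<and>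
      T \<le> poly p (sum_list (map length ws)) \<and> snd (m (k - 1)) = string_contents (F ws)"
  shows "polytime_computable n F"
  unfolding polytime_computable_def
proof (intro exI conjI allI impI)
  show "wf_tm (tm_of k G c)" using wf by (simp add: wf_tm_of)
  show "n \<le> num_tapes (tm_of k G c)" using wf by (simp add: tm_of_def)
  fix ws :: "bool list list"
  assume "length ws = n"
  from run[OF this] obtain T t f m where "exec c (initial_mem ws) t f m" "t \<le> T"
      "T \<le> poly p (sum_list (map length ws))" "snd (m (k - 1)) = string_contents (F ws)"
    unfolding runs_def by blast
  then have t: "exec c (initial_mem ws) t f m"
      "t \<le> poly p (sum_list (map length ws))" "snd (m (k - 1)) = string_contents (F ws)"
    by auto
  let ?T = "poly p (sum_list (map length ws))"
  \<comment> \<open>A finished program stays in its configuration, so its run may be prolonged to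
    exactly \<open>?T\<close> steps.\<close>
  have split: "cstep ^^ ?T = cstep ^^ (?T - t) \<circ> cstep ^^ t" using t(2) by (simp flip: funpow_add)
  have "(cstep ^^ n) ([], m) = ([], m)" for n by (induction n) auto
  then have T: "(cstep ^^ ?T) ([c], initial_mem ws) = ([], m)"
    using exec_cstep[OF t(1), of "[]"] by (simp add: split)
  have "[c] \<in> cstates c" by (simp add: cstates_def conts_start)
  from funpow_tm_of[OF wf(1) this, of ?T "initial_mem ws"]
  have "(tm_step (tm_of k G c) ^^ ?T) (cenc c [c], map (initial_mem ws) [0..<k]) =
     (cenc c [], map m [0..<k])" by (simp add: T)
  moreover have "tm_init (tm_of k G c) ws = (cenc c [c], map (initial_mem ws) [0..<k])"
    by (auto simp: tm_init_def tm_of_def initial_mem_def)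
  moreover have "last (map m [0..<k]) = m (k - 1)" using wf(2) by (simp add: last_map)
  ultimately show "computes_within (tm_of k G c) ws (F ws) ?T"
    using t(3) by (simp add: computes_within_def tm_of_def)
qed

section \<open>Rules for time-bounded runs\<close>

lemma runs_mono: "runs c m T f m' \<Longrightarrow> T \<le> T' \<Longrightarrow> runs c m T' f m'"
  unfolding runs_def by (meson order_trans)

lemma runs_Wr: "T \<ge> 1 \<Longrightarrow> m' = m(i := wr a (m i)) \<Longrightarrow> runs (Wr i a) m T True m'"
  unfolding runs_def using exec.Wr by blast

lemma runs_Mv: "T \<ge> 1 \<Longrightarrow> m' = m(i := mv d (m i)) \<Longrightarrow> runs (Mv i d) m T True m'"
  unfolding runs_def using exec.Mv by blast

lemma runs_Halt: "T \<ge> 1 \<Longrightarrow> runs Halt m T False m"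
  unfolding runs_def using exec.Halt by blast

lemma runs_Seq: "runs a m T True m1 \<Longrightarrow> runs b m1 T' f m2 \<Longrightarrow> T'' \<ge> Suc (T + T') \<Longrightarrow>
    runs (a ;; b) m T'' f m2"
  unfolding runs_def
  by (meson Suc_le_mono add_mono exec.Seq order_trans)

lemma runs_SeqH: "runs a m T False m1 \<Longrightarrow> T'' \<ge> Suc T \<Longrightarrow> runs (a ;; b) m T'' False m1"
  unfolding runs_def by (meson Suc_le_mono exec.SeqH order_trans)

lemma runs_Cond: "runs (if read_tape (m i) \<in> A then a else b) m T f m' \<Longrightarrow> T' \<ge> Suc T \<Longrightarrow>
    runs (Cond i A a b) m T' f m'"
  unfolding runs_def by (metis (full_types) Suc_le_mono exec.CondF exec.CondT order_trans)

lemma runs_WhileF: "read_tape (m i) \<notin> A \<Longrightarrow> T \<ge> 1 \<Longrightarrow> runs (While i A a) m T True m"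
  unfolding runs_def using exec.WhileF by blast

lemma runs_WhileT: "read_tape (m i) \<in> A \<Longrightarrow> runs a m T True m1 \<Longrightarrow>
    runs (While i A a) m1 T' f m2 \<Longrightarrow> T'' \<ge> Suc (T + T') \<Longrightarrow> runs (While i A a) m T'' f m2"
  unfolding runs_def by (meson Suc_le_mono add_mono exec.WhileT order_trans)

lemma runs_WhileH: "read_tape (m i) \<in> A \<Longrightarrow> runs a m T False m1 \<Longrightarrow> T'' \<ge> Suc T \<Longrightarrow>
    runs (While i A a) m T'' False m1"
  unfolding runs_def by (meson Suc_le_mono exec.WhileH order_trans)

section \<open>Strings on tapes\<close>

definition str :: "nat list \<Rightarrow> int \<Rightarrow> nat" where
  "str w i = (if 0 \<le> i \<and> i < int (length w) then w ! nat i else 0)"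

definition tp :: "int \<Rightarrow> nat list \<Rightarrow> tape" where
  "tp p w = (p, str w)"

lemma string_contents_str: "string_contents w = str (map bit_symbol w)"
  by (auto simp: string_contents_def str_def fun_eq_iff)

lemma read_tp [simp]: "read_tape (tp p w) = str w p"
  by (simp add: tp_def read_tape_def)

lemma mv_tp [simp]: "mv d (tp p w) = tp (p + d) w"
  by (simp add: tp_def mv_def)

lemma wr_tp_append: "p = int (length w) \<Longrightarrow> wr a (tp p w) = tp p (w @ [a])"
  by (auto simp: tp_def wr_def str_def fun_eq_iff nth_append)

lemma wr_tp_last: "p = int (length w) \<Longrightarrow> wr 0 (tp p (w @ [a])) = tp p w"
  by (auto simp: tp_def wr_def str_def fun_eq_iff nth_append)

lemma wr_tp_update: "wr a (tp (int (length v)) (v @ b # w)) = tp (int (length v)) (v @ a # w)"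
  by (auto simp: tp_def wr_def str_def fun_eq_iff nth_append nth_Cons split: nat.splits)

lemma str_append_nth: "str (v @ a # w) (int (length v)) = a"
  by (simp add: str_def)

lemma str_out [simp]: "p < 0 \<Longrightarrow> str w p = 0" "p \<ge> int (length w) \<Longrightarrow> str w p = 0"
  by (auto simp: str_def)

section \<open>Nondeterministic stack programs and NP\<close>

text \<open>
  Regular programs over stack operations. Register 0 is the input, consumed from the front; every
  nondeterministic choice consumes one bit of the certificate, so that the deterministic simulation
  takes linear time.
\<close>

datatype kat =
    Pop nat nat
  | Push nat nat
  | EndX
  | KSkip
  | KSeq kat kat (infixr "\<triangleright>" 62)
  | Plus kat kat
  | Star kat

type_synonym store = "nat \<Rightarrow> nat list"

text \<open>The comparisons of lengths let the recursion terminate before it is known that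
  evaluation only consumes the certificate; by \<open>keval_length\<close> they always succeed. Each
  alternative and each iteration consumes a bit, and a choice without a bit left is a
  rejection.\<close>

function keval :: "kat \<Rightarrow> store \<Rightarrow> bool list \<Rightarrow> (store \<times> bool list) option" where
  "keval (Pop r a) s us = (case s r of [] \<Rightarrow> None | x # l \<Rightarrow> if x = a then Some (s(r := l), us) else None)"
| "keval (Push r a) s us = Some (s(r := a # s r), us)"
| "keval EndX s us = (if s 0 = [] then Some (s, us) else None)"
| "keval KSkip s us = Some (s, us)"
| "keval (a \<triangleright> b) s us = (case keval a s us of None \<Rightarrow> None
     | Some (s', us') \<Rightarrow> if length us' \<le> length us then keval b s' us' else None)"
| "keval (Plus a b) s us = (case us of [] \<Rightarrow> None | u # vs \<Rightarrow> if u then keval a s vs else keval b s vs)"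
| "keval (Star a) s us = (case us of [] \<Rightarrow> None | u # vs \<Rightarrow>
     if u then (case keval a s vs of None \<Rightarrow> None
       | Some (s', us') \<Rightarrow> if length us' \<le> length vs then keval (Star a) s' us' else None)
     else Some (s, vs))"
  by pat_completeness auto
termination
  by (relation "measures [\<lambda>(e, s, us). length us, \<lambda>(e, s, us). size e]") auto

lemma keval_KSeqD:
  assumes "keval (a \<triangleright> b) s us = Some (s', us')"
  obtains s1 us1 where "keval a s us = Some (s1, us1)" "length us1 \<le> length us"
    "keval b s1 us1 = Some (s', us')"
  using assms by (cases "keval a s us") (auto split: if_splits)

lemma keval_PlusD:
  assumes "keval (Plus a b) s us = Some (s', us')"
  obtains u vs where "us = u # vs" "keval (if u then a else b) s vs = Some (s', us')"
  using assms by (cases us) (auto split: if_splits)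

lemma keval_StarD:
  assumes "keval (Star a) s us = Some (s', us')"
  obtains vs where "us = False # vs" "s' = s" "us' = vs"
  | vs s1 us1 where "us = True # vs" "keval a s vs = Some (s1, us1)" "length us1 \<le> length vs"
      "keval (Star a) s1 us1 = Some (s', us')"
proof (cases us)
  case Nil
  then show ?thesis using assms by simp
next
  case (Cons u vs)
  show ?thesis
  proof (cases u)
    case True
    with Cons assms obtain s1 us1 where "keval a s vs = Some (s1, us1)"
      by (cases "keval a s vs") auto
    with Cons True assms show ?thesis by (intro that(2)) (auto split: if_splits)
  qed (use that(1) Cons assms in auto)
qed

lemma keval_length: "keval e s us = Some (s', us') \<Longrightarrow> length us' \<le> length us"
proof (induction e s us arbitrary: s' us' rule: keval.induct)
  case (5 a b s us)
  from 5(3) show ?case by (rule keval_KSeqD) (use 5(2) in fastforce)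
next
  case (6 a b s us)
  from 6(3) show ?case
  proof (rule keval_PlusD)
    fix u vs assume "us = u # vs" "keval (if u then a else b) s vs = Some (s', us')"
    then show ?thesis using 6(1,2)[of u vs] by (cases u) fastforce+
  qed
next
  case (7 a s us)
  from 7(3) show ?case
  proof (rule keval_StarD)
    fix vs s1 us1
    assume "us = True # vs" "keval a s vs = Some (s1, us1)" "length us1 \<le> length vs"
      "keval (Star a) s1 us1 = Some (s', us')"
    then show ?thesis using 7(2)[of True vs "(s1, us1)" s1 us1] by fastforce
  qed auto
qed (auto split: list.splits if_splits)

text \<open>Tape 0 is the input and is consumed by moving right, tape 1 holds the certificate, and
  every other tape is a stack whose top is just left of the head. \<open>Halt\<close> is rejection,
  also at the blank after the certificate.\<close>

fun kc :: "kat \<Rightarrow> com" where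
  "kc (Pop r a) = (if r = 0 then Cond 0 {a} (Mv 0 1) Halt
     else Mv r (- 1) ;; Cond r {a} (Wr r 0) Halt)"
| "kc (Push r a) = Wr r a ;; Mv r 1"
| "kc EndX = Cond 0 {0} (Mv 0 0) Halt"
| "kc KSkip = Mv 0 0"
| "kc (a \<triangleright> b) = kc a ;; kc b"
| "kc (Plus a b) = Cond 1 {2} (Mv 1 1 ;; kc a) (Cond 1 {1} (Mv 1 1 ;; kc b) Halt)"
| "kc (Star a) = While 1 {2} (Mv 1 1 ;; kc a) ;; Cond 1 {1} (Mv 1 1) Halt"

fun wfk :: "nat \<Rightarrow> nat \<Rightarrow> kat \<Rightarrow> bool" where
  "wfk n G (Pop r a) \<longleftrightarrow> r \<noteq> 1 \<and> r < n \<and> a \<noteq> 0 \<and> a < G"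
| "wfk n G (Push r a) \<longleftrightarrow> 2 \<le> r \<and> r < n \<and> a \<noteq> 0 \<and> a < G"
| "wfk n G (a \<triangleright> b) \<longleftrightarrow> wfk n G a \<and> wfk n G b"
| "wfk n G (Plus a b) \<longleftrightarrow> wfk n G a \<and> wfk n G b"
| "wfk n G (Star a) \<longleftrightarrow> wfk n G a"
| "wfk n G _ \<longleftrightarrow> True"

text \<open>Time per consumed bit of the certificate. An iteration of \<open>Star\<close> pays its
  overhead with the bit that starts it, so a loop needs a larger constant and not a product.\<close>

fun kt :: "kat \<Rightarrow> nat" where
  "kt (Pop r a) = 4"
| "kt (Push r a) = 3"
| "kt EndX = 2"
| "kt KSkip = 1"
| "kt (a \<triangleright> b) = kt a + kt b + 1"
| "kt (Plus a b) = kt a + kt b + 5"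
| "kt (Star a) = kt a + 8"

section \<open>Correctness of the deterministic simulation\<close>

lemma wfc_kc: "wfk n G e \<Longrightarrow> n \<ge> 2 \<Longrightarrow> G \<ge> 3 \<Longrightarrow> n \<le> n' \<Longrightarrow> wfc n' G (kc e)"
  by (induction e) auto

text \<open>Input and certificate stay in place while their heads advance; a stack is written bottom
  first, with the head on the blank after its top. Input letters are nonzero, so a blank signals the
  end of the input.\<close>

definition krep :: "mem \<Rightarrow> store \<Rightarrow> bool list \<Rightarrow> bool" where
  "krep m s us \<longleftrightarrow>
     (\<exists>p w. m 0 = tp (int p) w \<and> p \<le> length w \<and> drop p w = s 0 \<and> 0 \<notin> set w) \<and>
     (\<exists>p w. m 1 = tp (int p) (map bit_symbol w) \<and> p \<le> length w \<and> drop p w = us) \<and>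
     (\<forall>r\<ge>2. m r = tp (int (length (s r))) (rev (s r)))"

lemma str_drop: "p \<le> length w \<Longrightarrow> str w (int p) = (case drop p w of [] \<Rightarrow> 0 | a # _ \<Rightarrow> a)"
  by (cases "p < length w") (auto simp: str_def simp flip: Cons_nth_drop_Suc)

lemma drop_ConsD: "drop p w = a # l \<Longrightarrow> Suc p \<le> length w \<and> drop (Suc p) w = l"
  by (metis drop_Suc drop_eq_Nil list.distinct(1) list.sel(3) not_less_eq_eq tl_drop)

lemma krep_read_choice:
  assumes "krep m s us"
  shows "read_tape (m (Suc 0)) = (case us of [] \<Rightarrow> 0 | u # _ \<Rightarrow> bit_symbol u)"
proof -
  obtain p w where "m 1 = tp (int p) (map bit_symbol w)" "p \<le> length w" "drop p w = us"
    using assms by (auto simp: krep_def)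
  then show ?thesis using str_drop[of p "map bit_symbol w"]
    by (auto simp: drop_map split: list.splits)
qed

lemma krep_mv_choice:
  assumes "krep m s (u # us)"
  shows "krep (m(Suc 0 := mv 1 (m (Suc 0)))) s us"
proof -
  obtain p w where w: "m 1 = tp (int p) (map bit_symbol w)" "p \<le> length w" "drop p w = u # us"
    using assms by (auto simp: krep_def)
  have "mv 1 (m (Suc 0)) = tp (int (Suc p)) (map bit_symbol w)" using w(1) by (simp add: add.commute)
  then show ?thesis using assms drop_ConsD[OF w(3)] unfolding krep_def
    by (intro conjI; (elim conjE)?) fastforce+
qed

lemma krep_input:
  assumes "krep m s us"
  shows "read_tape (m 0) = (case s 0 of [] \<Rightarrow> 0 | u # _ \<Rightarrow> u)" "0 \<notin> set (s 0)"
    "s 0 = a # l \<Longrightarrow> krep (m(0 := mv 1 (m 0))) (s(0 := l)) us"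
proof -
  obtain p w where w: "m 0 = tp (int p) w" "p \<le> length w" "drop p w = s 0" "0 \<notin> set w"
    using assms by (auto simp: krep_def)
  show "read_tape (m 0) = (case s 0 of [] \<Rightarrow> 0 | u # _ \<Rightarrow> u)" "0 \<notin> set (s 0)"
    using w str_drop[of p w] in_set_dropD[of 0 p w] by auto
  assume s: "s 0 = a # l"
  have "mv 1 (m 0) = tp (int (Suc p)) w" using w(1) by (simp add: add.commute)
  then show "krep (m(0 := mv 1 (m 0))) (s(0 := l)) us"
    using assms drop_ConsD[of p w a l] w s unfolding krep_def
    by (intro conjI; (elim conjE)?) (fastforce+)
qed

lemma krep_push:
  assumes "krep m s us" "r \<ge> 2"
  shows "krep (m(r := mv 1 (wr a (m r)))) (s(r := a # s r)) us"
  using assms by (auto simp: krep_def wr_tp_append add.commute)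

lemma krep_pop:
  assumes "krep m s us" "r \<ge> 2"
  shows "read_tape (mv (- 1) (m r)) = (case s r of [] \<Rightarrow> 0 | u # _ \<Rightarrow> u)"
    "s r = a # l \<Longrightarrow> krep (m(r := wr 0 (mv (- 1) (m r)))) (s(r := l)) us"
proof -
  have r: "m r = tp (int (length (s r))) (rev (s r))" using assms by (simp add: krep_def)
  show "read_tape (mv (- 1) (m r)) = (case s r of [] \<Rightarrow> 0 | u # _ \<Rightarrow> u)"
    using str_append_nth[of "rev (tl (s r))" "hd (s r)" "[]"]
    by (auto simp: r split: list.splits)
  assume "s r = a # l"
  then have "wr 0 (mv (- 1) (m r)) = tp (int (length l)) (rev l)"
    by (simp add: r wr_tp_last)
  then show "krep (m(r := wr 0 (mv (- 1) (m r)))) (s(r := l)) us"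
    using assms by (auto simp: krep_def)
qed

text \<open>\<open>Star\<close> compiles to a loop followed by a test, and the induction hypothesis
  for the remaining iterations is about both together. So one iteration is peeled off under the
  sequence.\<close>

lemma runs_While_Seq:
  assumes "read_tape (m i) \<in> A" "runs a m T True m1" "runs (While i A a ;; b) m1 T' f m2"
    "T'' \<ge> Suc (T + T')"
  shows "runs (While i A a ;; b) m T'' f m2"
proof -
  obtain t where t: "t \<le> T" "exec a m t True m1" using assms(2) by (auto simp: runs_def)
  obtain t' where t': "t' \<le> T'" "exec (While i A a ;; b) m1 t' f m2"
    using assms(3) by (auto simp: runs_def)
  from t'(2) have "exec (While i A a ;; b) m (Suc (t + t')) f m2"
  proof cases
    case (Seq t1 m3 t2)
    from exec.Seq[OF exec.WhileT[OF assms(1) t(2) Seq(2)] Seq(3)] show ?thesis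
      using Seq(1) by (simp add: add.assoc)
  next
    case (SeqH t1)
    from exec.SeqH[OF exec.WhileT[OF assms(1) t(2) SeqH(3)]] show ?thesis
      using SeqH(1,2) by simp
  qed
  then show ?thesis using t(1) t'(1) assms(4) unfolding runs_def
    by (meson Suc_le_mono add_mono order_trans)
qed

text \<open>Time is charged to the consumed bits; a failing run may have consumed all of them. Tapes
  from \<open>n\<close> on are preserved because tape \<open>n\<close> is to receive the
  verdict.\<close>

definition kspec :: "nat \<Rightarrow> kat \<Rightarrow> mem \<Rightarrow> bool list \<Rightarrow> (store \<times> bool list) option \<Rightarrow> bool" where
  "kspec n e m us res \<longleftrightarrow> (case res of
     None \<Rightarrow> \<exists>m'. runs (kc e) m (kt e * (length us + 1)) False m' \<and> (\<forall>r\<ge>n. m' r = m r)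
   | Some (s', us') \<Rightarrow> \<exists>m'. runs (kc e) m (kt e * (length us - length us' + 1)) True m' \<and>
       (\<forall>r\<ge>n. m' r = m r) \<and> krep m' s' us')"

lemma kspecN: "runs (kc e) m (kt e * (length us + 1)) False m' \<Longrightarrow> \<forall>r\<ge>n. m' r = m r \<Longrightarrow>
    kspec n e m us None"
  unfolding kspec_def by auto

lemma kspecS: "runs (kc e) m (kt e * (length us - length us' + 1)) True m' \<Longrightarrow>
    \<forall>r\<ge>n. m' r = m r \<Longrightarrow> krep m' s' us' \<Longrightarrow> kspec n e m us (Some (s', us'))"
  unfolding kspec_def by auto

lemma kspecND: "kspec n e m us None \<Longrightarrow>
    \<exists>m'. runs (kc e) m (kt e * (length us + 1)) False m' \<and> (\<forall>r\<ge>n. m' r = m r)"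
  unfolding kspec_def by auto

lemma kspecSD: "kspec n e m us (Some (s', us')) \<Longrightarrow>
    \<exists>m'. runs (kc e) m (kt e * (length us - length us' + 1)) True m' \<and>
       (\<forall>r\<ge>n. m' r = m r) \<and> krep m' s' us'"
  unfolding kspec_def by auto

text \<open>Induction along the evaluation. The bounds of consecutive parts add up because they
  consume disjoint pieces of the certificate.\<close>

lemma kc_correct:
  assumes "wfk n G e" "n \<ge> 2" "krep m s us"
  shows "kspec n e m us (keval e s us)"
  using assms
proof (induction e s us arbitrary: m rule: keval.induct)
  case (1 r a s us)
  show ?case
  proof (cases "r = 0")
    case True
    note in0 = krep_input(1,2)[OF 1(3)] krep_input(3)[OF 1(3)]
    show ?thesis
    proof (cases "\<exists>l. s 0 = a # l")
      case l: True
      then obtain l where l: "s 0 = a # l" by blast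
      then have "keval (Pop r a) s us = Some (s(0 := l), us)" using True by simp
      moreover have "runs (kc (Pop r a)) m 4 True (m(0 := mv 1 (m 0)))"
        using True in0(1) l by (auto intro!: runs_Cond[where T = 1] runs_Mv)
      ultimately show ?thesis using in0(3)[OF l] 1(2) by (auto intro!: kspecS)
    next
      case l: False
      then have "keval (Pop r a) s us = None" using True by (auto split: list.splits)
      moreover have "runs (kc (Pop r a)) m 2 False m"
        using True in0(1) l 1(1)
        by (auto intro!: runs_Cond[where T = 1] runs_Halt split: list.splits)
      then have "runs (kc (Pop r a)) m (kt (Pop r a) * (length us + 1)) False m"
        by (rule runs_mono) simp
      ultimately show ?thesis by (auto intro!: kspecN)
    qed
  next
    case False
    then have r: "r \<ge> 2" "r < n" using 1(1) by auto
    note pop = krep_pop(1)[OF 1(3) r(1)] krep_pop(2)[OF 1(3) r(1)]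
    let ?m = "m(r := mv (- 1) (m r))"
    have mv: "runs (Mv r (- 1)) m 1 True ?m" by (rule runs_Mv) auto
    show ?thesis
    proof (cases "\<exists>l. s r = a # l")
      case True
      then obtain l where l: "s r = a # l" by blast
      then have "keval (Pop r a) s us = Some (s(r := l), us)" by simp
      moreover have "runs (Cond r {a} (Wr r 0) Halt) ?m 2 True (m(r := wr 0 (mv (- 1) (m r))))"
        using pop(1) l by (auto intro!: runs_Cond[where T = 1] runs_Wr)
      from runs_Seq[OF mv this, of 4]
      have "runs (kc (Pop r a)) m 4 True (m(r := wr 0 (mv (- 1) (m r))))" using False by simp
      ultimately show ?thesis using pop(2)[OF l] r by (auto intro!: kspecS)
    next
      case l: False
      then have "keval (Pop r a) s us = None" by (auto split: list.splits)
      moreover have "runs (Cond r {a} (Wr r 0) Halt) ?m 2 False ?m"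
        using pop(1) l 1(1) by (auto intro!: runs_Cond[where T = 1] runs_Halt split: list.splits)
      from runs_Seq[OF mv this, of 4]
      have "runs (kc (Pop r a)) m 4 False ?m" using False by simp
      then have "runs (kc (Pop r a)) m (kt (Pop r a) * (length us + 1)) False ?m"
        by (rule runs_mono) simp
      ultimately show ?thesis using r by (auto intro!: kspecN)
    qed
  qed
next
  case (2 r a s us)
  have "runs (Wr r a ;; Mv r 1) m 3 True (m(r := mv 1 (wr a (m r))))"
    by (rule runs_Seq[OF runs_Wr runs_Mv, where T = 1 and T' = 1]) auto
  then show ?case using krep_push[OF 2(3), of r a] 2(1) by (auto intro!: kspecS)
next
  case (3 s us)
  show ?case
  proof (cases "s 0")
    case Nil
    then have "runs (Cond 0 {0} (Mv 0 0) Halt) m 2 True m"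
      using krep_input(1)[OF 3(3)] by (auto intro!: runs_Cond[where T = 1] runs_Mv simp: mv_def)
    then show ?thesis using Nil 3(3) by (auto intro!: kspecS)
  next
    case (Cons a l)
    then have "runs (Cond 0 {0} (Mv 0 0) Halt) m 2 False m"
      using krep_input(1,2)[OF 3(3)] by (auto intro!: runs_Cond[where T = 1] runs_Halt)
    then have "runs (kc EndX) m (kt EndX * (length us + 1)) False m"
      by (auto elim: runs_mono[where T = 2])
    then show ?thesis using Cons by (auto intro!: kspecN)
  qed
next
  case (4 s us)
  have "runs (Mv 0 0) m 1 True m" by (auto intro!: runs_Mv simp: mv_def)
  then show ?case using 4 by (auto intro!: kspecS)
next
  case (5 a b s us)
  then have wf: "wfk n G a" "wfk n G b" by auto
  note IH1 = 5(1)[OF wf(1) 5(4,5)]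
  show ?case
  proof (cases "keval a s us")
    case None
    then obtain m' where m': "runs (kc a) m (kt a * (length us + 1)) False m'" "\<forall>r\<ge>n. m' r = m r"
      using IH1 kspecND by metis
    show ?thesis using None m'(2)
      by (auto intro!: kspecN[OF _ m'(2)] runs_SeqH[OF m'(1)] simp: algebra_simps)
  next
    case (Some res)
    obtain s' us' where res: "keval a s us = Some (s', us')" using Some by (cases res) auto
    then obtain m1 where m1: "runs (kc a) m (kt a * (length us - length us' + 1)) True m1"
        "\<forall>r\<ge>n. m1 r = m r" "krep m1 s' us'"
      using IH1 kspecSD by metis
    have le: "length us' \<le> length us" using keval_length[OF res] .
    have IH2: "kspec n b m1 us' (keval b s' us')" using 5(2)[OF res refl le wf(2) 5(4) m1(3)] .
    have evs: "keval (a \<triangleright> b) s us = keval b s' us'" using res le by simp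
    show ?thesis
    proof (cases "keval b s' us'")
      case None
      then obtain m' where m': "runs (kc b) m1 (kt b * (length us' + 1)) False m'" "\<forall>r\<ge>n. m' r = m1 r"
        using IH2 kspecND by metis
      obtain j where j: "length us = length us' + j" using le le_Suc_ex by blast
      have "runs (kc a ;; kc b) m (kt (a \<triangleright> b) * (length us + 1)) False m'"
        by (intro runs_Seq[OF m1(1) m'(1)]) (simp add: j algebra_simps)
      then show ?thesis using None evs m'(2) m1(2) by (auto intro!: kspecN)
    next
      case (Some res2)
      obtain s2 us2 where res2: "keval b s' us' = Some (s2, us2)" using Some by (cases res2) auto
      then obtain m' where m': "runs (kc b) m1 (kt b * (length us' - length us2 + 1)) True m'"
          "\<forall>r\<ge>n. m' r = m1 r" "krep m' s2 us2"
        using IH2 kspecSD by metis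
      have le2: "length us2 \<le> length us'" using keval_length[OF res2] .
      have "kt a * (length us - length us') \<le> kt a * (length us - length us2)"
        "kt b * (length us' - length us2) \<le> kt b * (length us - length us2)"
        using le le2 by (auto intro!: mult_le_mono2)
      then have "runs (kc a ;; kc b) m (kt (a \<triangleright> b) * (length us - length us2 + 1)) True m'"
        by (intro runs_Seq[OF m1(1) m'(1)]) (simp add: algebra_simps)
      then show ?thesis using res2 evs m'(2,3) m1(2) by (auto intro!: kspecS)
    qed
  qed
next
  case (6 a b s us)
  then have wf: "wfk n G a" "wfk n G b" by auto
  note rd = krep_read_choice[OF 6(5)]
  show ?case
  proof (cases us)
    case Nil
    have "runs (Cond 1 {1} (Mv 1 1 ;; kc b) Halt) m 2 False m"
      using rd Nil by (auto intro!: runs_Cond[where T = 1] runs_Halt)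
    then have "runs (kc (Plus a b)) m (kt (Plus a b) * (length us + 1)) False m"
      using rd Nil by (auto intro!: runs_Cond[where T = 2])
    then show ?thesis using Nil by (auto intro!: kspecN)
  next
    case (Cons u vs)
    let ?m = "m(Suc 0 := mv 1 (m (Suc 0)))" and ?e = "if u then a else b"
    have rep: "krep ?m s vs" using krep_mv_choice 6(5) Cons by blast
    have mv: "runs (Mv 1 1) m 1 True ?m" by (rule runs_Mv) auto
    have IH: "kspec n ?e ?m vs (keval ?e s vs)"
      by (cases u) (use 6(1)[OF Cons _ wf(1) 6(4) rep] 6(2)[OF Cons _ wf(2) 6(4) rep] in
          \<open>simp_all only: if_True if_False simp_thms\<close>)
    have evs: "keval (Plus a b) s us = keval ?e s vs" using Cons by simp
    have run: "runs (kc (Plus a b)) m (T + 4) f m'" if "runs (kc ?e) ?m T f m'" for T f m'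
    proof (cases u)
      case True
      then show ?thesis using rd Cons that runs_Seq[OF mv, of "kc a" T f m']
        by (auto intro!: runs_Cond[where T = "T + 2"] simp: bit_symbol_def)
    next
      case False
      then have "runs (Mv 1 1 ;; kc b) m (T + 2) f m'"
        using that runs_Seq[OF mv, of "kc b" T f m'] by simp
      then have "runs (Cond 1 {1} (Mv 1 1 ;; kc b) Halt) m (T + 3) f m'"
        using rd Cons False by (auto intro!: runs_Cond[where T = "T + 2"] simp: bit_symbol_def)
      then show ?thesis
        using rd Cons False by (auto intro!: runs_Cond[where T = "T + 3"] simp: bit_symbol_def)
    qed
    show ?thesis
    proof (cases "keval ?e s vs")
      case None
      then obtain m' where m': "runs (kc ?e) ?m (kt ?e * (length vs + 1)) False m'" "\<forall>r\<ge>n. m' r = ?m r"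
        using IH kspecND by metis
      have "runs (kc (Plus a b)) m (kt (Plus a b) * (length us + 1)) False m'"
        by (rule runs_mono[OF run[OF m'(1)]]) (auto simp: Cons algebra_simps)
      then show ?thesis using None evs m'(2) 6(4) by (auto intro!: kspecN)
    next
      case (Some res)
      obtain s' us' where res: "keval ?e s vs = Some (s', us')" using Some by (cases res) auto
      then obtain m' where m': "runs (kc ?e) ?m (kt ?e * (length vs - length us' + 1)) True m'"
          "\<forall>r\<ge>n. m' r = ?m r" "krep m' s' us'"
        using IH kspecSD by metis
      have le: "length us' \<le> length vs" using keval_length[OF res] .
      then obtain j where j: "length vs = length us' + j" using le_Suc_ex by blast
      have "runs (kc (Plus a b)) m (kt (Plus a b) * (length us - length us' + 1)) True m'"
        by (rule runs_mono[OF run[OF m'(1)]]) (auto simp: Cons j algebra_simps)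
      then show ?thesis using res evs m'(2,3) 6(4) by (auto intro!: kspecS)
    qed
  qed
next
  case (7 a s us)
  then have wf: "wfk n G a" by auto
  note rd = krep_read_choice[OF 7(5)]
  show ?case
  proof (cases us)
    case Nil
    have "runs (Cond 1 {1} (Mv 1 1) Halt) m 2 False m"
      using rd Nil by (auto intro!: runs_Cond[where T = 1] runs_Halt)
    moreover have "runs (While 1 {2} (Mv 1 1 ;; kc a)) m 1 True m"
      using rd Nil by (auto intro!: runs_WhileF)
    ultimately have "runs (kc (Star a)) m (kt (Star a) * (length us + 1)) False m"
      unfolding kc.simps by (auto intro: runs_Seq)
    then show ?thesis using Nil by (auto intro!: kspecN)
  next
    case (Cons u vs)
    let ?m = "m(Suc 0 := mv 1 (m (Suc 0)))"
    have rep: "krep ?m s vs" using krep_mv_choice 7(5) Cons by blast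
    have mv: "runs (Mv 1 1) m 1 True ?m" by (rule runs_Mv) auto
    show ?thesis
    proof (cases u)
      case False
      have "runs (Cond 1 {1} (Mv 1 1) Halt) m 2 True ?m"
        using rd Cons False by (auto intro!: runs_Cond[where T = 1] runs_Mv simp: bit_symbol_def)
      moreover have "runs (While 1 {2} (Mv 1 1 ;; kc a)) m 1 True m"
        using rd Cons False by (auto intro!: runs_WhileF simp: bit_symbol_def)
      ultimately have "runs (kc (Star a)) m (kt (Star a) * (length us - length vs + 1)) True ?m"
        unfolding kc.simps by (auto intro: runs_Seq)
      then show ?thesis using Cons False rep 7(4) by (auto intro!: kspecS)
    next
      case True
      have sym: "read_tape (m 1) \<in> {2}" using rd Cons True by (simp add: bit_symbol_def)
      note IH1 = 7(1)[OF Cons True wf 7(4) rep]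
      show ?thesis
      proof (cases "keval a s vs")
        case None
        then obtain m' where m': "runs (kc a) ?m (kt a * (length vs + 1)) False m'" "\<forall>r\<ge>n. m' r = ?m r"
          using IH1 kspecND by metis
        have "runs (kc (Star a)) m (kt a * (length vs + 1) + 4) False m'"
          unfolding kc.simps
          by (intro runs_SeqH[OF runs_WhileH[OF sym runs_Seq[OF mv m'(1) order_refl] order_refl]]) simp
        then have "runs (kc (Star a)) m (kt (Star a) * (length us + 1)) False m'"
          by (rule runs_mono) (auto simp: Cons algebra_simps)
        then show ?thesis using None Cons True m'(2) 7(4) by (auto intro!: kspecN)
      next
        case (Some res)
        obtain s' us' where res: "keval a s vs = Some (s', us')" using Some by (cases res) auto
        then obtain m1 where m1: "runs (kc a) ?m (kt a * (length vs - length us' + 1)) True m1"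
            "\<forall>r\<ge>n. m1 r = ?m r" "krep m1 s' us'"
          using IH1 kspecSD by metis
        have le: "length us' \<le> length vs" using keval_length[OF res] .
        then obtain j where j: "length vs = length us' + j" using le_Suc_ex by blast
        have IH2: "kspec n (Star a) m1 us' (keval (Star a) s' us')"
          using 7(2)[OF Cons True res refl le _ 7(4) m1(3)] 7(3) by auto
        have evs: "keval (Star a) s us = keval (Star a) s' us'" using res le Cons True by simp
        note step = runs_While_Seq[OF sym runs_Seq[OF mv m1(1) order_refl]]
        show ?thesis
        proof (cases "keval (Star a) s' us'")
          case None
          then obtain m' where m': "runs (kc (Star a)) m1 (kt (Star a) * (length us' + 1)) False m'"
              "\<forall>r\<ge>n. m' r = m1 r"
            using IH2 kspecND by metis
          have "runs (kc (Star a)) m (kt (Star a) * (length us + 1)) False m'"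
            using step[OF m'(1)[unfolded kc.simps]] unfolding kc.simps
            by (rule runs_mono[OF _ order_refl]) (auto simp: Cons j algebra_simps)
          then show ?thesis using None evs m'(2) m1(2) 7(4) by (auto intro!: kspecN)
        next
          case (Some res2)
          obtain s2 us2 where res2: "keval (Star a) s' us' = Some (s2, us2)" using Some by (cases res2) auto
          then obtain m' where m': "runs (kc (Star a)) m1 (kt (Star a) * (length us' - length us2 + 1)) True m'"
              "\<forall>r\<ge>n. m' r = m1 r" "krep m' s2 us2"
            using IH2 kspecSD by metis
          have "length us2 \<le> length us'" using keval_length[OF res2] .
          then obtain i where i: "length us' = length us2 + i" using le_Suc_ex by blast
          have "runs (kc (Star a)) m (kt (Star a) * (length us - length us2 + 1)) True m'"
            using step[OF m'(1)[unfolded kc.simps]] unfolding kc.simps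
            by (rule runs_mono[OF _ order_refl]) (auto simp: Cons i j algebra_simps)
          then show ?thesis using res2 evs m'(2,3) m1(2) 7(4) by (auto intro!: kspecS)
        qed
      qed
    qed
  qed
qed

text \<open>The number counts the nondeterministic choices.\<close>

inductive ksem :: "kat \<Rightarrow> nat \<Rightarrow> store \<Rightarrow> store \<Rightarrow> bool" where
  Pop: "s r = a # l \<Longrightarrow> ksem (Pop r a) 0 s (s(r := l))"
| Push: "ksem (Push r a) 0 s (s(r := a # s r))"
| EndX: "s 0 = [] \<Longrightarrow> ksem EndX 0 s s"
| KSkip: "ksem KSkip 0 s s"
| KSeq: "ksem a n s s1 \<Longrightarrow> ksem b n' s1 s2 \<Longrightarrow> ksem (a \<triangleright> b) (n + n') s s2"
| PlusL: "ksem a n s s' \<Longrightarrow> ksem (Plus a b) (Suc n) s s'"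
| PlusR: "ksem b n s s' \<Longrightarrow> ksem (Plus a b) (Suc n) s s'"
| StarN: "ksem (Star a) 1 s s"
| StarC: "ksem a n s s1 \<Longrightarrow> ksem (Star a) n' s1 s2 \<Longrightarrow> ksem (Star a) (Suc (n + n')) s s2"

section \<open>Derivations and certificates\<close>

lemma keval_ksem: "keval e s us = Some (s', us') \<Longrightarrow> \<exists>n. ksem e n s s'"
proof (induction e s us arbitrary: s' us' rule: keval.induct)
  case (5 a b s us)
  from 5(3) show ?case
  proof (rule keval_KSeqD)
    fix s1 us1
    assume "keval a s us = Some (s1, us1)" "length us1 \<le> length us" "keval b s1 us1 = Some (s', us')"
    then show ?thesis using 5(1) 5(2)[of "(s1, us1)" s1 us1] ksem.KSeq by metis
  qed
next
  case (6 a b s us)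
  from 6(3) show ?case
  proof (rule keval_PlusD)
    fix u vs assume *: "us = u # vs" "keval (if u then a else b) s vs = Some (s', us')"
    show ?thesis
    proof (cases u)
      case True
      then obtain n where "ksem a n s s'" using 6(1)[OF *(1) True, of s' us'] *(2) by auto
      then show ?thesis using ksem.PlusL by blast
    next
      case False
      then obtain n where "ksem b n s s'" using 6(2)[OF *(1) False, of s' us'] *(2) by auto
      then show ?thesis using ksem.PlusR by blast
    qed
  qed
next
  case (7 a s us)
  from 7(3) show ?case
  proof (rule keval_StarD)
    fix vs assume "s' = s"
    then show ?thesis using ksem.StarN by blast
  next
    fix vs s1 us1
    assume *: "us = True # vs" "keval a s vs = Some (s1, us1)" "length us1 \<le> length vs"
      "keval (Star a) s1 us1 = Some (s', us')"
    then show ?thesis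
      using 7(1)[OF *(1) TrueI *(2)] 7(2)[OF *(1) TrueI *(2) refl *(3,4)] ksem.StarC by metis
  qed
qed (auto split: list.splits if_splits intro: ksem.intros)

text \<open>The choices, in the order of the derivation, form the certificate. An arbitrary rest
  follows it because the certificates of parts are concatenated.\<close>

lemma ksem_ev: "ksem e n s s' \<Longrightarrow> \<exists>vs. length vs = n \<and> (\<forall>us. keval e s (vs @ us) = Some (s', us))"
proof (induction rule: ksem.induct)
  case (KSeq a n s s1 b n' s2)
  then obtain vs vs' where "length vs = n" "\<forall>us. keval a s (vs @ us) = Some (s1, us)"
    "length vs' = n'" "\<forall>us. keval b s1 (vs' @ us) = Some (s2, us)" by blast
  then show ?case by (intro exI[of _ "vs @ vs'"]) simp
next
  case (PlusL a n s s' b)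
  then obtain vs where "length vs = n" "\<forall>us. keval a s (vs @ us) = Some (s', us)" by blast
  then show ?case by (intro exI[of _ "True # vs"]) simp
next
  case (PlusR b n s s' a)
  then obtain vs where "length vs = n" "\<forall>us. keval b s (vs @ us) = Some (s', us)" by blast
  then show ?case by (intro exI[of _ "False # vs"]) simp
next
  case (StarN a s)
  then show ?case by (intro exI[of _ "[False]"]) simp
next
  case (StarC a n s s1 n' s2)
  then obtain vs vs' where "length vs = n" "\<forall>us. keval a s (vs @ us) = Some (s1, us)"
    "length vs' = n'" "\<forall>us. keval (Star a) s1 (vs' @ us) = Some (s2, us)" by blast
  then show ?case by (intro exI[of _ "True # vs @ vs'"]) simp
qed auto

definition kinit :: "bool list \<Rightarrow> store" where
  "kinit x = (\<lambda>_. [])(0 := map bit_symbol x)"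

text \<open>The output tape \<open>n\<close> lies beyond all tapes of the program: a rejecting run
  halts before the final \<open>Wr n 2\<close> and leaves it blank. A certificate may be longer than
  the choices that are made, so soundness ignores its length.\<close>

lemma in_NP_kat:
  fixes p :: "nat poly"
  assumes wf: "wfk n G e" "n \<ge> 2" "G \<ge> 3"
    and complete: "\<And>x. x \<in> L \<Longrightarrow> \<exists>j s'. ksem e j (kinit x) s' \<and> j \<le> poly p (length x)"
    and sound: "\<And>x j s'. ksem e j (kinit x) s' \<Longrightarrow> x \<in> L"
  shows "in_NP L"
proof -
  let ?v = "\<lambda>ws. if keval e (kinit (ws ! 0)) (ws ! 1) = None then [] else [True]"
  have "polytime_computable 2 ?v"
  proof (rule polytime_computableI[where k = "n + 1" and G = G and c = "kc e ;; Wr n 2"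
        and p = "[:kt e + 2, kt e:]"])
    show "wfc (n + 1) G (kc e ;; Wr n 2)" using wfc_kc[OF wf, of "n + 1"] wf by simp
    fix ws :: "bool list list"
    assume ws: "length ws = 2"
    define x u where "x = ws ! 0" and "u = ws ! 1"
    have len: "sum_list (map length ws) = length x + length u"
      using ws by (auto simp: x_def u_def numeral_2_eq_2 length_Suc_conv)
    let ?m = "initial_mem ws"
    have m: "?m 0 = tp 0 (map bit_symbol x)" "?m 1 = tp 0 (map bit_symbol u)"
      "r \<ge> 2 \<Longrightarrow> ?m r = tp 0 []" for r
      using ws by (auto simp: initial_mem_def tp_def x_def u_def string_contents_str)
    have rep: "krep ?m (kinit x) u"
      unfolding krep_def
      by (intro conjI exI[of _ 0] exI[of _ "map bit_symbol x"] exI[of _ u])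
        (auto simp: m m[unfolded One_nat_def] kinit_def bit_symbol_def split: if_splits)
    from kc_correct[OF wf(1,2) rep] have spec: "kspec n e ?m u (keval e (kinit x) u)" .
    show "\<exists>T f m. runs (kc e ;; Wr n 2) ?m T f m \<and>
      T \<le> poly [:kt e + 2, kt e:] (sum_list (map length ws)) \<and>
      snd (m (n + 1 - 1)) = string_contents (?v ws)"
    proof (cases "keval e (kinit x) u")
      case None
      then obtain m' where m': "runs (kc e) ?m (kt e * (length u + 1)) False m'" "m' n = ?m n"
        using kspecND spec by (metis order_refl)
      show ?thesis
        by (rule exI, rule exI, rule exI, rule conjI[OF runs_SeqH[OF m'(1) order_refl]])
          (use None m'(2) m(3)[of n] wf(2) in \<open>auto simp: len tp_def string_contents_str algebra_simps
            simp flip: x_def u_def One_nat_def\<close>)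
    next
      case (Some res)
      obtain s' us' where res: "keval e (kinit x) u = Some (s', us')" using Some by (cases res) auto
      then obtain m' where m': "runs (kc e) ?m (kt e * (length u - length us' + 1)) True m'"
          "m' n = ?m n"
        using kspecSD spec by (metis order_refl)
      have wr2: "runs (Wr n 2) m' 1 True (m'(n := tp 0 [2]))"
        by (rule runs_Wr) (use m'(2) m(3)[of n] wf(2) wr_tp_append[of 0 "[]" 2] in auto)
      show ?thesis
        by (rule exI, rule exI, rule exI, rule conjI[OF runs_Seq[OF m'(1) wr2 order_refl]])
          (use res mult_le_mono2[OF diff_le_self, of "kt e" "length u" "length us'"] in
            \<open>auto simp: len tp_def string_contents_str bit_symbol_def algebra_simps
              simp flip: x_def u_def One_nat_def\<close>)
    qed
  qed (use wf in auto)
  moreover have "x \<in> L \<longleftrightarrow> (\<exists>u. length u \<le> poly p (length x) \<and> ?v [x, u] = [True])" for x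
  proof
    assume "x \<in> L"
    then obtain j s' where j: "ksem e j (kinit x) s'" "j \<le> poly p (length x)" using complete by blast
    from ksem_ev[OF j(1)] obtain vs where "length vs = j" "keval e (kinit x) (vs @ []) = Some (s', [])"
      by blast
    then show "\<exists>u. length u \<le> poly p (length x) \<and> ?v [x, u] = [True]"
      using j(2) by (intro exI[of _ vs]) simp
  next
    assume "\<exists>u. length u \<le> poly p (length x) \<and> ?v [x, u] = [True]"
    then show "x \<in> L" using keval_ksem sound by (auto split: if_splits) metis
  qed
  ultimately show ?thesis unfolding in_NP_def by blast
qed

section \<open>Lazy solutions\<close>

fun page_of :: "request \<Rightarrow> page" where
  "page_of (General p) = p"
| "page_of (Specific p j) = p"

fun slot_ok :: "nat \<Rightarrow> request \<Rightarrow> slot \<Rightarrow> bool" where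
  "slot_ok k (General p) s \<longleftrightarrow> s \<in> {1..k}"
| "slot_ok k (Specific p j) s \<longleftrightarrow> s \<in> {1..k} \<and> s = j"

text \<open>The number of retrievals if each request is served in the given slot and every slot keeps its
  page until it has to serve another one.\<close>

fun misses :: "cache \<Rightarrow> (request \<times> slot) list \<Rightarrow> nat" where
  "misses C [] = 0"
| "misses C ((r, s) # l) =
     (if C s = Some (page_of r) then 0 else 1) + misses (C(s \<mapsto> page_of r)) l"

fun caches :: "cache \<Rightarrow> (request \<times> slot) list \<Rightarrow> cache list" where
  "caches C [] = []"
| "caches C ((r, s) # l) = C(s \<mapsto> page_of r) # caches (C(s \<mapsto> page_of r)) l"

fun rcost :: "cache \<Rightarrow> cache list \<Rightarrow> nat" where
  "rcost B [] = 0"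
| "rcost B (C # Cs) = card {s. C s \<noteq> None \<and> B s \<noteq> C s} + rcost C Cs"

text \<open>The cache before the first step is a parameter, since the induction over the sequence
  moves it along.\<close>

definition retrievals_from :: "cache \<Rightarrow> cache list \<Rightarrow> (page \<times> slot \<times> nat) set" where
  "retrievals_from B Cs = {(p, s, t). t < length Cs \<and> (Cs ! t) s = Some p \<and>
     (if t = 0 then B s else (Cs ! (t - 1)) s) \<noteq> Some p}"

lemma card_retrievals_from:
  assumes "\<forall>C\<in>set Cs. finite (dom C)"
  shows "finite (retrievals_from B Cs) \<and> card (retrievals_from B Cs) = rcost B Cs"
  using assms
proof (induction Cs arbitrary: B)
  case Nil
  have "retrievals_from B [] = {}" by (auto simp: retrievals_from_def)
  then show ?case by simp
next
  case (Cons C Cs)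
  let ?S = "{s. C s \<noteq> None \<and> B s \<noteq> C s}"
  let ?A = "(\<lambda>s. (the (C s), s, 0::nat)) ` ?S" and ?f = "\<lambda>(p::page, s::slot, t). (p, s, Suc t)"
  have fin: "finite ?S" using Cons.prems by (auto intro: finite_subset[of _ "dom C"])
  have eq: "retrievals_from B (C # Cs) = ?A \<union> ?f ` retrievals_from C Cs" (is "?L = ?R")
  proof (intro equalityI subsetI)
    fix x assume "x \<in> ?L"
    then obtain p s t where x: "x = (p, s, t)" "t < Suc (length Cs)" "((C # Cs) ! t) s = Some p"
        "(if t = 0 then B s else ((C # Cs) ! (t - 1)) s) \<noteq> Some p"
      by (auto simp: retrievals_from_def)
    show "x \<in> ?R"
    proof (cases t)
      case 0
      then have "x = (\<lambda>s. (the (C s), s, 0)) s" "s \<in> ?S" using x by auto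
      then show ?thesis by blast
    next
      case (Suc t')
      then have "x = ?f (p, s, t')" "(p, s, t') \<in> retrievals_from C Cs"
        using x by (auto simp: retrievals_from_def nth_Cons split: nat.splits)
      then show ?thesis by blast
    qed
  next
    fix x assume "x \<in> ?R"
    then show "x \<in> ?L"
      by (auto simp: retrievals_from_def nth_Cons split: nat.splits if_splits)
  qed
  have "inj_on ?f (retrievals_from C Cs)" by (auto simp: inj_on_def)
  moreover have "inj_on (\<lambda>s. (the (C s), s, 0::nat)) ?S" by (auto simp: inj_on_def)
  moreover have "?A \<inter> ?f ` retrievals_from C Cs = {}" by auto
  ultimately show ?case using Cons fin
    by (simp add: eq card_Un_disjoint card_image)
qed

lemma cost_rcost: "\<forall>C\<in>set Cs. finite (dom C) \<Longrightarrow> cost Cs = rcost Map.empty Cs"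
proof -
  assume *: "\<forall>C\<in>set Cs. finite (dom C)"
  have "retrievals Cs = retrievals_from Map.empty Cs"
    by (auto simp: retrievals_def retrievals_from_def split: if_splits)
  then show ?thesis using card_retrievals_from[OF *] by (simp add: cost_def)
qed

text \<open>The potential counts the slots in which the lazy cache \<open>C\<close> differs from the actual cache
  \<open>B\<close>.\<close>

lemma misses_le_rcost:
  assumes "length \<sigma> = length ss" "length ss = length Cs"
    "\<forall>t < length \<sigma>. (Cs ! t) (ss ! t) = Some (page_of (\<sigma> ! t))"
    "\<forall>C\<in>set Cs. finite (dom C)" "finite (dom B)"
  shows "misses C (zip \<sigma> ss) \<le> rcost B Cs + card {s. B s \<noteq> None \<and> C s \<noteq> B s}"
  using assms
proof (induction \<sigma> ss Cs arbitrary: B C rule: list_induct3)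
  case (Cons r \<sigma> s ss B' Cs)
  have B's: "B' s = Some (page_of r)" using Cons.prems(1) by fastforce
  have rest: "\<forall>t < length \<sigma>. (Cs ! t) (ss ! t) = Some (page_of (\<sigma> ! t))"
    using Cons.prems(1) by fastforce
  let ?C = "C(s \<mapsto> page_of r)"
  let ?P = "\<lambda>C B. {s. B s \<noteq> None \<and> C s \<noteq> B s}"
  have fin: "finite (?P X B')" "finite (?P X B)" for X
    using Cons.prems by (auto intro: finite_subset[of _ "dom B'"] finite_subset[of _ "dom B"])
  have IH: "misses ?C (zip \<sigma> ss) \<le> rcost B' Cs + card (?P ?C B')"
    by (rule Cons.IH[OF rest]) (use Cons.prems in auto)
  \<comment> \<open>A triangle inequality for the sets of slots in which two caches differ; the set
    for \<open>B\<close> and \<open>B'\<close> is what the actual solution pays in this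
    step.\<close>
  have sub: "?P C B' \<subseteq> ?P C B \<union> ?P B B'" by auto
  have "card (?P C B') \<le> card (?P C B) + card (?P B B')"
    by (rule order_trans[OF card_mono[OF _ sub] card_Un_le]) (use fin in auto)
  \<comment> \<open>On a miss the lazy cache differs from \<open>B'\<close> in \<open>s\<close>,
    where \<open>B'\<close> holds the requested page. Serving the request removes this difference,
    which pays for the miss.\<close>
  moreover have "(if C s = Some (page_of r) then 0 else 1) + card (?P ?C B') \<le> card (?P C B')"
  proof (cases "C s = Some (page_of r)")
    case True
    then have "?C = C" by auto
    then show ?thesis using True by simp
  next
    case False
    have "?P C B' = insert s (?P ?C B')" "s \<notin> ?P ?C B'" using False B's by auto
    then show ?thesis using False fin by simp
  qed
  ultimately show ?case using IH by simp
qed simp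

lemma rcost_caches: "rcost C (caches C l) \<le> misses C l"
proof (induction l arbitrary: C)
  case (Cons x l)
  obtain r s where x: "x = (r, s)" by fastforce
  let ?C = "C(s \<mapsto> page_of r)"
  have "{s'. ?C s' \<noteq> None \<and> C s' \<noteq> ?C s'} = (if C s = Some (page_of r) then {} else {s})"
    by auto
  then have "card {s'. ?C s' \<noteq> None \<and> C s' \<noteq> ?C s'} = (if C s = Some (page_of r) then 0 else 1)"
    by simp
  then show ?case using Cons[of ?C] unfolding x rcost.simps misses.simps caches.simps by linarith
qed simp

lemma caches_props:
  assumes "list_all2 (slot_ok k) \<sigma> ss" "is_cache k C"
  shows "is_solution k \<sigma> (caches C (zip \<sigma> ss))"
  using assms
proof (induction \<sigma> ss arbitrary: C rule: list_all2_induct)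
  case Nil
  then show ?case by (simp add: is_solution_def)
next
  case (Cons r \<sigma> s ss)
  have s: "s \<in> {1..k}" using Cons(1) by (cases r) auto
  have C: "is_cache k (C(s \<mapsto> page_of r))" using Cons(4) s by (auto simp: is_cache_def)
  have "satisfies k (C(s \<mapsto> page_of r)) r" using Cons(1) by (cases r) auto
  then show ?case using Cons(3)[OF C] C unfolding is_solution_def
    by (auto simp: nth_Cons split: nat.splits)
qed

lemma is_cache_finite: "is_cache k C \<Longrightarrow> finite (dom C)"
  by (auto simp: is_cache_def intro: finite_subset)

lemma is_solution_finite:
  assumes "is_solution k \<sigma> Cs"
  shows "\<forall>C\<in>set Cs. finite (dom C)"
proof
  fix C assume "C \<in> set Cs"
  then obtain i where "i < length Cs" "C = Cs ! i" by (metis in_set_conv_nth)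
  then show "finite (dom C)" using assms is_cache_finite[of k C] by (simp add: is_solution_def)
qed

text \<open>Every solution names a slot that serves each request, and the lazy run with these slots
  costs no more: both start with the empty cache, hence with potential zero.\<close>

lemma solution_iff_misses:
  "(\<exists>Cs. is_solution k \<sigma> Cs \<and> cost Cs \<le> F) \<longleftrightarrow>
   (\<exists>ss. list_all2 (slot_ok k) \<sigma> ss \<and> misses Map.empty (zip \<sigma> ss) \<le> F)" (is "?L \<longleftrightarrow> ?R")
proof
  assume ?L
  then obtain Cs where Cs: "is_solution k \<sigma> Cs" "cost Cs \<le> F" by blast
  have "\<exists>s. slot_ok k (\<sigma> ! t) s \<and> (Cs ! t) s = Some (page_of (\<sigma> ! t))" if "t < length \<sigma>" for t
  proof -
    from that Cs have *: "is_cache k (Cs ! t)" "satisfies k (Cs ! t) (\<sigma> ! t)"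
      by (auto simp: is_solution_def)
    show ?thesis
    proof (cases "\<sigma> ! t")
      case (Specific p j)
      then have "(Cs ! t) j = Some p" using * by simp
      then have "j \<in> {1..k}" using *(1) unfolding is_cache_def by (metis domI subsetD)
      then show ?thesis using Specific * by auto
    qed (use * in auto)
  qed
  then obtain g where g: "\<forall>t<length \<sigma>. slot_ok k (\<sigma> ! t) (g t) \<and> (Cs ! t) (g t) = Some (page_of (\<sigma> ! t))"
    by metis
  let ?ss = "map g [0..<length \<sigma>]"
  have fin: "\<forall>C\<in>set Cs. finite (dom C)"
    using is_solution_finite[OF Cs(1)] .
  have "misses Map.empty (zip \<sigma> ?ss) \<le> rcost Map.empty Cs + card {s::slot. False}"
    using misses_le_rcost[of \<sigma> ?ss Cs Map.empty Map.empty] g fin Cs(1)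
    by (simp add: is_solution_def)
  then have "misses Map.empty (zip \<sigma> ?ss) \<le> F" using Cs(2) cost_rcost[OF fin] by simp
  moreover have "list_all2 (slot_ok k) \<sigma> ?ss" using g by (auto simp: list_all2_conv_all_nth)
  ultimately show ?R by blast
next
  assume ?R
  then obtain ss where ss: "list_all2 (slot_ok k) \<sigma> ss" "misses Map.empty (zip \<sigma> ss) \<le> F" by blast
  let ?Cs = "caches Map.empty (zip \<sigma> ss)"
  have sol: "is_solution k \<sigma> ?Cs" using caches_props[OF ss(1)] by (simp add: is_cache_def)
  then have "\<forall>C\<in>set ?Cs. finite (dom C)" by (rule is_solution_finite)
  then have "cost ?Cs \<le> F" using cost_rcost rcost_caches[of Map.empty "zip \<sigma> ss"] ss(2) by fastforce
  then show ?L using sol by blast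
qed

section \<open>All-or-One Paging is in NP\<close>

text \<open>Soundness does not depend on the number of choices and completeness only on an upper
  bound for it, hence the two relations \<open>sem\<close> and \<open>kle\<close>.\<close>

definition sem :: "kat \<Rightarrow> store \<Rightarrow> store \<Rightarrow> bool" where
  "sem e s s' \<longleftrightarrow> (\<exists>n. ksem e n s s')"

definition kle :: "kat \<Rightarrow> nat \<Rightarrow> store \<Rightarrow> store \<Rightarrow> bool" where
  "kle e N s s' \<longleftrightarrow> (\<exists>n\<le>N. ksem e n s s')"

inductive_cases ksem_PopE: "ksem (Pop r a) n s s'"
inductive_cases ksem_PushE: "ksem (Push r a) n s s'"
inductive_cases ksem_EndXE: "ksem EndX n s s'"
inductive_cases ksem_KSkipE: "ksem KSkip n s s'"
inductive_cases ksem_KSeqE: "ksem (a \<triangleright> b) n s s'"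
inductive_cases ksem_PlusE: "ksem (Plus a b) n s s'"
inductive_cases ksem_StarE: "ksem (Star a) n s s'"

lemma sem_simps [simp]:
  "sem (Pop r x) s s' \<longleftrightarrow> (\<exists>l. s r = x # l \<and> s' = s(r := l))"
  "sem (Push r x) s s' \<longleftrightarrow> s' = s(r := x # s r)"
  "sem EndX s s' \<longleftrightarrow> s' = s \<and> s 0 = []"
  "sem KSkip s s' \<longleftrightarrow> s' = s"
  "sem (a \<triangleright> b) s s' \<longleftrightarrow> (\<exists>s1. sem a s s1 \<and> sem b s1 s')"
  "sem (Plus a b) s s' \<longleftrightarrow> sem a s s' \<or> sem b s s'"
  unfolding sem_def
       apply (blast elim: ksem_PopE intro: ksem.Pop)
      apply (blast elim: ksem_PushE intro: ksem.Push)
     apply (blast elim: ksem_EndXE intro: ksem.EndX)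
    apply (blast elim: ksem_KSkipE intro: ksem.KSkip)
   apply (blast elim: ksem_KSeqE intro: ksem.KSeq)
  apply (blast elim: ksem_PlusE intro: ksem.PlusL ksem.PlusR)
  done

lemma ksem_Star_rtranclp: "ksem e n s s' \<Longrightarrow> e = Star a \<Longrightarrow> (sem a)\<^sup>*\<^sup>* s s'"
proof (induction arbitrary: a rule: ksem.induct)
  case (StarC b n s s1 n' s2)
  have "sem a s s1" using StarC.hyps(1) StarC.prems by (auto simp: sem_def)
  moreover have "(sem a)\<^sup>*\<^sup>* s1 s2" using StarC.IH(2) StarC.prems by simp
  ultimately show ?case by (rule converse_rtranclp_into_rtranclp)
qed auto

lemma sem_StarD: "sem (Star a) s s' \<Longrightarrow> (sem a)\<^sup>*\<^sup>* s s'"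
  using ksem_Star_rtranclp[OF _ refl, of a] sem_def[of "Star a"] by blast

lemma sem_Star_inv:
  assumes "sem (Star a) s s'" "I s" "\<And>s s'. I s \<Longrightarrow> sem a s s' \<Longrightarrow> I s'"
  shows "I s'"
  using sem_StarD[OF assms(1)] by (induction rule: rtranclp_induct) (use assms in auto)

fun alts :: "kat list \<Rightarrow> kat" where
  "alts [] = EndX"
| "alts [e] = e"
| "alts (e # f # esym) = Plus e (alts (f # esym))"

lemma sem_alts: "esym \<noteq> [] \<Longrightarrow> sem (alts esym) s s' \<longleftrightarrow> (\<exists>e\<in>set esym. sem e s s')"
  by (induction esym rule: alts.induct) auto

lemma kle_mono: "kle e N s s' \<Longrightarrow> N \<le> M \<Longrightarrow> kle e M s s'"
  unfolding kle_def by (meson order_trans)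

lemma kle_Seq: "kle a N s s1 \<Longrightarrow> kle b M s1 s2 \<Longrightarrow> N + M \<le> L \<Longrightarrow> kle (a \<triangleright> b) L s s2"
  unfolding kle_def by (meson add_mono ksem.KSeq order_trans)

lemma kle_PlusL: "kle a N s s' \<Longrightarrow> Suc N \<le> L \<Longrightarrow> kle (Plus a b) L s s'"
  unfolding kle_def by (meson Suc_le_mono ksem.PlusL order_trans)

lemma kle_PlusR: "kle b N s s' \<Longrightarrow> Suc N \<le> L \<Longrightarrow> kle (Plus a b) L s s'"
  unfolding kle_def by (meson Suc_le_mono ksem.PlusR order_trans)

lemma kle_KSkip: "kle KSkip 0 s s"
  unfolding kle_def using ksem.KSkip by blast

lemma kle_EndX: "s 0 = [] \<Longrightarrow> kle EndX 0 s s"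
  unfolding kle_def using ksem.EndX by blast

lemma kle_alts: "kle e N s s' \<Longrightarrow> e \<in> set esym \<Longrightarrow> N + length esym \<le> L \<Longrightarrow> kle (alts esym) L s s'"
proof (induction esym arbitrary: L rule: alts.induct)
  case (2 e')
  then show ?case by (auto elim: kle_mono)
next
  case (3 e' f esym)
  show ?case
  proof (cases "e = e'")
    case True
    then show ?thesis using 3(2,4) by (auto intro: kle_PlusL)
  next
    case False
    then have "kle (alts (f # esym)) (N + length (f # esym)) s s'" using 3(1)[OF 3(2)] 3(3) by simp
    then show ?thesis using 3(4) by (auto intro: kle_PlusR)
  qed
qed auto

text \<open>\<open>f i\<close> is the store after \<open>i\<close> iterations. Each costs at most
  \<open>c\<close> choices and one for continuing; a last choice leaves the loop.\<close>

lemma kle_Star: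
  assumes "\<And>i. i < len \<Longrightarrow> kle e c (f i) (f (Suc i))" "len * (c + 1) + 1 \<le> L"
  shows "kle (Star e) L (f 0) (f len)"
  using assms
proof (induction len arbitrary: f L)
  case 0
  then show ?case unfolding kle_def using ksem.StarN by auto
next
  case (Suc len)
  have "kle (Star e) (len * (c + 1) + 1) (f (Suc 0)) (f (Suc len))"
    using Suc.IH[of "\<lambda>i. f (Suc i)" "len * (c + 1) + 1"] Suc.prems(1) by simp
  then obtain n where n: "n \<le> len * (c + 1) + 1" "ksem (Star e) n (f (Suc 0)) (f (Suc len))"
    unfolding kle_def by blast
  obtain n' where n': "n' \<le> c" "ksem e n' (f 0) (f (Suc 0))"
    using Suc.prems(1)[of 0] unfolding kle_def by auto
  from ksem.StarC[OF n'(2) n(2)] show ?case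
    unfolding kle_def using n(1) n'(1) Suc.prems(2) by (intro exI[of _ "Suc (n' + n)"]) auto
qed

section \<open>Binary numerals on stacks\<close>

definition bsym :: "nat \<Rightarrow> nat list" where
  "bsym n = map bit_symbol (binary n)"

text \<open>The prefix-free code of a number without its end mark: the symbol 2 announces one more
  digit.\<close>

definition psym :: "nat list \<Rightarrow> nat list" where
  "psym l = concat (map (\<lambda>b. [2, b]) l)"

definition esym :: "nat \<Rightarrow> nat list" where
  "esym n = map bit_symbol (encode_nat n)"

lemma bit_symbol_simps [simp]: "bit_symbol True = 2" "bit_symbol False = 1"
  by (auto simp: bit_symbol_def)

lemma esym_psym: "esym n = psym (bsym n) @ [1]"
proof -
  have "map bit_symbol (concat (map (\<lambda>b. [True, b]) l)) = psym (map bit_symbol l)" for l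
    by (induction l) (auto simp: psym_def)
  then show ?thesis by (simp add: esym_def bsym_def encode_nat_def)
qed

lemma psym_append [simp]: "psym (a @ b) = psym a @ psym b" "psym [] = []" "psym (x # b) = 2 # x # psym b"
  by (auto simp: psym_def)

text \<open>Symbols other than 2 count as the digit 0, so neither padding with 1 nor the sentinel 3
  changes the value.\<close>

fun lsb_val :: "nat list \<Rightarrow> nat" where
  "lsb_val [] = 0"
| "lsb_val (x # xs) = (if x = 2 then 1 else 0) + 2 * lsb_val xs"

lemma binary_Cons: "n > 0 \<Longrightarrow> binary n = odd n # binary (n div 2)"
  by (simp add: binary.simps)

lemma binary_0 [simp]: "binary 0 = []"
  by (simp add: binary.simps)

lemma bsym_bits: "set (bsym n) \<subseteq> {1, 2}"
  by (auto simp: bsym_def bit_symbol_def)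

lemma lsb_val_bsym [simp]: "lsb_val (bsym n) = n"
proof (induction n rule: less_induct)
  case (less n)
  show ?case
  proof (cases "n = 0")
    case False
    then have "lsb_val (bsym (n div 2)) = n div 2" using less by simp
    then show ?thesis using False by (auto simp: bsym_def binary_Cons bit_symbol_def)
  qed (simp add: bsym_def)
qed

lemma bsym_double: "n > 0 \<Longrightarrow> bsym (2 * n) = 1 # bsym n" "bsym (Suc (2 * n)) = 2 # bsym n"
  by (auto simp: bsym_def binary_Cons)

lemma val_pos: "2 \<in> set xs \<Longrightarrow> lsb_val xs > 0"
  by (induction xs) auto

text \<open>Canonical numerals are the digit strings whose most significant digit is 1, that is,
  whose last symbol is 2. \<open>bsym_last\<close> is the converse for positive numbers.\<close>

lemma bsym_val: "set l \<subseteq> {1, 2} \<Longrightarrow> bsym (lsb_val (l @ [2])) = l @ [2]"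
proof (induction l)
  case Nil
  then show ?case using bsym_double(2)[of 0] by (simp add: bsym_def)
next
  case (Cons x l)
  have "lsb_val (l @ [2]) > 0" by (rule val_pos) simp
  then show ?case using Cons bsym_double[of "lsb_val (l @ [2])"] by auto
qed

lemma bsym_last: "n > 0 \<Longrightarrow> \<exists>l. bsym n = l @ [2] \<and> set l \<subseteq> {1, 2}"
proof (induction n rule: less_induct)
  case (less n)
  show ?case
  proof (cases "n div 2 = 0")
    case True
    then have "n = 1" using less.prems by auto
    then show ?thesis by (simp add: bsym_def binary_Cons)
  next
    case False
    then obtain l where "bsym (n div 2) = l @ [2]" "set l \<subseteq> {1, 2}"
      using less.IH[of "n div 2"] less.prems by auto
    then show ?thesis using less.prems
      by (intro exI[of _ "bit_symbol (odd n) # l"]) (auto simp: bsym_def binary_Cons bit_symbol_def)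
  qed
qed

lemma val_zeros [simp]: "lsb_val (l @ replicate j (Suc 0)) = lsb_val l" "lsb_val (l @ [3]) = lsb_val l"
proof -
  have "lsb_val (replicate j (Suc 0)) = 0" by (induction j) auto
  then show "lsb_val (l @ replicate j (Suc 0)) = lsb_val l" by (induction l) auto
  show "lsb_val (l @ [3]) = lsb_val l" by (induction l) auto
qed

lemma val_append: "lsb_val (a @ b) = lsb_val a + 2 ^ length a * lsb_val b"
  by (induction a) auto

lemma val_less: "lsb_val a < 2 ^ length a"
proof (induction a)
  case (Cons x a)
  then have "lsb_val a + 1 \<le> 2 ^ length a" by simp
  then show ?case by auto
qed simp

text \<open>The most significant changed digit decides, whatever happens below it. This is why
  \<open>decr\<close> may guess the lower digits freely.\<close>

lemma val_decrease: "length lo = length lo' \<Longrightarrow> lsb_val (lo' @ 1 # hi) < lsb_val (lo @ 2 # hi)"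
  using val_less[of lo'] by (simp add: val_append)

lemma val_inj: "length a = length b \<Longrightarrow> set a \<subseteq> {1, 2} \<Longrightarrow> set b \<subseteq> {1, 2} \<Longrightarrow> lsb_val a = lsb_val b \<Longrightarrow> a = b"
proof (induction a b rule: list_induct2)
  case (Cons x xs y ys)
  have "x = 1 \<or> x = 2" "y = 1 \<or> y = 2" using Cons.prems by auto
  then have "x = y \<and> lsb_val xs = lsb_val ys"
    using Cons.prems(3) by (auto simp: numeral_2_eq_2) presburger+
  then show ?case using Cons by auto
qed simp

text \<open>The converse of \<open>val_decrease\<close>: it shows that \<open>decr\<close> can reach
  every smaller value of the same width.\<close>

lemma val_less_split:
  assumes "length a = length b" "set a \<subseteq> {1, 2}" "set b \<subseteq> {1, 2}" "lsb_val b < lsb_val a"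
  shows "\<exists>lo lo' hi. a = lo @ 2 # hi \<and> b = lo' @ 1 # hi \<and> length lo = length lo' \<and>
    set lo \<subseteq> {1, 2} \<and> set lo' \<subseteq> {1, 2}"
  using assms
proof (induction a b rule: list_induct2)
  case (Cons x xs y ys)
  have xy: "x = 1 \<or> x = 2" "y = 1 \<or> y = 2" using Cons.prems by auto
  show ?case
  proof (cases "lsb_val ys < lsb_val xs")
    case True
    then obtain lo lo' hi where "xs = lo @ 2 # hi" "ys = lo' @ 1 # hi" "length lo = length lo'"
        "set lo \<subseteq> {1, 2}" "set lo' \<subseteq> {1, 2}"
      using Cons by auto
    then show ?thesis using xy
      by (intro exI[of _ "x # lo"] exI[of _ "y # lo'"] exI[of _ hi]) auto
  next
    case False
    then have "lsb_val xs = lsb_val ys" "x = 2" "y = 1"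
      using Cons.prems(3) xy by (auto split: if_splits)
    then have "xs = ys" using val_inj[OF Cons.hyps(1)] Cons.prems by auto
    then show ?thesis using \<open>x = 2\<close> \<open>y = 1\<close>
      by (intro exI[of _ "[]"] exI[of _ ys]) auto
  qed
qed simp

text \<open>The choice admits canonical numerals only: no digits at all, or a most significant digit
  1. Otherwise strings that are no codes of instances would be accepted.\<close>

definition emit_nat :: "nat \<Rightarrow> kat" where
  "emit_nat r = Plus KSkip
     (Star (Plus (Pop 0 2 \<triangleright> Pop 0 1 \<triangleright> Push r 1) (Pop 0 2 \<triangleright> Pop 0 2 \<triangleright> Push r 2))
        \<triangleright> Pop 0 2 \<triangleright> Pop 0 2 \<triangleright> Push r 2) \<triangleright> Pop 0 1"

definition mvs :: "nat \<Rightarrow> nat \<Rightarrow> nat list \<Rightarrow> kat" where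
  "mvs a b A = Star (alts (map (\<lambda>x. Pop a x \<triangleright> Push b x) A))"

text \<open>An emptiness test for the scratch stack 3, whose bottom symbol is 3.\<close>

definition tmtest :: kat where
  "tmtest = Pop 3 3 \<triangleright> Push 3 3"

text \<open>Replaces the number by an arbitrary smaller one of the same width. Strict decrease is
  all that budget and slot counter need, and it spares the propagation of borrows.\<close>

definition decr :: "nat \<Rightarrow> kat" where
  "decr r = Star (alts [Pop r 1 \<triangleright> Push 3 1, Pop r 1 \<triangleright> Push 3 2, Pop r 2 \<triangleright> Push 3 1, Pop r 2 \<triangleright> Push 3 2])
     \<triangleright> Pop r 2 \<triangleright> Push r 1 \<triangleright> mvs 3 r [1, 2] \<triangleright> tmtest"

definition read_nat :: "nat \<Rightarrow> kat" where
  "read_nat r = emit_nat 3 \<triangleright> mvs 3 r [1, 2] \<triangleright> tmtest"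

text \<open>Copies the slot counter on stack 2 into an entry with an empty page. The copy stops at
  the last 2, since the counter may have leading zeros but the slot of an entry has to be canonical;
  this also excludes slot 0.\<close>

definition new_entry :: kat where
  "new_entry = Push 5 4 \<triangleright> Push 5 7 \<triangleright> Push 5 5 \<triangleright>
     Star (alts [Pop 2 1 \<triangleright> Push 3 1 \<triangleright> Push 5 1, Pop 2 2 \<triangleright> Push 3 2 \<triangleright> Push 5 2]) \<triangleright>
     (Pop 2 2 \<triangleright> Push 3 2 \<triangleright> Push 5 2) \<triangleright> mvs 2 3 [1] \<triangleright> (Pop 2 3 \<triangleright> Push 2 3) \<triangleright>
     mvs 3 2 [1, 2] \<triangleright> tmtest \<triangleright> Push 5 6"

text \<open>Compares a coded number in the input with plain digits on stack 6. What has been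
  compared moves to stack 5, so the cache is preserved.\<close>

definition chunk :: kat where
  "chunk = Star (alts [Pop 0 2 \<triangleright> Pop 0 1 \<triangleright> Pop 6 1 \<triangleright> Push 5 1, Pop 0 2 \<triangleright> Pop 0 2 \<triangleright> Pop 6 2 \<triangleright> Push 5 2])
     \<triangleright> Pop 0 1"

definition skip_sym :: "nat \<Rightarrow> kat" where
  "skip_sym a = Pop 6 a \<triangleright> Push 5 a"

text \<open>The first alternative is a hit. The second is a miss, which may discard any old page,
  including the empty mark 7.\<close>

definition serve_page :: kat where
  "serve_page = Plus (chunk \<triangleright> skip_sym 5)
     (decr 4 \<triangleright> Star (alts [Pop 6 1, Pop 6 2, Pop 6 7]) \<triangleright> emit_nat 5 \<triangleright> skip_sym 5)"

text \<open>The two moves put the boundary between the stacks 5 and 6 anywhere, which selects an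
  entry without comparing slots; \<open>skip_sym 4\<close> admits only the start of an entry. A
  general request accepts any entry, a specific one compares the slot too.\<close>

definition serve :: kat where
  "serve = mvs 5 6 [1, 2, 4, 5, 6, 7] \<triangleright> mvs 6 5 [1, 2, 4, 5, 6, 7] \<triangleright> skip_sym 4 \<triangleright>
     Plus (Pop 0 1 \<triangleright> serve_page) (Pop 0 2 \<triangleright> serve_page \<triangleright> chunk \<triangleright> skip_sym 6)"

text \<open>
  The verifier guesses the instance together with a lazy solution and compares the instance with
  the input while it is generated. The slots that are used are enumerated in strictly decreasing
  order from \<open>k\<close>, which makes them distinct and at most \<open>k\<close>. The cache is a sequence of entries
  \<open>4 page 5 slot 6\<close> on the stacks 5 and 6, where the page is the symbol 7 if the slot is empty. Each
  miss decreases the budget \<open>F\<close> on stack 4.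
\<close>

definition verifier :: kat where
  "verifier = Push 3 3 \<triangleright> Push 2 3 \<triangleright> read_nat 2 \<triangleright> Pop 0 1 \<triangleright> read_nat 4 \<triangleright> Plus KSkip (decr 2) \<triangleright>
     Star (new_entry \<triangleright> decr 2) \<triangleright> Star (Pop 0 2 \<triangleright> serve) \<triangleright> Pop 0 1 \<triangleright> EndX"

lemma wfk_verifier: "wfk 7 8 verifier"
  by (simp add: verifier_def read_nat_def decr_def new_entry_def serve_def serve_page_def chunk_def skip_sym_def
      tmtest_def mvs_def emit_nat_def)

subsection \<open>Soundness\<close>

lemma sem_emit_nat:
  assumes "sem (emit_nat r) s s'" "r \<noteq> 0"
  shows "\<exists>n rest. s 0 = esym n @ rest \<and> s' = s(0 := rest, r := rev (bsym n) @ s r)"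
proof -
  have loop: "\<exists>l rest. set l \<subseteq> {1, 2} \<and> s 0 = psym l @ rest \<and> t = s(0 := rest, r := rev l @ s r)"
    if "sem (Star (Plus (Pop 0 2 \<triangleright> Pop 0 1 \<triangleright> Push r 1) (Pop 0 2 \<triangleright> Pop 0 2 \<triangleright> Push r 2))) s t" for t
    using that
  proof (rule sem_Star_inv)
    show "\<exists>l rest. set l \<subseteq> {1, 2} \<and> s 0 = psym l @ rest \<and> s = s(0 := rest, r := rev l @ s r)"
      by (rule exI[of _ "[]"], rule exI[of _ "s 0"]) auto
  next
    fix t t'
    assume "\<exists>l rest. set l \<subseteq> {1, 2} \<and> s 0 = psym l @ rest \<and> t = s(0 := rest, r := rev l @ s r)"
      and st: "sem (Plus (Pop 0 2 \<triangleright> Pop 0 1 \<triangleright> Push r 1) (Pop 0 2 \<triangleright> Pop 0 2 \<triangleright> Push r 2)) t t'"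
    then obtain l rest where l: "set l \<subseteq> {1, 2}" "s 0 = psym l @ rest" "t = s(0 := rest, r := rev l @ s r)"
      by blast
    from st assms(2) obtain x rest' where x: "x \<in> {1, 2}" "t 0 = 2 # x # rest'"
        "t' = t(0 := rest', r := x # t r)"
      by auto
    have "t' = s(0 := rest', r := rev (l @ [x]) @ s r)"
      unfolding x(3) l(3) using assms(2) by (intro ext) simp
    moreover have "rest = 2 # x # rest'" using x(2) l(3) assms(2) by simp
    ultimately    show "\<exists>l rest. set l \<subseteq> {1, 2} \<and> s 0 = psym l @ rest \<and> t' = s(0 := rest, r := rev l @ s r)"
      using l(1,2) x(1) by (intro exI[of _ "l @ [x]"] exI[of _ rest']) auto
  qed
  let ?P = "Star (Plus (Pop 0 2 \<triangleright> Pop 0 1 \<triangleright> Push r 1) (Pop 0 2 \<triangleright> Pop 0 2 \<triangleright> Push r 2))"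
  obtain t where t: "sem (Plus KSkip (?P \<triangleright> Pop 0 2 \<triangleright> Pop 0 2 \<triangleright> Push r 2)) s t" "sem (Pop 0 1) t s'"
    using assms(1) unfolding emit_nat_def sem_simps(5) by blast
  consider "t = s" | "sem (?P \<triangleright> Pop 0 2 \<triangleright> Pop 0 2 \<triangleright> Push r 2) s t"
    using t(1) unfolding sem_simps(6) by auto
  then show ?thesis
  proof cases
    case 1
    then obtain rest where "s 0 = 1 # rest" "s' = s(0 := rest)" using t(2) by auto
    then show ?thesis
      using assms(2) by (intro exI[of _ 0] exI[of _ rest]) (simp add: esym_psym bsym_def fun_upd_idem)
  next
    case 2
    then obtain t1 where t10: "sem ?P s t1" "sem (Pop 0 2 \<triangleright> Pop 0 2 \<triangleright> Push r 2) t1 t"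
      unfolding sem_simps(5) by blast
    then obtain rest where t1: "sem ?P s t1" "t1 0 = 2 # 2 # 1 # rest" "s' = t1(r := 2 # t1 r, 0 := rest)"
      using t(2) assms(2) by (auto simp: fun_upd_twist)
    from loop[OF t1(1)] obtain l rest1 where l: "set l \<subseteq> {1, 2}" "s 0 = psym l @ rest1"
        "t1 = s(0 := rest1, r := rev l @ s r)" by blast
    have "s' = s(0 := rest, r := rev (l @ [2]) @ s r)"
      unfolding t1(3) l(3) using assms(2) by (intro ext) simp
    moreover have "rest1 = 2 # 2 # 1 # rest" using t1(2) l(3) assms(2) by simp
    ultimately show ?thesis using l(2)
      by (intro exI[of _ "lsb_val (l @ [2])"] exI[of _ rest]) (simp add: esym_psym bsym_val[OF l(1)])
  qed
qed

lemma sem_mvs: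
  assumes "sem (mvs a b A) s s'" "a \<noteq> b" "A \<noteq> []"
  shows "\<exists>l rest. set l \<subseteq> set A \<and> s a = l @ rest \<and> s' = s(a := rest, b := rev l @ s b)"
  using assms(1) unfolding mvs_def
proof (rule sem_Star_inv)
  show "\<exists>l rest. set l \<subseteq> set A \<and> s a = l @ rest \<and> s = s(a := rest, b := rev l @ s b)"
    by (rule exI[of _ "[]"], rule exI[of _ "s a"]) auto
next
  fix t t'
  assume "\<exists>l rest. set l \<subseteq> set A \<and> s a = l @ rest \<and> t = s(a := rest, b := rev l @ s b)"
    and st: "sem (alts (map (\<lambda>x. Pop a x \<triangleright> Push b x) A)) t t'"
  then obtain l rest where l: "set l \<subseteq> set A" "s a = l @ rest" "t = s(a := rest, b := rev l @ s b)"
    by blast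
  from st assms(2,3) obtain x rest' where x: "x \<in> set A" "t a = x # rest'"
      "t' = t(a := rest', b := x # t b)"
    by (auto simp: sem_alts)
  have "t' = s(a := rest', b := rev (l @ [x]) @ s b)"
    unfolding x(3) l(3) using assms(2) by (intro ext) simp
  moreover have "rest = x # rest'" using x(2) l(3) assms(2) by simp
  ultimately show "\<exists>l rest. set l \<subseteq> set A \<and> s a = l @ rest \<and> t' = s(a := rest, b := rev l @ s b)"
    using l(1,2) x(1) by (intro exI[of _ "l @ [x]"] exI[of _ rest']) auto
qed

lemma sem_tmtest: "sem tmtest s s' \<longleftrightarrow> (\<exists>l. s 3 = 3 # l) \<and> s' = s"
proof
  show "sem tmtest s s' \<Longrightarrow> (\<exists>l. s 3 = 3 # l) \<and> s' = s"
    by (auto simp: tmtest_def fun_upd_idem)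
  assume "(\<exists>l. s 3 = 3 # l) \<and> s' = s"
  then obtain l where "s 3 = 3 # l" "s' = s" by blast
  then have "sem (Pop 3 3) s (s(3 := l))" "sem (Push 3 3) (s(3 := l)) s'"
    by (auto simp: fun_upd_idem)
  then show "sem tmtest s s'" unfolding tmtest_def sem_simps(5) by blast
qed

lemma append_sep:
  assumes "xs @ c # ys = xs' @ c # ys'" "c \<notin> set xs" "c \<notin> set xs'"
  shows "xs = xs' \<and> ys = ys'"
  using assms by (auto simp: append_eq_append_conv2 append_eq_Cons_conv Cons_eq_append_conv)

text \<open>\<open>mvs\<close> may stop anywhere, but the test meets the sentinel only if all digits
  have been moved.\<close>

lemma sem_mvs_tmtest:
  assumes "sem (mvs 3 r [1, 2]) s s1" "sem tmtest s1 s'" "r \<noteq> 3" "s 3 = l @ [3]" "set l \<subseteq> {1, 2}"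
  shows "s' = s(3 := [3], r := rev l @ s r)"
proof -
  obtain l' rest where l': "set l' \<subseteq> {1, 2}" "s 3 = l' @ rest" "s1 = s(3 := rest, r := rev l' @ s r)"
    using sem_mvs[OF assms(1)] assms(3) by auto
  then obtain rest' where r: "rest = 3 # rest'" "s' = s1"
    using assms(2,3) by (auto simp: sem_tmtest)
  have "l = l' \<and> [] = rest'"
    by (rule append_sep[of _ 3]) (use assms(4,5) l' r in auto)
  then show ?thesis using l' r by simp
qed

lemma sem_read_nat:
  assumes "sem (read_nat r) s s'" "r \<noteq> 3" "r \<noteq> 0" "s 3 = [3]"
  shows "\<exists>n rest. s 0 = esym n @ rest \<and> s' = s(0 := rest, r := bsym n @ s r)"
proof -
  obtain s1 s2 where st: "sem (emit_nat 3) s s1" "sem (mvs 3 r [1, 2]) s1 s2" "sem tmtest s2 s'"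
    using assms(1) by (auto simp: read_nat_def)
  obtain n rest where n: "s 0 = esym n @ rest" "s1 = s(0 := rest, 3 := rev (bsym n) @ s 3)"
    using sem_emit_nat[OF st(1)] by auto
  have "s' = s1(3 := [3], r := bsym n @ s1 r)"
    using sem_mvs_tmtest[OF st(2,3), of "rev (bsym n)"] assms n bsym_bits[of n] by simp
  then have "s' = s(0 := rest, r := bsym n @ s r)" unfolding n(2) using assms by (intro ext) simp
  then show ?thesis using n(1) by blast
qed

lemma sem_decr:
  assumes "sem (decr r) s s'" "r \<noteq> 3" "s 3 = [3]"
  shows "\<exists>lo lo' hi. s r = lo @ 2 # hi \<and> s' = s(r := lo' @ 1 # hi) \<and> length lo = length lo' \<and>
    set lo \<subseteq> {1, 2} \<and> set lo' \<subseteq> {1, 2}"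
proof -
  let ?e = "alts [Pop r 1 \<triangleright> Push 3 1, Pop r 1 \<triangleright> Push 3 2, Pop r 2 \<triangleright> Push 3 1, Pop r 2 \<triangleright> Push 3 2]"
  obtain s1 s2 s3 s4 where st1: "sem (Star ?e) s s1" "sem (Pop r 2) s1 s2" "sem (Push r 1) s2 s3"
     "sem (mvs 3 r [1, 2]) s3 s4" "sem tmtest s4 s'"
    using assms(1) unfolding decr_def sem_simps(5) by blast
  then have st: "sem (Star ?e) s s1" "s1 r = 2 # s2 r" "s2 = s1(r := s2 r)"
     "s3 = s2(r := 1 # s2 r)" "sem (mvs 3 r [1, 2]) s3 s4" "sem tmtest s4 s'"
    by auto
  have "\<exists>l l' rest. set l \<subseteq> {1, 2} \<and> set l' \<subseteq> {1, 2} \<and> length l = length l' \<and> s r = l @ rest \<and>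
      s1 = s(r := rest, 3 := rev l' @ s 3)"
    using st(1)
  proof (rule sem_Star_inv)
    show "\<exists>l l' rest. set l \<subseteq> {1, 2} \<and> set l' \<subseteq> {1, 2} \<and> length l = length l' \<and> s r = l @ rest \<and>
      s = s(r := rest, 3 := rev l' @ s 3)"
      by (rule exI[of _ "[]"], rule exI[of _ "[]"], rule exI[of _ "s r"]) auto
  next
    fix t t'
    assume "\<exists>l l' rest. set l \<subseteq> {1, 2} \<and> set l' \<subseteq> {1, 2} \<and> length l = length l' \<and> s r = l @ rest \<and>
      t = s(r := rest, 3 := rev l' @ s 3)" and e: "sem ?e t t'"
    then obtain l l' rest where l: "set l \<subseteq> {1, 2}" "set l' \<subseteq> {1, 2}" "length l = length l'"
      "s r = l @ rest" "t = s(r := rest, 3 := rev l' @ s 3)" by blast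
    from e obtain x y where "x \<in> {1, 2}" "y \<in> {1, 2}" "sem (Pop r x \<triangleright> Push 3 y) t t'"
      by (auto simp: sem_alts)
    then obtain rest' where x: "x \<in> {1, 2}" "y \<in> {1, 2}" "t r = x # rest'"
        "t' = t(r := rest', 3 := y # t 3)"
      using assms(2) by auto
    have "t' = s(r := rest', 3 := rev (l' @ [y]) @ s 3)"
      unfolding x(4) l(5) using assms(2) by (intro ext) simp
    moreover have "rest = x # rest'" using x(3) l(5) assms(2) by simp
    ultimately show "\<exists>l l' rest. set l \<subseteq> {1, 2} \<and> set l' \<subseteq> {1, 2} \<and> length l = length l' \<and> s r = l @ rest \<and>
      t' = s(r := rest, 3 := rev l' @ s 3)"
      using l(1-4) x(1,2) by (intro exI[of _ "l @ [x]"] exI[of _ "l' @ [y]"] exI[of _ rest']) auto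
  qed
  then obtain l l' rest where l: "set l \<subseteq> {1, 2}" "set l' \<subseteq> {1, 2}" "length l = length l'"
      "s r = l @ rest" "s1 = s(r := rest, 3 := rev l' @ s 3)" by blast
  have rest: "rest = 2 # s2 r" using st(2) l(5) assms(2) by auto
  have s3: "s3 = s(r := 1 # s2 r, 3 := rev l' @ [3])"
    unfolding st(4) using st(3) l(5) assms by (metis fun_upd_twist fun_upd_upd)
  have "s' = s3(3 := [3], r := rev (rev l') @ s3 r)"
    by (rule sem_mvs_tmtest[OF st(5,6)]) (use s3 assms l(2) in auto)
  then have "s' = s(r := l' @ 1 # s2 r)" unfolding s3 using assms by (intro ext) simp
  then show ?thesis using l rest by blast
qed

definition fld :: "nat option \<Rightarrow> nat list" where
  "fld po = (case po of None \<Rightarrow> [7] | Some p \<Rightarrow> bsym p)"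

definition ent :: "nat option \<times> nat \<Rightarrow> nat list" where
  "ent e = 4 # fld (fst e) @ 5 # bsym (snd e) @ [6]"

lemma fld_set: "set (fld po) \<subseteq> {1, 2, 7}"
  using bsym_bits by (auto simp: fld_def split: option.splits)

lemma sem_entry:
  assumes "sem new_entry s s'" "s 3 = [3]" "s 2 = xs @ [3]" "set xs \<subseteq> {1, 2}"
  shows "s' = s(5 := rev (ent (None, lsb_val xs)) @ s 5) \<and> lsb_val xs > 0"
proof -
  let ?e = "alts [Pop 2 1 \<triangleright> Push 3 1 \<triangleright> Push 5 1, Pop 2 2 \<triangleright> Push 3 2 \<triangleright> Push 5 2]"
  obtain t1 t2 s0 s1 u1 u2 s2 s3 u3 s4 s5 s6 where st0: "sem (Push 5 4) s t1" "sem (Push 5 7) t1 t2"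
     "sem (Push 5 5) t2 s0" "sem (Star ?e) s0 s1" "sem (Pop 2 2) s1 u1" "sem (Push 3 2) u1 u2"
     "sem (Push 5 2) u2 s2" "sem (mvs 2 3 [1]) s2 s3" "sem (Pop 2 3) s3 u3" "sem (Push 2 3) u3 s4"
     "sem (mvs 3 2 [1, 2]) s4 s5" "sem tmtest s5 s6" "sem (Push 5 6) s6 s'"
    using assms(1) unfolding new_entry_def sem_simps(5) by blast
  have s0_def: "s0 = s(5 := 5 # 7 # 4 # s 5)" using st0(1-3) by simp
  have "sem (Pop 2 2 \<triangleright> Push 3 2 \<triangleright> Push 5 2) s1 s2" "sem (Pop 2 3 \<triangleright> Push 2 3) s3 s4"
    "s' = s6(5 := 6 # s6 5)"
    using st0(5-7,9,10) unfolding sem_simps(5) by blast+ (use st0(13) in simp)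
  note st = st0(4) this(1) st0(8) this(2) st0(11,12) this(3)
  have "\<exists>l rest. set l \<subseteq> {1, 2} \<and> s0 2 = l @ rest \<and>
      s1 = s0(2 := rest, 3 := rev l @ s0 3, 5 := rev l @ s0 5)"
    using st(1)
  proof (rule sem_Star_inv)
    show "\<exists>l rest. set l \<subseteq> {1, 2} \<and> s0 2 = l @ rest \<and>
      s0 = s0(2 := rest, 3 := rev l @ s0 3, 5 := rev l @ s0 5)"
      by (rule exI[of _ "[]"], rule exI[of _ "s0 2"]) auto
  next
    fix t t'
    assume "\<exists>l rest. set l \<subseteq> {1, 2} \<and> s0 2 = l @ rest \<and>
      t = s0(2 := rest, 3 := rev l @ s0 3, 5 := rev l @ s0 5)" and e: "sem ?e t t'"
    then obtain l rest where l: "set l \<subseteq> {1, 2}" "s0 2 = l @ rest"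
      "t = s0(2 := rest, 3 := rev l @ s0 3, 5 := rev l @ s0 5)" by blast
    from e obtain x where "x \<in> {1, 2}" "sem (Pop 2 x \<triangleright> Push 3 x \<triangleright> Push 5 x) t t'"
      by (auto simp: sem_alts)
    then obtain rest' where x: "x \<in> {1, 2}" "t 2 = x # rest'"
        "t' = t(2 := rest', 3 := x # t 3, 5 := x # t 5)"
      by auto
    have "t' = s0(2 := rest', 3 := rev (l @ [x]) @ s0 3, 5 := rev (l @ [x]) @ s0 5)"
      unfolding x(3) l(3) by (intro ext) simp
    moreover have "rest = x # rest'" using x(2) l(3) by simp
    ultimately show "\<exists>l rest. set l \<subseteq> {1, 2} \<and> s0 2 = l @ rest \<and>
      t' = s0(2 := rest, 3 := rev l @ s0 3, 5 := rev l @ s0 5)"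
      using l(1,2) x(1) by (intro exI[of _ "l @ [x]"] exI[of _ rest']) auto
  qed
  then obtain l rest where l: "set l \<subseteq> {1, 2}" "s0 2 = l @ rest"
      "s1 = s0(2 := rest, 3 := rev l @ s0 3, 5 := rev l @ s0 5)" by blast
  from st(2) obtain rest2 where r20: "s1 2 = 2 # rest2" "s2 = s1(2 := rest2, 3 := 2 # s1 3, 5 := 2 # s1 5)"
    by auto
  have r2: "rest = 2 # rest2" "s2 = s0(2 := rest2, 3 := 2 # rev l @ s0 3, 5 := 2 # rev l @ s0 5)"
    using r20(1) l(3) apply simp
    unfolding r20(2) l(3) by (intro ext) simp
  from sem_mvs[OF st(3)] obtain z rest3 where z: "set z \<subseteq> {1}" "s2 2 = z @ rest3"
      "s3 = s2(2 := rest3, 3 := rev z @ s2 3)" by auto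
  from st(4) obtain rest4 where r40: "s3 2 = 3 # rest4" "s4 = s3(2 := 3 # rest4)" by auto
  then have r4: "rest3 = 3 # rest4" "s4 = s3" using z(3) by (auto simp: fun_upd_idem)
  \<comment> \<open>The sentinel fixes where the number ends, so the guessed split is the one at its
    last 2 and \<open>z\<close> consists of leading zeros.\<close>
  have "xs @ 3 # [] = (l @ 2 # z) @ 3 # rest4"
    using assms(3) l(2) r2 z(2) r4(1) by (simp add: s0_def)
  moreover have "3 \<notin> set xs" "3 \<notin> set (l @ 2 # z)" using assms(4) l(1) z(1) by auto
  ultimately have xs: "xs = l @ 2 # z" "rest4 = []" using append_sep by metis+
  have z': "z = replicate (length z) (Suc 0)" using z(1) by (auto simp: list_eq_iff_nth_eq subset_iff)
  have v: "lsb_val xs = lsb_val (l @ [2])" using val_zeros(1)[of "l @ [2]" "length z"] z' xs by simp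
  have "s4 3 = rev xs @ [3]" using r4 z r2 xs assms(2) by (simp add: s0_def)
  from sem_mvs_tmtest[OF st(5,6) _ this] have s6: "s6 = s4(3 := [3], 2 := xs @ s4 2)"
    using assms(4) by simp
  have "s' = s(5 := rev (ent (None, lsb_val xs)) @ s 5)"
    unfolding st(7) s6 r4(2) z(3) r2(2) s0_def
    using r4(1) xs(2) assms(2,3) bsym_val[OF l(1)] v by (intro ext) (simp add: ent_def fld_def)
  moreover have "lsb_val xs > 0" by (rule val_pos) (simp add: xs)
  ultimately show ?thesis by blast
qed

lemma sem_chunk:
  assumes "sem chunk s s'"
  shows "\<exists>l rest R. set l \<subseteq> {1, 2} \<and> s 0 = psym l @ 1 # rest \<and> s 6 = l @ R \<and>
    s' = s(0 := rest, 6 := R, 5 := rev l @ s 5)"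
proof -
  let ?e = "alts [Pop 0 2 \<triangleright> Pop 0 1 \<triangleright> Pop 6 1 \<triangleright> Push 5 1, Pop 0 2 \<triangleright> Pop 0 2 \<triangleright> Pop 6 2 \<triangleright> Push 5 2]"
  obtain s1 where st: "sem (Star ?e) s s1" "s1 0 = 1 # s' 0" "s' = s1(0 := s' 0)"
    using assms by (auto simp: chunk_def)
  have "\<exists>l rest R. set l \<subseteq> {1, 2} \<and> s 0 = psym l @ rest \<and> s 6 = l @ R \<and>
      s1 = s(0 := rest, 6 := R, 5 := rev l @ s 5)"
    using st(1)
  proof (rule sem_Star_inv)
    show "\<exists>l rest R. set l \<subseteq> {1, 2} \<and> s 0 = psym l @ rest \<and> s 6 = l @ R \<and>
      s = s(0 := rest, 6 := R, 5 := rev l @ s 5)"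
      by (rule exI[of _ "[]"], rule exI[of _ "s 0"], rule exI[of _ "s 6"]) auto
  next
    fix t t'
    assume "\<exists>l rest R. set l \<subseteq> {1, 2} \<and> s 0 = psym l @ rest \<and> s 6 = l @ R \<and>
      t = s(0 := rest, 6 := R, 5 := rev l @ s 5)" and e: "sem ?e t t'"
    then obtain l rest R where l: "set l \<subseteq> {1, 2}" "s 0 = psym l @ rest" "s 6 = l @ R"
      "t = s(0 := rest, 6 := R, 5 := rev l @ s 5)" by blast
    from e obtain x where "x \<in> {1, 2}" "sem (Pop 0 2 \<triangleright> Pop 0 x \<triangleright> Pop 6 x \<triangleright> Push 5 x) t t'"
      by (auto simp: sem_alts)
    then obtain rest' R' where x: "x \<in> {1, 2}" "t 0 = 2 # x # rest'" "t 6 = x # R'"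
        "t' = t(0 := rest', 6 := R', 5 := x # t 5)"
      by auto
    have "t' = s(0 := rest', 6 := R', 5 := rev (l @ [x]) @ s 5)"
      unfolding x(4) l(4) by (intro ext) simp
    moreover have "rest = 2 # x # rest'" "R = x # R'" using x(2,3) l(4) by auto
    ultimately show "\<exists>l rest R. set l \<subseteq> {1, 2} \<and> s 0 = psym l @ rest \<and> s 6 = l @ R \<and>
      t' = s(0 := rest, 6 := R, 5 := rev l @ s 5)"
      using l(1-3) x(1) by (intro exI[of _ "l @ [x]"] exI[of _ rest'] exI[of _ R']) auto
  qed
  then obtain l rest R where l: "set l \<subseteq> {1, 2}" "s 0 = psym l @ rest" "s 6 = l @ R"
      "s1 = s(0 := rest, 6 := R, 5 := rev l @ s 5)" by blast
  have "s' = s(0 := s' 0, 6 := R, 5 := rev l @ s 5)"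
    using st(3) unfolding l(4) by (metis fun_upd_twist fun_upd_upd num.distinct(1) zero_neq_numeral)
  then show ?thesis using l st(2) by (intro exI[of _ l] exI[of _ "s' 0"] exI[of _ R]) auto
qed

lemma sem_chunk_skip:
  assumes "sem (chunk \<triangleright> skip_sym a) s s'" "s 6 = f @ a # R" "a \<notin> set f" "a \<notin> {1, 2}"
  shows "\<exists>rest. s 0 = psym f @ 1 # rest \<and> s' = s(0 := rest, 6 := R, 5 := a # rev f @ s 5)"
proof -
  obtain s1 where s1: "sem chunk s s1" "sem (skip_sym a) s1 s'" using assms(1) by auto
  obtain l rest R' where l: "set l \<subseteq> {1, 2}" "s 0 = psym l @ 1 # rest" "s 6 = l @ R'"
      "s1 = s(0 := rest, 6 := R', 5 := rev l @ s 5)" using sem_chunk[OF s1(1)] by blast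
  obtain R2 where R2: "R' = a # R2" "s' = s1(6 := R2, 5 := a # s1 5)"
    using s1(2) l(4) by (auto simp: skip_sym_def)
  have "l @ a # R2 = f @ a # R" using assms(2) l(3) R2(1) by simp
  from append_sep[OF this] have "l = f" "R2 = R" using assms(3,4) l(1) by auto
  then have "s' = s(0 := rest, 6 := R, 5 := a # rev f @ s 5)"
    unfolding R2(2) l(4) by (intro ext) simp
  then show ?thesis using l(2) \<open>l = f\<close> by blast
qed

lemma sem_page:
  assumes "sem serve_page s s'" "s 6 = fld po @ 5 # R" "s 3 = [3]"
  shows "\<exists>p rest. s 0 = esym p @ rest \<and>
    s' = s(0 := rest, 6 := R, 5 := 5 # rev (bsym p) @ s 5, 4 := s' 4) \<and>
    (po = Some p \<and> s' 4 = s 4 \<or> lsb_val (s' 4) < lsb_val (s 4))"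
proof -
  have five: "5 \<notin> set (fld po)" using fld_set[of po] by auto
  consider "sem (chunk \<triangleright> skip_sym 5) s s'" |
    "sem (decr 4 \<triangleright> Star (alts [Pop 6 1, Pop 6 2, Pop 6 7]) \<triangleright> emit_nat 5 \<triangleright> skip_sym 5) s s'"
    using assms(1) unfolding serve_page_def sem_simps(6) by blast
  then show ?thesis
  proof cases
    case 1
    from sem_chunk_skip[OF this assms(2) five] obtain rest where
      r: "s 0 = psym (fld po) @ 1 # rest" "s' = s(0 := rest, 6 := R, 5 := 5 # rev (fld po) @ s 5)"
      by auto
    show ?thesis
    proof (cases po)
      case None
      obtain s1 where "sem chunk s s1" "sem (skip_sym 5) s1 s'" using 1 by auto
      then obtain l rest R' R2 where "set l \<subseteq> {1::nat, 2}" "s 6 = l @ R'" "R' = 5 # R2"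
        using sem_chunk[of s s1] by (auto simp: skip_sym_def)
      \<comment> \<open>The mark 7 of an empty slot is not a digit. So \<open>chunk\<close> cannot
        get past it, and an empty slot gives no hit.\<close>
      then have "7 # 5 # R = l @ 5 # R2" using assms(2) None by (simp add: fld_def)
      then have False using \<open>set l \<subseteq> {1, 2}\<close> by (cases l) auto
      then show ?thesis ..
    next
      case (Some p)
      show ?thesis
        by (rule exI[of _ p], rule exI[of _ rest]) (use Some r in \<open>auto simp: fld_def esym_psym\<close>)
    qed
  next
    case 2
    then obtain s1 s2 s3 where st: "sem (decr 4) s s1" "sem (Star (alts [Pop 6 1, Pop 6 2, Pop 6 7])) s1 s2"
        "sem (emit_nat 5) s2 s3" "sem (skip_sym 5) s3 s'"
      unfolding sem_simps(5) by blast
    from sem_decr[OF st(1)] assms(3) obtain lo lo' hi where d: "s 4 = lo @ 2 # hi"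
        "s1 = s(4 := lo' @ 1 # hi)" "length lo = length lo'" by auto
    have "\<exists>l R'. set l \<subseteq> {1, 2, 7} \<and> s1 6 = l @ R' \<and> s2 = s1(6 := R')"
      using st(2)
    proof (rule sem_Star_inv)
      show "\<exists>l R'. set l \<subseteq> {1, 2, 7} \<and> s1 6 = l @ R' \<and> s1 = s1(6 := R')"
        by (rule exI[of _ "[]"], rule exI[of _ "s1 6"]) auto
    next
      fix t t'
      assume "\<exists>l R'. set l \<subseteq> {1, 2, 7} \<and> s1 6 = l @ R' \<and> t = s1(6 := R')"
        and "sem (alts [Pop 6 1, Pop 6 2, Pop 6 7]) t t'"
      then obtain l R' where l: "set l \<subseteq> {1, 2, 7}" "s1 6 = l @ R'" "t = s1(6 := R')"
        and "sem (alts [Pop 6 1, Pop 6 2, Pop 6 7]) t t'" by blast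
      then obtain x where "x \<in> {1, 2, 7}" "sem (Pop 6 x) t t'" by (auto simp: sem_alts)
      then obtain R2 where "x \<in> {1, 2, 7}" "R' = x # R2" "t' = s1(6 := R2)" using l(3) by auto
      then show "\<exists>l R'. set l \<subseteq> {1, 2, 7} \<and> s1 6 = l @ R' \<and> t' = s1(6 := R')"
        using l by (intro exI[of _ "l @ [x]"] exI[of _ R2]) auto
    qed
    then obtain l R' where l: "set l \<subseteq> {1, 2, 7}" "s1 6 = l @ R'" "s2 = s1(6 := R')" by blast
    from sem_emit_nat[OF st(3)] obtain p rest where p: "s2 0 = esym p @ rest"
        "s3 = s2(0 := rest, 5 := rev (bsym p) @ s2 5)" by auto
    from st(4) p(2) l(3) obtain R2 where R2: "R' = 5 # R2" "s' = s3(6 := R2, 5 := 5 # s3 5)"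
      by (auto simp: skip_sym_def)
    have "fld po @ 5 # R = l @ 5 # R2" using assms(2) l d R2 by simp
    moreover have "5 \<notin> set l" using l(1) by auto
    ultimately have R: "R2 = R" using append_sep five by metis
    have "s' = s(0 := rest, 6 := R, 5 := 5 # rev (bsym p) @ s 5, 4 := lo' @ 1 # hi)"
      unfolding R2(2) p(2) l(3) d(2) R by (intro ext) simp
    moreover have "s 0 = esym p @ rest" using p(1) l(3) d(2) by simp
    ultimately show ?thesis using d(1) val_decrease[OF d(3), of hi]
      by (intro exI[of _ p] exI[of _ rest]) simp
  qed
qed

definition ents :: "(nat option \<times> nat) list \<Rightarrow> nat list" where
  "ents c = concat (map ent c)"

lemma ents_simps [simp]: "ents [] = []" "ents (e # c) = ent e @ ents c" "ents (a @ b) = ents a @ ents b"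
  by (auto simp: ents_def)

lemma append_sep_prefix:
  "xs @ c # ys = b @ zs \<Longrightarrow> c \<notin> set b \<Longrightarrow> \<exists>us. xs = b @ us \<and> us @ c # ys = zs"
proof (induction b arbitrary: xs)
  case (Cons x b)
  then show ?case by (cases xs) auto
qed auto

text \<open>The symbol 4 occurs nowhere but at the start of an entry, so a boundary guessed in front
  of a 4 is aligned with the entries.\<close>

lemma ents_split:
  "pre @ 4 # R = ents c \<Longrightarrow> \<exists>c1 po v c2. c = c1 @ (po, v) # c2 \<and> pre = ents c1 \<and>
     R = fld po @ 5 # bsym v @ 6 # ents c2"
proof (induction c arbitrary: pre)
  case (Cons e c)
  obtain po v where e: "e = (po, v)" by fastforce
  let ?b = "fld po @ 5 # bsym v @ [6]"
  have b: "4 \<notin> set ?b" using fld_set[of po] bsym_bits[of v] by auto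
  have eq: "pre @ 4 # R = 4 # ?b @ ents c" using Cons.prems by (simp add: e ent_def)
  show ?case
  proof (cases pre)
    case Nil
    then show ?thesis using eq e by (intro exI[of _ "[]"]) auto
  next
    case (Cons x pre')
    then have "pre' @ 4 # R = ?b @ ents c" using eq by simp
    from append_sep_prefix[OF this b] obtain us where us: "pre' = ?b @ us" "us @ 4 # R = ents c"
      by blast
    from Cons.IH[OF us(2)] obtain c1 po' v' c2 where "c = c1 @ (po', v') # c2" "us = ents c1"
      "R = fld po' @ 5 # bsym v' @ 6 # ents c2" by blast
    then show ?thesis using us(1) e Cons eq
      by (intro exI[of _ "e # c1"] exI[of _ po'] exI[of _ v'] exI[of _ c2]) (auto simp: ent_def)
  qed
qed simp

lemma sem_serve:
  assumes "sem serve s s'" "rev (s 5) @ s 6 = ents c" "s 3 = [3]"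
  shows "\<exists>c1 po v c2 p r. c = c1 @ (po, v) # c2 \<and> (r = General p \<or> r = Specific p v) \<and>
    s 0 = map bit_symbol (encode_request r) @ s' 0 \<and>
    rev (s' 5) @ s' 6 = ents (c1 @ (Some p, v) # c2) \<and> s' 3 = [3] \<and>
    (po = Some p \<and> s' 4 = s 4 \<or> lsb_val (s' 4) < lsb_val (s 4))"
proof -
  let ?A = "[1, 2, 4, 5, 6, 7]"
  obtain s1 s2 s3 where st: "sem (mvs 5 6 ?A) s s1" "sem (mvs 6 5 ?A) s1 s2" "sem (skip_sym 4) s2 s3"
      "sem (Plus (Pop 0 1 \<triangleright> serve_page) (Pop 0 2 \<triangleright> serve_page \<triangleright> chunk \<triangleright> skip_sym 6)) s3 s'"
    using assms(1) unfolding serve_def sem_simps(5) by blast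
  obtain l1 r1 where l1: "s 5 = l1 @ r1" "s1 = s(5 := r1, 6 := rev l1 @ s 6)"
    using sem_mvs[OF st(1)] by auto
  obtain l2 r2 where l2: "s1 6 = l2 @ r2" "s2 = s1(6 := r2, 5 := rev l2 @ s1 5)"
    using sem_mvs[OF st(2)] by auto
  have inv2: "rev (s2 5) @ s2 6 = ents c"
    using assms(2) l1 l2 by simp
  obtain R where R: "s2 6 = 4 # R" "s3 = s2(6 := R, 5 := 4 # s2 5)"
    using st(3) by (auto simp: skip_sym_def)
  have s3: "s3 0 = s 0" "s3 3 = [3]" "s3 4 = s 4" "s3 6 = R" "s3 5 = 4 # s2 5"
    using l1 l2 R assms(3) by auto
  obtain c1 po v c2 where c: "c = c1 @ (po, v) # c2" "rev (s2 5) = ents c1"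
      "R = fld po @ 5 # bsym v @ 6 # ents c2"
    using ents_split[of "rev (s2 5)" R c] inv2 R(1) by auto
  consider s4 where "sem (Pop 0 1) s3 s4" "sem serve_page s4 s'"
    | s4 s5 where "sem (Pop 0 2) s3 s4" "sem serve_page s4 s5" "sem (chunk \<triangleright> skip_sym 6) s5 s'"
    using st(4) unfolding sem_simps(5,6) by blast
  then show ?thesis
  proof cases
    case 1
    then obtain x where x: "s 0 = 1 # x" "s4 = s3(0 := x)" using s3 by auto
    have "s4 6 = fld po @ 5 # bsym v @ 6 # ents c2" "s4 3 = [3]" using x s3 c by auto
    from sem_page[OF 1(2) this] obtain p rest where p: "s4 0 = esym p @ rest"
      "s' = s4(0 := rest, 6 := bsym v @ 6 # ents c2, 5 := 5 # rev (bsym p) @ s4 5, 4 := s' 4)"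
      "po = Some p \<and> s' 4 = s4 4 \<or> lsb_val (s' 4) < lsb_val (s4 4)" by blast
    have s': "s' 0 = rest" "s' 3 = [3]" "s' 6 = bsym v @ 6 # ents c2"
        "s' 5 = 5 # rev (bsym p) @ 4 # s2 5" "s4 4 = s 4"
      using x s3 by (subst p(2), simp)+ (simp add: x s3)
    show ?thesis
      by (rule exI[of _ c1], rule exI[of _ po], rule exI[of _ v], rule exI[of _ c2], rule exI[of _ p],
          rule exI[of _ "General p"])
        (use p(1,3) s' x c in \<open>auto simp: esym_def ent_def fld_def\<close>)
  next
    case 2
    then obtain x where x: "s 0 = 2 # x" "s4 = s3(0 := x)" using s3 by auto
    have "s4 6 = fld po @ 5 # bsym v @ 6 # ents c2" "s4 3 = [3]" using x s3 c by auto
    from sem_page[OF 2(2) this] obtain p rest where p: "s4 0 = esym p @ rest"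
      "s5 = s4(0 := rest, 6 := bsym v @ 6 # ents c2, 5 := 5 # rev (bsym p) @ s4 5, 4 := s5 4)"
      "po = Some p \<and> s5 4 = s4 4 \<or> lsb_val (s5 4) < lsb_val (s4 4)" by blast
    have s5: "s5 0 = rest" "s5 3 = [3]" "s5 6 = bsym v @ 6 # ents c2"
        "s5 5 = 5 # rev (bsym p) @ 4 # s2 5" "s4 4 = s 4"
      using x s3 by (subst p(2), simp)+ (simp add: x s3)
    have "6 \<notin> set (bsym v)" using bsym_bits[of v] by auto
    from sem_chunk_skip[OF 2(3) s5(3) this] obtain rest' where r: "rest = psym (bsym v) @ 1 # rest'"
        "s' = s5(0 := rest', 6 := ents c2, 5 := 6 # rev (bsym v) @ s5 5)"
      using s5 by auto
    show ?thesis
      by (rule exI[of _ c1], rule exI[of _ po], rule exI[of _ v], rule exI[of _ c2], rule exI[of _ p],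
          rule exI[of _ "Specific p v"])
        (use p(1,3) s5 r x c esym_psym[of v] in \<open>auto simp: esym_def ent_def fld_def\<close>)
  qed
qed

fun cmap :: "(nat option \<times> nat) list \<Rightarrow> cache" where
  "cmap [] = Map.empty"
| "cmap ((po, v) # c) = (cmap c)(v := po)"

lemma cmap_at: "v \<notin> snd ` set c1 \<Longrightarrow> cmap (c1 @ (po, v) # c2) v = po"
  by (induction c1) auto

lemma cmap_upd: "v \<notin> snd ` set c1 \<Longrightarrow> cmap (c1 @ (po', v) # c2) = (cmap (c1 @ (po, v) # c2))(v := po')"
  by (induction c1) (auto simp: fun_upd_twist)

definition enc_reqs :: "request list \<Rightarrow> nat list" where
  "enc_reqs \<sigma> = concat (map (\<lambda>r. 2 # map bit_symbol (encode_request r)) \<sigma>)"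

text \<open>Every miss decreases the budget and nothing increases it, so its initial value bounds
  the number of misses.\<close>

lemma sem_serves:
  assumes "sem (Star (Pop 0 2 \<triangleright> serve)) s s'" "rev (s 5) @ s 6 = ents c" "s 3 = [3]"
    "distinct (map snd c)" "snd ` set c \<subseteq> {1..k}"
  shows "\<exists>\<sigma> ss. s 0 = enc_reqs \<sigma> @ s' 0 \<and> list_all2 (slot_ok k) \<sigma> ss \<and>
    misses (cmap c) (zip \<sigma> ss) \<le> lsb_val (s 4)"
  using sem_StarD[OF assms(1)] assms(2-)
proof (induction arbitrary: c rule: converse_rtranclp_induct)
  case base
  show ?case by (rule exI[of _ "[]"], rule exI[of _ "[]"]) (simp add: enc_reqs_def)
next
  case (step s t)
  obtain x where x: "s 0 = 2 # x" "sem serve (s(0 := x)) t" using step(1) by auto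
  have "rev ((s(0 := x)) 5) @ (s(0 := x)) 6 = ents c" "(s(0 := x)) 3 = [3]"
    using step.prems by auto
  from sem_serve[OF x(2) this] obtain c1 po v c2 p r where
    t0: "c = c1 @ (po, v) # c2" "r = General p \<or> r = Specific p v"
    "(s(0 := x)) 0 = map bit_symbol (encode_request r) @ t 0"
    "rev (t 5) @ t 6 = ents (c1 @ (Some p, v) # c2)" "t 3 = [3]"
    "po = Some p \<and> t 4 = (s(0 := x)) 4 \<or> lsb_val (t 4) < lsb_val ((s(0 := x)) 4)" by blast
  have "x = map bit_symbol (encode_request r) @ t 0"
    "po = Some p \<and> t 4 = s 4 \<or> lsb_val (t 4) < lsb_val (s 4)" using t0(3,6) by simp_all
  note t = t0(1,2) this(1) t0(4,5) this(2)
  let ?c = "c1 @ (Some p, v) # c2"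
  from step.IH[OF t(4,5), of] step.prems t(1) obtain \<sigma> ss where
    \<sigma>: "t 0 = enc_reqs \<sigma> @ s' 0" "list_all2 (slot_ok k) \<sigma> ss" "misses (cmap ?c) (zip \<sigma> ss) \<le> lsb_val (t 4)"
    by auto
  have v: "v \<notin> snd ` set c1" using step.prems(3) t(1) by auto
  have pg: "page_of r = p" and ok: "slot_ok k r v" using t(1,2) step.prems(4) by auto
  have "cmap ?c = (cmap c)(v \<mapsto> p)" using cmap_upd[OF v, of "Some p" c2 po] t(1) by simp
  moreover have "cmap c v = po" using cmap_at[OF v] t(1) by simp
  ultimately have "misses (cmap c) (zip (r # \<sigma>) (v # ss)) \<le> lsb_val (s 4)"
    using \<sigma>(3) t(6) pg by auto
  then show ?case using \<sigma>(1,2) ok x(1) t(3)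
    by (intro exI[of _ "r # \<sigma>"] exI[of _ "v # ss"]) (simp add: enc_reqs_def)
qed

text \<open>The slots listed so far lie above the counter on stack 2. Since the counter strictly
  decreases, they are distinct without being compared.\<close>

definition cache_inv :: "nat \<Rightarrow> store \<Rightarrow> store \<Rightarrow> bool" where
  "cache_inv k s0 s \<longleftrightarrow> s 3 = [3] \<and> s 0 = s0 0 \<and> s 4 = s0 4 \<and> s 6 = [] \<and>
     (\<exists>xs. set xs \<subseteq> {1, 2} \<and> s 2 = xs @ [3] \<and> lsb_val xs \<le> k \<and>
       (\<exists>c. rev (s 5) = ents c \<and> distinct (map snd c) \<and>
         (\<forall>e\<in>set c. fst e = None \<and> lsb_val xs < snd e \<and> snd e \<le> k)))"

lemma sem_decr2:
  assumes "sem (decr 2) s s'" "s 3 = [3]" "s 2 = xs @ [3]" "set xs \<subseteq> {1, 2}"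
  shows "\<exists>ys. set ys \<subseteq> {1, 2} \<and> s' = s(2 := ys @ [3]) \<and> lsb_val ys < lsb_val xs"
proof -
  obtain lo lo' hi where d: "s 2 = lo @ 2 # hi" "s' = s(2 := lo' @ 1 # hi)" "length lo = length lo'"
     "set lo \<subseteq> {1, 2}" "set lo' \<subseteq> {1, 2}" using sem_decr[OF assms(1)] assms(2) by auto
  have "lo @ 2 # hi = xs @ [3]" using d(1) assms(3) by simp
  then obtain hi' where hi: "hi = hi' @ [3]" "xs = lo @ 2 # hi'"
    by (cases hi rule: rev_cases) auto
  have "lsb_val (lo' @ 1 # hi') < lsb_val xs" using val_decrease[OF d(3), of hi'] hi(2) by simp
  moreover have "set (lo' @ 1 # hi') \<subseteq> {1, 2}" using d(5) hi(2) assms(4) by auto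
  moreover have "s' = s(2 := (lo' @ 1 # hi') @ [3])" using d(2) hi(1) by simp
  ultimately show ?thesis by blast
qed

lemma sem_entries:
  assumes "sem (Star (new_entry \<triangleright> decr 2)) s s'" "cache_inv k s0 s"
  shows "cache_inv k s0 s'"
  using assms
proof (rule sem_Star_inv)
  fix t t' assume inv: "cache_inv k s0 t" and "sem (new_entry \<triangleright> decr 2) t t'"
  then obtain u where u: "sem new_entry t u" "sem (decr 2) u t'" by auto
  obtain xs c where c: "t 3 = [3]" "t 0 = s0 0" "t 4 = s0 4" "t 6 = []" "set xs \<subseteq> {1, 2}" "t 2 = xs @ [3]"
     "lsb_val xs \<le> k" "rev (t 5) = ents c" "distinct (map snd c)"
     "\<forall>e\<in>set c. fst e = None \<and> lsb_val xs < snd e \<and> snd e \<le> k"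
    using inv unfolding cache_inv_def by blast
  have e: "u = t(5 := rev (ent (None, lsb_val xs)) @ t 5)" "lsb_val xs > 0"
    using sem_entry[OF u(1) c(1,6,5)] by auto
  obtain ys where ys: "set ys \<subseteq> {1, 2}" "t' = u(2 := ys @ [3])" "lsb_val ys < lsb_val xs"
    using sem_decr2[OF u(2) _ _ c(5)] e c by auto
  let ?c = "c @ [(None, lsb_val xs)]"
  have "rev (t' 5) = ents ?c" using ys(2) e c(8) by simp
  moreover have "distinct (map snd ?c)" using c(9,10) by auto
  moreover have "\<forall>e\<in>set ?c. fst e = None \<and> lsb_val ys < snd e \<and> snd e \<le> k"
    using c(7,10) ys(3) by auto
  moreover have "t' 3 = [3]" "t' 0 = s0 0" "t' 4 = s0 4" "t' 6 = []" "t' 2 = ys @ [3]"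
    using ys(2) e c by auto
  moreover have "lsb_val ys \<le> k" using ys(3) c(7) by simp
  ultimately show "cache_inv k s0 t'" unfolding cache_inv_def using ys(1) by blast
qed

lemma cmap_None: "\<forall>e\<in>set c. fst e = None \<Longrightarrow> cmap c = Map.empty"
  by (induction c) auto

lemma map_bit_symbol_inj: "map bit_symbol x = map bit_symbol y \<Longrightarrow> x = y"
  by (rule map_injective) (auto simp: inj_def bit_symbol_def split: if_splits)

lemma slot_ok_valid: "list_all2 (slot_ok k) \<sigma> ss \<Longrightarrow> \<forall>r\<in>set \<sigma>. valid_request k r"
proof
  fix r assume a: "list_all2 (slot_ok k) \<sigma> ss" "r \<in> set \<sigma>"
  then obtain s where "slot_ok k r s" by (auto simp: list_all2_conv_all_nth in_set_conv_nth)
  then show "valid_request k r" by (cases r) auto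
qed

lemma All_or_One_Paging_iff:
  "encode_instance k \<sigma> F \<in> All_or_One_Paging \<longleftrightarrow>
     (\<exists>ss. list_all2 (slot_ok k) \<sigma> ss \<and> int (misses Map.empty (zip \<sigma> ss)) \<le> F)"
proof -
  have "encode_instance k \<sigma> F \<in> All_or_One_Paging \<longleftrightarrow> (\<forall>r\<in>set \<sigma>. valid_request k r) \<and>
     (\<exists>Cs. is_solution k \<sigma> Cs \<and> int (cost Cs) \<le> F)"
    unfolding All_or_One_Paging_def using encode_instance_inj by auto
  also have "\<dots> \<longleftrightarrow> (\<forall>r\<in>set \<sigma>. valid_request k r) \<and> F \<ge> 0 \<and> (\<exists>Cs. is_solution k \<sigma> Cs \<and> cost Cs \<le> nat F)"
    by (auto simp: le_nat_iff)
  also have "\<dots> \<longleftrightarrow> (\<exists>ss. list_all2 (slot_ok k) \<sigma> ss \<and> int (misses Map.empty (zip \<sigma> ss)) \<le> F)"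
    unfolding solution_iff_misses using slot_ok_valid by (auto simp: le_nat_iff)
  finally show ?thesis .
qed

lemma verifier_sound:
  assumes "ksem verifier n (kinit x) s'"
  shows "x \<in> All_or_One_Paging"
proof -
  have "sem verifier (kinit x) s'" using assms by (auto simp: sem_def)
  then obtain t1 t2 t3 t4 t5 t6 t7 t8 t9 where st: "sem (Push 3 3) (kinit x) t1" "sem (Push 2 3) t1 t2"
     "sem (read_nat 2) t2 t3" "sem (Pop 0 1) t3 t4" "sem (read_nat 4) t4 t5"
     "sem (Plus KSkip (decr 2)) t5 t6" "sem (Star (new_entry \<triangleright> decr 2)) t6 t7"
     "sem (Star (Pop 0 2 \<triangleright> serve)) t7 t8" "sem (Pop 0 1) t8 t9" "sem EndX t9 s'"
    unfolding verifier_def sem_simps(5) by blast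
  have t2: "t2 = (kinit x)(3 := [3], 2 := [3])" using st(1,2) by (simp add: kinit_def)
  obtain k r1 where k: "map bit_symbol x = esym k @ r1" "t3 = t2(0 := r1, 2 := bsym k @ [3])"
    using sem_read_nat[OF st(3)] t2 by (auto simp: kinit_def)
  \<comment> \<open>This symbol is the sign of the budget; a negative budget is rejected.\<close>
  obtain r2 where r2: "r1 = 1 # r2" "t4 = t3(0 := r2)" using st(4) k(2) by auto
  obtain F r3 where F: "r2 = esym F @ r3" "t5 = t4(0 := r3, 4 := bsym F @ t4 4)"
    using sem_read_nat[OF st(5)] r2 k(2) t2 by auto
  have t5: "t5 3 = [3]" "t5 2 = bsym k @ [3]" "t5 0 = r3" "t5 4 = bsym F" "t5 5 = []" "t5 6 = []"
    using F(2) r2(2) k(2) t2 by (auto simp: kinit_def)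
  have "cache_inv k t5 t6"
  proof -
    \<comment> \<open>The list of slots may begin with \<open>k\<close> itself or with any smaller
      number.\<close>
    consider "t6 = t5" | "sem (decr 2) t5 t6" using st(6) by auto
    then obtain ys where ys: "set ys \<subseteq> {1, 2}" "t6 = t5(2 := ys @ [3])" "lsb_val ys \<le> k"
    proof cases
      case 1
      then show ?thesis using that[of "bsym k"] bsym_bits t5(2) by (auto simp: fun_upd_idem)
    next
      case 2
      from sem_decr2[OF 2 t5(1,2) bsym_bits] show ?thesis using that by fastforce
    qed
    show ?thesis unfolding cache_inv_def
      using ys t5 by (intro conjI exI[of _ ys] exI[of _ "[]"]) auto
  qed
  from sem_entries[OF st(7) this] obtain c where c: "t7 3 = [3]" "t7 0 = r3" "t7 4 = bsym F" "t7 6 = []"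
     "rev (t7 5) = ents c" "distinct (map snd c)" "\<forall>e\<in>set c. fst e = None \<and> 0 < snd e \<and> snd e \<le> k"
    unfolding cache_inv_def t5 by fastforce
  have "snd ` set c \<subseteq> {1..k}" using c(7) by auto
  from sem_serves[OF st(8) _ c(1,6) this] c(4,5) obtain \<sigma> ss where
    \<sigma>: "t7 0 = enc_reqs \<sigma> @ t8 0" "list_all2 (slot_ok k) \<sigma> ss" "misses (cmap c) (zip \<sigma> ss) \<le> lsb_val (t7 4)"
    by auto
  have end8: "t8 0 = [1]" using st(9,10) by auto
  have "misses Map.empty (zip \<sigma> ss) \<le> F" using \<sigma>(3) c(3,7) cmap_None[of c] by simp
  then have "encode_instance k \<sigma> (int F) \<in> All_or_One_Paging"
    using \<sigma>(2) unfolding All_or_One_Paging_iff by auto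
  moreover have "map bit_symbol x = map bit_symbol (encode_instance k \<sigma> (int F))"
  proof -
    have "enc_reqs \<sigma> = map bit_symbol (concat (map (\<lambda>r. True # encode_request r) \<sigma>))"
      by (induction \<sigma>) (auto simp: enc_reqs_def)
    then show ?thesis using k(1) r2(1) F(1) \<sigma>(1) c(2) end8
      by (simp add: encode_instance_def encode_int_def encode_requests_def esym_def)
  qed
  ultimately show ?thesis using map_bit_symbol_inj by metis
qed

subsection \<open>Completeness\<close>

lemma kle_simps [simp]:
  "kle (Pop r x) N s s' \<longleftrightarrow> (\<exists>l. s r = x # l \<and> s' = s(r := l))"
  "kle (Push r x) N s s' \<longleftrightarrow> s' = s(r := x # s r)"
  "kle (a \<triangleright> b) 0 s s' \<longleftrightarrow> (\<exists>s1. kle a 0 s s1 \<and> kle b 0 s1 s')"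
  unfolding kle_def
    apply (blast elim: ksem_PopE intro: ksem.Pop)
   apply (blast elim: ksem_PushE intro: ksem.Push)
  apply (auto elim!: ksem_KSeqE)
  using ksem.KSeq by fastforce

lemma kle_StarC: "kle a N s s1 \<Longrightarrow> kle (Star a) M s1 s2 \<Longrightarrow> Suc (N + M) \<le> L \<Longrightarrow> kle (Star a) L s s2"
  unfolding kle_def by (meson Suc_le_mono add_mono ksem.StarC order_trans)

lemma kle_StarN: "1 \<le> L \<Longrightarrow> kle (Star a) L s s"
  unfolding kle_def using ksem.StarN by blast

lemma take_drop_nth:
  "i < length l \<Longrightarrow> drop i l = l ! i # drop (Suc i) l"
  "i < length l \<Longrightarrow> rev (take (Suc i) l) = l ! i # rev (take i l)"
  by (simp_all add: Cons_nth_drop_Suc take_Suc_conv_app_nth)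

lemma nth_bits: "set l \<subseteq> {1, 2} \<Longrightarrow> i < length l \<Longrightarrow> l ! i = Suc 0 \<or> l ! i = 2"
proof -
  assume "set l \<subseteq> {1, 2}" "i < length l"
  then have "l ! i \<in> {1, 2}" by (meson nth_mem subsetD)
  then show ?thesis by auto
qed

lemma kle_emit_nat:
  assumes "s 0 = esym n @ rest" "r \<noteq> 0" "s' = s(0 := rest, r := rev (bsym n) @ s r)"
    "3 * length (bsym n) + 3 \<le> L"
  shows "kle (emit_nat r) L s s'"
proof (cases "n = 0")
  case True
  then have "kle (Pop 0 1) 0 s s'" using assms by (auto simp: esym_psym bsym_def fun_upd_idem)
  then show ?thesis unfolding emit_nat_def
    by (rule kle_Seq[OF kle_PlusL[OF kle_KSkip order_refl]]) (use assms(4) in auto)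
next
  case False
  then obtain l where l: "bsym n = l @ [2]" "set l \<subseteq> {1, 2}" using bsym_last by blast
  let ?e = "Plus (Pop 0 2 \<triangleright> Pop 0 1 \<triangleright> Push r 1) (Pop 0 2 \<triangleright> Pop 0 2 \<triangleright> Push r 2)"
  \<comment> \<open>The store after \<open>i\<close> iterations, in the form required by
    \<open>kle_Star\<close>; the loops below are treated in the same way.\<close>
  define f where "f i = s(0 := psym (drop i l) @ 2 # 2 # 1 # rest, r := rev (take i l) @ s r)" for i
  have "kle (Star ?e) (length l * 2 + 1) (f 0) (f (length l))"
  proof (rule kle_Star)
    fix i assume i: "i < length l"
    have eq: "(f i)(0 := psym (drop (Suc i) l) @ 2 # 2 # 1 # rest, r := l ! i # f i r) = f (Suc i)"
      unfolding f_def using take_drop_nth[OF i] assms(2) by (intro ext) simp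
    from nth_bits[OF l(2) i] show "kle ?e 1 (f i) (f (Suc i))"
    proof
      assume "l ! i = Suc 0"
      then have "kle (Pop 0 2 \<triangleright> Pop 0 1 \<triangleright> Push r 1) 0 (f i) (f (Suc i))"
        using eq assms(2) by (simp add: f_def take_drop_nth[OF i])
      then show ?thesis by (rule kle_PlusL) simp
    next
      assume "l ! i = 2"
      then have "kle (Pop 0 2 \<triangleright> Pop 0 2 \<triangleright> Push r 2) 0 (f i) (f (Suc i))"
        using eq assms(2) by (simp add: f_def take_drop_nth[OF i])
      then show ?thesis by (rule kle_PlusR) simp
    qed
  qed simp
  moreover have "f 0 = s" using assms(1,2) l by (simp add: f_def esym_psym fun_upd_idem)
  ultimately have loop: "kle (Star ?e) (length l * 2 + 1) s (f (length l))" by simp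
  have t: "kle (Pop 0 2 \<triangleright> Pop 0 2 \<triangleright> Push r 2) 0 (f (length l)) (s(0 := 1 # rest, r := rev (bsym n) @ s r))"
    using assms(2) l by (simp add: f_def fun_upd_twist)
  have t': "kle (Pop 0 1) 0 (s(0 := 1 # rest, r := rev (bsym n) @ s r)) s'"
    using assms(2,3) by (simp add: fun_upd_twist)
  show ?thesis unfolding emit_nat_def
    by (rule kle_Seq[OF kle_PlusR[OF kle_Seq[OF loop t order_refl] order_refl] t'])
      (use assms(4) l in simp)
qed

lemma kle_mvs:
  assumes "s a = l @ rest" "set l \<subseteq> set A" "a \<noteq> b" "s' = s(a := rest, b := rev l @ s b)"
    "length l * (length A + 1) + 1 \<le> L"
  shows "kle (mvs a b A) L s s'"
proof -
  define f where "f i = s(a := drop i l @ rest, b := rev (take i l) @ s b)" for i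
  have "kle (mvs a b A) L (f 0) (f (length l))"
    unfolding mvs_def
  proof (rule kle_Star)
    fix i assume i: "i < length l"
    have "(f i)(a := drop (Suc i) l @ rest, b := l ! i # f i b) = f (Suc i)"
      unfolding f_def using take_drop_nth[OF i] assms(3) by (intro ext) simp
    then have "kle (Pop a (l ! i) \<triangleright> Push b (l ! i)) 0 (f i) (f (Suc i))"
      using assms(3) by (simp add: f_def take_drop_nth[OF i])
    then show "kle (alts (map (\<lambda>x. Pop a x \<triangleright> Push b x) A)) (length A) (f i) (f (Suc i))"
      by (rule kle_alts) (use assms(2) i nth_mem in auto)
  qed (rule assms(5))
  moreover have "f 0 = s" "f (length l) = s'" using assms(1,3,4) by (simp_all add: f_def fun_upd_idem)
  ultimately show ?thesis by simp
qed

lemma kle_tmtest: "s 3 = 3 # l \<Longrightarrow> kle tmtest 0 s s"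
  unfolding tmtest_def by (simp add: fun_upd_idem)

lemma kle_decr:
  assumes "s 3 = [3]" "r \<noteq> 3" "s r = xs @ rest" "length xs = length ys" "set xs \<subseteq> {1, 2}"
    "set ys \<subseteq> {1, 2}" "lsb_val ys < lsb_val xs" "s' = s(r := ys @ rest)" "8 * length xs + 2 \<le> L"
  shows "kle (decr r) L s s'"
proof -
  obtain lo lo' hi where lo: "xs = lo @ 2 # hi" "ys = lo' @ 1 # hi" "length lo = length lo'"
      "set lo \<subseteq> {1, 2}" "set lo' \<subseteq> {1, 2}"
    using val_less_split[OF assms(4-7)] by blast
  let ?esym = "[Pop r 1 \<triangleright> Push 3 1, Pop r 1 \<triangleright> Push 3 2, Pop r 2 \<triangleright> Push 3 1, Pop r 2 \<triangleright> Push 3 2]"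
  define f where "f i = s(r := drop i lo @ 2 # hi @ rest, 3 := rev (take i lo') @ [3])" for i
  have "kle (Star (alts ?esym)) (length lo * 5 + 1) (f 0) (f (length lo))"
  proof (rule kle_Star[where c = 4])
    fix i assume i: "i < length lo"
    then have i': "i < length lo'" using lo(3) by simp
    have "(f i)(r := drop (Suc i) lo @ 2 # hi @ rest, 3 := lo' ! i # f i 3) = f (Suc i)"
      unfolding f_def using take_drop_nth(2)[OF i'] assms(2) by (intro ext) simp
    then have "kle (Pop r (lo ! i) \<triangleright> Push 3 (lo' ! i)) 0 (f i) (f (Suc i))"
      using assms(2) by (simp add: f_def take_drop_nth(1)[OF i])
    then show "kle (alts ?esym) 4 (f i) (f (Suc i))"
      by (rule kle_alts) (use nth_bits[OF lo(4) i] nth_bits[OF lo(5) i'] in auto)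
  qed simp
  moreover have "f 0 = s" using assms lo by (simp add: f_def fun_upd_idem)
  ultimately have loop: "kle (Star (alts ?esym)) (length lo * 5 + 1) s (f (length lo))" by simp
  let ?t = "s(r := 1 # hi @ rest, 3 := rev lo' @ [3])"
  have p1: "kle (Pop r 2) 0 (f (length lo)) (s(r := hi @ rest, 3 := rev lo' @ [3]))"
    using assms(2) lo(3) by (simp add: f_def fun_upd_twist)
  have p2: "kle (Push r 1) 0 (s(r := hi @ rest, 3 := rev lo' @ [3])) ?t"
    using assms(2) by (simp add: fun_upd_twist)
  have p3: "kle (mvs 3 r [1, 2]) (3 * length lo + 1) ?t s'"
  proof (rule kle_mvs)
    show "?t 3 = rev lo' @ [3]" by simp
    show "set (rev lo') \<subseteq> set [1, 2]" using lo(5) by simp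
    show "s' = ?t(3 := [3], r := rev (rev lo') @ ?t r)"
      unfolding assms(8) using assms(1,2) lo(2) by (intro ext) simp
  qed (use assms(2) lo(3) in auto)
  have p4: "kle tmtest 0 s' s'" by (rule kle_tmtest[of _ "[]"]) (use assms in simp)
  show ?thesis unfolding decr_def
    by (rule kle_Seq[OF loop kle_Seq[OF p1 kle_Seq[OF p2 kle_Seq[OF p3 p4 order_refl] order_refl] order_refl]])
      (use assms(9) lo in simp)
qed

lemma kle_read_nat:
  assumes "s 0 = esym n @ rest" "s 3 = [3]" "r \<noteq> 3" "r \<noteq> 0" "s' = s(0 := rest, r := bsym n @ s r)"
    "6 * length (bsym n) + 4 \<le> L"
  shows "kle (read_nat r) L s s'"
proof -
  let ?t = "s(0 := rest, 3 := rev (bsym n) @ s 3)"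
  have p1: "kle (emit_nat 3) (3 * length (bsym n) + 3) s ?t"
    by (rule kle_emit_nat[where n = n and rest = rest]) (use assms(1) in auto)
  have p2: "kle (mvs 3 r [1, 2]) (3 * length (bsym n) + 1) ?t s'"
  proof (rule kle_mvs)
    show "?t 3 = rev (bsym n) @ [3]" using assms(2) by simp
    show "set (rev (bsym n)) \<subseteq> set [1, 2]" using bsym_bits by simp
    show "s' = ?t(3 := [3], r := rev (rev (bsym n)) @ ?t r)"
      unfolding assms(5) using assms(2-4) by (intro ext) simp
  qed (use assms(3) in auto)
  have p3: "kle tmtest 0 s' s'" by (rule kle_tmtest[of _ "[]"]) (use assms in simp)
  show ?thesis unfolding read_nat_def
    by (rule kle_Seq[OF p1 kle_Seq[OF p2 p3 order_refl]]) (use assms(6) in simp)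
qed

lemma kle_entry:
  assumes "s 3 = [3]" "s 2 = (l @ 2 # replicate j 1) @ [3]" "set l \<subseteq> {1, 2}"
    "s' = s(5 := rev (ent (None, lsb_val (l @ [2]))) @ s 5)" "8 * (length l + j + 1) + 3 \<le> L"
  shows "kle new_entry L s s'"
proof -
  let ?esym = "[Pop 2 1 \<triangleright> Push 3 1 \<triangleright> Push 5 1, Pop 2 2 \<triangleright> Push 3 2 \<triangleright> Push 5 2]"
  let ?z = "replicate j (1::nat)"
  let ?s0 = "s(5 := 5 # 7 # 4 # s 5)"
  define f where "f i = s(2 := drop i l @ 2 # ?z @ [3], 3 := rev (take i l) @ [3],
     5 := rev (take i l) @ 5 # 7 # 4 # s 5)" for i
  have "kle (Star (alts ?esym)) (length l * 3 + 1) (f 0) (f (length l))"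
  proof (rule kle_Star[where c = 2])
    fix i assume i: "i < length l"
    have "(f i)(2 := drop (Suc i) l @ 2 # ?z @ [3], 3 := l ! i # f i 3, 5 := l ! i # f i 5) = f (Suc i)"
      unfolding f_def using take_drop_nth(2)[OF i] by (intro ext) simp
    then have "kle (Pop 2 (l ! i) \<triangleright> Push 3 (l ! i) \<triangleright> Push 5 (l ! i)) 0 (f i) (f (Suc i))"
      by (simp add: f_def take_drop_nth(1)[OF i])
    then show "kle (alts ?esym) 2 (f i) (f (Suc i))"
      by (rule kle_alts) (use nth_bits[OF assms(3) i] in auto)
  qed simp
  moreover have "f 0 = ?s0" unfolding f_def using assms by (intro ext) simp
  ultimately have loop: "kle (Star (alts ?esym)) (length l * 3 + 1) ?s0 (f (length l))" by simp
  let ?t1 = "s(2 := ?z @ [3], 3 := 2 # rev l @ [3], 5 := 2 # rev l @ 5 # 7 # 4 # s 5)"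
  let ?t2 = "s(2 := [3], 3 := ?z @ 2 # rev l @ [3], 5 := 2 # rev l @ 5 # 7 # 4 # s 5)"
  let ?t3 = "s(5 := 2 # rev l @ 5 # 7 # 4 # s 5)"
  have p0: "kle (Push 5 4) 0 s (s(5 := 4 # s 5))"
    "kle (Push 5 7) 0 (s(5 := 4 # s 5)) (s(5 := 7 # 4 # s 5))"
    "kle (Push 5 5) 0 (s(5 := 7 # 4 # s 5)) ?s0" by auto
  have p1: "kle (Pop 2 2 \<triangleright> Push 3 2 \<triangleright> Push 5 2) 0 (f (length l)) ?t1"
    by (simp add: f_def fun_upd_twist)
  have p2: "kle (mvs 2 3 [1]) (2 * j + 1) ?t1 ?t2"
  proof (rule kle_mvs)
    show "?t1 2 = ?z @ [3]" by simp
    show "?t2 = ?t1(2 := [3], 3 := rev ?z @ ?t1 3)" by (intro ext) simp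
  qed auto
  have p3: "kle (Pop 2 3 \<triangleright> Push 2 3) 0 ?t2 ?t2" by (simp, intro ext, simp)
  have p4: "kle (mvs 3 2 [1, 2]) (3 * (length l + j + 1) + 1) ?t2 ?t3"
  proof (rule kle_mvs)
    show "?t2 3 = (?z @ 2 # rev l) @ [3]" by simp
    show "set (?z @ 2 # rev l) \<subseteq> set [1, 2]" using assms(3) by auto
    show "?t3 = ?t2(3 := [3], 2 := rev (?z @ 2 # rev l) @ ?t2 2)"
      using assms(1,2) by (intro ext) simp
  qed auto
  have p5: "kle tmtest 0 ?t3 ?t3" by (rule kle_tmtest[of _ "[]"]) (use assms in simp)
  have p6: "kle (Push 5 6) 0 ?t3 s'"
    using assms(4) bsym_val[OF assms(3)] by (simp add: ent_def fld_def)
  show ?thesis unfolding new_entry_def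
    by (rule kle_Seq[OF p0(1) kle_Seq[OF p0(2) kle_Seq[OF p0(3) kle_Seq[OF loop kle_Seq[OF p1
          kle_Seq[OF p2 kle_Seq[OF p3 kle_Seq[OF p4 kle_Seq[OF p5 p6 order_refl] order_refl] order_refl]
            order_refl] order_refl] order_refl] order_refl] order_refl]]) (use assms(5) in simp)
qed

lemma kle_chunk_skip:
  assumes "s 0 = psym g @ 1 # rest" "s 6 = g @ a # R" "set g \<subseteq> {1, 2}"
    "s' = s(0 := rest, 6 := R, 5 := a # rev g @ s 5)" "3 * length g + 1 \<le> L"
  shows "kle (chunk \<triangleright> skip_sym a) L s s'"
proof -
  let ?esym = "[Pop 0 2 \<triangleright> Pop 0 1 \<triangleright> Pop 6 1 \<triangleright> Push 5 1, Pop 0 2 \<triangleright> Pop 0 2 \<triangleright> Pop 6 2 \<triangleright> Push 5 2]"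
  define f where "f i = s(0 := psym (drop i g) @ 1 # rest, 6 := drop i g @ a # R,
     5 := rev (take i g) @ s 5)" for i
  have "kle (Star (alts ?esym)) (length g * 3 + 1) (f 0) (f (length g))"
  proof (rule kle_Star[where c = 2])
    fix i assume i: "i < length g"
    have "(f i)(0 := psym (drop (Suc i) g) @ 1 # rest, 6 := drop (Suc i) g @ a # R, 5 := g ! i # f i 5)
        = f (Suc i)"
      unfolding f_def using take_drop_nth(2)[OF i] by (intro ext) simp
    then have "kle (Pop 0 2 \<triangleright> Pop 0 (g ! i) \<triangleright> Pop 6 (g ! i) \<triangleright> Push 5 (g ! i)) 0 (f i) (f (Suc i))"
      by (simp add: f_def take_drop_nth(1)[OF i])
    then show "kle (alts ?esym) 2 (f i) (f (Suc i))"
      by (rule kle_alts) (use nth_bits[OF assms(3) i] in auto)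
  qed simp
  moreover have "f 0 = s" unfolding f_def using assms by (intro ext) simp
  ultimately have loop: "kle (Star (alts ?esym)) (length g * 3 + 1) s (f (length g))" by simp
  have p1: "kle (Pop 0 1) 0 (f (length g)) (s(0 := rest, 6 := a # R, 5 := rev g @ s 5))"
    by (simp add: f_def fun_upd_twist)
  have p2: "kle (skip_sym a) 0 (s(0 := rest, 6 := a # R, 5 := rev g @ s 5)) s'"
    using assms(4) by (simp add: skip_sym_def fun_upd_twist)
  show ?thesis unfolding chunk_def
    by (rule kle_Seq[OF kle_Seq[OF loop p1 order_refl] p2]) (use assms(5) in simp)
qed

text \<open>\<open>decr\<close> keeps the number of digits, so the values it produces are numerals
  of fixed width with leading zeros, written as the symbol 1.\<close>

definition pad :: "nat \<Rightarrow> nat \<Rightarrow> nat list" where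
  "pad W v = bsym v @ replicate (W - length (bsym v)) 1"

lemma length_bs_mono: "v \<le> k \<Longrightarrow> length (bsym v) \<le> length (bsym k)"
proof (cases "v = 0")
  case False
  assume "v \<le> k"
  obtain l where l: "bsym v = l @ [2]" using bsym_last False by blast
  have "v = lsb_val l + 2 ^ length l" using lsb_val_bsym[of v] l by (simp add: val_append)
  then have "2 ^ length l < (2::nat) ^ length (bsym k)"
    using \<open>v \<le> k\<close> val_less[of "bsym k"] unfolding lsb_val_bsym by linarith
  then have "length l < length (bsym k)" by (rule power_less_imp_less_exp[rotated]) simp
  then show ?thesis using l by simp
qed (simp add: bsym_def)

lemma pad_props:
  assumes "v \<le> k"
  shows "length (pad (length (bsym k)) v) = length (bsym k)" "set (pad W v) \<subseteq> {1, 2}" "lsb_val (pad W v) = v"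
  using length_bs_mono[OF assms] bsym_bits[of v] by (auto simp: pad_def)

lemma kle_decr_pad:
  assumes "s 3 = [3]" "r \<noteq> 3" "s r = pad (length (bsym k)) v @ rest" "u < v" "v \<le> k"
    "s' = s(r := pad (length (bsym k)) u @ rest)" "8 * length (bsym k) + 2 \<le> L"
  shows "kle (decr r) L s s'"
  by (rule kle_decr[OF assms(1,2,3) _ _ _ _ assms(6)])
    (use assms pad_props[of v k] pad_props[of u k] in simp_all)

lemma kle_page_hit:
  assumes "s 0 = esym p @ rest" "s 6 = bsym p @ 5 # R"
    "s' = s(0 := rest, 6 := R, 5 := 5 # rev (bsym p) @ s 5)" "3 * length (bsym p) + 2 \<le> L"
  shows "kle serve_page L s s'"
  unfolding serve_page_def
  by (rule kle_PlusL[OF kle_chunk_skip[OF _ assms(2) bsym_bits assms(3) order_refl]])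
    (use assms(1,4) in \<open>simp_all add: esym_psym\<close>)

lemma kle_page_miss:
  assumes "s 0 = esym p @ rest" "s 6 = fld po @ 5 # R" "s 3 = [3]" "s 4 = pad (length (bsym F)) f"
    "0 < f" "f \<le> F"
    "s' = s(0 := rest, 6 := R, 5 := 5 # rev (bsym p) @ s 5, 4 := pad (length (bsym F)) (f - 1))"
    "8 * length (bsym F) + 4 * length (fld po) + 3 * length (bsym p) + 7 \<le> L"
  shows "kle serve_page L s s'"
proof -
  let ?W = "length (bsym F)" and ?esym = "[Pop 6 1, Pop 6 2, Pop 6 7]"
  let ?t1 = "s(4 := pad ?W (f - 1))"
  have p1: "kle (decr 4) (8 * ?W + 2) s ?t1"
    by (rule kle_decr_pad[of _ _ F f "[]" "f - 1"]) (use assms in auto)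
  define g where "g i = ?t1(6 := drop i (fld po) @ 5 # R)" for i
  have "kle (Star (alts ?esym)) (length (fld po) * 4 + 1) (g 0) (g (length (fld po)))"
  proof (rule kle_Star[where c = 3])
    fix i assume i: "i < length (fld po)"
    have "kle (Pop 6 (fld po ! i)) 0 (g i) (g (Suc i))"
      by (simp add: g_def take_drop_nth(1)[OF i])
    then show "kle (alts ?esym) 3 (g i) (g (Suc i))"
      by (rule kle_alts) (use fld_set[of po] nth_mem[OF i] in auto)
  qed simp
  moreover have "g 0 = ?t1" unfolding g_def using assms by (intro ext) simp
  ultimately have p2: "kle (Star (alts ?esym)) (length (fld po) * 4 + 1) ?t1 (?t1(6 := 5 # R))"
    by (simp add: g_def)
  have p3: "kle (emit_nat 5) (3 * length (bsym p) + 3) (?t1(6 := 5 # R))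
      (?t1(6 := 5 # R, 0 := rest, 5 := rev (bsym p) @ s 5))"
    by (rule kle_emit_nat) (use assms in auto)
  have p4: "kle (skip_sym 5) 0 (?t1(6 := 5 # R, 0 := rest, 5 := rev (bsym p) @ s 5)) s'"
    unfolding assms(7) skip_sym_def by (auto intro!: ext)
  show ?thesis unfolding serve_page_def
    by (rule kle_PlusR[OF kle_Seq[OF p1 kle_Seq[OF p2 kle_Seq[OF p3 p4 order_refl] order_refl] order_refl]])
      (use assms(8) in simp)
qed

lemma ents_set: "set (ents c) \<subseteq> {1, 2, 4, 5, 6, 7}"
proof (induction c)
  case (Cons e c)
  then show ?case using fld_set[of "fst e"] bsym_bits[of "snd e"] by (auto simp: ent_def)
qed simp

text \<open>The bound counts seven choices per symbol for each of the two moves over the cache, at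
  most \<open>18 * B + 7\<close> for the page and \<open>3 * B + 1\<close> for the slot, and one for
  the kind of request.\<close>

lemma kle_serve:
  assumes s: "rev (s 5) @ s 6 = ents (c1 @ (po, v) # c2)" "s 3 = [3]"
      "s 4 = pad (length (bsym F)) f" "f \<le> F" "f = f' \<and> po = Some p \<or> f = Suc f'"
    and r: "r = General p \<or> r = Specific p v" "s 0 = map bit_symbol (encode_request r) @ rest"
    and B: "length (ents (c1 @ (po, v) # c2)) \<le> B" "length (bsym F) \<le> B" "length (bsym p) \<le> B"
  shows "\<exists>s'. kle serve (35 * B + 12) s s' \<and> s' 0 = rest \<and> s' 3 = [3] \<and>
    s' 4 = pad (length (bsym F)) f' \<and> rev (s' 5) @ s' 6 = ents (c1 @ (Some p, v) # c2)"
proof -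
  let ?A = "[1, 2, 4, 5, 6, 7::nat]" and ?W = "length (bsym F)"
  let ?body = "fld po @ 5 # bsym v @ 6 # ents c2"
  \<comment> \<open>All of the cache is first moved to stack 6 and then the entries
    \<open>c1\<close> back to stack 5, which selects the entry of \<open>v\<close>.\<close>
  let ?t1 = "s(5 := [], 6 := ents c1 @ 4 # ?body)"
  let ?t2 = "s(5 := rev (ents c1), 6 := 4 # ?body)"
  let ?t3 = "s(5 := 4 # rev (ents c1), 6 := ?body)"
  have sub: "set (s 5) \<subseteq> set ?A" "length (s 5) \<le> B"
    using ents_set[of "c1 @ (po, v) # c2"] arg_cong[OF s(1), of set] arg_cong[OF s(1), of length] B(1)
    by auto
  have len: "length (fld po) + length (bsym v) \<le> B" "length (ents c1) \<le> B" using B(1) by (auto simp: ent_def)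
  have p1: "kle (mvs 5 6 ?A) (7 * B + 1) s ?t1"
  proof (rule kle_mvs)
    show "s 5 = s 5 @ []" by simp
    show "?t1 = s(5 := [], 6 := rev (s 5) @ s 6)" using s(1) by (simp add: ent_def)
  qed (use sub in auto)
  have p2: "kle (mvs 6 5 ?A) (7 * B + 1) ?t1 ?t2"
  proof (rule kle_mvs)
    show "?t1 6 = ents c1 @ 4 # ?body" by simp
    show "set (ents c1) \<subseteq> set ?A" using ents_set by simp
    show "?t2 = ?t1(6 := 4 # ?body, 5 := rev (ents c1) @ ?t1 5)" by (intro ext) simp
  qed (use len in auto)
  have p3: "kle (skip_sym 4) 0 ?t2 ?t3" unfolding skip_sym_def by (auto intro!: ext)
  have serve_page: "kle serve_page (18 * B + 7) t (t(0 := q, 6 := bsym v @ 6 # ents c2,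
      5 := 5 # rev (bsym p) @ 4 # rev (ents c1), 4 := pad ?W f'))"
    if t: "t = ?t3(0 := esym p @ q)" for t q
    using s(5)
  proof
    assume h: "f = f' \<and> po = Some p"
    show ?thesis
      by (rule kle_page_hit[where p = p and rest = q and R = "bsym v @ 6 # ents c2"])
        (use t h s(3) B(3) in \<open>auto simp: fld_def intro!: ext\<close>)
  next
    assume h: "f = Suc f'"
    show ?thesis
      by (rule kle_page_miss[where p = p and rest = q and R = "bsym v @ 6 # ents c2" and po = po
            and F = F and f = f])
        (use t h s(2,3,4) B len in \<open>auto intro!: ext\<close>)
  qed
  from r(1) show ?thesis
  proof
    assume r': "r = General p"
    let ?t4 = "?t3(0 := esym p @ rest)"
    let ?s' = "?t4(0 := rest, 6 := bsym v @ 6 # ents c2, 5 := 5 # rev (bsym p) @ 4 # rev (ents c1), 4 := pad ?W f')"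
    have p4: "kle (Pop 0 1) 0 ?t3 ?t4" using r(2) r' by (simp add: esym_def)
    have "kle serve (35 * B + 12) s ?s'" unfolding serve_def
      by (rule kle_Seq[OF p1 kle_Seq[OF p2 kle_Seq[OF p3 kle_PlusL[OF kle_Seq[OF p4 serve_page[OF refl] order_refl]
                order_refl] order_refl] order_refl]]) simp
    then show ?thesis using s(2) by (intro exI[of _ ?s']) (simp add: ent_def fld_def)
  next
    assume r': "r = Specific p v"
    let ?q = "esym v @ rest"
    let ?t4 = "?t3(0 := esym p @ ?q)"
    let ?t5 = "?t4(0 := ?q, 6 := bsym v @ 6 # ents c2, 5 := 5 # rev (bsym p) @ 4 # rev (ents c1), 4 := pad ?W f')"
    let ?s' = "?t5(0 := rest, 6 := ents c2, 5 := 6 # rev (bsym v) @ ?t5 5)"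
    have p4: "kle (Pop 0 2) 0 ?t3 ?t4" using r(2) r' by (simp add: esym_def)
    have p5: "kle (chunk \<triangleright> skip_sym 6) (3 * length (bsym v) + 1) ?t5 ?s'"
      by (rule kle_chunk_skip[OF _ _ bsym_bits refl order_refl]) (auto simp: esym_psym)
    have "kle serve (35 * B + 12) s ?s'" unfolding serve_def
      by (rule kle_Seq[OF p1 kle_Seq[OF p2 kle_Seq[OF p3 kle_PlusR[OF kle_Seq[OF p4 kle_Seq[OF serve_page[OF refl] p5
                order_refl] order_refl] order_refl] order_refl] order_refl]]) (use len in simp)
    then show ?thesis using s(2) by (intro exI[of _ ?s']) (simp add: ent_def fld_def)
  qed
qed

lemma length_ents:
  "\<forall>e\<in>set c. length (fld (fst e)) \<le> X \<and> length (bsym (snd e)) \<le> X \<Longrightarrow> length (ents c) \<le> length c * (2 * X + 3)"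
  by (induction c) (auto simp: ent_def)

lemma kle_serves:
  assumes "list_all2 (slot_ok k) \<sigma> ss" "misses (cmap c) (zip \<sigma> ss) \<le> f" "f \<le> F" "set ss \<subseteq> snd ` set c"
    "distinct (map snd c)" "rev (s 5) @ s 6 = ents c" "s 3 = [3]" "s 4 = pad (length (bsym F)) f"
    "s 0 = enc_reqs \<sigma> @ rest" "\<forall>e\<in>set c. length (fld (fst e)) \<le> X \<and> length (bsym (snd e)) \<le> X"
    "\<forall>r\<in>set \<sigma>. length (bsym (page_of r)) \<le> X"
    "length c * (2 * X + 3) \<le> B" "length (bsym F) \<le> B" "X \<le> B" "length \<sigma> * (35 * B + 13) + 1 \<le> L"
  shows "\<exists>s'. kle (Star (Pop 0 2 \<triangleright> serve)) L s s' \<and> s' 0 = rest"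
  using assms
proof (induction \<sigma> ss arbitrary: c f s L rule: list_all2_induct)
  case Nil
  then show ?case using kle_StarN[of L _ s] by (intro exI[of _ s]) (simp add: enc_reqs_def)
next
  case (Cons r \<sigma> v ss)
  obtain c1 po c2 where c: "c = c1 @ (po, v) # c2"
    using Cons.prems(3) by (auto dest: split_list)
  have v: "v \<notin> snd ` set c1" using Cons.prems(4) c by auto
  let ?p = "page_of r" and ?c = "c1 @ (Some (page_of r), v) # c2"
  define f' where "f' = (if po = Some ?p then f else f - 1)"
  have cm: "cmap c v = po" "cmap ?c = (cmap c)(v \<mapsto> ?p)"
    using cmap_at[OF v] cmap_upd[OF v, of "Some ?p" c2 po] c by auto
  have m: "misses (cmap ?c) (zip \<sigma> ss) \<le> f'" "f = f' \<and> po = Some ?p \<or> f = Suc f'" "f' \<le> F"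
    using Cons.prems(1,2) cm by (auto simp: f'_def split: if_splits)
  have r: "r = General ?p \<or> r = Specific ?p v" using Cons(1) by (cases r) auto
  let ?s = "s(0 := map bit_symbol (encode_request r) @ enc_reqs \<sigma> @ rest)"
  have "\<exists>s'. kle serve (35 * B + 12) ?s s' \<and> s' 0 = enc_reqs \<sigma> @ rest \<and> s' 3 = [3] \<and>
    s' 4 = pad (length (bsym F)) f' \<and> rev (s' 5) @ s' 6 = ents ?c"
  proof (rule kle_serve[where po = po and f = f and r = r])
    show "length (ents (c1 @ (po, v) # c2)) \<le> B"
      using length_ents[OF Cons.prems(9)] Cons.prems(11) c by simp
    show "length (bsym ?p) \<le> B" using Cons.prems(10,13) by auto
  qed (use Cons.prems c m r in auto)
  then obtain s1 where s1: "kle serve (35 * B + 12) ?s s1" "s1 0 = enc_reqs \<sigma> @ rest" "s1 3 = [3]"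
    "s1 4 = pad (length (bsym F)) f'" "rev (s1 5) @ s1 6 = ents ?c" by blast
  have "\<exists>s'. kle (Star (Pop 0 2 \<triangleright> serve)) (length \<sigma> * (35 * B + 13) + 1) s1 s' \<and> s' 0 = rest"
  proof (rule Cons.IH[where c = ?c and f = f'])
    show "\<forall>e\<in>set ?c. length (fld (fst e)) \<le> X \<and> length (bsym (snd e)) \<le> X"
      using Cons.prems(9,10) c by (auto simp: fld_def)
  qed (use s1 m Cons.prems c in auto)
  then obtain s' where s': "kle (Star (Pop 0 2 \<triangleright> serve)) (length \<sigma> * (35 * B + 13) + 1) s1 s'" "s' 0 = rest"
    by blast
  have pop: "kle (Pop 0 2) 0 s ?s" using Cons.prems(8) by (simp add: enc_reqs_def)
  have "kle (Star (Pop 0 2 \<triangleright> serve)) L s s'"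
    by (rule kle_StarC[OF kle_Seq[OF pop s1(1) order_refl] s'(1)]) (use Cons.prems(14) in simp)
  then show ?case using s'(2) by blast
qed

lemma kle_entries:
  assumes "sorted_wrt (>) vs" "\<forall>v\<in>set vs. 0 < v \<and> v \<le> k" "s 3 = [3]"
    "vs \<noteq> [] \<Longrightarrow> s 2 = pad (length (bsym k)) (hd vs) @ [3]" "length vs * (16 * length (bsym k) + 14) + 1 \<le> L"
  shows "\<exists>xs. kle (Star (new_entry \<triangleright> decr 2)) L s (s(2 := xs, 5 := rev (ents (map (Pair None) vs)) @ s 5))"
  using assms
proof (induction vs arbitrary: s L)
  case Nil
  then show ?case using kle_StarN[of L _ s] by (intro exI[of _ "s 2"]) simp
next
  case (Cons v vs)
  let ?W = "length (bsym k)"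
  obtain l where l: "bsym v = l @ [2]" "set l \<subseteq> {1, 2}" using bsym_last[of v] Cons.prems(2) by auto
  let ?t = "s(5 := rev (ent (None, v)) @ s 5)"
  have v: "lsb_val (l @ [2]) = v" "v \<le> k" using lsb_val_bsym[of v] l Cons.prems(2) by auto
  have s2: "s 2 = (l @ 2 # replicate (?W - length (bsym v)) 1) @ [3]"
    using Cons.prems(4) l by (simp add: pad_def)
  have lw: "length l + (?W - length (bsym v)) + 1 = ?W" using length_bs_mono[OF v(2)] l(1) by simp
  have p1: "kle new_entry (8 * ?W + 3) s ?t"
    by (rule kle_entry[OF Cons.prems(3) s2 l(2)]) (use v lw in auto)
  \<comment> \<open>Each iteration ends with a decrease, also the last one; after the last slot the
    counter goes to 0.\<close>
  define u where "u = (if vs = [] then 0 else hd vs)"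
  have u: "u < v" using Cons.prems(1,2) by (cases vs) (auto simp: u_def)
  let ?t' = "?t(2 := pad ?W u @ [3])"
  have p2: "kle (decr 2) (8 * ?W + 2) ?t ?t'"
    by (rule kle_decr_pad[of _ _ k v "[3]" u]) (use Cons.prems u v in auto)
  have "\<exists>xs. kle (Star (new_entry \<triangleright> decr 2)) (length vs * (16 * ?W + 14) + 1) ?t'
      (?t'(2 := xs, 5 := rev (ents (map (Pair None) vs)) @ ?t' 5))"
    by (rule Cons.IH) (use Cons.prems in \<open>auto simp: u_def\<close>)
  then obtain xs where xs: "kle (Star (new_entry \<triangleright> decr 2)) (length vs * (16 * ?W + 14) + 1) ?t'
      (?t'(2 := xs, 5 := rev (ents (map (Pair None) vs)) @ ?t' 5))" by blast
  have eq: "?t'(2 := xs, 5 := rev (ents (map (Pair None) vs)) @ ?t' 5) =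
     s(2 := xs, 5 := rev (ents (map (Pair None) (v # vs))) @ s 5)" by (intro ext) simp
  have "kle (Star (new_entry \<triangleright> decr 2)) L s (?t'(2 := xs, 5 := rev (ents (map (Pair None) vs)) @ ?t' 5))"
    by (rule kle_StarC[OF kle_Seq[OF p1 p2 order_refl] xs]) (use Cons.prems(5) in simp)
  then show ?case unfolding eq by blast
qed

lemma length_enc_reqs:
  "length \<sigma> \<le> length (enc_reqs \<sigma>)" "\<forall>r\<in>set \<sigma>. length (bsym (page_of r)) \<le> length (enc_reqs \<sigma>)"
proof -
  show "length \<sigma> \<le> length (enc_reqs \<sigma>)" by (induction \<sigma>) (auto simp: enc_reqs_def)
  have "length (bsym (page_of r)) \<le> length (encode_request r)" for r
    using arg_cong[OF esym_psym, of length "page_of r"]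
    by (cases r) (auto simp: esym_def psym_def length_concat sum_list_triv comp_def)
  then show "\<forall>r\<in>set \<sigma>. length (bsym (page_of r)) \<le> length (enc_reqs \<sigma>)"
    by (induction \<sigma>) (auto simp: enc_reqs_def intro: le_SucI trans_le_add1 trans_le_add2)
qed

text \<open>Only slots that serve some request are listed, at most one per request. So the cache has
  quadratic length even if \<open>k\<close> is exponential, and scanning it for every request makes
  a cubic number of choices.\<close>

lemma verifier_complete:
  assumes "x \<in> All_or_One_Paging"
  shows "\<exists>j s'. ksem verifier j (kinit x) s' \<and> j \<le> poly [:40, 60, 200, 70:] (length x)"
proof -
  obtain k \<sigma> F where x: "x = encode_instance k \<sigma> F"
    using assms unfolding All_or_One_Paging_def by blast
  then obtain ss where ss: "list_all2 (slot_ok k) \<sigma> ss" "int (misses Map.empty (zip \<sigma> ss)) \<le> F"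
    using assms All_or_One_Paging_iff by blast
  define f where "f = nat F"
  have f: "F = int f" "misses Map.empty (zip \<sigma> ss) \<le> f" using ss(2) by (auto simp: f_def)
  have xs: "map bit_symbol x = esym k @ 1 # esym f @ enc_reqs \<sigma> @ [1]"
  proof -
    have "enc_reqs \<sigma> = map bit_symbol (concat (map (\<lambda>r. True # encode_request r) \<sigma>))"
      by (induction \<sigma>) (auto simp: enc_reqs_def)
    then show ?thesis
      by (simp add: x f(1) encode_instance_def encode_int_def encode_requests_def esym_def)
  qed
  define X where "X = length x"
  have lpr: "length (bsym n) \<le> length (esym n)" for n
    by (simp add: esym_psym psym_def length_concat sum_list_triv comp_def)
  have "length (map bit_symbol x) = length (esym k @ 1 # esym f @ enc_reqs \<sigma> @ [1])" using xs by simp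
  then have X: "length (bsym k) \<le> X" "length (bsym f) \<le> X" "length \<sigma> \<le> X" "length (enc_reqs \<sigma>) \<le> X" "1 \<le> X"
    using lpr[of k] lpr[of f] length_enc_reqs(1)[of \<sigma>] by (auto simp: X_def)
  define vs where "vs = rev (sorted_list_of_set (set ss))"
  have vs: "set vs = set ss" "sorted_wrt (>) vs" "distinct vs"
    by (auto simp: vs_def sorted_wrt_rev )
  have "length vs \<le> length ss" using card_length[of ss] vs distinct_card[OF vs(3)] by simp
  then have lvs: "length vs \<le> X" using X list_all2_lengthD[OF ss(1)] by simp
  have ssk: "\<forall>v\<in>set vs. 0 < v \<and> v \<le> k"
  proof
    fix v assume "v \<in> set vs"
    then obtain r where "slot_ok k r v"
      using ss(1) vs(1) by (auto simp: list_all2_conv_all_nth in_set_conv_nth)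
    then show "0 < v \<and> v \<le> k" by (cases r) auto
  qed
  let ?W = "length (bsym k)"
  let ?t2 = "(kinit x)(3 := [3], 2 := [3])"
  let ?r1 = "1 # esym f @ enc_reqs \<sigma> @ [1]" and ?r3 = "enc_reqs \<sigma> @ [1]"
  let ?t3 = "?t2(0 := ?r1, 2 := bsym k @ [3])"
  let ?t4 = "?t3(0 := esym f @ ?r3)"
  let ?t5 = "?t4(0 := ?r3, 4 := bsym f)"
  have p1: "kle (Push 3 3) 0 (kinit x) ((kinit x)(3 := [3]))" by (simp add: kinit_def)
  have p2: "kle (Push 2 3) 0 ((kinit x)(3 := [3])) ?t2" by (simp add: kinit_def)
  have p3: "kle (read_nat 2) (6 * X + 4) ?t2 ?t3"
    by (rule kle_read_nat[where n = k and rest = ?r1]) (use xs X in \<open>auto simp: kinit_def\<close>)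
  have p4: "kle (Pop 0 1) 0 ?t3 ?t4" by simp
  have p5: "kle (read_nat 4) (6 * X + 4) ?t4 ?t5"
    by (rule kle_read_nat[where n = f and rest = ?r3]) (use X in \<open>auto simp: kinit_def intro!: ext\<close>)
  have padk: "pad ?W k = bsym k" "pad (length (bsym f)) f = bsym f" by (simp_all add: pad_def)
  obtain ys where ys: "kle (Plus KSkip (decr 2)) (8 * X + 3) ?t5 (?t5(2 := ys @ [3]))"
      "vs \<noteq> [] \<Longrightarrow> ys = pad ?W (hd vs)"
  proof (cases "vs = [] \<or> hd vs = k")
    case True
    have "?t5(2 := bsym k @ [3]) = ?t5" by (intro ext) simp
    then have "kle (Plus KSkip (decr 2)) (8 * X + 3) ?t5 (?t5(2 := bsym k @ [3]))"
      using kle_PlusL[OF kle_KSkip, of "8 * X + 3" "decr 2" ?t5] by simp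
    then show ?thesis using that True padk by auto
  next
    case False
    then have "hd vs < k" using ssk by (metis hd_in_set le_neq_implies_less)
    have "kle (decr 2) (8 * X + 2) ?t5 (?t5(2 := pad ?W (hd vs) @ [3]))"
      by (rule kle_decr_pad[of _ _ k k "[3]" "hd vs"]) (use X padk \<open>hd vs < k\<close> in auto)
    from kle_PlusR[OF this, of "8 * X + 3"] show ?thesis using that by auto
  qed
  let ?t6 = "?t5(2 := ys @ [3])"
  let ?c = "map (Pair None) vs :: (nat option \<times> nat) list"
  have "\<exists>zs. kle (Star (new_entry \<triangleright> decr 2)) (X * (16 * X + 14) + 1) ?t6
      (?t6(2 := zs, 5 := rev (ents ?c) @ ?t6 5))"
    by (rule kle_entries[OF vs(2) ssk])
      (use ys(2) X(1) lvs in \<open>auto simp: kinit_def intro!: mult_le_mono\<close>)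
  then obtain zs where p7: "kle (Star (new_entry \<triangleright> decr 2)) (X * (16 * X + 14) + 1) ?t6
      (?t6(2 := zs, 5 := rev (ents ?c) @ ?t6 5))" by blast
  let ?t7 = "?t6(2 := zs, 5 := rev (ents ?c) @ ?t6 5)"
  \<comment> \<open>At most \<open>X\<close> entries, each with at most \<open>X\<close> digits for
    the page and for the slot and three separators; the additional \<open>X\<close> covers single
    numbers.\<close>
  define B where "B = X * (2 * X + 3) + X"
  have "\<exists>s'. kle (Star (Pop 0 2 \<triangleright> serve)) (X * (35 * B + 13) + 1) ?t7 s' \<and> s' 0 = [1]"
  proof (rule kle_serves[OF ss(1), where c = ?c and f = f and F = f and X = X and B = B])
    show "misses (cmap ?c) (zip \<sigma> ss) \<le> f" using f(2) cmap_None[of ?c] by auto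
    show "\<forall>e\<in>set ?c. length (fld (fst e)) \<le> X \<and> length (bsym (snd e)) \<le> X"
      using ssk length_bs_mono X(1,5) by (fastforce simp: fld_def)
    show "\<forall>r\<in>set \<sigma>. length (bsym (page_of r)) \<le> X" using length_enc_reqs(2)[of \<sigma>] X(4) by fastforce
    show "length ?c * (2 * X + 3) \<le> B" using lvs by (simp add: B_def trans_le_add1 mult_le_mono1)
    show "length \<sigma> * (35 * B + 13) + 1 \<le> X * (35 * B + 13) + 1" using X(3) by simp
  qed (use vs X padk in \<open>auto simp: kinit_def B_def comp_def image_image\<close>)
  then obtain s8 where p8: "kle (Star (Pop 0 2 \<triangleright> serve)) (X * (35 * B + 13) + 1) ?t7 s8" "s8 0 = [1]"
    by blast
  have p9: "kle (Pop 0 1) 0 s8 (s8(0 := []))" using p8(2) by simp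
  have p10: "kle EndX 0 (s8(0 := [])) (s8(0 := []))" by (rule kle_EndX) simp
  have "kle verifier (poly [:40, 60, 200, 70:] X) (kinit x) (s8(0 := []))"
    unfolding verifier_def
    by (rule kle_Seq[OF p1 kle_Seq[OF p2 kle_Seq[OF p3 kle_Seq[OF p4 kle_Seq[OF p5 kle_Seq[OF ys(1)
          kle_Seq[OF p7 kle_Seq[OF p8(1) kle_Seq[OF p9 p10 order_refl] order_refl] order_refl] order_refl]
            order_refl] order_refl] order_refl] order_refl]])
      (simp add: B_def algebra_simps)
  then show ?thesis unfolding kle_def X_def by blast
qed

theorem All_or_One_Paging_in_NP: "in_NP All_or_One_Paging"
  by (rule in_NP_kat[OF wfk_verifier _ _ verifier_complete]) (auto intro: verifier_sound)

section \<open>Instances in which every page is retrieved exactly once\<close>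

text \<open>A page is requested twice, when it starts and when it ends to be needed; the optional slot is that
  of a specific request.\<close>

datatype 'p ev = St 'p "slot option" | En 'p "slot option"

fun rq :: "('p \<Rightarrow> nat) \<Rightarrow> 'p ev \<Rightarrow> request" where
  "rq f (St p None) = General (f p)"
| "rq f (St p (Some j)) = Specific (f p) j"
| "rq f (En p None) = General (f p)"
| "rq f (En p (Some j)) = Specific (f p) j"

fun starts :: "'p ev list \<Rightarrow> 'p list" where
  "starts [] = []"
| "starts (St p j # es) = p # starts es"
| "starts (En p j # es) = starts es"

fun life :: "'p set \<Rightarrow> 'p ev list \<Rightarrow> bool" where
  "life A [] \<longleftrightarrow> A = {}"
| "life A (St p j # es) \<longleftrightarrow> p \<notin> A \<and> life (insert p A) es"
| "life A (En p j # es) \<longleftrightarrow> p \<in> A \<and> life (A - {p}) es"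

text \<open>Here a page occupies its slot only between start and end, so the slot is free as soon as
  the page has ended, whereas a lazy cache keeps the page until the slot is reused.\<close>

fun feas :: "nat \<Rightarrow> 'p ev list \<Rightarrow> (slot \<rightharpoonup> 'p) \<Rightarrow> bool" where
  "feas k [] C \<longleftrightarrow> True"
| "feas k (St p j # es) C \<longleftrightarrow>
     (\<exists>s\<in>{1..k}. C s = None \<and> (j = None \<or> j = Some s) \<and> feas k es (C(s \<mapsto> p)))"
| "feas k (En p j # es) C \<longleftrightarrow>
     (\<exists>s. C s = Some p \<and> (j = None \<or> j = Some s) \<and> feas k es (C(s := None)))"

lemma starts_append [simp]: "starts (a @ b) = starts a @ starts b"
  by (induction a rule: starts.induct) auto

fun ev_page :: "'p ev \<Rightarrow> 'p" where
  "ev_page (St p j) = p" | "ev_page (En p j) = p"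

fun ev_slot_ok :: "'p ev \<Rightarrow> slot \<Rightarrow> bool" where
  "ev_slot_ok (St p j) s \<longleftrightarrow> j = None \<or> j = Some s"
| "ev_slot_ok (En p j) s \<longleftrightarrow> j = None \<or> j = Some s"

lemma page_of_rq [simp]: "page_of (rq f e) = f (ev_page e)"
  by (cases "(f, e)" rule: rq.cases) auto

lemma slot_ok_rq: "slot_ok k (rq f e) s \<longleftrightarrow> s \<in> {1..k} \<and> ev_slot_ok e s"
  by (cases "(f, e)" rule: rq.cases) auto

lemma map_option_comp_upd: "(map_option f \<circ> C)(s \<mapsto> f p) = map_option f \<circ> (C(s \<mapsto> p))"
  by (intro ext) simp

text \<open>A page that has not started cannot be in the cache, so each start is a miss. The bound
  is applied to the remaining events, to show that they need all of the remaining budget.\<close>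

lemma misses_lower:
  assumes "inj f" "life A es" "distinct (starts es)" "(A \<union> ran C) \<inter> set (starts es) = {}"
    "length ss = length es"
  shows "length (starts es) \<le> misses (map_option f \<circ> C) (zip (map (rq f) es) ss)"
  using assms(2-)
proof (induction es arbitrary: A C ss)
  case (Cons e es)
  obtain s ss' where ss: "ss = s # ss'" using Cons.prems(4) by (cases ss) auto
  let ?C = "C(s \<mapsto> ev_page e)"
  have ran: "ran ?C \<subseteq> insert (ev_page e) (ran C)" by (auto simp: ran_def)
  obtain A' where A': "life A' es" "A' \<subseteq> insert (ev_page e) A" "ev_page e \<notin> set (starts es)"
      "distinct (starts es)" "set (starts es) \<subseteq> set (starts (e # es))"
    using Cons.prems by (cases e) auto
  have IH: "length (starts es) \<le> misses (map_option f \<circ> ?C) (zip (map (rq f) es) ss')"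
  proof (rule Cons.IH[OF A'(1,4)])
    show "(A' \<union> ran ?C) \<inter> set (starts es) = {}" using A'(2,3,5) ran Cons.prems(3) by blast
  qed (use Cons.prems(4) ss in auto)
  have "C s \<noteq> Some (ev_page e)" if "starts (e # es) \<noteq> starts es"
    using that Cons.prems(3) ranI[of C s] by (cases e) auto
  then have "length (starts (e # es)) \<le> (if C s = Some (ev_page e) then 0 else 1) + length (starts es)"
    by (cases e) auto
  moreover have hit: "(map_option f \<circ> C) s = Some (f (ev_page e)) \<longleftrightarrow> C s = Some (ev_page e)"
    using assms(1) by (cases "C s") (auto simp: inj_eq)
  ultimately show ?case using IH
    unfolding ss list.map zip_Cons_Cons misses.simps page_of_rq map_option_comp_upd hit by linarith
qed simp

text \<open>Forgets the pages that have ended, which turns a lazy cache into a configuration of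
  \<open>feas\<close>.\<close>

definition restr :: "'p set \<Rightarrow> (slot \<rightharpoonup> 'p) \<Rightarrow> slot \<rightharpoonup> 'p" where
  "restr A C s = (if C s \<in> Some ` A then C s else None)"

text \<open>Since the starts use up the budget, every end must be a hit, hence happens in the slot
  where the page started. The conjunct \<open>A \<subseteq> ran C\<close> carries this backwards: a
  live page must be cached now, because it cannot be retrieved again, so a start never overwrites a
  live page.\<close>

lemma misses_imp_feas:
  assumes "inj f" "life A es" "distinct (starts es)" "(A \<union> ran C) \<inter> set (starts es) = {}"
    "list_all2 (slot_ok k) (map (rq f) es) ss" "\<forall>s s' p. C s = Some p \<longrightarrow> C s' = Some p \<longrightarrow> s = s'"
    "misses (map_option f \<circ> C) (zip (map (rq f) es) ss) \<le> length (starts es)"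
  shows "A \<subseteq> ran C \<and> feas k es (restr A C)"
  using assms(2-)
proof (induction es arbitrary: A C ss)
  case (Cons e es)
  obtain s ss' where ss: "ss = s # ss'" "slot_ok k (rq f e) s" "list_all2 (slot_ok k) (map (rq f) es) ss'"
    using Cons.prems(4) by (cases ss) auto
  then have s: "s \<in> {1..k}" "ev_slot_ok e s" by (simp_all add: slot_ok_rq)
  have len: "length ss' = length es" using ss(3) list_all2_lengthD by fastforce
  let ?p = "ev_page e"
  let ?C = "C(s \<mapsto> ?p)"
  have hit: "(map_option f \<circ> C) s = Some (f ?p) \<longleftrightarrow> C s = Some ?p"
    using assms(1) by (cases "C s") (auto simp: inj_eq)
  have ran: "ran ?C \<subseteq> insert ?p (ran C)" by (auto simp: ran_def)
  have m: "(if C s = Some ?p then 0 else 1) + misses (map_option f \<circ> ?C) (zip (map (rq f) es) ss')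
      \<le> length (starts (e # es))"
    using Cons.prems(6)
    unfolding ss(1) list.map zip_Cons_Cons misses.simps page_of_rq map_option_comp_upd hit .
  \<comment> \<open>A live page that is cached after the start was cached before it, and not in
    \<open>s\<close>, because no page is cached twice.\<close>
  have fresh: "A \<subseteq> ran C \<and> C s \<notin> Some ` A" if e: "ev_page e \<notin> A" "ev_page e \<notin> ran C"
    and IH: "A \<subseteq> ran ?C" 
  proof -
    have *: "C s \<noteq> Some q" if "q \<in> A" for q
    proof
      assume q: "C s = Some q"
      from that IH obtain s' where s': "?C s' = Some q" by (auto simp: ran_def)
      with that e have "s' \<noteq> s" by auto
      then have "C s' = Some q" using s' by simp
      then show False using q Cons.prems(5) \<open>s' \<noteq> s\<close> by blast
    qed
    moreover have "q \<in> ran C" if "q \<in> A" for q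
      using that IH e by (auto simp: ran_def split: if_splits)
    ultimately show ?thesis by auto
  qed
  have inj: "\<forall>s s' p. ?C s = Some p \<longrightarrow> ?C s' = Some p \<longrightarrow> s = s'" if "ev_page e \<notin> ran C \<or> C s = Some ?p"
    using that Cons.prems(5) by (auto simp: ran_def)
  show ?case
  proof (cases e)
    case (St p j)
    then have p: "p \<notin> A" "p \<notin> ran C" "p \<notin> set (starts es)" using Cons.prems(1-3) by auto
    then have miss: "C s \<noteq> Some p" by (auto simp: ran_def)
    have IH: "insert p A \<subseteq> ran ?C \<and> feas k es (restr (insert p A) ?C)"
    proof (rule Cons.IH[OF _ _ _ ss(3)])
      show "misses (map_option f \<circ> ?C) (zip (map (rq f) es) ss') \<le> length (starts es)"
        using m St miss by simp
      show "life (insert p A) es" "distinct (starts es)" using Cons.prems(1,2) St by auto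
      show "(insert p A \<union> ran ?C) \<inter> set (starts es) = {}" using Cons.prems(3) ran p(3) St by auto
      show "\<forall>s s' p. ?C s = Some p \<longrightarrow> ?C s' = Some p \<longrightarrow> s = s'" by (rule inj) (use p(2) St in simp)
    qed
    have fr: "A \<subseteq> ran C" "C s \<notin> Some ` A" using fresh IH p St by auto
    have "restr (insert p A) ?C = (restr A C)(s \<mapsto> p)"
      using p fr(2) St by (auto simp: restr_def fun_eq_iff ran_def)
    moreover have "restr A C s = None" using fr(2) by (simp add: restr_def)
    ultimately have "feas k (e # es) (restr A C)"
      unfolding St feas.simps by (intro bexI[of _ s]) (use IH s St in auto)
    then show ?thesis using fr by blast
  next
    case (En p j)
    then have p: "p \<in> A" "life (A - {p}) es" using Cons.prems(1) by auto
    have ps: "p \<notin> set (starts es)" using p Cons.prems(3) En by auto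
    \<comment> \<open>The later starts need the whole budget, so this end cannot be a miss.\<close>
    have "length (starts es) \<le> misses (map_option f \<circ> ?C) (zip (map (rq f) es) ss')"
    proof (rule misses_lower[OF assms(1) p(2) _ _ len])
      show "distinct (starts es)" using Cons.prems(2) En by auto
      show "(A - {p} \<union> ran ?C) \<inter> set (starts es) = {}" using Cons.prems(3) ran ps En by auto
    qed
    then have C: "C s = Some p" using m En by (auto split: if_splits)
    then have upd: "?C = C" using En by (auto simp: fun_eq_iff)
    have IH: "A - {p} \<subseteq> ran C \<and> feas k es (restr (A - {p}) C)"
    proof (rule Cons.IH[OF p(2) _ _ ss(3) Cons.prems(5)])
      show "distinct (starts es)" using Cons.prems(2) En by auto
      show "(A - {p} \<union> ran C) \<inter> set (starts es) = {}" using Cons.prems(3) En by auto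
      show "misses (map_option f \<circ> C) (zip (map (rq f) es) ss') \<le> length (starts es)"
        using m C En unfolding upd by simp
    qed
    have "restr (A - {p}) C = (restr A C)(s := None)"
      using C Cons.prems(5) by (auto simp: restr_def fun_eq_iff)
    moreover have "restr A C s = Some p" using C p by (simp add: restr_def)
    ultimately have "feas k (e # es) (restr A C)"
      unfolding En feas.simps by (intro exI[of _ s]) (use IH s En in auto)
    moreover have "A \<subseteq> ran C" using IH ranI[of C s p] C by auto
    ultimately show ?thesis by blast
  qed
qed simp

text \<open>Ended pages linger in the lazy cache \<open>B\<close>, so it is only required to extend
  \<open>C\<close>.\<close>

lemma feas_imp_misses:
  assumes "feas k es C" "\<forall>s p. C s = Some p \<longrightarrow> B s = Some p" "dom C \<subseteq> {1..k}"
  shows "\<exists>ss. list_all2 (slot_ok k) (map (rq f) es) ss \<and>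
    misses (map_option f \<circ> B) (zip (map (rq f) es) ss) \<le> length (starts es)"
  using assms
proof (induction es arbitrary: B C)
  case (Cons e es)
  obtain s C' where s: "s \<in> {1..k}" "ev_slot_ok e s" "feas k es C'"
      "\<forall>u p. C' u = Some p \<longrightarrow> (B(s \<mapsto> ev_page e)) u = Some p" "dom C' \<subseteq> {1..k}"
      "starts (e # es) = starts es \<Longrightarrow> B s = Some (ev_page e)"
  proof (cases e)
    case (St p j)
    then obtain s where "s \<in> {1..k}" "C s = None" "j = None \<or> j = Some s" "feas k es (C(s \<mapsto> p))"
      using Cons.prems(1) by auto
    then show ?thesis using that[of s "C(s \<mapsto> p)"] Cons.prems(2,3) St by auto
  next
    case (En p j)
    then obtain s where "C s = Some p" "j = None \<or> j = Some s" "feas k es (C(s := None))"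
      using Cons.prems(1) by auto
    moreover from this have "s \<in> {1..k}" using Cons.prems(3) by blast
    moreover have "\<forall>u q. (C(s := None)) u = Some q \<longrightarrow> (B(s \<mapsto> p)) u = Some q" "dom (C(s := None)) \<subseteq> {1..k}"
      using Cons.prems(2,3) by auto
    ultimately show ?thesis using that[of s "C(s := None)"] Cons.prems(2) En by fastforce
  qed
  from Cons.IH[OF s(3,4,5)] obtain ss where ss: "list_all2 (slot_ok k) (map (rq f) es) ss"
    "misses (map_option f \<circ> (B(s \<mapsto> ev_page e))) (zip (map (rq f) es) ss) \<le> length (starts es)" by blast
  have "misses (map_option f \<circ> B) (zip (map (rq f) (e # es)) (s # ss)) \<le> length (starts (e # es))"
    using ss(2) s(6) unfolding list.map zip_Cons_Cons misses.simps page_of_rq map_option_comp_upd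
    by (cases e) auto
  moreover have "list_all2 (slot_ok k) (map (rq f) (e # es)) (s # ss)"
    using ss(1) s(1,2) by (simp add: slot_ok_rq)
  ultimately show ?case by blast
qed simp

lemma misses_iff_feas:
  assumes "inj f" "life {} es" "distinct (starts es)"
  shows "(\<exists>ss. list_all2 (slot_ok k) (map (rq f) es) ss \<and>
    misses Map.empty (zip (map (rq f) es) ss) \<le> length (starts es)) \<longleftrightarrow> feas k es Map.empty"
proof -
  have e: "map_option f \<circ> Map.empty = Map.empty" by (auto simp: fun_eq_iff)
  have r: "restr {} Map.empty = Map.empty" by (auto simp: restr_def fun_eq_iff)
  show ?thesis
    using misses_imp_feas[OF assms, of Map.empty k] feas_imp_misses[of k es Map.empty Map.empty f]
    unfolding e r by auto
qed

section \<open>Networks of optional swaps\<close>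

text \<open>
  The slots are tokens on positions, and a page is a position during a period of time. Since all
  slots are always occupied, the slots of two pages that end are those of the two pages that start
  next, in any order: an optional swap.
\<close>

datatype 'c pos = PC nat | PW 'c | PZ 'c

text \<open>The second argument of \<open>Wt\<close> and \<open>Dn\<close> and the first of
  \<open>Ch\<close> is the period. All chain pages are renewed at every operation, so one global
  counter serves them; the pages of a constraint are renewed only at its own gates.\<close>

datatype 'c nm = Ch nat nat | Wt 'c nat | Dn 'c nat

datatype 'c op = Sw0 nat | SwW 'c nat nat | SwZ 'c nat nat | As

definition sw :: "'c pos \<Rightarrow> 'c pos \<Rightarrow> ('c pos \<Rightarrow> slot) \<Rightarrow> 'c pos \<Rightarrow> slot" where
  "sw a b \<sigma> = \<sigma>(a := \<sigma> b, b := \<sigma> a)"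

fun game :: "'c op list \<Rightarrow> ('c pos \<Rightarrow> slot) \<Rightarrow> (('c pos \<Rightarrow> slot) \<Rightarrow> bool) \<Rightarrow> bool" where
  "game [] \<sigma> G \<longleftrightarrow> G \<sigma>"
| "game (Sw0 d # ops) \<sigma> G \<longleftrightarrow> game ops \<sigma> G \<or> game ops (sw (PC 0) (PC d) \<sigma>) G"
| "game (SwW c i d # ops) \<sigma> G \<longleftrightarrow> game ops \<sigma> G \<or> game ops (sw (PW c) (PC d) \<sigma>) G"
| "game (SwZ c i d # ops) \<sigma> G \<longleftrightarrow> game ops \<sigma> G \<or> game ops (sw (PC d) (PZ c) \<sigma>) G"
| "game (As # ops) \<sigma> G \<longleftrightarrow> \<sigma> (PC 0) = 1 \<and> game ops \<sigma> G"

definition ren :: "nat \<Rightarrow> nat list \<Rightarrow> 'c nm ev list" where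
  "ren g ds = concat (map (\<lambda>d. [En (Ch g d) None, St (Ch (Suc g) d) None]) ds)"

text \<open>Two pages end before two others start, so each of the two free slots may take either new
  page: this is the optional swap. The other chain pages are renewed one at a time, which leaves no
  choice.\<close>

fun evop :: "nat \<Rightarrow> nat \<Rightarrow> 'c op \<Rightarrow> 'c nm ev list" where
  "evop D g (Sw0 d) =
     [En (Ch g 0) None, En (Ch g d) None, St (Ch (Suc g) 0) None, St (Ch (Suc g) d) None] @
     ren g (filter (\<lambda>e. e \<noteq> 0 \<and> e \<noteq> d) [0..<D])"
| "evop D g (SwW c i d) =
     [En (Wt c i) None, En (Ch g d) None, St (Wt c (Suc i)) None, St (Ch (Suc g) d) None] @
     ren g (filter (\<lambda>e. e \<noteq> d) [0..<D])"
| "evop D g (SwZ c i d) =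
     [En (Ch g d) None, En (Dn c i) None, St (Ch (Suc g) d) None, St (Dn c (Suc i)) None] @
     ren g (filter (\<lambda>e. e \<noteq> d) [0..<D])"
| "evop D g As = [En (Ch g 0) (Some 1), St (Ch (Suc g) 0) None] @
     ren g (filter (\<lambda>e. e \<noteq> 0) [0..<D])"

fun evops :: "nat \<Rightarrow> nat \<Rightarrow> 'c op list \<Rightarrow> 'c nm ev list" where
  "evops D g [] = []"
| "evops D g (op # ops) = evop D g op @ evops D (Suc g) ops"

definition nm :: "(nat \<Rightarrow> nat) \<Rightarrow> ('c \<Rightarrow> nat) \<Rightarrow> ('c \<Rightarrow> nat) \<Rightarrow> 'c pos \<Rightarrow> 'c nm" where
  "nm gf lw lz x = (case x of PC d \<Rightarrow> Ch (gf d) d | PW c \<Rightarrow> Wt c (lw c) | PZ c \<Rightarrow> Dn c (lz c))"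

lemma nm_simps [simp]: "nm gf lw lz (PC d) = Ch (gf d) d" "nm gf lw lz (PW c) = Wt c (lw c)"
    "nm gf lw lz (PZ c) = Dn c (lz c)"
  by (auto simp: nm_def)

lemma inj_nm: "inj (nm gf lw lz)"
  by (auto simp: inj_def nm_def split: pos.splits)

lemma nm_upd:
  "(nm gf lw lz)(PC d := Ch h d) = nm (gf(d := h)) lw lz"
  "(nm gf lw lz)(PW c := Wt c i) = nm gf (lw(c := i)) lz"
  "(nm gf lw lz)(PZ c := Dn c i) = nm gf lw (lz(c := i))"
  by (auto simp: fun_eq_iff nm_def split: pos.splits)

lemma feas_En: "(\<And>s. C s = Some p \<longleftrightarrow> s = t) \<Longrightarrow>
    feas k (En p j # es) C \<longleftrightarrow> (j = None \<or> j = Some t) \<and> feas k es (C(t := None))"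
  by simp

lemma feas_En_None: "(\<And>s. C s = Some p \<longleftrightarrow> s = t) \<Longrightarrow>
    feas k (En p None # es) C \<longleftrightarrow> feas k es (C(t := None))"
  by simp

lemma feas_St1:
  assumes "\<And>s. C s = None \<and> s \<in> {1..k} \<longleftrightarrow> s = t"
  shows "feas k (St p None # es) C \<longleftrightarrow> feas k es (C(t \<mapsto> p))"
proof -
  have "feas k (St p None # es) C \<longleftrightarrow> (\<exists>s. (C s = None \<and> s \<in> {1..k}) \<and> feas k es (C(s \<mapsto> p)))" by auto
  then show ?thesis unfolding assms by simp
qed

lemma feas_St2:
  assumes "\<And>s. C s = None \<and> s \<in> {1..k} \<longleftrightarrow> s = t \<or> s = t'"
  shows "feas k (St p None # es) C \<longleftrightarrow> feas k es (C(t \<mapsto> p)) \<or> feas k es (C(t' \<mapsto> p))"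
proof -
  have "feas k (St p None # es) C \<longleftrightarrow> (\<exists>s. (C s = None \<and> s \<in> {1..k}) \<and> feas k es (C(s \<mapsto> p)))" by auto
  then show ?thesis unfolding assms by blast
qed

section \<open>Feasible event sequences as a game with tokens\<close>

locale network =
  fixes D :: nat and cs :: "'c list" and r :: "'c \<Rightarrow> nat"
  assumes D: "D \<ge> 1" and distinct_cs: "distinct cs"
begin

definition P :: "'c pos set" where
  "P = PC ` {..<D} \<union> PW ` set cs \<union> PZ ` set cs"

definition k :: nat where
  "k = D + 2 * length cs"

lemma P_iff [simp]: "PC d \<in> P \<longleftrightarrow> d < D" "PW c \<in> P \<longleftrightarrow> c \<in> set cs" "PZ c \<in> P \<longleftrightarrow> c \<in> set cs"
  by (auto simp: P_def)

text \<open>The token at position \<open>x\<close> is slot \<open>\<sigma> x\<close> and holds page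
  \<open>\<nu> x\<close>. As \<open>\<sigma>\<close> is a bijection onto \<open>{1..k}\<close>, no
  slot is ever left empty between operations.\<close>

definition mk :: "('c pos \<Rightarrow> 'c nm) \<Rightarrow> ('c pos \<Rightarrow> slot) \<Rightarrow> slot \<rightharpoonup> 'c nm" where
  "mk \<nu> \<sigma> s = (if s \<in> {1..k} then Some (\<nu> (inv_into P \<sigma> s)) else None)"

definition tok :: "('c pos \<Rightarrow> slot) \<Rightarrow> bool" where
  "tok \<sigma> \<longleftrightarrow> bij_betw \<sigma> P {1..k}"

lemma mk_at: "tok \<sigma> \<Longrightarrow> x \<in> P \<Longrightarrow> mk \<nu> \<sigma> (\<sigma> x) = Some (\<nu> x)"
  unfolding mk_def tok_def by (metis bij_betwE bij_betw_inv_into_left)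

lemma mk_iff: "tok \<sigma> \<Longrightarrow> inj \<nu> \<Longrightarrow> x \<in> P \<Longrightarrow> mk \<nu> \<sigma> s = Some (\<nu> x) \<longleftrightarrow> s = \<sigma> x"
  unfolding mk_def tok_def
  by (metis bij_betwE bij_betw_inv_into_left bij_betw_inv_into_right injD option.distinct(1) option.inject)

lemma mk_None: "mk \<nu> \<sigma> s = None \<longleftrightarrow> s \<notin> {1..k}"
  by (simp add: mk_def)

lemma tok_sw:
  assumes "tok \<sigma>" "a \<in> P" "b \<in> P"
  shows "tok (sw a b \<sigma>)"
proof -
  have "inj_on (sw a b \<sigma>) P"
    using assms unfolding tok_def bij_betw_def sw_def by (auto simp: inj_on_def)
  moreover have "sw a b \<sigma> x \<in> \<sigma> ` P" if "x \<in> P" for x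
    using that assms(2,3) by (auto simp: sw_def)
  moreover have "\<sigma> x \<in> sw a b \<sigma> ` P" if "x \<in> P" for x
  proof -
    have "\<sigma> x = sw a b \<sigma> (if x = a then b else if x = b then a else x)" by (simp add: sw_def)
    moreover have "(if x = a then b else if x = b then a else x) \<in> P" using that assms(2,3) by simp
    ultimately show ?thesis by (rule image_eqI)
  qed
  ultimately have "inj_on (sw a b \<sigma>) P \<and> sw a b \<sigma> ` P = \<sigma> ` P" by blast
  then show ?thesis using assms(1) by (simp add: tok_def bij_betw_def)
qed

lemma tok_neq: "tok \<sigma> \<Longrightarrow> a \<in> P \<Longrightarrow> b \<in> P \<Longrightarrow> a \<noteq> b \<Longrightarrow> \<sigma> a \<noteq> \<sigma> b"
  unfolding tok_def bij_betw_def by (meson inj_onD)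

lemma tok_cases:
  assumes "tok \<sigma>" "s \<in> {1..k}"
  obtains x where "x \<in> P" "s = \<sigma> x"
  using assms unfolding tok_def bij_betw_def by blast

lemma mk_upd:
  assumes "tok \<sigma>" "a \<in> P"
  shows "(mk \<nu> \<sigma>)(\<sigma> a \<mapsto> p) = mk (\<nu>(a := p)) \<sigma>"
proof
  fix s
  show "((mk \<nu> \<sigma>)(\<sigma> a \<mapsto> p)) s = mk (\<nu>(a := p)) \<sigma> s"
  proof (cases "s \<in> {1..k}")
    case True
    with assms(1) obtain x where x: "x \<in> P" "s = \<sigma> x" using tok_cases by blast
    then show ?thesis using assms mk_at[OF assms(1)] tok_neq[OF assms(1)]
      by (cases "x = a") auto
  next
    case False
    moreover have "\<sigma> a \<in> {1..k}" using assms by (auto simp: tok_def bij_betw_def)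
    ultimately show ?thesis by (auto simp: mk_def)
  qed
qed

text \<open>Exchanging both the names and the tokens of two positions is a mere relabelling. It
  turns the second way of filling two free slots into a swap of tokens.\<close>

lemma mk_sw:
  assumes "tok \<sigma>" "a \<in> P" "b \<in> P"
  shows "mk (\<nu>(a := \<nu> b, b := \<nu> a)) (sw a b \<sigma>) = mk \<nu> \<sigma>"
proof
  fix s
  let ?\<sigma> = "sw a b \<sigma>"
  have t: "tok ?\<sigma>" using tok_sw assms by blast
  show "mk (\<nu>(a := \<nu> b, b := \<nu> a)) ?\<sigma> s = mk \<nu> \<sigma> s"
  proof (cases "s \<in> {1..k}")
    case True
    with t obtain x where x: "x \<in> P" "s = ?\<sigma> x" using tok_cases by blast
    define y where "y = (if x = a then b else if x = b then a else x)"
    have y: "y \<in> P" "s = \<sigma> y" "(\<nu>(a := \<nu> b, b := \<nu> a)) x = \<nu> y"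
      using x assms by (auto simp: y_def sw_def)
    have "mk (\<nu>(a := \<nu> b, b := \<nu> a)) ?\<sigma> s = Some (\<nu> y)"
      unfolding x(2) mk_at[OF t x(1)] y(3) ..
    moreover have "mk \<nu> \<sigma> s = Some (\<nu> y)" unfolding y(2) mk_at[OF assms(1) y(1)] ..
    ultimately show ?thesis by simp
  qed (auto simp: mk_def)
qed

lemma feas_ren1:
  assumes "tok \<sigma>" "inj \<nu>" "a \<in> P" "j = None \<or> j = Some s"
  shows "feas k (En (\<nu> a) j # St p None # es) (mk \<nu> \<sigma>) \<longleftrightarrow>
    (j = Some s \<longrightarrow> \<sigma> a = s) \<and> feas k es (mk (\<nu>(a := p)) \<sigma>)"
proof -
  have a: "\<sigma> a \<in> {1..k}" using assms by (auto simp: tok_def bij_betw_def)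
  have free: "((mk \<nu> \<sigma>)(\<sigma> a := None)) t = None \<and> t \<in> {1..k} \<longleftrightarrow> t = \<sigma> a" for t
    using a by (auto simp: mk_None)
  have "feas k (En (\<nu> a) j # St p None # es) (mk \<nu> \<sigma>) \<longleftrightarrow>
     (j = None \<or> j = Some (\<sigma> a)) \<and> feas k (St p None # es) ((mk \<nu> \<sigma>)(\<sigma> a := None))"
    by (rule feas_En[OF mk_iff[OF assms(1,2,3)]])
  also have "feas k (St p None # es) ((mk \<nu> \<sigma>)(\<sigma> a := None)) \<longleftrightarrow> feas k es ((mk \<nu> \<sigma>)(\<sigma> a \<mapsto> p))"
    using feas_St1[OF free, of p es] unfolding fun_upd_upd .
  finally show ?thesis using mk_upd[OF assms(1,3), of \<nu> p] assms(4) by auto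
qed

text \<open>After the two ends exactly two slots are free, and the start of \<open>p\<close> takes
  either of them; \<open>q\<close> gets the other one.\<close>

lemma feas_swap:
  assumes "tok \<sigma>" "inj \<nu>" "a \<in> P" "b \<in> P" "a \<noteq> b"
  shows "feas k (En (\<nu> a) None # En (\<nu> b) None # St p None # St q None # es) (mk \<nu> \<sigma>) \<longleftrightarrow>
    feas k es (mk (\<nu>(a := p, b := q)) \<sigma>) \<or> feas k es (mk (\<nu>(a := p, b := q)) (sw a b \<sigma>))"
proof -
  have ab: "\<sigma> a \<in> {1..k}" "\<sigma> b \<in> {1..k}" "\<sigma> a \<noteq> \<sigma> b"
    using assms tok_neq by (auto simp: tok_def bij_betw_def)
  let ?C = "(mk \<nu> \<sigma>)(\<sigma> a := None, \<sigma> b := None)"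
  have free: "?C t = None \<and> t \<in> {1..k} \<longleftrightarrow> t = \<sigma> a \<or> t = \<sigma> b" for t
    using ab by (auto simp: mk_None)
  have free1: "(?C(\<sigma> a \<mapsto> p)) t = None \<and> t \<in> {1..k} \<longleftrightarrow> t = \<sigma> b"
    "(?C(\<sigma> b \<mapsto> p)) t = None \<and> t \<in> {1..k} \<longleftrightarrow> t = \<sigma> a" for t
    using ab by (auto simp: mk_None)
  have "feas k (En (\<nu> a) None # En (\<nu> b) None # St p None # St q None # es) (mk \<nu> \<sigma>) \<longleftrightarrow>
      feas k (En (\<nu> b) None # St p None # St q None # es) ((mk \<nu> \<sigma>)(\<sigma> a := None))"
    by (rule feas_En_None[OF mk_iff[OF assms(1,2,3)]])
  also have "\<dots> \<longleftrightarrow> feas k (St p None # St q None # es) ?C"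
  proof -
    have "((mk \<nu> \<sigma>)(\<sigma> a := None)) s = Some (\<nu> b) \<longleftrightarrow> s = \<sigma> b" for s
      using mk_iff[OF assms(1,2,4)] ab(3) by auto
    then show ?thesis by (rule feas_En_None)
  qed
  also have "\<dots> \<longleftrightarrow> feas k (St q None # es) (?C(\<sigma> a \<mapsto> p)) \<or> feas k (St q None # es) (?C(\<sigma> b \<mapsto> p))"
    by (rule feas_St2[OF free])
  also have "feas k (St q None # es) (?C(\<sigma> a \<mapsto> p)) \<longleftrightarrow> feas k es (?C(\<sigma> a \<mapsto> p, \<sigma> b \<mapsto> q))"
    by (rule feas_St1[OF free1(1)])
  also have "feas k (St q None # es) (?C(\<sigma> b \<mapsto> p)) \<longleftrightarrow> feas k es (?C(\<sigma> b \<mapsto> p, \<sigma> a \<mapsto> q))"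
    by (rule feas_St1[OF free1(2)])
  also have "?C(\<sigma> a \<mapsto> p, \<sigma> b \<mapsto> q) = mk (\<nu>(a := p, b := q)) \<sigma>"
    using ab mk_upd[OF assms(1,3)] mk_upd[OF assms(1,4)] by (simp add: fun_upd_twist)
  also have "?C(\<sigma> b \<mapsto> p, \<sigma> a \<mapsto> q) = mk (\<nu>(b := p, a := q)) \<sigma>"
    using ab mk_upd[OF assms(1,3)] mk_upd[OF assms(1,4)] fun_upd_twist[OF assms(5), of \<nu> q p]
    by (simp add: fun_upd_twist)
  also have "mk (\<nu>(b := p, a := q)) \<sigma> = mk (\<nu>(a := p, b := q)) (sw a b \<sigma>)"
    using mk_sw[OF assms(1,3,4), of "\<nu>(b := p, a := q)"] assms(5) by (simp add: fun_upd_twist)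
  finally show ?thesis .
qed

lemma feas_ren:
  assumes "tok \<sigma>" "distinct ds" "\<forall>d\<in>set ds. d < D \<and> gf d = g"
  shows "feas k (ren g ds @ es) (mk (nm gf lw lz) \<sigma>) \<longleftrightarrow>
    feas k es (mk (nm (\<lambda>d. if d \<in> set ds then Suc g else gf d) lw lz) \<sigma>)"
  using assms(2,3)
proof (induction ds arbitrary: gf)
  case Nil
  then show ?case by (simp add: ren_def)
next
  case (Cons d ds)
  have "feas k (ren g (d # ds) @ es) (mk (nm gf lw lz) \<sigma>) \<longleftrightarrow>
      feas k (ren g ds @ es) (mk (nm (gf(d := Suc g)) lw lz) \<sigma>)"
    using feas_ren1[OF assms(1) inj_nm, of "PC d" None _ gf lw lz "Ch (Suc g) d" "ren g ds @ es"]
      Cons.prems(2) by (simp add: ren_def nm_upd)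
  also have "\<dots> \<longleftrightarrow> feas k es (mk (nm (\<lambda>e. if e \<in> set ds then Suc g else (gf(d := Suc g)) e) lw lz) \<sigma>)"
    by (rule Cons.IH) (use Cons.prems in auto)
  also have "(\<lambda>e. if e \<in> set ds then Suc g else (gf(d := Suc g)) e) =
      (\<lambda>e. if e \<in> set (d # ds) then Suc g else gf e)" by auto
  finally show ?case .
qed

lemma mk_cong: "tok \<sigma> \<Longrightarrow> (\<And>x. x \<in> P \<Longrightarrow> \<nu> x = \<nu>' x) \<Longrightarrow> mk \<nu> \<sigma> = mk \<nu>' \<sigma>"
  unfolding mk_def fun_eq_iff tok_def by (metis bij_betw_def inv_into_into)

definition lev :: "nat \<Rightarrow> ('c \<Rightarrow> nat) \<Rightarrow> ('c \<Rightarrow> nat) \<Rightarrow> 'c pos \<Rightarrow> 'c nm" where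
  "lev g = nm (\<lambda>_. g)"

lemma mk_lev:
  assumes "tok \<sigma>" "\<forall>d<D. gf d = g"
  shows "mk (nm gf lw lz) \<sigma> = mk (lev g lw lz) \<sigma>"
  by (rule mk_cong[OF assms(1)]) (use assms(2) in \<open>auto simp: P_def lev_def\<close>)

fun wfo :: "('c \<Rightarrow> nat) \<Rightarrow> ('c \<Rightarrow> nat) \<Rightarrow> 'c op list \<Rightarrow> bool" where
  "wfo lw lz [] \<longleftrightarrow> (\<forall>c\<in>set cs. lw c = r c \<and> lz c = r c)"
| "wfo lw lz (Sw0 d # ops) \<longleftrightarrow> 0 < d \<and> d < D \<and> wfo lw lz ops"
| "wfo lw lz (SwW c i d # ops) \<longleftrightarrow> c \<in> set cs \<and> d < D \<and> lw c = i \<and> wfo (lw(c := Suc i)) lz ops"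
| "wfo lw lz (SwZ c i d # ops) \<longleftrightarrow> c \<in> set cs \<and> d < D \<and> lz c = i \<and> wfo lw (lz(c := Suc i)) ops"
| "wfo lw lz (As # ops) \<longleftrightarrow> wfo lw lz ops"

text \<open>\<open>D + 1 + 2 * q\<close> is the slot that starts at the position \<open>PW\<close>
  of constraint number \<open>q\<close>. It has to have arrived at \<open>PZ\<close>.\<close>

definition final :: "nat \<Rightarrow> 'c nm ev list" where
  "final g = map (\<lambda>d. En (Ch g d) None) [0..<D] @
     concat (map (\<lambda>q. [En (Dn (cs ! q) (r (cs ! q))) (Some (D + 1 + 2 * q)),
        En (Wt (cs ! q) (r (cs ! q))) None]) [0..<length cs])"

definition goal :: "('c pos \<Rightarrow> slot) \<Rightarrow> bool" where
  "goal \<sigma> \<longleftrightarrow> (\<forall>q<length cs. \<sigma> (PZ (cs ! q)) = D + 1 + 2 * q)"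

text \<open>When only ends remain, no page can change its slot, so each request is an independent
  test of the final configuration.\<close>

lemma feas_ends:
  assumes "distinct (map fst l)" "\<forall>(p, j)\<in>set l. \<forall>s. C s = Some p \<longleftrightarrow> s = h p"
  shows "feas k (map (\<lambda>(p, j). En p j) l) C \<longleftrightarrow> (\<forall>(p, j)\<in>set l. j = None \<or> j = Some (h p))"
  using assms
proof (induction l arbitrary: C)
  case (Cons x l)
  obtain p j where x: "x = (p, j)" by fastforce
  have p: "C s = Some p \<longleftrightarrow> s = h p" for s using Cons.prems(2) x by auto
  have "feas k (map (\<lambda>(p, j). En p j) l) (C(h p := None)) \<longleftrightarrow> (\<forall>(p, j)\<in>set l. j = None \<or> j = Some (h p))"
  proof (rule Cons.IH)
    show "\<forall>(q, j)\<in>set l. \<forall>s. (C(h p := None)) s = Some q \<longleftrightarrow> s = h q"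
    proof (intro ballI, clarify)
      fix q j s assume "(q, j) \<in> set l"
      then have "q \<noteq> p" "\<forall>s. C s = Some q \<longleftrightarrow> s = h q" using Cons.prems x by force+
      moreover from this have "h q \<noteq> h p" using p by (metis option.inject)
      ultimately show "(C(h p := None)) s = Some q \<longleftrightarrow> s = h q" by auto
    qed
  qed (use Cons.prems in auto)
  then show ?case using p x by auto
qed simp

definition ends :: "nat \<Rightarrow> ('c nm \<times> slot option) list" where
  "ends g = map (\<lambda>d. (Ch g d, None)) [0..<D] @
     concat (map (\<lambda>q. [(Dn (cs ! q) (r (cs ! q)), Some (D + 1 + 2 * q)),
        (Wt (cs ! q) (r (cs ! q)), None)]) [0..<length cs])"

lemma final_ends: "final g = map (\<lambda>(p, j). En p j) (ends g)"
  by (simp add: final_def ends_def map_concat comp_def)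

lemma set_ends: "set (ends g) = (\<lambda>d. (Ch g d, None)) ` {..<D} \<union>
    (\<lambda>q. (Dn (cs ! q) (r (cs ! q)), Some (D + 1 + 2 * q))) ` {..<length cs} \<union>
    (\<lambda>q. (Wt (cs ! q) (r (cs ! q)), None)) ` {..<length cs}"
  by (auto simp: ends_def)

lemma distinct_ends: "distinct (map fst (ends g))"
proof -
  have "distinct (concat (map (\<lambda>q. [Dn (cs ! q) (r (cs ! q)), Wt (cs ! q) (r (cs ! q))]) [0..<n]))"
    if "n \<le> length cs" for n
    using that
  proof (induction n)
    case (Suc n)
    have "cs ! q \<noteq> cs ! n \<and> cs ! n \<noteq> cs ! q" if "q < n" for q
      using that Suc.prems distinct_cs by (simp add: nth_eq_iff_index_eq)
    then show ?case using Suc by auto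
  qed simp
  moreover have "distinct (map (Ch g) [0..<D] :: 'c nm list)" by (simp add: distinct_map inj_on_def)
  ultimately show ?thesis
    by (auto simp: ends_def map_concat comp_def distinct_map)
qed

lemma feas_final:
  assumes "tok \<sigma>" "\<forall>c\<in>set cs. lw c = r c \<and> lz c = r c"
  shows "feas k (final g) (mk (lev g lw lz) \<sigma>) \<longleftrightarrow> goal \<sigma>"
proof -
  define h where "h p = (case p of Ch g d \<Rightarrow> \<sigma> (PC d) | Wt c i \<Rightarrow> \<sigma> (PW c) | Dn c i \<Rightarrow> \<sigma> (PZ c))" for p
  note iff = mk_iff[OF assms(1) inj_nm, of _ "\<lambda>_. g" lw lz]
  have "\<forall>(p, j)\<in>set (ends g). \<forall>s. mk (lev g lw lz) \<sigma> s = Some p \<longleftrightarrow> s = h p"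
    using iff[of "PC _"] iff[of "PW _"] iff[of "PZ _"] assms(2)
    by (auto simp: set_ends h_def lev_def)
  from feas_ends[OF distinct_ends this] show ?thesis
    unfolding final_ends by (auto simp: set_ends h_def goal_def ball_Un)
qed

text \<open>An operation takes all chain pages to the next period together. So between operations
  one level describes all chains, and the induction hypothesis applies.\<close>

lemma feas_game:
  assumes "tok \<sigma>" "wfo lw lz ops"
  shows "feas k (evops D g ops @ final (g + length ops)) (mk (lev g lw lz) \<sigma>) \<longleftrightarrow> game ops \<sigma> goal"
  using assms
proof (induction ops arbitrary: g \<sigma> lw lz)
  case Nil
  then show ?case using feas_final by simp
next
  case (Cons op ops)
  let ?es = "evops D (Suc g) ops @ final (Suc g + length ops)"
  show ?case
  proof (cases op)
    case (Sw0 d)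
    then have d: "0 < d" "d < D" "wfo lw lz ops" using Cons.prems by auto
    let ?ds = "filter (\<lambda>e. e \<noteq> 0 \<and> e \<noteq> d) [0..<D]"
    let ?gf = "(\<lambda>_. g)(0 := Suc g, d := Suc g)"
    have r: "feas k (ren g ?ds @ ?es) (mk (nm ?gf lw lz) \<tau>) \<longleftrightarrow> game ops \<tau> goal" if "tok \<tau>" for \<tau>
    proof -
      have eq: "mk (nm (\<lambda>e. if e \<in> set ?ds then Suc g else ?gf e) lw lz) \<tau> = mk (lev (Suc g) lw lz) \<tau>"
        by (rule mk_lev[OF that]) auto
      have fr: "feas k (ren g ?ds @ ?es) (mk (nm ?gf lw lz) \<tau>) \<longleftrightarrow>
          feas k ?es (mk (nm (\<lambda>e. if e \<in> set ?ds then Suc g else ?gf e) lw lz) \<tau>)"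
        by (rule feas_ren[OF that]) auto
      show ?thesis unfolding fr eq by (rule Cons.IH[OF that d(3), of "Suc g"])
    qed
    have t: "tok (sw (PC 0) (PC d) \<sigma>)" using tok_sw[OF Cons.prems(1)] d D by auto
    have "feas k (evop D g op @ ?es) (mk (lev g lw lz) \<sigma>) \<longleftrightarrow>
      feas k (ren g ?ds @ ?es) (mk (nm ?gf lw lz) \<sigma>) \<or>
      feas k (ren g ?ds @ ?es) (mk (nm ?gf lw lz) (sw (PC 0) (PC d) \<sigma>))"
      using feas_swap[OF Cons.prems(1) inj_nm, of "PC 0" "PC d" "\<lambda>_. g" lw lz "Ch (Suc g) 0" "Ch (Suc g) d"
          "ren g ?ds @ ?es"] d D
      by (simp add: Sw0 lev_def nm_upd)
    then show ?thesis using r[OF Cons.prems(1)] r[OF t] by (simp add: Sw0)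
  next
    case (SwW c i d)
    then have d: "c \<in> set cs" "d < D" "lw c = i" "wfo (lw(c := Suc i)) lz ops" using Cons.prems by auto
    let ?ds = "filter (\<lambda>e. e \<noteq> d) [0..<D]"
    let ?gf = "(\<lambda>_. g)(d := Suc g)" and ?lw = "lw(c := Suc i)"
    have r: "feas k (ren g ?ds @ ?es) (mk (nm ?gf ?lw lz) \<tau>) \<longleftrightarrow> game ops \<tau> goal" if "tok \<tau>" for \<tau>
    proof -
      have eq: "mk (nm (\<lambda>e. if e \<in> set ?ds then Suc g else ?gf e) ?lw lz) \<tau> = mk (lev (Suc g) ?lw lz) \<tau>"
        by (rule mk_lev[OF that]) auto
      have fr: "feas k (ren g ?ds @ ?es) (mk (nm ?gf ?lw lz) \<tau>) \<longleftrightarrow>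
          feas k ?es (mk (nm (\<lambda>e. if e \<in> set ?ds then Suc g else ?gf e) ?lw lz) \<tau>)"
        by (rule feas_ren[OF that]) auto
      show ?thesis unfolding fr eq by (rule Cons.IH[OF that d(4), of "Suc g"])
    qed
    have t: "tok (sw (PW c) (PC d) \<sigma>)" using tok_sw[OF Cons.prems(1)] d by auto
    have "feas k (evop D g op @ ?es) (mk (lev g lw lz) \<sigma>) \<longleftrightarrow>
      feas k (ren g ?ds @ ?es) (mk (nm ?gf ?lw lz) \<sigma>) \<or>
      feas k (ren g ?ds @ ?es) (mk (nm ?gf ?lw lz) (sw (PW c) (PC d) \<sigma>))"
      using feas_swap[OF Cons.prems(1) inj_nm, of "PW c" "PC d" "\<lambda>_. g" lw lz "Wt c (Suc i)" "Ch (Suc g) d"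
          "ren g ?ds @ ?es"] d
      by (simp add: SwW lev_def nm_upd)
    then show ?thesis using r[OF Cons.prems(1)] r[OF t] by (simp add: SwW)
  next
    case (SwZ c i d)
    then have d: "c \<in> set cs" "d < D" "lz c = i" "wfo lw (lz(c := Suc i)) ops" using Cons.prems by auto
    let ?ds = "filter (\<lambda>e. e \<noteq> d) [0..<D]"
    let ?gf = "(\<lambda>_. g)(d := Suc g)" and ?lz = "lz(c := Suc i)"
    have r: "feas k (ren g ?ds @ ?es) (mk (nm ?gf lw ?lz) \<tau>) \<longleftrightarrow> game ops \<tau> goal" if "tok \<tau>" for \<tau>
    proof -
      have eq: "mk (nm (\<lambda>e. if e \<in> set ?ds then Suc g else ?gf e) lw ?lz) \<tau> = mk (lev (Suc g) lw ?lz) \<tau>"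
        by (rule mk_lev[OF that]) auto
      have fr: "feas k (ren g ?ds @ ?es) (mk (nm ?gf lw ?lz) \<tau>) \<longleftrightarrow>
          feas k ?es (mk (nm (\<lambda>e. if e \<in> set ?ds then Suc g else ?gf e) lw ?lz) \<tau>)"
        by (rule feas_ren[OF that]) auto
      show ?thesis unfolding fr eq by (rule Cons.IH[OF that d(4), of "Suc g"])
    qed
    have t: "tok (sw (PC d) (PZ c) \<sigma>)" using tok_sw[OF Cons.prems(1)] d by auto
    have "feas k (evop D g op @ ?es) (mk (lev g lw lz) \<sigma>) \<longleftrightarrow>
      feas k (ren g ?ds @ ?es) (mk (nm ?gf lw ?lz) \<sigma>) \<or>
      feas k (ren g ?ds @ ?es) (mk (nm ?gf lw ?lz) (sw (PC d) (PZ c) \<sigma>))"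
      using feas_swap[OF Cons.prems(1) inj_nm, of "PC d" "PZ c" "\<lambda>_. g" lw lz "Ch (Suc g) d" "Dn c (Suc i)"
          "ren g ?ds @ ?es"] d
      by (simp add: SwZ lev_def nm_upd)
    then show ?thesis using r[OF Cons.prems(1)] r[OF t] by (simp add: SwZ)
  next
    case As
    then have w: "wfo lw lz ops" using Cons.prems by auto
    let ?ds = "filter (\<lambda>e. e \<noteq> 0) [0..<D]"
    let ?gf = "(\<lambda>_. g)(0 := Suc g)"
    have eq: "mk (nm (\<lambda>e. if e \<in> set ?ds then Suc g else ?gf e) lw lz) \<sigma> = mk (lev (Suc g) lw lz) \<sigma>"
      by (rule mk_lev[OF Cons.prems(1)]) auto
    have fr: "feas k (ren g ?ds @ ?es) (mk (nm ?gf lw lz) \<sigma>) \<longleftrightarrow>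
        feas k ?es (mk (nm (\<lambda>e. if e \<in> set ?ds then Suc g else ?gf e) lw lz) \<sigma>)"
      by (rule feas_ren[OF Cons.prems(1)]) auto
    have r: "feas k (ren g ?ds @ ?es) (mk (nm ?gf lw lz) \<sigma>) \<longleftrightarrow> game ops \<sigma> goal"
      unfolding fr eq by (rule Cons.IH[OF Cons.prems(1) w, of "Suc g"])
    have "feas k (evop D g op @ ?es) (mk (lev g lw lz) \<sigma>) \<longleftrightarrow>
      \<sigma> (PC 0) = 1 \<and> feas k (ren g ?ds @ ?es) (mk (nm ?gf lw lz) \<sigma>)"
      using feas_ren1[OF Cons.prems(1) inj_nm, of "PC 0" "Some 1" 1 "\<lambda>_. g" lw lz "Ch (Suc g) 0"
          "ren g ?ds @ ?es"] D
      by (simp add: As lev_def nm_upd)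
    then show ?thesis using r by (simp add: As)
  qed
qed

end

section \<open>Every page starts and ends exactly once\<close>

context network
begin

lemma life_ren1:
  assumes "inj \<nu>" "a \<in> P" "p \<notin> \<nu> ` P"
  shows "life (\<nu> ` P) (En (\<nu> a) j # St p j' # es) \<longleftrightarrow> life ((\<nu>(a := p)) ` P) es"
proof -
  have "insert p (\<nu> ` P - {\<nu> a}) = (\<nu>(a := p)) ` P" using assms(1,2) by (auto simp: inj_eq)
  then show ?thesis using assms by simp
qed

lemma life_swap:
  assumes "inj \<nu>" "a \<in> P" "b \<in> P" "a \<noteq> b" "p \<notin> \<nu> ` P" "q \<notin> \<nu> ` P" "p \<noteq> q"
  shows "life (\<nu> ` P) (En (\<nu> a) None # En (\<nu> b) None # St p None # St q None # es) \<longleftrightarrow>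
    life ((\<nu>(a := p, b := q)) ` P) es"
proof -
  have "insert q (insert p (\<nu> ` P - {\<nu> a} - {\<nu> b})) = (\<nu>(a := p, b := q)) ` P"
    using assms(1-4) by (auto simp: inj_eq)
  moreover have "\<nu> b \<noteq> \<nu> a" using assms(1,4) by (auto simp: inj_eq)
  ultimately show ?thesis using assms by simp
qed

lemma life_ren:
  assumes "distinct ds" "\<forall>d\<in>set ds. d < D \<and> gf d = g"
  shows "life (nm gf lw lz ` P) (ren g ds @ es) \<longleftrightarrow>
    life (nm (\<lambda>d. if d \<in> set ds then Suc g else gf d) lw lz ` P) es"
  using assms
proof (induction ds arbitrary: gf)
  case Nil
  then show ?case by (simp add: ren_def)
next
  case (Cons d ds)
  have "Ch (Suc g) d \<notin> nm gf lw lz ` P" using Cons.prems(2) by (auto simp: P_def)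
  then have "life (nm gf lw lz ` P) (ren g (d # ds) @ es) \<longleftrightarrow>
      life (nm (gf(d := Suc g)) lw lz ` P) (ren g ds @ es)"
    using life_ren1[OF inj_nm, of "PC d" "Ch (Suc g) d" gf lw lz None None "ren g ds @ es"] Cons.prems(2)
    by (simp add: ren_def nm_upd)
  also have "\<dots> \<longleftrightarrow> life (nm (\<lambda>e. if e \<in> set ds then Suc g else (gf(d := Suc g)) e) lw lz ` P) es"
    by (rule Cons.IH) (use Cons.prems in auto)
  also have "(\<lambda>e. if e \<in> set ds then Suc g else (gf(d := Suc g)) e) =
      (\<lambda>e. if e \<in> set (d # ds) then Suc g else gf e)" by auto
  finally show ?case .
qed

lemma lev_image: "\<forall>d<D. gf d = g \<Longrightarrow> nm gf lw lz ` P = lev g lw lz ` P"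
  by (rule image_cong) (auto simp: P_def lev_def)

lemma life_ren_lev:
  assumes "distinct ds" "\<forall>d\<in>set ds. d < D \<and> gf d = g" "\<forall>d<D. d \<notin> set ds \<longrightarrow> gf d = Suc g"
  shows "life (nm gf lw lz ` P) (ren g ds @ es) \<longleftrightarrow> life (lev (Suc g) lw lz ` P) es"
  unfolding life_ren[OF assms(1,2)]
  using lev_image[of "\<lambda>d. if d \<in> set ds then Suc g else gf d" "Suc g" lw lz] assms(3) by simp

lemma life_ends:
  "distinct (map fst l) \<Longrightarrow> life (fst ` set l) (map (\<lambda>(p, j). En p j) l)"
proof (induction l)
  case (Cons x l)
  obtain p j where "x = (p, j)" by fastforce
  moreover have "insert p (fst ` set l) - {p} = fst ` set l" using Cons.prems calculation by auto
  ultimately show ?case using Cons by simp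
qed simp

lemma life_final:
  assumes "\<forall>c\<in>set cs. lw c = r c \<and> lz c = r c"
  shows "life (lev g lw lz ` P) (final g)"
proof -
  have "lev g lw lz ` P = Ch g ` {..<D} \<union> (\<lambda>c. Wt c (r c)) ` set cs \<union> (\<lambda>c. Dn c (r c)) ` set cs"
    using assms by (force simp: P_def lev_def image_Un image_image)
  also have "set cs = (!) cs ` {..<length cs}" by (auto simp: set_conv_nth)
  also have "Ch g ` {..<D} \<union> (\<lambda>c. Wt c (r c)) ` (!) cs ` {..<length cs} \<union>
      (\<lambda>c. Dn c (r c)) ` (!) cs ` {..<length cs} = fst ` set (ends g)"
    unfolding set_ends image_Un image_image fst_conv by blast
  finally show ?thesis using life_ends[OF distinct_ends] by (simp add: final_ends)
qed

lemma life_evops: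
  "wfo lw lz ops \<Longrightarrow> life (lev g lw lz ` P) (evops D g ops @ final (g + length ops))"
proof (induction ops arbitrary: g lw lz)
  case Nil
  then show ?case using life_final by simp
next
  case (Cons op ops)
  let ?es = "evops D (Suc g) ops @ final (Suc g + length ops)"
  note inj = inj_nm[of "\<lambda>_. g" lw lz]
  have IH: "life (lev (Suc g) lw' lz' ` P) ?es" if "wfo lw' lz' ops" for lw' lz'
    using Cons.IH[OF that, of "Suc g"] .
  have fresh: "Ch (Suc g) d \<notin> nm (\<lambda>_. g) lw lz ` P" "Wt c (Suc (lw c)) \<notin> nm (\<lambda>_. g) lw lz ` P"
    "Dn c (Suc (lz c)) \<notin> nm (\<lambda>_. g) lw lz ` P" for d c by (auto simp: P_def)
  show ?case
  proof (cases op)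
    case (Sw0 d)
    then have d: "0 < d" "d < D" "wfo lw lz ops" using Cons.prems by auto
    have "life (nm ((\<lambda>_. g)(0 := Suc g, d := Suc g)) lw lz ` P) (ren g (filter (\<lambda>e. e \<noteq> 0 \<and> e \<noteq> d) [0..<D]) @ ?es)"
      by (subst life_ren_lev) (use IH[OF d(3)] in auto)
    then show ?thesis
      using life_swap[OF inj, of "PC 0" "PC d" "Ch (Suc g) 0" "Ch (Suc g) d"] fresh d D
      by (simp add: Sw0 lev_def nm_upd del: life.simps)
  next
    case (SwW c i d)
    then have d: "c \<in> set cs" "d < D" "op = SwW c (lw c) d" "wfo (lw(c := Suc (lw c))) lz ops"
      using Cons.prems by auto
    have "life (nm ((\<lambda>_. g)(d := Suc g)) (lw(c := Suc (lw c))) lz ` P) (ren g (filter (\<lambda>e. e \<noteq> d) [0..<D]) @ ?es)"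
      by (subst life_ren_lev) (use IH[OF d(4)] in auto)
    then show ?thesis
      using life_swap[OF inj, of "PW c" "PC d" "Wt c (Suc (lw c))" "Ch (Suc g) d"] fresh d(1,2)
      by (simp add: d(3) lev_def nm_upd del: life.simps)
  next
    case (SwZ c i d)
    then have d: "c \<in> set cs" "d < D" "op = SwZ c (lz c) d" "wfo lw (lz(c := Suc (lz c))) ops"
      using Cons.prems by auto
    have "life (nm ((\<lambda>_. g)(d := Suc g)) lw (lz(c := Suc (lz c))) ` P) (ren g (filter (\<lambda>e. e \<noteq> d) [0..<D]) @ ?es)"
      by (subst life_ren_lev) (use IH[OF d(4)] in auto)
    then show ?thesis
      using life_swap[OF inj, of "PC d" "PZ c" "Ch (Suc g) d" "Dn c (Suc (lz c))"] fresh d(1,2)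
      by (simp add: d(3) lev_def nm_upd del: life.simps)
  next
    case As
    then have w: "wfo lw lz ops" using Cons.prems by auto
    have "life (nm ((\<lambda>_. g)(0 := Suc g)) lw lz ` P) (ren g (filter (\<lambda>e. e \<noteq> 0) [0..<D]) @ ?es)"
      by (subst life_ren_lev) (use IH[OF w] in auto)
    then show ?thesis
      using life_ren1[OF inj, of "PC 0" "Ch (Suc g) 0"] fresh D
      by (simp add: As lev_def nm_upd del: life.simps)
  qed
qed

lemma starts_ren: "starts (ren g ds) = map (Ch (Suc g)) ds"
  by (induction ds) (auto simp: ren_def)

lemma starts_ends: "starts (map (\<lambda>(p, j). En p j) l) = []"
  by (induction l) auto

text \<open>The names that can still be introduced. Those started by an operation are no longer in
  the set for the next levels, so no name starts twice.\<close>

definition later :: "nat \<Rightarrow> ('c \<Rightarrow> nat) \<Rightarrow> ('c \<Rightarrow> nat) \<Rightarrow> 'c nm set" where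
  "later g lw lz = {Ch h d |h d. h > g} \<union> {Wt c i |c i. i > lw c} \<union> {Dn c i |c i. i > lz c}"

lemma later_iff [simp]: "Ch h d \<in> later g lw lz \<longleftrightarrow> h > g" "Wt c i \<in> later g lw lz \<longleftrightarrow> i > lw c"
    "Dn c i \<in> later g lw lz \<longleftrightarrow> i > lz c"
  by (auto simp: later_def)

lemma later_mono: "g \<le> g' \<Longrightarrow> \<forall>c. lw c \<le> lw' c \<Longrightarrow> \<forall>c. lz c \<le> lz' c \<Longrightarrow> later g' lw' lz' \<subseteq> later g lw lz"
proof
  fix x assume "g \<le> g'" "\<forall>c. lw c \<le> lw' c" "\<forall>c. lz c \<le> lz' c" "x \<in> later g' lw' lz'"
  then show "x \<in> later g lw lz" by (cases x) (auto intro: le_less_trans)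
qed

lemma distinct_starts_step:
  assumes "distinct S \<and> set S \<subseteq> U'" "distinct N" "\<forall>x\<in>set N. x \<notin> U' \<and> x \<in> U" "U' \<subseteq> U"
  shows "distinct (N @ S) \<and> set (N @ S) \<subseteq> U"
  using assms by auto

lemma distinct_starts_evops:
  "wfo lw lz ops \<Longrightarrow>
    distinct (starts (evops D g ops)) \<and> set (starts (evops D g ops)) \<subseteq> later g lw lz"
proof (induction ops arbitrary: g lw lz)
  case (Cons op ops)
  let ?F = "\<lambda>Q. map (Ch (Suc g)) (filter Q [0..<D]) :: 'c nm list"
  have dist: "distinct (?F Q)" for Q by (simp add: distinct_map inj_on_def)
  show ?case
  proof (cases op)
    case (Sw0 d)
    have "distinct (([Ch (Suc g) 0, Ch (Suc g) d] @ ?F (\<lambda>e. e \<noteq> 0 \<and> e \<noteq> d)) @ starts (evops D (Suc g) ops)) \<and>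
      set (([Ch (Suc g) 0, Ch (Suc g) d] @ ?F (\<lambda>e. e \<noteq> 0 \<and> e \<noteq> d)) @ starts (evops D (Suc g) ops)) \<subseteq> later g lw lz"
      by (rule distinct_starts_step[OF Cons.IH[of lw lz]])
        (use Cons.prems Sw0 dist later_mono in auto)
    then show ?thesis by (simp add: Sw0 starts_ren)
  next
    case (SwW c i d)
    have "distinct (([Wt c (Suc i), Ch (Suc g) d] @ ?F (\<lambda>e. e \<noteq> d)) @ starts (evops D (Suc g) ops)) \<and>
      set (([Wt c (Suc i), Ch (Suc g) d] @ ?F (\<lambda>e. e \<noteq> d)) @ starts (evops D (Suc g) ops)) \<subseteq> later g lw lz"
    proof (rule distinct_starts_step[OF Cons.IH])
      show "wfo (lw(c := Suc i)) lz ops" using Cons.prems SwW by simp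
      show "later (Suc g) (lw(c := Suc i)) lz \<subseteq> later g lw lz"
        by (rule later_mono) (use Cons.prems SwW in auto)
    qed (use Cons.prems SwW dist in auto)
    then show ?thesis by (simp add: SwW starts_ren)
  next
    case (SwZ c i d)
    have "distinct (([Ch (Suc g) d, Dn c (Suc i)] @ ?F (\<lambda>e. e \<noteq> d)) @ starts (evops D (Suc g) ops)) \<and>
      set (([Ch (Suc g) d, Dn c (Suc i)] @ ?F (\<lambda>e. e \<noteq> d)) @ starts (evops D (Suc g) ops)) \<subseteq> later g lw lz"
    proof (rule distinct_starts_step[OF Cons.IH])
      show "wfo lw (lz(c := Suc i)) ops" using Cons.prems SwZ by simp
      show "later (Suc g) lw (lz(c := Suc i)) \<subseteq> later g lw lz"
        by (rule later_mono) (use Cons.prems SwZ in auto)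
    qed (use Cons.prems SwZ dist in auto)
    then show ?thesis by (simp add: SwZ starts_ren)
  next
    case As
    have "distinct (([Ch (Suc g) 0] @ ?F (\<lambda>e. e \<noteq> 0)) @ starts (evops D (Suc g) ops)) \<and>
      set (([Ch (Suc g) 0] @ ?F (\<lambda>e. e \<noteq> 0)) @ starts (evops D (Suc g) ops)) \<subseteq> later g lw lz"
      by (rule distinct_starts_step[OF Cons.IH[of lw lz]])
        (use Cons.prems As dist later_mono in auto)
    then show ?thesis by (simp add: As starts_ren)
  qed
qed simp

section \<open>Initial placement of the tokens\<close>

definition idx :: "'c \<Rightarrow> nat" where
  "idx = inv_into {..<length cs} ((!) cs)"

lemma idx_nth: "q < length cs \<Longrightarrow> idx (cs ! q) = q"
  using distinct_cs unfolding idx_def by (intro inv_into_f_f inj_on_nth) auto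

lemma idx_cs: "c \<in> set cs \<Longrightarrow> idx c < length cs \<and> cs ! idx c = c"
  by (metis idx_nth in_set_conv_nth)

definition \<sigma>0 :: "'c pos \<Rightarrow> slot" where
  "\<sigma>0 x = (case x of PC d \<Rightarrow> Suc d | PW c \<Rightarrow> D + 1 + 2 * idx c | PZ c \<Rightarrow> D + 2 + 2 * idx c)"

lemma \<sigma>0_simps [simp]: "\<sigma>0 (PC d) = Suc d" "\<sigma>0 (PW c) = D + 1 + 2 * idx c" "\<sigma>0 (PZ c) = D + 2 + 2 * idx c"
  by (auto simp: \<sigma>0_def)

lemma tok_\<sigma>0: "tok \<sigma>0"
  unfolding tok_def bij_betw_def
proof (intro conjI equalityI subsetI)
  show "inj_on \<sigma>0 P"
  proof (rule inj_onI)
    fix x y assume "x \<in> P" "y \<in> P" "\<sigma>0 x = \<sigma>0 y"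
    moreover have "c = c'" if "idx c = idx c'" "c \<in> set cs" "c' \<in> set cs" for c c'
      using that idx_cs by metis
    ultimately show "x = y" by (cases x; cases y; simp; presburger)
  qed
  fix s
  { assume "s \<in> \<sigma>0 ` P"
    then show "s \<in> {1..k}" using idx_cs by (fastforce simp: P_def k_def) }
  assume s: "s \<in> {1..k}"
  show "s \<in> \<sigma>0 ` P"
  proof (cases "s \<le> D")
    case True
    then have "s = \<sigma>0 (PC (s - 1))" "PC (s - 1) \<in> P" using s by auto
    then show ?thesis by blast
  next
    case False
    define q where "q = (s - D - 1) div 2"
    have q: "q < length cs" using s False by (auto simp: q_def k_def)
    have "s = D + 1 + 2 * q \<or> s = D + 2 + 2 * q" using False unfolding q_def by presburger
    then have "s = \<sigma>0 (PW (cs ! q)) \<or> s = \<sigma>0 (PZ (cs ! q))" using idx_nth[OF q] by simp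
    moreover have "PW (cs ! q) \<in> P" "PZ (cs ! q) \<in> P" using q by auto
    ultimately show ?thesis by blast
  qed
qed

definition init :: "'c nm ev list" where
  "init = map (\<lambda>d. St (Ch 0 d) (Some (Suc d))) [0..<D] @
     concat (map (\<lambda>q. [St (Wt (cs ! q) 0) (Some (D + 1 + 2 * q)),
       St (Dn (cs ! q) 0) (Some (D + 2 + 2 * q))]) [0..<length cs])"

definition ipage :: "slot \<Rightarrow> 'c nm" where
  "ipage s = lev 0 (\<lambda>_. 0) (\<lambda>_. 0) (inv_into P \<sigma>0 s)"

lemma ipage_\<sigma>0: "x \<in> P \<Longrightarrow> ipage (\<sigma>0 x) = lev 0 (\<lambda>_. 0) (\<lambda>_. 0) x"
  using tok_\<sigma>0 unfolding ipage_def tok_def by (metis bij_betw_inv_into_left)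

text \<open>The two slots of a constraint are consecutive, so the initial requests fill the slots in
  increasing order and form a single loop over slots.\<close>

lemma init_ipage: "init = map (\<lambda>s. St (ipage s) (Some s)) [1..<Suc k]"
proof -
  have "concat (map (\<lambda>q. [D + 1 + 2 * q, D + 2 + 2 * q]) [0..<n]) = [Suc D..<Suc (D + 2 * n)]" for n
    by (induction n) auto
  then have "[1..<Suc k] = map Suc [0..<D] @ concat (map (\<lambda>q. [D + 1 + 2 * q, D + 2 + 2 * q]) [0..<length cs])"
    using upt_add_eq_append[of 1 "Suc D" "2 * length cs"] by (simp add: k_def map_Suc_upt)
  moreover have "ipage (Suc d) = Ch 0 d" if "d < D" for d
    using ipage_\<sigma>0[of "PC d"] that by (simp add: lev_def)
  moreover have "ipage (D + 1 + 2 * q) = Wt (cs ! q) 0" "ipage (D + 2 + 2 * q) = Dn (cs ! q) 0"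
    if "q < length cs" for q
    using ipage_\<sigma>0[of "PW (cs ! q)"] ipage_\<sigma>0[of "PZ (cs ! q)"] that by (auto simp: lev_def idx_nth)
  ultimately show ?thesis
    by (auto simp: init_def map_concat intro!: arg_cong[of _ _ concat])
qed

lemma feas_init:
  assumes "a \<le> Suc k" "1 \<le> a"
  shows "feas k (map (\<lambda>s. St (f s) (Some s)) [a..<Suc k] @ es) (\<lambda>s. if s \<in> {1..<a} then Some (f s) else None) \<longleftrightarrow>
    feas k es (\<lambda>s. if s \<in> {1..k} then Some (f s) else None)"
  using assms
proof (induction a rule: inc_induct)
  case base
  have "{1..<Suc k} = {1..k}" by auto
  then show ?case by simp
next
  case (step a)
  have eq: "(\<lambda>s. if s \<in> {1..<a} then Some (f s) else None)(a \<mapsto> f a) =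
      (\<lambda>s. if s \<in> {1..<Suc a} then Some (f s) else None)"
    using step.prems by (auto simp: fun_eq_iff)
  have "[a..<Suc k] = a # [Suc a..<Suc k]" using step.hyps by (simp add: upt_rec)
  then have "feas k (map (\<lambda>s. St (f s) (Some s)) [a..<Suc k] @ es) (\<lambda>s. if s \<in> {1..<a} then Some (f s) else None) \<longleftrightarrow>
      feas k (map (\<lambda>s. St (f s) (Some s)) [Suc a..<Suc k] @ es)
        ((\<lambda>s. if s \<in> {1..<a} then Some (f s) else None)(a \<mapsto> f a))"
    using step.hyps step.prems by (simp only: list.map append_Cons feas.simps) auto
  then show ?case using step.IH step.prems unfolding eq by simp
qed

lemma ipage_image: "ipage ` {1..k} = lev 0 (\<lambda>_. 0) (\<lambda>_. 0) ` P" "inj_on ipage {1..k}"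
proof -
  have b: "bij_betw \<sigma>0 P {1..k}" using tok_\<sigma>0 by (simp add: tok_def)
  then have "ipage ` {1..k} = ipage ` \<sigma>0 ` P" by (simp add: bij_betw_def)
  also have "\<dots> = lev 0 (\<lambda>_. 0) (\<lambda>_. 0) ` P" using ipage_\<sigma>0 by (simp add: image_image)
  finally show "ipage ` {1..k} = lev 0 (\<lambda>_. 0) (\<lambda>_. 0) ` P" .
  have "inj_on (inv_into P \<sigma>0) {1..k}" using b by (metis bij_betw_inv_into bij_betw_imp_inj_on)
  then have "inj_on (nm (\<lambda>_. 0) (\<lambda>_. 0) (\<lambda>_. 0) \<circ> inv_into P \<sigma>0) {1..k}"
    by (rule comp_inj_on[OF _ inj_on_subset[OF inj_nm subset_UNIV]])
  then show "inj_on ipage {1..k}" unfolding inj_on_def comp_apply ipage_def lev_def .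
qed

lemma life_init:
  "life A (map (\<lambda>s. St (f s) (Some s)) l @ es) \<longleftrightarrow>
     distinct (map f l) \<and> A \<inter> f ` set l = {} \<and> life (A \<union> f ` set l) es"
  by (induction l arbitrary: A) auto

definition net :: "'c op list \<Rightarrow> 'c nm ev list" where
  "net ops = init @ evops D 0 ops @ final (length ops)"

lemma starts_init: "starts (map (\<lambda>s. St (f s) (Some s)) l) = map f l"
  by (induction l) auto

lemma net_game:
  assumes "wfo (\<lambda>_. 0) (\<lambda>_. 0) ops"
  shows "life {} (net ops)" "distinct (starts (net ops))"
    "feas k (net ops) Map.empty \<longleftrightarrow> game ops \<sigma>0 goal"
proof -
  have set: "set [1..<Suc k] = {1..k}" by auto
  have dist: "distinct (map ipage [1..<Suc k])"
    unfolding distinct_map set using ipage_image(2) distinct_upt by blast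
  show "life {} (net ops)"
    unfolding net_def init_ipage life_init set ipage_image(1)
    using dist life_evops[OF assms, of 0] by simp
  have "set (starts (evops D 0 ops)) \<inter> ipage ` {1..k} = {}"
    using distinct_starts_evops[OF assms, of 0] unfolding ipage_image(1)
    by (fastforce simp: P_def lev_def)
  then show "distinct (starts (net ops))"
    using distinct_starts_evops[OF assms, of 0] dist set
    by (auto simp: net_def init_ipage starts_init final_ends starts_ends simp del: upt_Suc)
  have e: "Map.empty = (\<lambda>s. if s \<in> {1..<1} then Some (ipage s) else None)" by auto
  have mk: "(\<lambda>s. if s \<in> {1..k} then Some (ipage s) else None) = mk (lev 0 (\<lambda>_. 0) (\<lambda>_. 0)) \<sigma>0"
    by (auto simp: mk_def ipage_def fun_eq_iff)
  show "feas k (net ops) Map.empty \<longleftrightarrow> game ops \<sigma>0 goal"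
    using feas_init[of 1 ipage "evops D 0 ops @ final (length ops)"] feas_game[OF tok_\<sigma>0 assms, of 0]
    unfolding net_def init_ipage mk e[symmetric] by simp
qed

end

section \<open>Constraint satisfaction as a network\<close>

text \<open>
  A constraint \<open>c\<close> forbids that all variables of \<open>lits c\<close> take the given values. Slot 1 chooses the
  value of the current variable: it has to be among the chain positions before and after the gates
  of the variable and cannot leave them in between, because each constraint has only one gate for it.
  The token of \<open>c\<close> can leave \<open>PW c\<close> only through a chain that slot 1 does not occupy.
\<close>

locale csp =
  fixes D :: nat and cs :: "'c list" and lits :: "'c \<Rightarrow> ('v \<times> nat) list" and vs :: "'v list"
  assumes D: "D \<ge> 1" and distinct_cs: "distinct cs" and distinct_vs: "distinct vs"
    and lits_D: "\<And>c v d. c \<in> set cs \<Longrightarrow> (v, d) \<in> set (lits c) \<Longrightarrow> d < D"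
    and lits_vs: "\<And>c. c \<in> set cs \<Longrightarrow> map fst (lits c) = filter (\<lambda>v. v \<in> fst ` set (lits c)) vs"
begin

sublocale network D cs "\<lambda>c. length (lits c)"
  by unfold_locales (fact D, fact distinct_cs)

text \<open>By \<open>lits_vs\<close> a variable occurs at most once in \<open>c\<close>, so this
  list has at most one entry. The index of the literal doubles as the period of the pages of
  \<open>c\<close>.\<close>

definition inner :: "'v \<Rightarrow> 'c \<Rightarrow> ('c \<times> nat \<times> nat) list" where
  "inner v c = concat (map (\<lambda>i. if fst (lits c ! i) = v then [(c, i, snd (lits c ! i))] else [])
     [0..<length (lits c)])"

definition gates :: "'v \<Rightarrow> ('c \<times> nat \<times> nat) list" where
  "gates v = concat (map (inner v) cs)"

text \<open>Taking both swaps carries the token at \<open>PW c\<close> over chain \<open>d\<close>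
  to \<open>PZ c\<close>. If slot 1 is on that chain, the first swap moves it into
  \<open>PW c\<close>.\<close>

definition gl :: "('c \<times> nat \<times> nat) list \<Rightarrow> 'c op list" where
  "gl ts = concat (map (\<lambda>(c, i, d). [SwW c i d, SwZ c i d]) ts)"

definition pass :: "'c op list" where
  "pass = map Sw0 [1..<D]"

text \<open>The first \<open>pass\<close> brings slot 1 back to \<open>PC 0\<close>, where
  \<open>As\<close> checks that it is still on a chain; the second one takes it to the chosen value.
  The final pair makes this check after the last variable.\<close>

definition ops :: "'v list \<Rightarrow> 'c op list" where
  "ops us = concat (map (\<lambda>v. pass @ As # pass @ gl (gates v)) us) @ pass @ [As]"

definition sat :: "('v \<Rightarrow> nat) \<Rightarrow> bool" where
  "sat a \<longleftrightarrow> (\<forall>v\<in>set vs. a v < D) \<and> (\<forall>c\<in>set cs. \<exists>(v, d)\<in>set (lits c). a v \<noteq> d)"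

lemma gl_simps [simp]: "gl [] = []" "gl ((c, i, d) # ts) = SwW c i d # SwZ c i d # gl ts"
    "gl (a @ b) = gl a @ gl b"
  by (auto simp: gl_def)

lemma distinct_lits: "c \<in> set cs \<Longrightarrow> distinct (map fst (lits c))"
  using lits_vs distinct_vs by (metis distinct_filter)

lemma set_inner: "(c', i, d) \<in> set (inner v c) \<longleftrightarrow> c' = c \<and> i < length (lits c) \<and> lits c ! i = (v, d)"
  by (auto simp: inner_def prod_eq_iff split: if_splits)

lemma concat_single:
  assumes "i < n" "\<And>j. j < n \<Longrightarrow> Q j \<longleftrightarrow> j = i"
  shows "concat (map (\<lambda>j. if Q j then [f j] else []) [0..<n]) = [f i]"
proof -
  have "concat (map (\<lambda>j. if Q j then [f j] else []) l) = map f (filter Q l)" for l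
    by (induction l) auto
  moreover have "filter Q [0..<n] = [i]"
  proof -
    have "[0..<n] = [0..<i] @ i # [Suc i..<n]"
      using assms(1) upt_add_eq_append[of 0 i "n - i"] by (simp add: upt_conv_Cons)
    moreover have "filter Q [0..<i] = []" "filter Q [Suc i..<n] = []" "Q i"
      using assms by (auto simp: filter_empty_conv)
    ultimately show ?thesis by simp
  qed
  ultimately show ?thesis by simp
qed

lemma inner_None: "v \<notin> fst ` set (lits c) \<Longrightarrow> inner v c = []"
proof (rule ccontr)
  assume "v \<notin> fst ` set (lits c)" "inner v c \<noteq> []"
  then obtain x where "x \<in> set (inner v c)" by (meson list.set_sel(1))
  moreover obtain c' i d where "x = (c', i, d)" by (cases x)
  ultimately have "i < length (lits c)" "lits c ! i = (v, d)" by (auto simp: set_inner)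
  then show False using \<open>v \<notin> fst ` set (lits c)\<close> by (metis fst_conv image_eqI nth_mem)
qed

lemma inner_Some:
  assumes "c \<in> set cs" "i < length (lits c)" "fst (lits c ! i) = v"
  shows "inner v c = [(c, i, snd (lits c ! i))]"
  unfolding inner_def
proof (rule concat_single[OF assms(2)])
  fix j assume "j < length (lits c)"
  then show "fst (lits c ! j) = v \<longleftrightarrow> j = i"
    using distinct_lits[OF assms(1)] assms(2,3)
    by (metis length_map nth_eq_iff_index_eq nth_map)
qed

text \<open>Since the literals follow the order of \<open>vs\<close>, the number of literals already
  met is the index of the next one.\<close>

definition lvl :: "'v list \<Rightarrow> 'c \<Rightarrow> nat" where
  "lvl us c = length (filter (\<lambda>v. v \<in> fst ` set (lits c)) us)"

lemma inner_lvl: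
  assumes "c \<in> set cs" "vs = us @ v # ws"
  shows "(inner v c = [] \<and> lvl (us @ [v]) c = lvl us c) \<or>
    (\<exists>d<D. inner v c = [(c, lvl us c, d)] \<and> lvl (us @ [v]) c = Suc (lvl us c))"
proof (cases "v \<in> fst ` set (lits c)")
  case True
  let ?F = "filter (\<lambda>v. v \<in> fst ` set (lits c))"
  have eq: "map fst (lits c) = ?F us @ v # ?F ws" using lits_vs[OF assms(1)] assms(2) True by simp
  have i: "lvl us c < length (lits c)"
    using arg_cong[OF eq, of length] by (simp add: lvl_def)
  have "fst (lits c ! lvl us c) = v"
    using arg_cong[OF eq, of "\<lambda>l. l ! lvl us c"] i by (simp add: lvl_def nth_append)
  from inner_Some[OF assms(1) i this] show ?thesis
    using True lits_D[OF assms(1), of "fst (lits c ! lvl us c)" "snd (lits c ! lvl us c)"] i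
    by (auto simp: lvl_def)
next
  case False
  then show ?thesis using inner_None by (auto simp: lvl_def)
qed

section \<open>The gates of a constraint are numbered consecutively\<close>

lemma wfo_pass: "wfo lw lz (pass @ rest) \<longleftrightarrow> wfo lw lz rest"
proof -
  have "wfo lw lz (map Sw0 ds @ rest) \<longleftrightarrow> wfo lw lz rest" if "\<forall>d\<in>set ds. 0 < d \<and> d < D" for ds
    using that by (induction ds) auto
  then show ?thesis by (auto simp: pass_def)
qed

lemma wfo_inner:
  assumes "vs = us @ v # ws" "distinct l" "set l \<subseteq> set cs"
    "\<forall>c\<in>set l. lw c = lvl us c \<and> lz c = lvl us c"
    "wfo (\<lambda>c. if c \<in> set l then lvl (us @ [v]) c else lw c) (\<lambda>c. if c \<in> set l then lvl (us @ [v]) c else lz c) rest"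
  shows "wfo lw lz (gl (concat (map (inner v) l)) @ rest)"
  using assms(2-)
proof (induction l arbitrary: lw lz)
  case (Cons c l)
  have c: "c \<in> set cs" using Cons.prems by simp
  let ?lw = "lw(c := lvl (us @ [v]) c)" and ?lz = "lz(c := lvl (us @ [v]) c)"
  have f: "(\<lambda>e. if e \<in> set l then lvl (us @ [v]) e else ?lw e) = (\<lambda>e. if e \<in> set (c # l) then lvl (us @ [v]) e else lw e)"
    "(\<lambda>e. if e \<in> set l then lvl (us @ [v]) e else ?lz e) = (\<lambda>e. if e \<in> set (c # l) then lvl (us @ [v]) e else lz e)"
    using Cons.prems(1) by auto
  have IH: "wfo ?lw ?lz (gl (concat (map (inner v) l)) @ rest)"
    by (rule Cons.IH) (use Cons.prems in \<open>auto simp only: f list.set distinct.simps insert_subset fun_upd_other\<close>,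
      use Cons.prems(1,3) in auto)
  from inner_lvl[OF c assms(1)] show ?case
  proof
    assume h: "inner v c = [] \<and> lvl (us @ [v]) c = lvl us c"
    then have "?lw = lw" "?lz = lz" using Cons.prems(3) by auto
    then show ?thesis using IH h by simp
  next
    assume "\<exists>d<D. inner v c = [(c, lvl us c, d)] \<and> lvl (us @ [v]) c = Suc (lvl us c)"
    then obtain d where "d < D" "inner v c = [(c, lvl us c, d)]" "lvl (us @ [v]) c = Suc (lvl us c)" by blast
    then show ?thesis using IH c Cons.prems(3) by simp
  qed
qed simp

lemma wfo_cong: "\<forall>c\<in>set cs. lw c = lw' c \<and> lz c = lz' c \<Longrightarrow> wfo lw lz os \<Longrightarrow> wfo lw' lz' os"
proof (induction os arbitrary: lw lz lw' lz')
  case (Cons x os)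
  show ?case
  proof (cases x)
    case (SwW c i d)
    have "wfo (lw'(c := Suc i)) lz' os"
    proof (rule Cons.IH)
      show "wfo (lw(c := Suc i)) lz os" using Cons.prems SwW by simp
    qed (use Cons.prems in auto)
    then show ?thesis using Cons.prems SwW by auto
  next
    case (SwZ c i d)
    have "wfo lw' (lz'(c := Suc i)) os"
    proof (rule Cons.IH)
      show "wfo lw (lz(c := Suc i)) os" using Cons.prems SwZ by simp
    qed (use Cons.prems in auto)
    then show ?thesis using Cons.prems SwZ by auto
  qed (use Cons in auto)
qed simp

lemma wfo_ops: "wfo (\<lambda>_. 0) (\<lambda>_. 0) (ops vs)"
proof -
  have "wfo (lvl us) (lvl us) (ops ws)" if "vs = us @ ws" for us ws
    using that
  proof (induction ws arbitrary: us)
    case Nil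
    have "lvl us c = length (lits c)" if "c \<in> set cs" for c
      using arg_cong[OF lits_vs[OF that], of length] Nil by (simp add: lvl_def)
    then show ?case by (simp add: ops_def wfo_pass)
  next
    case (Cons v ws)
    have IH: "wfo (lvl (us @ [v])) (lvl (us @ [v])) (ops ws)" using Cons by simp
    have "wfo (lvl us) (lvl us) (gl (gates v) @ ops ws)"
      unfolding gates_def
      by (rule wfo_inner[OF Cons.prems distinct_cs]) (auto intro: wfo_cong[OF _ IH])
    then show ?case by (simp add: ops_def wfo_pass)
  qed
  moreover have "lvl [] = (\<lambda>_. 0)" by (auto simp: lvl_def fun_eq_iff)
  ultimately show ?thesis by (metis append_Nil)
qed

lemma distinct_map_append:
  assumes "distinct (map f X)" "distinct (map f Y)" "f ` set X \<subseteq> {c}" "f ` set Y \<subseteq> L" "c \<notin> L"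
  shows "distinct (map f (X @ Y)) \<and> f ` set (X @ Y) \<subseteq> insert c L"
  using assms by auto

lemma gates_props:
  "distinct (map fst (gates v))" "(c, i, d) \<in> set (gates v) \<Longrightarrow> c \<in> set cs \<and> d < D \<and> (v, d) \<in> set (lits c)"
proof -
  have "map fst (inner v c) = [] \<or> map fst (inner v c) = [c]" if "c \<in> set cs" for c
  proof (cases "v \<in> fst ` set (lits c)")
    case True
    then obtain i where "i < length (lits c)" "fst (lits c ! i) = v"
      by (metis imageE in_set_conv_nth)
    then show ?thesis using inner_Some[OF that] by simp
  qed (simp add: inner_None)
  then have "distinct (map fst (concat (map (inner v) l))) \<and> fst ` set (concat (map (inner v) l)) \<subseteq> set l"
    if "distinct l" "set l \<subseteq> set cs" for l
    using that
  proof (induction l)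
    case (Cons c l)
    then have "map fst (inner v c) = [] \<or> map fst (inner v c) = [c]" by simp
    then have "distinct (map fst (inner v c))" "fst ` set (inner v c) \<subseteq> {c}"
      by (metis distinct.simps(1) distinct_singleton, metis empty_subsetI list.set(1) list.set_map list.simps(15) order_refl)
    moreover have "distinct (map fst (concat (map (inner v) l)))"
      "fst ` set (concat (map (inner v) l)) \<subseteq> set l" "c \<notin> set l" using Cons by auto
    ultimately show ?case
      using distinct_map_append[of fst "inner v c" "concat (map (inner v) l)" c "set l"]
      unfolding list.map concat.simps list.set by blast
  qed simp
  then show "distinct (map fst (gates v))" using distinct_cs by (simp add: gates_def)
  assume "(c, i, d) \<in> set (gates v)"
  then obtain c' where "c' \<in> set cs" "(c, i, d) \<in> set (inner v c')" by (auto simp: gates_def)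
  then show "c \<in> set cs \<and> d < D \<and> (v, d) \<in> set (lits c)"
    using lits_D by (auto simp: set_inner dest: nth_mem)
qed

lemma gates_ex: "c \<in> set cs \<Longrightarrow> (v, d) \<in> set (lits c) \<Longrightarrow> \<exists>i. (c, i, d) \<in> set (gates v)"
  by (auto simp: gates_def set_inner in_set_conv_nth[of _ "lits c"])

section \<open>From a won game to an assignment\<close>

lemma game_pass:
  assumes "game (pass @ rest) \<sigma> G" "tok \<sigma>"
  shows "\<exists>\<sigma>'. game rest \<sigma>' G \<and> tok \<sigma>' \<and> (\<forall>c. \<sigma>' (PW c) = \<sigma> (PW c)) \<and>
    ((\<exists>d<D. \<sigma>' (PC d) = 1) \<longleftrightarrow> (\<exists>d<D. \<sigma> (PC d) = 1))"
proof -
  have "\<exists>\<sigma>'. game rest \<sigma>' G \<and> tok \<sigma>' \<and> (\<forall>c. \<sigma>' (PW c) = \<sigma> (PW c)) \<and>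
    ((\<exists>d<D. \<sigma>' (PC d) = 1) \<longleftrightarrow> (\<exists>d<D. \<sigma> (PC d) = 1))"
    if "game (map Sw0 ds @ rest) \<sigma> G" "tok \<sigma>" "\<forall>d\<in>set ds. d < D" for ds \<sigma>
    using that
  proof (induction ds arbitrary: \<sigma>)
    case (Cons d ds)
    have t: "tok (sw (PC 0) (PC d) \<sigma>)" using tok_sw[OF Cons.prems(2)] D Cons.prems(3) by auto
    have e: "(\<exists>e<D. sw (PC 0) (PC d) \<sigma> (PC e) = 1) \<longleftrightarrow> (\<exists>e<D. \<sigma> (PC e) = 1)"
    proof
      assume "\<exists>e<D. sw (PC 0) (PC d) \<sigma> (PC e) = 1"
      then obtain e where "e < D" "sw (PC 0) (PC d) \<sigma> (PC e) = 1" by blast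
      then show "\<exists>e<D. \<sigma> (PC e) = 1" using D Cons.prems(3)
        by (intro exI[of _ "if e = d then 0 else if e = 0 then d else e"]) (auto simp: sw_def split: if_splits)
    next
      assume "\<exists>e<D. \<sigma> (PC e) = 1"
      then obtain e where e: "e < D" "\<sigma> (PC e) = 1" by blast
      then show "\<exists>e<D. sw (PC 0) (PC d) \<sigma> (PC e) = 1"
        using D Cons.prems(3)
        by (intro exI[of _ "if e = 0 then d else if e = d then 0 else e"]) (auto simp: sw_def)
    qed
    from Cons.prems(1) have "game (map Sw0 ds @ rest) \<sigma> G \<or> game (map Sw0 ds @ rest) (sw (PC 0) (PC d) \<sigma>) G"
      by simp
    then show ?case
    proof
      assume "game (map Sw0 ds @ rest) \<sigma> G"
      then show ?thesis using Cons.IH Cons.prems by auto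
    next
      assume "game (map Sw0 ds @ rest) (sw (PC 0) (PC d) \<sigma>) G"
      from Cons.IH[OF this t] Cons.prems(3) e show ?thesis by (auto simp: sw_def)
    qed
  qed auto
  from this[of "[1..<D]"] show ?thesis using assms by (auto simp: pass_def)
qed

text \<open>The remaining gates only exchange tokens between positions none of which holds slot 1,
  so it cannot return to a chain.\<close>

lemma game_lost:
  assumes "game (gl ts @ rest) \<sigma> G" "\<forall>d<D. \<sigma> (PC d) \<noteq> 1"
    "\<forall>(c, i, d)\<in>set ts. \<sigma> (PW c) \<noteq> 1 \<and> \<sigma> (PZ c) \<noteq> 1 \<and> d < D" "tok \<sigma>" "\<forall>(c, i, d)\<in>set ts. c \<in> set cs"
  shows "\<exists>\<sigma>'. game rest \<sigma>' G \<and> tok \<sigma>' \<and> (\<forall>d<D. \<sigma>' (PC d) \<noteq> 1)"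
  using assms
proof (induction ts arbitrary: \<sigma>)
  case (Cons x ts)
  obtain c i d where x: "x = (c, i, d)" by (cases x)
  have d: "d < D" "c \<in> set cs" "\<sigma> (PW c) \<noteq> 1" "\<sigma> (PZ c) \<noteq> 1" using Cons.prems x by auto
  obtain \<sigma>1 where \<sigma>1: "\<sigma>1 = \<sigma> \<or> \<sigma>1 = sw (PW c) (PC d) \<sigma>" "game (SwZ c i d # gl ts @ rest) \<sigma>1 G"
    using Cons.prems(1) x by auto
  then obtain \<sigma>2 where \<sigma>2: "\<sigma>2 = \<sigma>1 \<or> \<sigma>2 = sw (PC d) (PZ c) \<sigma>1" "game (gl ts @ rest) \<sigma>2 G" by auto
  have "tok \<sigma>1" using \<sigma>1(1) Cons.prems(4) tok_sw d by auto
  then have t: "tok \<sigma>2" using \<sigma>2(1) tok_sw d by auto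
  have n1: "(\<forall>d<D. \<sigma>1 (PC d) \<noteq> 1) \<and> (\<forall>(c, i, d)\<in>set (x # ts). \<sigma>1 (PW c) \<noteq> 1 \<and> \<sigma>1 (PZ c) \<noteq> 1)"
    using \<sigma>1(1) Cons.prems(2,3) d by (auto simp: sw_def split: if_splits)
  then have "(\<forall>d<D. \<sigma>2 (PC d) \<noteq> 1) \<and> (\<forall>(c, i, d)\<in>set (x # ts). \<sigma>2 (PW c) \<noteq> 1 \<and> \<sigma>2 (PZ c) \<noteq> 1)"
    using \<sigma>2(1) d x by (auto simp: sw_def split: if_splits)
  moreover have "\<forall>(c, i, d)\<in>set ts. d < D \<and> c \<in> set cs" using Cons.prems(3,5) by auto
  ultimately show ?case by (intro Cons.IH[OF \<sigma>2(2) _ _ t]) auto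
qed auto

text \<open>A gate on the chain of slot 1 cannot release the token of its constraint without taking
  slot 1 along. Slot 1 then stays at \<open>PW c\<close> or \<open>PZ c\<close>, because the
  distinctness of the constraints in \<open>ts\<close> excludes a second gate of
  \<open>c\<close>.\<close>

lemma game_gates:
  assumes "game (gl ts @ rest) \<sigma> G" "tok \<sigma>" "\<sigma> (PC d0) = 1" "d0 < D" "distinct (map fst ts)"
    "\<forall>(c, i, d)\<in>set ts. c \<in> set cs \<and> d < D"
  shows "\<exists>\<sigma>'. game rest \<sigma>' G \<and> tok \<sigma>' \<and> ((\<forall>d<D. \<sigma>' (PC d) \<noteq> 1) \<or>
    (\<forall>c\<in>set cs. \<sigma>' (PW c) = \<sigma> (PW c) \<or> (\<exists>i d. (c, i, d) \<in> set ts \<and> d \<noteq> d0)))"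
  using assms
proof (induction ts arbitrary: \<sigma>)
  case (Cons x ts)
  obtain c i d where x: "x = (c, i, d)" by (cases x)
  have d: "d < D" "c \<in> set cs" "c \<notin> fst ` set ts" using Cons.prems x by auto
  obtain \<sigma>1 where \<sigma>1: "\<sigma>1 = \<sigma> \<or> \<sigma>1 = sw (PW c) (PC d) \<sigma>" "game (SwZ c i d # gl ts @ rest) \<sigma>1 G"
    using Cons.prems(1) x by auto
  then obtain \<sigma>2 where \<sigma>2: "\<sigma>2 = \<sigma>1 \<or> \<sigma>2 = sw (PC d) (PZ c) \<sigma>1" "game (gl ts @ rest) \<sigma>2 G" by auto
  have "tok \<sigma>1" using \<sigma>1(1) Cons.prems(2) tok_sw d by auto
  then have t: "tok \<sigma>2" using \<sigma>2(1) tok_sw d by auto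
  show ?case
  proof (cases "\<sigma>2 (PC d0) = 1")
    case True
    have "\<exists>\<sigma>'. game rest \<sigma>' G \<and> tok \<sigma>' \<and> ((\<forall>d<D. \<sigma>' (PC d) \<noteq> 1) \<or>
      (\<forall>c\<in>set cs. \<sigma>' (PW c) = \<sigma>2 (PW c) \<or> (\<exists>i d. (c, i, d) \<in> set ts \<and> d \<noteq> d0)))"
      using Cons.IH[OF \<sigma>2(2) t True Cons.prems(4)] Cons.prems(5,6) by auto
    moreover have "\<sigma>2 (PW e) = \<sigma> (PW e) \<or> (e = c \<and> d \<noteq> d0)" for e
    proof (cases "e = c \<and> d = d0")
      case h: True
      \<comment> \<open>The first swap would move slot 1 into \<open>PW c\<close>, and the second
        swap does not touch that position.\<close>
      have "\<sigma>1 = \<sigma>"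
      proof (rule ccontr)
        assume "\<sigma>1 \<noteq> \<sigma>"
        then have "\<sigma>1 (PW c) = 1" using \<sigma>1(1) h Cons.prems(3) by (auto simp: sw_def)
        then have "\<sigma>2 (PW c) = 1" using \<sigma>2(1) by (auto simp: sw_def)
        then show False using True tok_neq[OF t, of "PW c" "PC d0"] d h by auto
      qed
      then show ?thesis using \<sigma>2(1) by (auto simp: sw_def)
    qed (use \<sigma>1(1) \<sigma>2(1) in \<open>auto simp: sw_def split: if_splits\<close>)
    ultimately show ?thesis using x by (metis list.set_intros)
  next
    case False
    \<comment> \<open>Only a swap on its own chain can have moved slot 1 away.\<close>
    have dd: "d = d0"
      using False \<sigma>1(1) \<sigma>2(1) Cons.prems(3) by (auto simp: sw_def split: if_splits)
    have one: "\<sigma>2 (PW c) = 1 \<or> \<sigma>2 (PZ c) = 1"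
      using \<sigma>1(1) \<sigma>2(1) Cons.prems(3) False dd by (auto simp: sw_def split: if_splits)
    have "\<forall>d<D. \<sigma>2 (PC d) \<noteq> 1"
    proof (intro allI impI)
      fix e assume "e < D"
      then show "\<sigma>2 (PC e) \<noteq> 1"
        using one tok_neq[OF t, of "PW c" "PC e"] tok_neq[OF t, of "PZ c" "PC e"] d by auto
    qed
    moreover have "\<forall>(c', i, d)\<in>set ts. \<sigma>2 (PW c') \<noteq> 1 \<and> \<sigma>2 (PZ c') \<noteq> 1 \<and> d < D"
    proof (intro ballI, clarify)
      fix c' i' d' assume m: "(c', i', d') \<in> set ts"
      then have c': "c' \<noteq> c" "c' \<in> set cs" "d' < D" using d(3) Cons.prems(6) by force+
      then show "\<sigma>2 (PW c') \<noteq> 1 \<and> \<sigma>2 (PZ c') \<noteq> 1 \<and> d' < D"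
        using one tok_neq[OF t, of "PW c" "PW c'"] tok_neq[OF t, of "PW c" "PZ c'"]
          tok_neq[OF t, of "PZ c" "PW c'"] tok_neq[OF t, of "PZ c" "PZ c'"] d by auto
    qed
    moreover have "\<forall>(c, i, d)\<in>set ts. c \<in> set cs" using Cons.prems(6) by auto
    ultimately show ?thesis using game_lost[OF \<sigma>2(2) _ _ t] by blast
  qed
qed auto

lemma ops_Cons: "ops (v # us) = pass @ As # pass @ gl (gates v) @ ops us"
  by (simp add: ops_def)

lemma game_ops_start: "\<exists>rest. ops us = pass @ As # rest"
  by (cases us) (auto simp: ops_def)

text \<open>The value of a variable is the chain on which slot 1 stands when its gates begin. A
  token can leave \<open>PW c\<close> only at a gate whose value differs from it, which satisfies
  the constraint.\<close>

lemma game_ops_sound: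
  assumes "game (ops us) \<sigma> G" "tok \<sigma>" "distinct us"
  shows "\<exists>\<sigma>' a. G \<sigma>' \<and> tok \<sigma>' \<and> (\<forall>v. a v < D) \<and> (\<forall>c\<in>set cs. \<sigma>' (PW c) = \<sigma> (PW c) \<or>
    (\<exists>v\<in>set us. \<exists>d. (v, d) \<in> set (lits c) \<and> d \<noteq> a v))"
  using assms
proof (induction us arbitrary: \<sigma>)
  case Nil
  then have "game (pass @ [As]) \<sigma> G" by (simp add: ops_def)
  from game_pass[OF this Nil(2)] obtain \<sigma>' where "game [As] \<sigma>' G" "tok \<sigma>'" "\<forall>c. \<sigma>' (PW c) = \<sigma> (PW c)" by blast
  then show ?case using D by (intro exI[of _ \<sigma>'] exI[of _ "\<lambda>_. 0"]) auto
next
  case (Cons v us)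
  have "game (pass @ As # pass @ gl (gates v) @ ops us) \<sigma> G" using Cons.prems(1) by (simp add: ops_Cons)
  from game_pass[OF this Cons.prems(2)] obtain \<sigma>1 where
    \<sigma>1: "game (As # pass @ gl (gates v) @ ops us) \<sigma>1 G" "tok \<sigma>1" "\<forall>c. \<sigma>1 (PW c) = \<sigma> (PW c)" by blast
  then have "\<sigma>1 (PC 0) = 1" "game (pass @ gl (gates v) @ ops us) \<sigma>1 G" by auto
  from game_pass[OF this(2) \<sigma>1(2)] this(1) D obtain \<sigma>2 d0 where
    \<sigma>2: "game (gl (gates v) @ ops us) \<sigma>2 G" "tok \<sigma>2" "\<forall>c. \<sigma>2 (PW c) = \<sigma> (PW c)" "\<sigma>2 (PC d0) = 1" "d0 < D"
    using \<sigma>1(3) by auto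
  have "\<forall>(c, i, d)\<in>set (gates v). c \<in> set cs \<and> d < D" using gates_props(2) by auto
  from game_gates[OF \<sigma>2(1,2,4,5) gates_props(1) this] obtain \<sigma>3 where
    \<sigma>3: "game (ops us) \<sigma>3 G" "tok \<sigma>3" "(\<forall>d<D. \<sigma>3 (PC d) \<noteq> 1) \<or>
      (\<forall>c\<in>set cs. \<sigma>3 (PW c) = \<sigma>2 (PW c) \<or> (\<exists>i d. (c, i, d) \<in> set (gates v) \<and> d \<noteq> d0))" by blast
  \<comment> \<open>What follows begins with a \<open>pass\<close> and \<open>As\<close>, and a
    \<open>pass\<close> cannot bring slot 1 onto a chain; so a lost slot 1 fails the next
    test.\<close>
  have "\<not> (\<forall>d<D. \<sigma>3 (PC d) \<noteq> 1)"
  proof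
    assume lost: "\<forall>d<D. \<sigma>3 (PC d) \<noteq> 1"
    obtain rest where "game (pass @ As # rest) \<sigma>3 G" using \<sigma>3(1) game_ops_start by metis
    from game_pass[OF this \<sigma>3(2)] lost obtain \<sigma>' where "game (As # rest) \<sigma>' G" "\<not> (\<exists>d<D. \<sigma>' (PC d) = 1)"
      by blast
    then show False using D by auto
  qed
  then have keep: "\<forall>c\<in>set cs. \<sigma>3 (PW c) = \<sigma> (PW c) \<or> (\<exists>d. (v, d) \<in> set (lits c) \<and> d \<noteq> d0)"
    using \<sigma>3(3) \<sigma>2(3) gates_props(2) by metis
  from Cons.IH[OF \<sigma>3(1,2)] Cons.prems(3) obtain \<sigma>' a where a: "G \<sigma>'" "tok \<sigma>'" "\<forall>v. a v < D"
    "\<forall>c\<in>set cs. \<sigma>' (PW c) = \<sigma>3 (PW c) \<or> (\<exists>v\<in>set us. \<exists>d. (v, d) \<in> set (lits c) \<and> d \<noteq> a v)" by auto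
  have False: "v \<notin> set us" using Cons.prems(3) by simp
  have eq: "(a(v := d0)) u = a u" if "u \<in> set us" for u using that False by auto
  have "\<forall>c\<in>set cs. \<sigma>' (PW c) = \<sigma> (PW c) \<or> (\<exists>u\<in>set (v # us). \<exists>d. (u, d) \<in> set (lits c) \<and> d \<noteq> (a(v := d0)) u)"
  proof
    fix c assume c: "c \<in> set cs"
    show "\<sigma>' (PW c) = \<sigma> (PW c) \<or> (\<exists>u\<in>set (v # us). \<exists>d. (u, d) \<in> set (lits c) \<and> d \<noteq> (a(v := d0)) u)"
      using keep[rule_format, OF c] a(4)[rule_format, OF c] eq by (metis fun_upd_same list.set_intros)
  qed
  then show ?case using a(1-3) \<sigma>2(5) by (intro exI[of _ \<sigma>'] exI[of _ "a(v := d0)"]) auto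
qed

section \<open>From an assignment to a won game\<close>

lemma game_pass_complete:
  assumes "game rest (sw (PC 0) (PC t) \<sigma>) G" "t < D"
  shows "game (pass @ rest) \<sigma> G"
proof -
  have skip: "game rest \<tau> G \<Longrightarrow> game (map Sw0 ds @ rest) \<tau> G" for \<tau> ds
    by (induction ds) auto
  have "game (map Sw0 ds @ rest) \<sigma> G" if "t = 0 \<or> t \<in> set ds" for ds
    using that
  proof (induction ds)
    case Nil
    then show ?case using assms(1) by (simp add: sw_def)
  next
    case (Cons d ds)
    show ?case
    proof (cases "d = t")
      case True
      then show ?thesis using skip[OF assms(1)] by simp
    qed (use Cons in auto)
  qed
  from this[of "[1..<D]"] show ?thesis using assms(2) by (cases "t = 0") (auto simp: pass_def)
qed

lemma game_gates_complete:
  assumes "\<sigma> (PC d0) = 1" "\<forall>c. \<sigma> (PW c) = t c \<or> \<sigma> (PZ c) = t c" "\<forall>(c, i, d)\<in>set ts. d < D"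
  shows "\<exists>\<sigma>'. (game rest \<sigma>' G \<longrightarrow> game (gl ts @ rest) \<sigma> G) \<and> \<sigma>' (PC d0) = 1 \<and>
    (\<forall>c. \<sigma>' (PW c) = t c \<or> \<sigma>' (PZ c) = t c) \<and> (\<forall>c. \<sigma> (PZ c) = t c \<longrightarrow> \<sigma>' (PZ c) = t c) \<and>
    (\<forall>(c, i, d)\<in>set ts. d \<noteq> d0 \<longrightarrow> \<sigma>' (PZ c) = t c)"
  using assms
proof (induction ts arbitrary: \<sigma>)
  case Nil
  then show ?case by (intro exI[of _ \<sigma>]) auto
next
  case (Cons x ts)
  obtain c i d where x: "x = (c, i, d)" by (cases x)
  \<comment> \<open>The token \<open>t c\<close> takes both swaps at the first gate off the chain of
    slot 1 and rests afterwards, so it is never left on a chain.\<close>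
  define \<sigma>2 where "\<sigma>2 = (if d \<noteq> d0 \<and> \<sigma> (PZ c) \<noteq> t c then sw (PC d) (PZ c) (sw (PW c) (PC d) \<sigma>) else \<sigma>)"
  have \<sigma>2: "\<sigma>2 (PC d0) = 1" "\<forall>c. \<sigma>2 (PW c) = t c \<or> \<sigma>2 (PZ c) = t c" "\<forall>c. \<sigma> (PZ c) = t c \<longrightarrow> \<sigma>2 (PZ c) = t c"
    "d \<noteq> d0 \<longrightarrow> \<sigma>2 (PZ c) = t c" "game rest' \<sigma>2 G \<longrightarrow> game (SwW c i d # SwZ c i d # rest') \<sigma> G" for rest'
    using Cons.prems(1,2) by (auto simp: \<sigma>2_def sw_def)
  have "\<forall>(c, i, d)\<in>set ts. d < D" using Cons.prems(3) by simp
  from Cons.IH[OF \<sigma>2(1,2) this] obtain \<sigma>' where \<sigma>': "game rest \<sigma>' G \<longrightarrow> game (gl ts @ rest) \<sigma>2 G"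
    "\<sigma>' (PC d0) = 1" "\<forall>c. \<sigma>' (PW c) = t c \<or> \<sigma>' (PZ c) = t c" "\<forall>c. \<sigma>2 (PZ c) = t c \<longrightarrow> \<sigma>' (PZ c) = t c"
    "\<forall>(c, i, d)\<in>set ts. d \<noteq> d0 \<longrightarrow> \<sigma>' (PZ c) = t c" by blast
  show ?case
    by (rule exI[of _ \<sigma>']) (use \<sigma>' \<sigma>2(3,4) \<sigma>2(5)[of "gl ts @ rest"] x in auto)
qed

text \<open>The goal is abstract so that the induction can strengthen what may be assumed about the
  final placement: a token that has reached \<open>PZ\<close> stays there.\<close>

lemma game_ops_complete:
  assumes "\<forall>v. a v < D" "\<exists>d<D. \<sigma> (PC d) = 1" "\<forall>c. \<sigma> (PW c) = t c \<or> \<sigma> (PZ c) = t c"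
    "\<And>\<sigma>'. (\<forall>c. \<sigma> (PZ c) = t c \<longrightarrow> \<sigma>' (PZ c) = t c) \<Longrightarrow>
      (\<forall>v\<in>set us. \<forall>(c, i, d)\<in>set (gates v). d \<noteq> a v \<longrightarrow> \<sigma>' (PZ c) = t c) \<Longrightarrow> G \<sigma>'"
  shows "game (ops us) \<sigma> G"
  using assms(2-)
proof (induction us arbitrary: \<sigma>)
  case Nil
  obtain d0 where d0: "d0 < D" "\<sigma> (PC d0) = 1" using Nil by blast
  let ?\<sigma> = "sw (PC 0) (PC d0) \<sigma>"
  have "G ?\<sigma>" by (rule Nil(3)) (auto simp: sw_def)
  moreover have "?\<sigma> (PC 0) = 1" using d0 by (auto simp: sw_def)
  ultimately have "game [As] ?\<sigma> G" by simp
  from game_pass_complete[OF this d0(1)] show ?case by (simp add: ops_def)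
next
  case (Cons v us)
  obtain d0 where d0: "d0 < D" "\<sigma> (PC d0) = 1" using Cons by blast
  let ?\<sigma>1 = "sw (PC 0) (PC d0) \<sigma>"
  let ?\<sigma>2 = "sw (PC 0) (PC (a v)) ?\<sigma>1"
  have \<sigma>2: "?\<sigma>2 (PC (a v)) = 1" "\<forall>c. ?\<sigma>2 (PW c) = t c \<or> ?\<sigma>2 (PZ c) = t c" "\<forall>c. ?\<sigma>2 (PZ c) = \<sigma> (PZ c)"
    using d0 Cons.prems(2) by (auto simp: sw_def)
  have "\<forall>(c, i, d)\<in>set (gates v). d < D" using gates_props(2) by auto
  from game_gates_complete[OF \<sigma>2(1,2) this, of "ops us" G] obtain \<sigma>' where
    \<sigma>': "game (ops us) \<sigma>' G \<longrightarrow> game (gl (gates v) @ ops us) ?\<sigma>2 G" "\<sigma>' (PC (a v)) = 1"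
      "\<forall>c. \<sigma>' (PW c) = t c \<or> \<sigma>' (PZ c) = t c" "\<forall>c. ?\<sigma>2 (PZ c) = t c \<longrightarrow> \<sigma>' (PZ c) = t c"
      "\<forall>(c, i, d)\<in>set (gates v). d \<noteq> a v \<longrightarrow> \<sigma>' (PZ c) = t c" by blast
  have "game (ops us) \<sigma>' G"
  proof (rule Cons.IH)
    show "\<exists>d<D. \<sigma>' (PC d) = 1" using \<sigma>'(2) assms(1) by blast
    show "\<forall>c. \<sigma>' (PW c) = t c \<or> \<sigma>' (PZ c) = t c" by (rule \<sigma>'(3))
    fix \<sigma>'' assume *: "\<forall>c. \<sigma>' (PZ c) = t c \<longrightarrow> \<sigma>'' (PZ c) = t c"
      "\<forall>v\<in>set us. \<forall>(c, i, d)\<in>set (gates v). d \<noteq> a v \<longrightarrow> \<sigma>'' (PZ c) = t c"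
    show "G \<sigma>''"
      by (rule Cons.prems(3)) (use * \<sigma>'(4,5) \<sigma>2(3) in fastforce)+
  qed
  then have "game (gl (gates v) @ ops us) ?\<sigma>2 G" using \<sigma>'(1) by blast
  from game_pass_complete[OF this] assms(1) have "game (pass @ gl (gates v) @ ops us) ?\<sigma>1 G" by blast
  then have "game (As # pass @ gl (gates v) @ ops us) ?\<sigma>1 G" using d0 by (auto simp: sw_def)
  from game_pass_complete[OF this d0(1)] show ?case by (simp add: ops_Cons)
qed

theorem csp_iff_feas: "(\<exists>a. sat a) \<longleftrightarrow> feas k (net (ops vs)) Map.empty"
proof
  assume "\<exists>a. sat a"
  then obtain a where a: "sat a" ..
  \<comment> \<open>\<open>sat\<close> bounds only the values of variables in \<open>vs\<close>;
    elsewhere 0 is a legal default because \<open>D\<close> is positive.\<close>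
  let ?a = "\<lambda>v. if v \<in> set vs then a v else 0"
  have "game (ops vs) \<sigma>0 goal"
  proof (rule game_ops_complete[where a = ?a and t = "\<lambda>c. \<sigma>0 (PW c)"])
    show "\<forall>v. ?a v < D" using a D by (auto simp: sat_def)
    show "\<exists>d<D. \<sigma>0 (PC d) = 1" using D by (intro exI[of _ 0]) auto
    fix \<sigma>' :: "'c pos \<Rightarrow> slot"
    assume g: "\<forall>v\<in>set vs. \<forall>(c, i, d)\<in>set (gates v). d \<noteq> ?a v \<longrightarrow> \<sigma>' (PZ c) = \<sigma>0 (PW c)"
    show "goal \<sigma>'" unfolding goal_def
    proof (intro allI impI)
      fix q assume q: "q < length cs"
      then have c: "cs ! q \<in> set cs" by simp
      then obtain v d where vd: "(v, d) \<in> set (lits (cs ! q))" "a v \<noteq> d" using a by (auto simp: sat_def)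
      have v: "v \<in> set vs" using arg_cong[OF lits_vs[OF c], of set] vd(1) by force
      obtain i where "(cs ! q, i, d) \<in> set (gates v)" using gates_ex[OF c vd(1)] by blast
      then have "\<sigma>' (PZ (cs ! q)) = \<sigma>0 (PW (cs ! q))" using g v vd(2) by fastforce
      then show "\<sigma>' (PZ (cs ! q)) = D + 1 + 2 * q" using idx_nth[OF q] by simp
    qed
  qed auto
  then show "feas k (net (ops vs)) Map.empty" using net_game(3)[OF wfo_ops] by simp
next
  assume "feas k (net (ops vs)) Map.empty"
  then have "game (ops vs) \<sigma>0 goal" using net_game(3)[OF wfo_ops] by simp
  from game_ops_sound[OF this tok_\<sigma>0 distinct_vs] obtain \<sigma>' a where
    a: "goal \<sigma>'" "tok \<sigma>'" "\<forall>v. a v < D"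
    "\<forall>c\<in>set cs. \<sigma>' (PW c) = \<sigma>0 (PW c) \<or> (\<exists>v\<in>set vs. \<exists>d. (v, d) \<in> set (lits c) \<and> d \<noteq> a v)" by blast
  have "\<exists>(v, d)\<in>set (lits c). a v \<noteq> d" if c: "c \<in> set cs" for c
  proof -
    \<comment> \<open>At the end the token that started at \<open>PW c\<close> is at
      \<open>PZ c\<close>. Distinct positions hold distinct tokens, so \<open>PW c\<close> holds
      another one than at the start.\<close>
    have "\<sigma>' (PZ c) = \<sigma>0 (PW c)" using a(1) idx_cs[OF c] by (auto simp: goal_def)
    moreover have "\<sigma>' (PW c) \<noteq> \<sigma>' (PZ c)" using tok_neq[OF a(2)] c by auto
    ultimately show ?thesis using a(4) c by fastforce
  qed
  then show "\<exists>a. sat a" using a(3) by (auto simp: sat_def)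
qed

end

section \<open>Programs that generate strings by nested loops\<close>

text \<open>
  The loop variable \<open>i\<close> runs over the string \<open>w i\<close>, which is on tape \<open>2 i\<close>; its index is kept in
  unary, after a sentinel, on tape \<open>2 i + 1\<close>. Besides, there is a binary counter.
\<close>

datatype gen =
    Out nat
  | Inc
  | Dec
  | Reset
  | OutCtr
  | OutIdx nat "nat list"
  | GSkip
  | GSeq gen gen (infixr ";>" 63)
  | For nat gen
  | IfLet nat "nat set" gen gen
  | IfEq nat nat nat gen gen

fun gfor :: "('a \<Rightarrow> nat \<Rightarrow> nat list \<times> nat) \<Rightarrow> 'a list \<Rightarrow> nat \<Rightarrow> nat list \<times> nat" where
  "gfor f [] n = ([], n)"
| "gfor f (p # ps) n =
     (fst (f p n) @ fst (gfor f ps (snd (f p n))), snd (gfor f ps (snd (f p n))))"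

primrec gsem :: "(nat \<Rightarrow> nat list) \<Rightarrow> gen \<Rightarrow> (nat \<Rightarrow> nat) \<Rightarrow> nat \<Rightarrow> nat list \<times> nat" where
  "gsem w (Out a) ix n = ([a], n)"
| "gsem w Inc ix n = ([], Suc n)"
| "gsem w Dec ix n = ([], n - 1)"
| "gsem w Reset ix n = ([], 0)"
| "gsem w OutCtr ix n = (psym (bsym n), n)"
| "gsem w (OutIdx i l) ix n = (concat (replicate (ix i) l), n)"
| "gsem w GSkip ix n = ([], n)"
| "gsem w (a ;> b) ix n = (fst (gsem w a ix n) @ fst (gsem w b ix (snd (gsem w a ix n))),
     snd (gsem w b ix (snd (gsem w a ix n))))"
| "gsem w (For i g) ix n = gfor (\<lambda>p. gsem w g (ix(i := p))) [0..<length (w i)] n"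
| "gsem w (IfLet i A g h) ix n = (if str (w i) (int (ix i)) \<in> A then gsem w g ix n else gsem w h ix n)"
| "gsem w (IfEq i j c g h) ix n = (if ix i + c = ix j then gsem w g ix n else gsem w h ix n)"

fun outs :: "nat \<Rightarrow> nat list \<Rightarrow> com" where
  "outs x [] = Mv x 0"
| "outs x (a # l) = Wr x a ;; Mv x 1 ;; outs x l"

abbreviation goR :: "nat \<Rightarrow> nat set \<Rightarrow> com" where
  "goR t A \<equiv> While t A (Mv t 1)"

abbreviation goL :: "nat \<Rightarrow> nat set \<Rightarrow> com" where
  "goL t A \<equiv> While t A (Mv t (- 1))"

fun stepback :: "nat \<Rightarrow> nat \<Rightarrow> com" where
  "stepback t 0 = Mv t 0"
| "stepback t (Suc c) = Mv t (- 1) ;; stepback t c"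

text \<open>Every command returns all heads but that of the output to where they were.
  \<open>IfEq\<close> moves both unary heads left until the first one meets its sentinel, then the
  second one by \<open>c\<close> more cells: equality holds if it is then on its own sentinel. As it
  may have run beyond it to the left, \<open>rest\<close> crosses blanks before going right.\<close>

fun gc :: "nat \<Rightarrow> nat \<Rightarrow> gen \<Rightarrow> com" where
  "gc cc x (Out a) = outs x [a]"
| "gc cc x Inc = While cc {2} (Wr cc 1 ;; Mv cc 1) ;; Wr cc 2 ;; goL cc (- {0}) ;; Mv cc 1"
| "gc cc x Dec = While cc {1} (Wr cc 2 ;; Mv cc 1) ;; Mv cc 1 ;;
     Cond cc {0} (Mv cc (- 1) ;; Wr cc 0) (Mv cc (- 1) ;; Wr cc 1) ;; Mv cc (- 1) ;; goL cc (- {0}) ;; Mv cc 1"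
| "gc cc x Reset = goR cc (- {0}) ;; Mv cc (- 1) ;; While cc (- {0}) (Wr cc 0 ;; Mv cc (- 1)) ;; Mv cc 1"
| "gc cc x OutCtr = While cc (- {0}) (Cond cc {2} (outs x [2, 2]) (outs x [2, 1]) ;; Mv cc 1) ;;
     Mv cc (- 1) ;; goL cc (- {0}) ;; Mv cc 1"
| "gc cc x (OutIdx i l) = Mv (2 * i + 1) (- 1) ;;
     While (2 * i + 1) {1} (outs x l ;; Mv (2 * i + 1) (- 1)) ;;
     Mv (2 * i + 1) 1 ;; goR (2 * i + 1) {1}"
| "gc cc x GSkip = Mv x 0"
| "gc cc x (a ;> b) = gc cc x a ;; gc cc x b"
| "gc cc x (For i g) =
     While (2 * i) (- {0}) (gc cc x g ;; Wr (2 * i + 1) 1 ;; Mv (2 * i + 1) 1 ;; Mv (2 * i) 1) ;;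
     Mv (2 * i) (- 1) ;; goL (2 * i) (- {0}) ;; Mv (2 * i) 1 ;;
     Mv (2 * i + 1) (- 1) ;; While (2 * i + 1) {1} (Wr (2 * i + 1) 0 ;; Mv (2 * i + 1) (- 1)) ;;
     Mv (2 * i + 1) 1"
| "gc cc x (IfLet i A g h) = Cond (2 * i) A (gc cc x g) (gc cc x h)"
| "gc cc x (IfEq i j c g h) =
     (let a = 2 * i + 1; b = 2 * j + 1;
        rest = Mv a 1 ;; goR a {1} ;; goR b {0} ;; Mv b 1 ;; goR b {1}
      in Mv a (- 1) ;; Mv b (- 1) ;; While a {1} (Mv a (- 1) ;; Mv b (- 1)) ;; stepback b c ;;
         Cond b {3} (rest ;; gc cc x g) (rest ;; gc cc x h))"

section \<open>Running times of the primitive commands\<close>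

lemma runs_While_count:
  assumes "\<And>p. p < N \<Longrightarrow> read_tape (f p i) \<in> A" "\<And>p. p < N \<Longrightarrow> runs a (f p) T True (f (Suc p))"
    "read_tape (f N i) \<notin> A" "N * (T + 1) + 1 \<le> T'"
  shows "runs (While i A a) (f 0) T' True (f N)"
  using assms
proof (induction N arbitrary: f T')
  case 0
  then show ?case by (intro runs_WhileF) auto
next
  case (Suc N)
  have "runs (While i A a) (f (Suc 0)) (N * (T + 1) + 1) True (f (Suc N))"
    using Suc.IH[of "\<lambda>p. f (Suc p)"] Suc.prems by simp
  from runs_WhileT[OF Suc.prems(1)[of 0] Suc.prems(2)[of 0] this] show ?case
    using Suc.prems(4) by simp
qed

lemma runs_goR:
  assumes "m i = tp p w" "\<forall>j<k. str w (p + int j) \<in> A" "str w (p + int k) \<notin> A" "q = p + int k" "2 * k + 1 \<le> T"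
  shows "runs (goR i A) m T True (m(i := tp q w))"
proof -
  define f where "f j = m(i := tp (p + int j) w)" for j
  have "runs (goR i A) (f 0) T True (f k)"
  proof (rule runs_While_count[where T = 1])
    fix j assume "j < k"
    then show "read_tape (f j i) \<in> A" using assms(2) by (simp add: f_def)
    show "runs (Mv i 1) (f j) 1 True (f (Suc j))"
      by (rule runs_Mv) (auto simp: f_def algebra_simps)
  qed (use assms(3,5) in \<open>auto simp: f_def\<close>)
  moreover have "f 0 = m" using assms(1) by (auto simp: f_def)
  ultimately show ?thesis using assms(4) by (simp add: f_def)
qed

lemma runs_goL:
  assumes "m i = tp p w" "\<forall>j<k. str w (p - int j) \<in> A" "str w (p - int k) \<notin> A" "q = p - int k" "2 * k + 1 \<le> T"
  shows "runs (goL i A) m T True (m(i := tp q w))"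
proof -
  define f where "f j = m(i := tp (p - int j) w)" for j
  have "runs (goL i A) (f 0) T True (f k)"
  proof (rule runs_While_count[where T = 1])
    fix j assume "j < k"
    then show "read_tape (f j i) \<in> A" using assms(2) by (simp add: f_def)
    show "runs (Mv i (- 1)) (f j) 1 True (f (Suc j))"
      by (rule runs_Mv) (auto simp: f_def algebra_simps)
  qed (use assms(3,5) in \<open>auto simp: f_def\<close>)
  moreover have "f 0 = m" using assms(1) by (auto simp: f_def)
  ultimately show ?thesis using assms(4) by (simp add: f_def)
qed

lemma runs_Mv': "m i = tp p w \<Longrightarrow> q = p + d \<Longrightarrow> 1 \<le> T \<Longrightarrow> runs (Mv i d) m T True (m(i := tp q w))"
  by (rule runs_Mv) auto

lemma runs_outs:
  "m x = tp (int (length u)) u \<Longrightarrow> 4 * length l + 1 \<le> T \<Longrightarrow>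
    runs (outs x l) m T True (m(x := tp (int (length (u @ l))) (u @ l)))"
proof (induction l arbitrary: m u T)
  case Nil
  then have "runs (Mv x 0) m T True m" by (intro runs_Mv) (auto simp: mv_def)
  then show ?case using Nil by (simp add: fun_upd_idem)
next
  case (Cons a l)
  let ?m1 = "m(x := tp (int (length u)) (u @ [a]))"
  let ?m2 = "m(x := tp (int (length (u @ [a]))) (u @ [a]))"
  have p1: "runs (Wr x a) m 1 True ?m1"
    by (rule runs_Wr) (use Cons.prems(1) wr_tp_append[of "int (length u)" u a] in auto)
  have p2: "runs (Mv x 1) ?m1 1 True ?m2"
    by (rule runs_Mv) (auto simp: add.commute)
  have p3: "runs (outs x l) ?m2 (4 * length l + 1) True (?m2(x := tp (int (length ((u @ [a]) @ l))) ((u @ [a]) @ l)))"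
    by (rule Cons.IH) auto
  have "runs (outs x (a # l)) m T True (?m2(x := tp (int (length ((u @ [a]) @ l))) ((u @ [a]) @ l)))"
    unfolding outs.simps
    by (rule runs_Seq[OF p1 runs_Seq[OF p2 p3 order_refl]]) (use Cons.prems(2) in simp)
  then show ?case unfolding fun_upd_upd append_assoc append_Cons append_Nil .
qed

lemma runs_stepback: "m t = tp p w \<Longrightarrow> q = p - int c \<Longrightarrow> 2 * c + 1 \<le> T \<Longrightarrow> runs (stepback t c) m T True (m(t := tp q w))"
proof (induction c arbitrary: m p T)
  case 0
  then have "runs (Mv t 0) m T True m" by (intro runs_Mv) (auto simp: mv_def)
  then show ?case using 0 by (simp add: fun_upd_idem)
next
  case (Suc c)
  let ?m = "m(t := tp (p - 1) w)"
  have p1: "runs (Mv t (- 1)) m 1 True ?m" by (rule runs_Mv') (use Suc.prems in auto)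
  have p2: "runs (stepback t c) ?m (2 * c + 1) True (?m(t := tp q w))"
    by (rule Suc.IH[of _ "p - 1"]) (use Suc.prems in auto)
  have "runs (stepback t (Suc c)) m T True (?m(t := tp q w))"
    unfolding stepback.simps by (rule runs_Seq[OF p1 p2]) (use Suc.prems in simp)
  then show ?case unfolding fun_upd_upd .
qed

lemma str_nonzero: "0 \<notin> set l \<Longrightarrow> 0 \<le> p \<Longrightarrow> p < int (length l) \<Longrightarrow> str l p \<noteq> 0"
proof -
  assume a: "0 \<notin> set l" "0 \<le> p" "p < int (length l)"
  then have "l ! nat p \<in> set l" by (simp add: nat_less_iff)
  then have "l ! nat p \<noteq> 0" using a(1) by metis
  then show ?thesis using a by (simp add: str_def)
qed

lemma runs_rewind:
  assumes "m i = tp (int (length w)) w" "0 \<notin> set w" "2 * length w + 6 \<le> T"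
  shows "runs (Mv i (- 1) ;; goL i (- {0}) ;; Mv i 1) m T True (m(i := tp 0 w))"
proof -
  let ?n = "length w"
  have p1: "runs (Mv i (- 1)) m 1 True (m(i := tp (int ?n - 1) w))"
    by (rule runs_Mv') (use assms in auto)
  have p2: "runs (goL i (- {0})) (m(i := tp (int ?n - 1) w)) (2 * ?n + 1) True
      ((m(i := tp (int ?n - 1) w))(i := tp (- 1) w))"
    by (rule runs_goL[where k = ?n and p = "int ?n - 1"]) (use str_nonzero[OF assms(2)] in auto)
  have p3: "runs (Mv i 1) ((m(i := tp (int ?n - 1) w))(i := tp (- 1) w)) 1 True
      (((m(i := tp (int ?n - 1) w))(i := tp (- 1) w))(i := tp 0 w))"
    by (rule runs_Mv'[where p = "- 1"]) auto
  show ?thesis using runs_Seq[OF p1 runs_Seq[OF p2 p3 order_refl], of T] assms(3) by simp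
qed

text \<open>Carry propagation with the least significant digit first: \<open>j\<close> low ones
  become zeros, and the next digit, or a new leading one, becomes one.\<close>

lemma bsym_Suc:
  "\<exists>j. (bsym n = replicate j 2 \<and> bsym (Suc n) = replicate j 1 @ [2]) \<or>
     (\<exists>l. bsym n = replicate j 2 @ 1 # l \<and> bsym (Suc n) = replicate j 1 @ 2 # l)"
proof (induction n rule: less_induct)
  case (less n)
  consider "n = 0" | a where "n = 2 * a" "a > 0" | a where "n = Suc (2 * a)"
    by (metis One_nat_def add.right_neutral add_Suc_right evenE gr0I mult_0_right oddE)
  then show ?case
  proof cases
    case 1
    have "bsym 0 = replicate 0 2 \<and> bsym (Suc 0) = replicate 0 1 @ [2]"
      by (simp add: bsym_def binary_Cons)
    then show ?thesis using 1 by blast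
  next
    case 2
    then have "bsym n = replicate 0 2 @ 1 # bsym a \<and> bsym (Suc n) = replicate 0 1 @ 2 # bsym a"
      using bsym_double[of a] by simp
    then show ?thesis by blast
  next
    case 3
    have s: "bsym n = 2 # bsym a" "bsym (Suc n) = 1 # bsym (Suc a)"
      using 3 bsym_double(2)[of a] bsym_double(1)[of "Suc a"] by auto
    have "a < n" using 3 by simp
    from less.IH[OF this] obtain j where j: "(bsym a = replicate j 2 \<and> bsym (Suc a) = replicate j 1 @ [2]) \<or>
      (\<exists>l. bsym a = replicate j 2 @ 1 # l \<and> bsym (Suc a) = replicate j 1 @ 2 # l)" by blast
    then show ?thesis by (intro exI[of _ "Suc j"]) (auto simp: s)
  qed
qed

text \<open>A crude bound is enough, because the counter has polynomially bounded values and not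
  merely polynomially many digits.\<close>

lemma length_bsym_le: "length (bsym n) \<le> n"
proof (induction n rule: less_induct)
  case (less n)
  show ?case
  proof (cases "n = 0")
    case False
    then have "length (bsym (n div 2)) \<le> n div 2" using less by simp
    then show ?thesis using False by (simp add: bsym_def binary_Cons)
  qed (simp add: bsym_def)
qed

lemma bsym_nonzero: "0 \<notin> set (bsym n)"
  using bsym_bits[of n] by auto

lemma runs_Inc:
  assumes "m cc = tp 0 (bsym n)" "10 * (n + 2) \<le> T"
  shows "runs (gc cc x Inc) m T True (m(cc := tp 0 (bsym (Suc n))))"
proof -
  obtain j u u' where j: "bsym n = replicate j 2 @ u" "bsym (Suc n) = replicate j 1 @ 2 # u'"
      "u = [] \<and> u' = [] \<or> u = 1 # u'"
    using bsym_Suc[of n] by (metis append.right_neutral)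
  define f where "f p = m(cc := tp (int p) (replicate p 1 @ replicate (j - p) 2 @ u))" for p
  have jn: "j \<le> n" using length_bsym_le[of n] j(1) by simp
  have p1: "runs (While cc {2} (Wr cc 1 ;; Mv cc 1)) (f 0) (4 * j + 1) True (f j)"
  proof (rule runs_While_count[where T = 3])
    fix p assume p: "p < j"
    then have s: "replicate (j - p) (2::nat) = 2 # replicate (j - Suc p) 2"
      by (metis Suc_diff_Suc replicate_Suc)
    show "read_tape (f p cc) \<in> {2}"
      using str_append_nth[of "replicate p 1" 2 "replicate (j - Suc p) 2 @ u"] by (simp add: f_def s)
    have a: "runs (Wr cc 1) (f p) 1 True (m(cc := tp (int p) (replicate p 1 @ 1 # replicate (j - Suc p) 2 @ u)))"
      by (rule runs_Wr) (use wr_tp_update[of 1 "replicate p 1" 2] in \<open>auto simp: f_def s\<close>)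
    have b: "runs (Mv cc 1) (m(cc := tp (int p) (replicate p 1 @ 1 # replicate (j - Suc p) 2 @ u))) 1 True (f (Suc p))"
      by (rule runs_Mv) (auto simp: f_def replicate_append_same[symmetric] add.commute)
    show "runs (Wr cc 1 ;; Mv cc 1) (f p) 3 True (f (Suc p))"
      by (rule runs_Seq[OF a b]) simp
  next
    show "read_tape (f j cc) \<notin> {2}"
      using j(3) str_append_nth[of "replicate j 1" 1 u'] by (auto simp: f_def)
  qed simp
  have f0: "f 0 = m" using assms(1) j(1) by (auto simp: f_def)
  let ?w = "bsym (Suc n)"
  have p2: "runs (Wr cc 2) (f j) 1 True (m(cc := tp (int j) ?w))"
  proof (rule runs_Wr)
    have "wr 2 (tp (int j) (replicate j 1 @ u)) = tp (int j) ?w"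
      using j(2,3) wr_tp_append[of "int j" "replicate j 1" 2] wr_tp_update[of 2 "replicate j 1" 1 u'] by auto
    then show "m(cc := tp (int j) ?w) = (f j)(cc := wr 2 (f j cc))" by (simp add: f_def)
  qed simp
  have len: "j < length ?w" using j(2) by simp
  have p3: "runs (goL cc (- {0})) (m(cc := tp (int j) ?w)) (2 * j + 3) True ((m(cc := tp (int j) ?w))(cc := tp (- 1) ?w))"
    by (rule runs_goL[where k = "Suc j" and p = "int j"]) (use str_nonzero[OF bsym_nonzero] len in auto)
  have p4: "runs (Mv cc 1) (m(cc := tp (- 1) ?w)) 1 True (m(cc := tp 0 ?w))"
    by (rule runs_Mv) auto
  show ?thesis using f0 p1
      runs_Seq[OF p1 runs_Seq[OF p2 runs_Seq[OF p3[unfolded fun_upd_upd] p4 order_refl] order_refl], of T] assms(2) jn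
    by simp
qed

lemma runs_Dec:
  assumes "m cc = tp 0 (bsym n)" "10 * (n + 2) \<le> T"
  shows "runs (gc cc x Dec) m T True (m(cc := tp 0 (bsym (n - 1))))"
proof -
  obtain j u u' where j: "bsym (n - 1) = replicate j 2 @ u" "bsym n = replicate j 1 @ u'"
      "u = [] \<and> (u' = [] \<or> u' = [2]) \<or> (\<exists>l. u = 1 # l \<and> u' = 2 # l \<and> l \<noteq> [])"
  proof (cases n)
    case 0
    then show ?thesis using that[of 0 "[]" "[]"] by (simp add: bsym_def binary.simps)
  next
    case (Suc n')
    from bsym_Suc[of n'] obtain j where
      "(bsym n' = replicate j 2 \<and> bsym (Suc n') = replicate j 1 @ [2]) \<or>
       (\<exists>l. bsym n' = replicate j 2 @ 1 # l \<and> bsym (Suc n') = replicate j 1 @ 2 # l)" ..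
    then show ?thesis
    proof (elim disjE exE conjE)
      assume "bsym n' = replicate j 2" "bsym (Suc n') = replicate j 1 @ [2]"
      then show ?thesis using that[of j "[]" "[2]"] Suc by simp
    next
      fix l assume l: "bsym n' = replicate j 2 @ 1 # l" "bsym (Suc n') = replicate j 1 @ 2 # l"
      have "n' > 0" using l(1) by (cases n') (simp_all add: bsym_def binary.simps)
      from bsym_last[OF this] obtain l' where "replicate j 2 @ 1 # l = l' @ [2]" using l by auto
      from arg_cong[OF this, of last] have "l \<noteq> []" by auto
      then show ?thesis using that[of j "1 # l" "2 # l"] l Suc by simp
    qed
  qed
  have u': "str (replicate j 2 @ u') (int j) \<noteq> 1"
    using j(3) str_append_nth[of "replicate j 2" 2] by auto
  define f where "f p = m(cc := tp (int p) (replicate p 2 @ replicate (j - p) 1 @ u'))" for p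
  have jn: "j \<le> n" using length_bsym_le[of n] j(2) by simp
  have p1: "runs (While cc {1} (Wr cc 2 ;; Mv cc 1)) (f 0) (4 * j + 1) True (f j)"
  proof (rule runs_While_count[where T = 3])
    fix p assume p: "p < j"
    then have s: "replicate (j - p) (Suc 0) = Suc 0 # replicate (j - Suc p) (Suc 0)"
      by (metis Suc_diff_Suc replicate_Suc)
    show "read_tape (f p cc) \<in> {1}"
      using str_append_nth[of "replicate p 2" 1 "replicate (j - Suc p) 1 @ u'"] by (simp add: f_def s)
    have a: "runs (Wr cc 2) (f p) 1 True (m(cc := tp (int p) (replicate p 2 @ 2 # replicate (j - Suc p) 1 @ u')))"
      by (rule runs_Wr) (use wr_tp_update[of 2 "replicate p 2" 1] in \<open>auto simp: f_def s\<close>)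
    have b: "runs (Mv cc 1) (m(cc := tp (int p) (replicate p 2 @ 2 # replicate (j - Suc p) 1 @ u'))) 1 True (f (Suc p))"
      by (rule runs_Mv) (auto simp: f_def replicate_append_same[symmetric] add.commute)
    show "runs (Wr cc 2 ;; Mv cc 1) (f p) 3 True (f (Suc p))"
      by (rule runs_Seq[OF a b]) simp
  qed (use u' in \<open>auto simp: f_def\<close>)
  have f0: "f 0 = m" using assms(1) j(2) by (auto simp: f_def)
  let ?v = "replicate j 2 @ u'" and ?w = "bsym (n - 1)"
  have p2: "runs (Mv cc 1) (f j) 1 True (m(cc := tp (int j + 1) ?v))"
    by (rule runs_Mv) (auto simp: f_def)
  have q1: "runs (Mv cc (- 1)) (m(cc := tp (int j + 1) ?v)) 1 True (m(cc := tp (int j) ?v))"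
    by (rule runs_Mv) auto
  have q2: "runs (Wr cc a) (m(cc := tp (int j) ?v)) 1 True (m(cc := tp (int j) ?w))"
    if "a = (if u = [] then 0 else 1)" for a
  proof (rule runs_Wr)
    have "wr a (tp (int j) ?v) = tp (int j) ?w"
    proof -
      have e: "wr 0 (tp (int j) (replicate j 2)) = tp (int j) (replicate j 2)"
        by (auto simp: wr_def tp_def fun_eq_iff)
      show ?thesis using j(3)
      proof (elim disjE conjE exE)
        assume "u = []" "u' = []"
        then show ?thesis using e that j(1) by simp
      next
        assume "u = []" "u' = [2]"
        then show ?thesis using that j(1) wr_tp_last[of "int j" "replicate j 2" 2] by simp
      next
        fix l assume "u = 1 # l" "u' = 2 # l"
        then show ?thesis using that j(1) wr_tp_update[of 1 "replicate j 2" 2 l] by simp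
      qed
    qed
    then show "m(cc := tp (int j) ?w) = (m(cc := tp (int j) ?v))(cc := wr a ((m(cc := tp (int j) ?v)) cc))" by simp
  qed simp
  \<comment> \<open>The cell after position \<open>j\<close> decides: if it is blank, the digit at
    \<open>j\<close> is the leading one and is erased instead of turned into 0, as the numeral must
    stay canonical. This also covers the counter value 0.\<close>
  have rd: "read_tape ((m(cc := tp (int j + 1) ?v)) cc) \<in> {0} \<longleftrightarrow> u = []"
  proof (cases "u = []")
    case False
    then obtain b l where l: "u' = 2 # b # l" using j(3) by (metis neq_Nil_conv)
    then have "b \<in> set (bsym n)" using j(2) by simp
    then have "b \<noteq> 0" using bsym_nonzero by metis
    then show ?thesis using False str_append_nth[of "replicate j 2 @ [2]" b l] l by (simp add: add.commute)
  next
    case True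
    then show ?thesis using j(3) by auto
  qed
  have p3: "runs (Cond cc {0} (Mv cc (- 1) ;; Wr cc 0) (Mv cc (- 1) ;; Wr cc 1)) (m(cc := tp (int j + 1) ?v)) 4 True
      (m(cc := tp (int j) ?w))"
    by (rule runs_Cond[where T = 3]) (use rd runs_Seq[OF q1 q2] in auto)
  have p4: "runs (Mv cc (- 1)) (m(cc := tp (int j) ?w)) 1 True (m(cc := tp (int j - 1) ?w))"
    by (rule runs_Mv) auto
  have len: "j \<le> length ?w" using j(1) by simp
  have p5: "runs (goL cc (- {0})) (m(cc := tp (int j - 1) ?w)) (2 * j + 1) True ((m(cc := tp (int j - 1) ?w))(cc := tp (- 1) ?w))"
    by (rule runs_goL[where k = j and p = "int j - 1"]) (use str_nonzero[OF bsym_nonzero] len in auto)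
  have p6: "runs (Mv cc 1) (m(cc := tp (- 1) ?w)) 1 True (m(cc := tp 0 ?w))"
    by (rule runs_Mv) auto
  show ?thesis unfolding gc.simps
    by (rule runs_Seq[OF p1[unfolded f0] runs_Seq[OF p2 runs_Seq[OF p3 runs_Seq[OF p4
          runs_Seq[OF p5[unfolded fun_upd_upd] p6 order_refl] order_refl] order_refl] order_refl]]) (use assms(2) jn in simp)
qed

lemma runs_Reset:
  assumes "m cc = tp 0 (bsym n)" "10 * (n + 2) \<le> T"
  shows "runs (gc cc x Reset) m T True (m(cc := tp 0 []))"
proof -
  let ?w = "bsym n"
  let ?n = "length ?w"
  have le: "?n \<le> n" by (rule length_bsym_le)
  have p1: "runs (goR cc (- {0})) m (2 * ?n + 1) True (m(cc := tp (int ?n) ?w))"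
    by (rule runs_goR[where k = ?n and p = 0]) (use assms str_nonzero[OF bsym_nonzero] in auto)
  define f where "f p = m(cc := tp (int ?n - 1 - int p) (take (?n - p) ?w))" for p
  have p2: "runs (Mv cc (- 1)) (m(cc := tp (int ?n) ?w)) 1 True (f 0)"
    by (rule runs_Mv) (auto simp: f_def)
  have p3: "runs (While cc (- {0}) (Wr cc 0 ;; Mv cc (- 1))) (f 0) (4 * ?n + 1) True (f ?n)"
  proof (rule runs_While_count[where T = 3])
    fix p assume p: "p < ?n"
    let ?v = "take (?n - Suc p) ?w" and ?a = "?w ! (?n - Suc p)"
    have v: "take (?n - p) ?w = ?v @ [?a]" "int ?n - 1 - int p = int (length ?v)"
      using p take_Suc_conv_app_nth[of "?n - Suc p" ?w] by (auto simp: Suc_diff_Suc)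
    have "?a \<noteq> 0" using bsym_nonzero[of n] p by (metis diff_less nth_mem zero_less_Suc length_greater_0_conv less_nat_zero_code list.size(3))
    then show "read_tape (f p cc) \<in> - {0}"
      using str_append_nth[of ?v ?a "[]"] v by (simp add: f_def)
    have a: "runs (Wr cc 0) (f p) 1 True (m(cc := tp (int (length ?v)) ?v))"
      by (rule runs_Wr) (use v wr_tp_last[of _ ?v ?a] in \<open>auto simp: f_def\<close>)
    have b: "runs (Mv cc (- 1)) (m(cc := tp (int (length ?v)) ?v)) 1 True (f (Suc p))"
      by (rule runs_Mv) (use v p in \<open>auto simp: f_def\<close>)
    show "runs (Wr cc 0 ;; Mv cc (- 1)) (f p) 3 True (f (Suc p))"
      by (rule runs_Seq[OF a b]) simp
  qed (auto simp: f_def)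
  have p4: "runs (Mv cc 1) (f ?n) 1 True (m(cc := tp 0 []))"
    by (rule runs_Mv) (auto simp: f_def)
  show ?thesis unfolding gc.simps
    by (rule runs_Seq[OF p1 runs_Seq[OF p2 runs_Seq[OF p3 p4 order_refl] order_refl]]) (use assms(2) le in simp)
qed

lemma runs_OutCtr:
  assumes "m cc = tp 0 (bsym n)" "m x = tp (int (length u)) u" "x \<noteq> cc" "20 * (n + 2) \<le> T"
  shows "runs (gc cc x OutCtr) m T True (m(x := tp (int (length (u @ psym (bsym n)))) (u @ psym (bsym n))))"
proof -
  let ?w = "bsym n"
  let ?n = "length ?w"
  have le: "?n \<le> n" by (rule length_bsym_le)
  define g where "g p = u @ psym (take p ?w)" for p
  define f where "f p = m(cc := tp (int p) ?w, x := tp (int (length (g p))) (g p))" for p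
  let ?b = "Cond cc {2} (outs x [2, 2]) (outs x [2, 1]) ;; Mv cc 1"
  have p1: "runs (While cc (- {0}) ?b) (f 0) (14 * ?n + 1) True (f ?n)"
  proof (rule runs_While_count[where T = 13])
    fix p assume p: "p < ?n"
    show "read_tape (f p cc) \<in> - {0}"
      using p assms(3) str_nonzero[OF bsym_nonzero, of "int p" n] by (simp add: f_def)
    have rd: "read_tape (f p cc) = ?w ! p" using p assms(3) by (simp add: f_def str_def)
    have g: "g (Suc p) = g p @ [2, ?w ! p]" using p by (simp add: g_def take_Suc_conv_app_nth)
    have "runs (outs x [2, ?w ! p]) (f p) 9 True ((f p)(x := tp (int (length (g (Suc p)))) (g (Suc p))))"
      unfolding g by (rule runs_outs) (auto simp: f_def)
    moreover have "?w ! p = 1 \<or> ?w ! p = 2" using nth_bits[OF bsym_bits p] by simp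
    ultimately have "runs (Cond cc {2} (outs x [2, 2]) (outs x [2, 1])) (f p) 10 True
        ((f p)(x := tp (int (length (g (Suc p)))) (g (Suc p))))"
      by (intro runs_Cond[where T = 9]) (auto simp: rd)
    moreover have "runs (Mv cc 1) ((f p)(x := tp (int (length (g (Suc p)))) (g (Suc p)))) 1 True (f (Suc p))"
      by (rule runs_Mv) (use assms(3) in \<open>auto simp: f_def fun_eq_iff add.commute\<close>)
    ultimately show "runs ?b (f p) 13 True (f (Suc p))" by (rule runs_Seq) simp
  qed (use assms(3) in \<open>auto simp: f_def\<close>)
  have f0: "f 0 = m" using assms by (auto simp: f_def g_def fun_eq_iff)
  have p2: "runs (Mv cc (- 1) ;; goL cc (- {0}) ;; Mv cc 1) (f ?n) (2 * ?n + 6) True ((f ?n)(cc := tp 0 ?w))"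
    by (rule runs_rewind[OF _ bsym_nonzero]) (use assms(3) in \<open>auto simp: f_def\<close>)
  have eq: "(f ?n)(cc := tp 0 ?w) = m(x := tp (int (length (u @ psym (bsym n)))) (u @ psym (bsym n)))"
    using assms by (auto simp: f_def g_def fun_eq_iff)
  show ?thesis unfolding gc.simps eq[symmetric]
    by (rule runs_Seq[OF p1[unfolded f0] p2]) (use assms(4) le in simp)
qed

definition ixs :: "nat \<Rightarrow> nat list" where
  "ixs k = 3 # replicate k 1"

lemma length_ixs [simp]: "length (ixs k) = Suc k"
  by (simp add: ixs_def)

lemma ixs_0 [simp]: "ixs 0 = [3]"
  by (simp add: ixs_def)

lemma ixs_Suc: "ixs (Suc k) = ixs k @ [1]"
  by (simp add: ixs_def replicate_append_same)

lemma str_ixs: "str (ixs k) p = (if p = 0 then 3 else if 1 \<le> p \<and> p \<le> int k then 1 else 0)"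
  by (auto simp: str_def ixs_def nth_Cons' nat_le_iff)

lemma runs_OutIdx:
  assumes "m (2 * i + 1) = tp (int k + 1) (ixs k)" "m x = tp (int (length u)) u" "x \<noteq> 2 * i + 1"
    "(k + 2) * (4 * length l + 10) \<le> T"
  shows "runs (gc cc x (OutIdx i l)) m T True
    (m(x := tp (int (length (u @ concat (replicate k l)))) (u @ concat (replicate k l))))"
proof -
  let ?a = "2 * i + 1" and ?s = "ixs k"
  define g where "g p = u @ concat (replicate p l)" for p
  define f where "f p = m(?a := tp (int k - int p) ?s, x := tp (int (length (g p))) (g p))" for p
  have p1: "runs (Mv ?a (- 1)) m 1 True (f 0)"
    by (rule runs_Mv) (use assms in \<open>auto simp: f_def g_def fun_eq_iff\<close>)
  have p2: "runs (While ?a {1} (outs x l ;; Mv ?a (- 1))) (f 0) (k * (4 * length l + 4) + 1) True (f k)"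
  proof (rule runs_While_count[where T = "4 * length l + 3"])
    fix p assume p: "p < k"
    show "read_tape (f p ?a) \<in> {1}" using p assms(3) by (simp add: f_def str_ixs)
    have g: "g (Suc p) = g p @ l" by (simp add: g_def replicate_append_same[symmetric])
    have "runs (outs x l) (f p) (4 * length l + 1) True ((f p)(x := tp (int (length (g (Suc p)))) (g (Suc p))))"
      unfolding g by (rule runs_outs) (auto simp: f_def)
    moreover have "runs (Mv ?a (- 1)) ((f p)(x := tp (int (length (g (Suc p)))) (g (Suc p)))) 1 True (f (Suc p))"
      by (rule runs_Mv) (use assms(3) in \<open>auto simp: f_def fun_eq_iff algebra_simps\<close>)
    ultimately show "runs (outs x l ;; Mv ?a (- 1)) (f p) (4 * length l + 3) True (f (Suc p))"
      by (rule runs_Seq) simp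
  qed (use assms(3) in \<open>auto simp: f_def str_ixs\<close>)
  let ?m = "m(x := tp (int (length (g k))) (g k))"
  have p3: "runs (Mv ?a 1) (f k) 1 True (?m(?a := tp 1 ?s))"
    by (rule runs_Mv) (use assms(3) in \<open>auto simp: f_def fun_eq_iff\<close>)
  have p4: "runs (goR ?a {1}) (?m(?a := tp 1 ?s)) (2 * k + 1) True ((?m(?a := tp 1 ?s))(?a := tp (int k + 1) ?s))"
    by (rule runs_goR[where k = k and p = 1]) (auto simp: str_ixs)
  have eq: "(?m(?a := tp 1 ?s))(?a := tp (int k + 1) ?s) = ?m"
    using assms(1,3) by (auto simp: fun_eq_iff)
  show ?thesis unfolding gc.simps g_def[symmetric]
    by (rule runs_Seq[OF p1 runs_Seq[OF p2 runs_Seq[OF p3 p4[unfolded eq] order_refl] order_refl]])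
      (use assms(4) in \<open>simp add: algebra_simps\<close>)
qed

lemma runs_compare:
  assumes "m a = tp (int k + 1) (ixs k)" "m b = tp (int k' + 1) (ixs k')" "a \<noteq> b"
    "runs (if k + c = k' then g else h) m T f m'" "T + 20 * (k + k' + c + 2) \<le> T'"
  shows "runs (let rest = Mv a 1 ;; goR a {1} ;; goR b {0} ;; Mv b 1 ;; goR b {1}
      in Mv a (- 1) ;; Mv b (- 1) ;; While a {1} (Mv a (- 1) ;; Mv b (- 1)) ;; stepback b c ;;
         Cond b {3} (rest ;; g) (rest ;; h)) m T' f m'"
proof -
  let ?s = "ixs k" and ?s' = "ixs k'"
  define F where "F p = m(a := tp (int k - int p) ?s, b := tp (int k' - int p) ?s')" for p
  have p1: "runs (Mv a (- 1)) m 1 True (m(a := tp (int k) ?s))"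
    by (rule runs_Mv) (use assms in auto)
  have p2: "runs (Mv b (- 1)) (m(a := tp (int k) ?s)) 1 True (F 0)"
    by (rule runs_Mv) (use assms in \<open>auto simp: F_def\<close>)
  have p3: "runs (While a {1} (Mv a (- 1) ;; Mv b (- 1))) (F 0) (4 * k + 1) True (F k)"
  proof (rule runs_While_count[where T = 3])
    fix p assume p: "p < k"
    show "read_tape (F p a) \<in> {1}" using p assms(3) by (simp add: F_def str_ixs)
    have x: "runs (Mv a (- 1)) (F p) 1 True (m(a := tp (int k - int (Suc p)) ?s, b := tp (int k' - int p) ?s'))"
      by (rule runs_Mv) (use assms(3) in \<open>auto simp: F_def fun_eq_iff algebra_simps\<close>)
    have y: "runs (Mv b (- 1)) (m(a := tp (int k - int (Suc p)) ?s, b := tp (int k' - int p) ?s')) 1 True (F (Suc p))"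
      by (rule runs_Mv) (use assms(3) in \<open>auto simp: F_def fun_eq_iff algebra_simps\<close>)
    show "runs (Mv a (- 1) ;; Mv b (- 1)) (F p) 3 True (F (Suc p))" by (rule runs_Seq[OF x y]) simp
  qed (use assms(3) in \<open>auto simp: F_def str_ixs\<close>)
  \<comment> \<open>The final position of the second head, whose sentinel is in cell 0. It is
    negative if the head has run past the sentinel.\<close>
  define q where "q = int k' - int k - int c"
  let ?m1 = "m(a := tp 0 ?s, b := tp q ?s')"
  have p4: "runs (stepback b c) (F k) (2 * c + 1) True ((F k)(b := tp q ?s'))"
    by (rule runs_stepback[where p = "int k' - int k"]) (auto simp: F_def q_def)
  have m1: "(F k)(b := tp q ?s') = ?m1" by (auto simp: F_def fun_eq_iff)
  have q: "q \<le> int k'" by (simp add: q_def)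
  have r1: "runs (Mv a 1) ?m1 1 True (m(a := tp 1 ?s, b := tp q ?s'))"
    by (rule runs_Mv) (use assms(3) in \<open>auto simp: fun_eq_iff\<close>)
  have r2: "runs (goR a {1}) (m(a := tp 1 ?s, b := tp q ?s')) (2 * k + 1) True
     ((m(a := tp 1 ?s, b := tp q ?s'))(a := tp (int k + 1) ?s))"
    by (rule runs_goR[where k = k and p = 1]) (use assms(3) in \<open>auto simp: str_ixs\<close>)
  have e2: "(m(a := tp 1 ?s, b := tp q ?s'))(a := tp (int k + 1) ?s) = m(b := tp q ?s')"
    using assms(1,3) by (auto simp: fun_eq_iff)
  have r3: "runs (goR b {0}) (m(b := tp q ?s')) (2 * (k + c) + 1) True ((m(b := tp q ?s'))(b := tp (max q 0) ?s'))"
    by (rule runs_goR[where k = "nat (- q)" and p = q]) (use q in \<open>auto simp: str_ixs q_def\<close>)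
  have r4: "runs (Mv b 1) (m(b := tp (max q 0) ?s')) 1 True (m(b := tp (max q 0 + 1) ?s'))"
    by (rule runs_Mv) auto
  have r5: "runs (goR b {1}) (m(b := tp (max q 0 + 1) ?s')) (2 * k' + 1) True
      ((m(b := tp (max q 0 + 1) ?s'))(b := tp (int k' + 1) ?s'))"
    by (rule runs_goR[where k = "nat (int k' - max q 0)" and p = "max q 0 + 1"])
      (use q in \<open>auto simp: str_ixs\<close>)
  have e5: "(m(b := tp (max q 0 + 1) ?s'))(b := tp (int k' + 1) ?s') = m"
    using assms(2) by (auto simp: fun_eq_iff)
  define rest where "rest = Mv a 1 ;; goR a {1} ;; goR b {0} ;; Mv b 1 ;; goR b {1}"
  have rs: "runs rest ?m1 (2 * k + 2 * (k + c) + 2 * k' + 9) True m"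
    unfolding rest_def
    by (rule runs_Seq[OF r1 runs_Seq[OF r2[unfolded e2] runs_Seq[OF r3[unfolded fun_upd_upd]
          runs_Seq[OF r4 r5[unfolded e5] order_refl] order_refl] order_refl]]) simp
  have "read_tape (?m1 b) \<in> {3} \<longleftrightarrow> k + c = k'"
    by (auto simp: str_ixs q_def)
  then have cond: "runs (Cond b {3} (rest ;; g) (rest ;; h)) ?m1 (2 * k + 2 * (k + c) + 2 * k' + 11 + T) f m'"
    using runs_Seq[OF rs assms(4) order_refl] by (intro runs_Cond) (auto split: if_splits)
  show ?thesis unfolding Let_def rest_def[symmetric]
    by (rule runs_Seq[OF p1 runs_Seq[OF p2 runs_Seq[OF p3 runs_Seq[OF p4[unfolded m1] cond order_refl]
          order_refl] order_refl]]) (use assms(5) in \<open>simp add: algebra_simps\<close>)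
qed

text \<open>\<open>A\<close> contains the variables whose loops are not running. \<open>For\<close>
  needs such a variable, as it expects its heads at the start and moves them.\<close>

fun gwf :: "nat set \<Rightarrow> nat set \<Rightarrow> gen \<Rightarrow> bool" where
  "gwf V A (OutIdx i l) \<longleftrightarrow> i \<in> V"
| "gwf V A (a ;> b) \<longleftrightarrow> gwf V A a \<and> gwf V A b"
| "gwf V A (For i g) \<longleftrightarrow> i \<in> A \<and> gwf V (A - {i}) g"
| "gwf V A (IfLet i S g h) \<longleftrightarrow> i \<in> V \<and> gwf V A g \<and> gwf V A h"
| "gwf V A (IfEq i j c g h) \<longleftrightarrow> i \<in> V \<and> j \<in> V \<and> i \<noteq> j \<and> gwf V A g \<and> gwf V A h"
| "gwf V A _ \<longleftrightarrow> True"

section \<open>Bounds on counter and time\<close>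

fun gib :: "nat \<Rightarrow> gen \<Rightarrow> nat" where
  "gib n Inc = 1"
| "gib n (a ;> b) = gib n a + gib n b"
| "gib n (For i g) = n * gib n g"
| "gib n (IfLet i S g h) = gib n g + gib n h"
| "gib n (IfEq i j c g h) = gib n g + gib n h"
| "gib n _ = 0"

fun gtb :: "nat \<Rightarrow> nat \<Rightarrow> gen \<Rightarrow> nat" where
  "gtb n N (Out a) = 5"
| "gtb n N Inc = 10 * (N + 2)"
| "gtb n N Dec = 10 * (N + 2)"
| "gtb n N Reset = 10 * (N + 2)"
| "gtb n N OutCtr = 20 * (N + 2)"
| "gtb n N (OutIdx i l) = (n + 2) * (4 * length l + 10)"
| "gtb n N GSkip = 1"
| "gtb n N (a ;> b) = gtb n N a + gtb n N b + 1"
| "gtb n N (For i g) = (n + 2) * (gtb n N g + 20)"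
| "gtb n N (IfLet i S g h) = gtb n N g + gtb n N h + 1"
| "gtb n N (IfEq i j c g h) = gtb n N g + gtb n N h + 20 * (2 * n + c + 2)"

lemma gfor_append:
  "gfor f (a @ b) n = (fst (gfor f a n) @ fst (gfor f b (snd (gfor f a n))), snd (gfor f b (snd (gfor f a n))))"
  by (induction a arbitrary: n) auto

definition gmem :: "nat set \<Rightarrow> nat \<Rightarrow> (nat \<Rightarrow> nat list) \<Rightarrow> (nat \<Rightarrow> nat) \<Rightarrow> nat \<Rightarrow> mem \<Rightarrow> bool" where
  "gmem V cc w ix n m \<longleftrightarrow> (\<forall>i\<in>V. m (2 * i) = tp (int (ix i)) (w i) \<and>
     m (2 * i + 1) = tp (int (ix i) + 1) (ixs (ix i))) \<and> m cc = tp 0 (bsym n)"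

definition gres :: "nat \<Rightarrow> nat \<Rightarrow> nat list \<Rightarrow> nat list \<times> nat \<Rightarrow> mem \<Rightarrow> mem" where
  "gres cc x u r m = m(cc := tp 0 (bsym (snd r)), x := tp (int (length (u @ fst r))) (u @ fst r))"

lemma gc_For:
  assumes m: "m (2 * i) = tp 0 v" "m (2 * i + 1) = tp 1 [3]" "m cc = tp 0 (bsym n)" "m x = tp (int (length u)) u"
    and neq: "x \<noteq> cc" "x \<noteq> 2 * i" "x \<noteq> 2 * i + 1" "cc \<noteq> 2 * i" "cc \<noteq> 2 * i + 1"
    and v: "0 \<notin> set v" "length v \<le> nn"
    and body: "\<And>p. p < length v \<Longrightarrow> runs (gc cc x g)
       (gres cc x u (gfor F [0..<p] n) (m(2 * i := tp (int p) v, 2 * i + 1 := tp (int p + 1) (ixs p)))) B True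
       (gres cc x u (gfor F [0..<Suc p] n) (m(2 * i := tp (int p) v, 2 * i + 1 := tp (int p + 1) (ixs p))))"
    and T: "(nn + 2) * (B + 20) \<le> T"
  shows "runs (gc cc x (For i g)) m T True (gres cc x u (gfor F [0..<length v] n) m)"
proof -
  let ?a = "2 * i" and ?b = "2 * i + 1" and ?N = "length v"
  define f where "f p = gres cc x u (gfor F [0..<p] n) (m(?a := tp (int p) v, ?b := tp (int p + 1) (ixs p)))" for p
  let ?body = "gc cc x g ;; Wr ?b 1 ;; Mv ?b 1 ;; Mv ?a 1"
  have p1: "runs (While ?a (- {0}) ?body) (f 0) (?N * (B + 7) + 1) True (f ?N)"
  proof (rule runs_While_count[where T = "B + 6"])
    fix p assume p: "p < ?N"
    show "read_tape (f p ?a) \<in> - {0}"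
      using p neq str_nonzero[OF v(1), of "int p"] by (simp add: f_def gres_def)
    define M where "M q s = gres cc x u (gfor F [0..<Suc p] n) (m(?a := tp (int p) v, ?b := tp q s))" for q s
    have a: "runs (gc cc x g) (f p) B True (M (int p + 1) (ixs p))"
      unfolding f_def M_def by (rule body[OF p])
    have b: "runs (Wr ?b 1) (M (int p + 1) (ixs p)) 1 True (M (int p + 1) (ixs (Suc p)))"
    proof (rule runs_Wr)
      have "wr 1 (tp (int p + 1) (ixs p)) = tp (int p + 1) (ixs (Suc p))"
        using wr_tp_append[of "int p + 1" "ixs p" 1] by (simp add: ixs_Suc)
      then show "M (int p + 1) (ixs (Suc p)) = (M (int p + 1) (ixs p))(?b := wr 1 (M (int p + 1) (ixs p) ?b))"
        using neq by (auto simp: M_def gres_def fun_eq_iff)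
    qed simp
    have c: "runs (Mv ?b 1) (M (int p + 1) (ixs (Suc p))) 1 True (M (2 + int p) (ixs (Suc p)))"
      by (rule runs_Mv) (use neq in \<open>auto simp: M_def gres_def fun_eq_iff\<close>)
    have d: "runs (Mv ?a 1) (M (2 + int p) (ixs (Suc p))) 1 True (f (Suc p))"
      by (rule runs_Mv) (use neq in \<open>auto simp: M_def f_def gres_def fun_eq_iff algebra_simps\<close>)
    show "runs ?body (f p) (B + 6) True (f (Suc p))"
      by (rule runs_Seq[OF a runs_Seq[OF b runs_Seq[OF c d order_refl] order_refl]]) simp
  qed (use neq in \<open>auto simp: f_def gres_def\<close>)
  have f0: "f 0 = m" using m neq by (auto simp: f_def gres_def fun_eq_iff)
  define R where "R q s p = gres cc x u (gfor F [0..<?N] n) (m(?a := tp p v, ?b := tp q s))" for q s p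
  have "runs (Mv ?a (- 1) ;; goL ?a (- {0}) ;; Mv ?a 1) (f ?N) (2 * ?N + 6) True ((f ?N)(?a := tp 0 v))"
    by (rule runs_rewind[OF _ v(1)]) (use neq in \<open>auto simp: f_def gres_def\<close>)
  moreover have "(f ?N)(?a := tp 0 v) = R (int ?N + 1) (ixs ?N) 0"
    using neq by (auto simp: f_def R_def gres_def fun_eq_iff)
  ultimately have p2: "runs (Mv ?a (- 1) ;; goL ?a (- {0}) ;; Mv ?a 1) (f ?N) (2 * ?N + 6) True (R (int ?N + 1) (ixs ?N) 0)"
    by simp
  define h where "h p = R (int ?N - int p) (ixs (?N - p)) 0" for p
  have p3: "runs (Mv ?b (- 1)) (R (int ?N + 1) (ixs ?N) 0) 1 True (h 0)"
    by (rule runs_Mv) (use neq in \<open>auto simp: h_def R_def gres_def fun_eq_iff\<close>)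
  have p4: "runs (While ?b {1} (Wr ?b 0 ;; Mv ?b (- 1))) (h 0) (?N * 4 + 1) True (h ?N)"
  proof (rule runs_While_count[where T = 3])
    fix p assume p: "p < ?N"
    show "read_tape (h p ?b) \<in> {1}" using p neq by (simp add: h_def R_def gres_def str_ixs)
    have s: "ixs (?N - p) = ixs (?N - Suc p) @ [1]"
      using p ixs_Suc[of "?N - Suc p"] by (simp add: Suc_diff_Suc)
    have w: "wr 0 (tp (int ?N - int p) (ixs (?N - p))) = tp (int ?N - int p) (ixs (?N - Suc p))"
      unfolding s by (rule wr_tp_last) (use p in auto)
    have a: "runs (Wr ?b 0) (h p) 1 True (R (int ?N - int p) (ixs (?N - Suc p)) 0)"
      by (rule runs_Wr) (use w neq in \<open>auto simp: h_def R_def gres_def fun_eq_iff\<close>)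
    have b: "runs (Mv ?b (- 1)) (R (int ?N - int p) (ixs (?N - Suc p)) 0) 1 True (h (Suc p))"
      by (rule runs_Mv) (use neq in \<open>auto simp: h_def R_def gres_def fun_eq_iff algebra_simps\<close>)
    show "runs (Wr ?b 0 ;; Mv ?b (- 1)) (h p) 3 True (h (Suc p))" by (rule runs_Seq[OF a b]) simp
  qed (use neq in \<open>auto simp: h_def R_def gres_def str_ixs str_def\<close>)
  have p5: "runs (Mv ?b 1) (h ?N) 1 True (gres cc x u (gfor F [0..<?N] n) m)"
    by (rule runs_Mv) (use neq m(1,2) in \<open>auto simp: h_def R_def gres_def fun_eq_iff\<close>)
  \<comment> \<open>The compiled loop nests its sequence to the right, whereas
    \<open>runs_rewind\<close> is about a group of three commands in the middle of it.\<close>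
  have assoc: "runs (A ;; A1 ;; A2 ;; A3 ;; K) M t fl M'" if *: "runs A M t1 True M1"
    "runs (A1 ;; A2 ;; A3) M1 t2 True M2" "runs K M2 t3 fl M'" "t1 + t2 + t3 + 2 \<le> t" for A A1 A2 A3 K M t fl M' M1 M2 t1 t2 t3
  proof -
    obtain s1 where s1: "s1 \<le> t2" "exec (A1 ;; A2 ;; A3) M1 s1 True M2" using *(2) by (auto simp: runs_def)
    from s1(2) obtain Ma r1 r2 where r: "exec A1 M1 r1 True Ma" "exec (A2 ;; A3) Ma r2 True M2" "s1 = Suc (r1 + r2)"
      by cases auto
    from r(2) obtain Mb q1 q2 where q: "exec A2 Ma q1 True Mb" "exec A3 Mb q2 True M2" "r2 = Suc (q1 + q2)"
      by cases auto
    have a: "runs A1 M1 r1 True Ma" "runs A2 Ma q1 True Mb" "runs A3 Mb q2 True M2"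
      using r q by (auto simp: runs_def)
    show ?thesis
      by (rule runs_Seq[OF *(1) runs_Seq[OF a(1) runs_Seq[OF a(2) runs_Seq[OF a(3) *(3) order_refl]
            order_refl] order_refl]]) (use s1(1) r(3) q(3) *(4) in simp)
  qed
  have tail: "runs (Mv ?b (- 1) ;; While ?b {1} (Wr ?b 0 ;; Mv ?b (- 1)) ;; Mv ?b 1)
      (R (int ?N + 1) (ixs ?N) 0) (?N * 4 + 5) True (gres cc x u (gfor F [0..<?N] n) m)"
    by (rule runs_Seq[OF p3 runs_Seq[OF p4 p5 order_refl]]) simp
  have time: "?N * (B + 7) + 1 + (2 * ?N + 6) + (?N * 4 + 5) + 2 \<le> T"
  proof -
    have "?N * (B + 13) \<le> nn * (B + 13)" using v(2) by (rule mult_le_mono1)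
    moreover have "?N * (B + 7) + 1 + (2 * ?N + 6) + (?N * 4 + 5) + 2 = ?N * (B + 13) + 14"
      by (simp add: algebra_simps)
    moreover have "nn * (B + 13) + 14 \<le> (nn + 2) * (B + 20)" by (simp add: algebra_simps)
    ultimately show ?thesis using T by linarith
  qed
  show ?thesis unfolding gc.simps by (rule assoc[OF p1[unfolded f0] p2 tail time])
qed

lemma runs_conjI: "runs c m T True m' \<Longrightarrow> r = m' \<Longrightarrow> Q \<Longrightarrow> runs c m T True r \<and> Q"
  by simp

text \<open>The bound on the counter is proved together with the run, since the time of the counter
  commands depends on the value of the counter.\<close>

lemma gc_correct:
  assumes "gwf V A g" "gmem V cc w ix n m" "m x = tp (int (length u)) u" "\<forall>i\<in>A. ix i = 0" "A \<subseteq> V"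
    "x \<noteq> cc" "\<forall>i\<in>V. x \<noteq> 2 * i \<and> x \<noteq> 2 * i + 1 \<and> cc \<noteq> 2 * i \<and> cc \<noteq> 2 * i + 1"
    "\<forall>i\<in>V. 0 \<notin> set (w i) \<and> length (w i) \<le> nn \<and> ix i \<le> nn" "n + gib nn g \<le> N"
  shows "runs (gc cc x g) m (gtb nn N g) True (gres cc x u (gsem w g ix n) m) \<and>
    snd (gsem w g ix n) \<le> n + gib nn g"
  using assms
proof (induction g arbitrary: A ix n m u)
  case (Out a)
  have e: "gres cc x u (gsem w (Out a) ix n) m = m(x := tp (int (length (u @ [a]))) (u @ [a]))"
    using Out.prems(2) by (auto simp: gres_def gmem_def)
  have r: "runs (gc cc x (Out a)) m 5 True (m(x := tp (int (length (u @ [a]))) (u @ [a])))"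
    unfolding gc.simps by (rule runs_outs) (use Out in auto)
  show ?case unfolding gtb.simps by (rule runs_conjI[OF r e]) simp
next
  case Inc
  have "runs (gc cc x Inc) m (10 * (N + 2)) True (m(cc := tp 0 (bsym (Suc n))))"
    by (rule runs_Inc) (use Inc in \<open>auto simp: gmem_def\<close>)
  moreover have "gres cc x u (gsem w Inc ix n) m = m(cc := tp 0 (bsym (Suc n)))"
    using Inc by (auto simp: gres_def fun_eq_iff)
  ultimately show ?case unfolding gtb.simps by (rule runs_conjI) simp
next
  case Dec
  have "runs (gc cc x Dec) m (10 * (N + 2)) True (m(cc := tp 0 (bsym (n - 1))))"
    by (rule runs_Dec) (use Dec in \<open>auto simp: gmem_def\<close>)
  moreover have "gres cc x u (gsem w Dec ix n) m = m(cc := tp 0 (bsym (n - 1)))"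
    using Dec by (auto simp: gres_def fun_eq_iff)
  ultimately show ?case unfolding gtb.simps by (rule runs_conjI) simp
next
  case Reset
  have "runs (gc cc x Reset) m (10 * (N + 2)) True (m(cc := tp 0 []))"
    by (rule runs_Reset) (use Reset in \<open>auto simp: gmem_def\<close>)
  moreover have "gres cc x u (gsem w Reset ix n) m = m(cc := tp 0 [])"
    using Reset by (auto simp: gres_def fun_eq_iff bsym_def)
  ultimately show ?case unfolding gtb.simps by (rule runs_conjI) simp
next
  case OutCtr
  have "runs (gc cc x OutCtr) m (20 * (N + 2)) True
     (m(x := tp (int (length (u @ psym (bsym n)))) (u @ psym (bsym n))))"
    by (rule runs_OutCtr) (use OutCtr in \<open>auto simp: gmem_def\<close>)
  moreover have "gres cc x u (gsem w OutCtr ix n) m =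
     m(x := tp (int (length (u @ psym (bsym n)))) (u @ psym (bsym n)))"
    using OutCtr by (auto simp: gres_def gmem_def fun_eq_iff)
  ultimately show ?case unfolding gtb.simps by (rule runs_conjI) simp
next
  case (OutIdx i l)
  have i: "i \<in> V" using OutIdx.prems(1) by simp
  have "runs (gc cc x (OutIdx i l)) m ((nn + 2) * (4 * length l + 10)) True
     (m(x := tp (int (length (u @ concat (replicate (ix i) l)))) (u @ concat (replicate (ix i) l))))"
    by (rule runs_OutIdx) (use OutIdx.prems i in \<open>auto simp: gmem_def intro!: mult_le_mono1\<close>)
  moreover have "gres cc x u (gsem w (OutIdx i l) ix n) m =
     m(x := tp (int (length (u @ concat (replicate (ix i) l)))) (u @ concat (replicate (ix i) l)))"
    using OutIdx.prems by (auto simp: gres_def gmem_def fun_eq_iff)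
  ultimately show ?case unfolding gtb.simps by (rule runs_conjI) simp
next
  case GSkip
  have "runs (Mv x 0) m 1 True m" by (rule runs_Mv) (auto simp: mv_def)
  then show ?case using GSkip by (auto simp: gres_def gmem_def fun_upd_idem)
next
  case (GSeq a b)
  let ?r = "gsem w a ix n"
  have IH1: "runs (gc cc x a) m (gtb nn N a) True (gres cc x u ?r m)" "snd ?r \<le> n + gib nn a"
    using GSeq.IH(1)[of A ix n m u] GSeq.prems by auto
  have mem: "gmem V cc w ix (snd ?r) (gres cc x u ?r m)"
    using GSeq.prems(2,6,7) by (auto simp: gmem_def gres_def)
  have IH2: "runs (gc cc x b) (gres cc x u ?r m) (gtb nn N b) True
      (gres cc x (u @ fst ?r) (gsem w b ix (snd ?r)) (gres cc x u ?r m)) \<and>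
     snd (gsem w b ix (snd ?r)) \<le> snd ?r + gib nn b"
    by (rule GSeq.IH(2)[OF _ mem]) (use GSeq.prems IH1(2) in \<open>auto simp: gres_def\<close>)
  have eq: "gres cc x (u @ fst ?r) (gsem w b ix (snd ?r)) (gres cc x u ?r m) = gres cc x u (gsem w (a ;> b) ix n) m"
    by (auto simp: gres_def fun_eq_iff)
  have "runs (gc cc x a ;; gc cc x b) m (gtb nn N (a ;> b)) True (gres cc x u (gsem w (a ;> b) ix n) m)"
    by (rule runs_Seq[OF IH1(1) IH2[THEN conjunct1, unfolded eq]]) simp
  then show ?case using IH1(2) IH2 by simp
next
  case (For i g)
  have i: "i \<in> A" "i \<in> V" "ix i = 0" "gwf V (A - {i}) g" using For.prems by auto
  let ?F = "\<lambda>p. gsem w g (ix(i := p))" and ?v = "w i"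
  have v: "0 \<notin> set ?v" "length ?v \<le> nn" using For.prems(8) i by auto
  have inc: "n + nn * gib nn g \<le> N" using For.prems(9) by simp
  have step: "runs (gc cc x g) (gres cc x u (gfor ?F [0..<p] n) (m(2 * i := tp (int p) ?v, 2 * i + 1 := tp (int p + 1) (ixs p))))
       (gtb nn N g) True
       (gres cc x u (gfor ?F [0..<Suc p] n) (m(2 * i := tp (int p) ?v, 2 * i + 1 := tp (int p + 1) (ixs p)))) \<and>
     snd (gfor ?F [0..<Suc p] n) \<le> n + Suc p * gib nn g"
    if p: "p < length ?v" and c: "snd (gfor ?F [0..<p] n) \<le> n + p * gib nn g" for p
  proof -
    let ?r = "gfor ?F [0..<p] n"
    let ?m = "m(2 * i := tp (int p) ?v, 2 * i + 1 := tp (int p + 1) (ixs p))"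
    have "Suc p * gib nn g \<le> nn * gib nn g" using p v(2) by (intro mult_le_mono1) simp
    then have c': "snd ?r + gib nn g \<le> N" using c inc by simp
    have mem: "gmem V cc w (ix(i := p)) (snd ?r) (gres cc x u ?r ?m)"
      using For.prems(2,6,7) unfolding gmem_def gres_def by (auto; presburger)
    have "runs (gc cc x g) (gres cc x u ?r ?m) (gtb nn N g) True
        (gres cc x (u @ fst ?r) (?F p (snd ?r)) (gres cc x u ?r ?m)) \<and>
       snd (?F p (snd ?r)) \<le> snd ?r + gib nn g"
      by (rule For.IH[OF i(4) mem]) (use For.prems p v c' in \<open>auto simp: gres_def\<close>)
    moreover have "gres cc x (u @ fst ?r) (?F p (snd ?r)) (gres cc x u ?r ?m) = gres cc x u (gfor ?F [0..<Suc p] n) ?m"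
      by (auto simp: gres_def gfor_append fun_eq_iff)
    moreover have "snd (gfor ?F [0..<Suc p] n) = snd (?F p (snd ?r))" by (simp add: gfor_append)
    ultimately show ?thesis using c by simp
  qed
  have ctr: "snd (gfor ?F [0..<p] n) \<le> n + p * gib nn g" if "p \<le> length ?v" for p
    using that
  proof (induction p)
    case (Suc p)
    have "p < length ?v" "p \<le> length ?v" using Suc.prems by auto
    from step[OF this(1) Suc.IH[OF this(2)]] show ?case by (rule conjunct2)
  qed simp
  have "runs (gc cc x (For i g)) m (gtb nn N (For i g)) True (gres cc x u (gfor ?F [0..<length ?v] n) m)"
  proof (rule gc_For[where u = u and v = ?v and nn = nn and B = "gtb nn N g" and m = m])
    show "m (2 * i) = tp 0 ?v" "m (2 * i + 1) = tp 1 [3]" "m cc = tp 0 (bsym n)"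
      using For.prems(2) i by (auto simp: gmem_def)
    show "m x = tp (int (length u)) u" "x \<noteq> cc" by (fact For.prems)+
    show "x \<noteq> 2 * i" "x \<noteq> 2 * i + 1" "cc \<noteq> 2 * i" "cc \<noteq> 2 * i + 1" using For.prems(7) i by auto
    show "0 \<notin> set ?v" "length ?v \<le> nn" by (fact v)+
    show "(nn + 2) * (gtb nn N g + 20) \<le> gtb nn N (For i g)" by simp
  qed (rule step[THEN conjunct1], assumption, rule ctr, rule less_imp_le)
  moreover have "snd (gfor ?F [0..<length ?v] n) \<le> n + nn * gib nn g"
    using ctr[of "length ?v"] mult_le_mono1[OF v(2), of "gib nn g"] by (rule_tac order_trans) auto
  ultimately show ?case unfolding gsem.simps gib.simps by (rule conjI)
next
  case (IfLet i S g h)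
  have i: "i \<in> V" using IfLet.prems(1) by simp
  have rd: "read_tape (m (2 * i)) = str (w i) (int (ix i))" using IfLet.prems(2) i by (simp add: gmem_def)
  show ?case
  proof (cases "str (w i) (int (ix i)) \<in> S")
    case True
    have "runs (gc cc x g) m (gtb nn N g) True (gres cc x u (gsem w g ix n) m) \<and> snd (gsem w g ix n) \<le> n + gib nn g"
      by (rule IfLet.IH(1)) (use IfLet.prems in auto)
    then show ?thesis using True rd by (auto intro!: runs_Cond[where T = "gtb nn N g"])
  next
    case False
    have "runs (gc cc x h) m (gtb nn N h) True (gres cc x u (gsem w h ix n) m) \<and> snd (gsem w h ix n) \<le> n + gib nn h"
      by (rule IfLet.IH(2)) (use IfLet.prems in auto)
    then show ?thesis using False rd by (auto intro!: runs_Cond[where T = "gtb nn N h"])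
  qed
next
  case (IfEq i j c g h)
  have i: "i \<in> V" "j \<in> V" "i \<noteq> j" using IfEq.prems(1) by auto
  let ?e = "if ix i + c = ix j then g else h"
  have IH: "runs (gc cc x ?e) m (gtb nn N ?e) True (gres cc x u (gsem w ?e ix n) m) \<and> snd (gsem w ?e ix n) \<le> n + gib nn ?e"
  proof (cases "ix i + c = ix j")
    case True
    show ?thesis unfolding if_P[OF True] by (rule IfEq.IH(1)) (use IfEq.prems in auto)
  next
    case False
    show ?thesis unfolding if_not_P[OF False] by (rule IfEq.IH(2)) (use IfEq.prems in auto)
  qed
  have e: "gsem w (IfEq i j c g h) ix n = gsem w ?e ix n" "gtb nn N ?e \<le> gtb nn N g + gtb nn N h"
    "gib nn ?e \<le> gib nn g + gib nn h" "(if ix i + c = ix j then gc cc x g else gc cc x h) = gc cc x ?e" by auto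
  have "runs (gc cc x (IfEq i j c g h)) m (gtb nn N (IfEq i j c g h)) True (gres cc x u (gsem w ?e ix n) m)"
    unfolding gc.simps Let_def[of "2 * i + 1"] Let_def[of "2 * j + 1"]
  proof (rule runs_compare[where k = "ix i" and k' = "ix j" and T = "gtb nn N ?e"])
    show "gtb nn N ?e + 20 * (ix i + ix j + c + 2) \<le> gtb nn N (IfEq i j c g h)"
    proof -
      have "ix i \<le> nn" "ix j \<le> nn" using IfEq.prems(8) i by auto
      then show ?thesis using e(2) by simp
    qed
  qed (use IfEq.prems(2) i IH e(4) in \<open>auto simp: gmem_def\<close>)
  then show ?case using IH e by simp
qed

section \<open>Polynomially bounded functions\<close>

definition polyb :: "(nat \<Rightarrow> nat) \<Rightarrow> bool" where
  "polyb f \<longleftrightarrow> (\<exists>p :: nat poly. \<forall>n. f n \<le> poly p n)"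

lemma polybI: "(\<And>n. f n \<le> poly p n) \<Longrightarrow> polyb f"
  unfolding polyb_def by blast

lemma poly_mono_nat: "x \<le> y \<Longrightarrow> poly p x \<le> poly p (y :: nat)" for p :: "nat poly"
  by (induction p) (auto intro: add_mono mult_mono)

lemma polyb_const: "polyb (\<lambda>n. c)"
  by (rule polybI[where p = "[:c:]"]) simp

lemma polyb_id: "polyb (\<lambda>n. n)"
  by (rule polybI[where p = "[:0, 1:]"]) simp

lemma polyb_add: "polyb f \<Longrightarrow> polyb g \<Longrightarrow> polyb (\<lambda>n. f n + g n)"
proof -
  assume "polyb f" "polyb g"
  then obtain p q :: "nat poly" where "\<forall>n. f n \<le> poly p n" "\<forall>n. g n \<le> poly q n" by (auto simp: polyb_def)
  then show ?thesis by (intro polybI[where p = "p + q"]) (simp add: add_mono)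
qed

lemma polyb_mult: "polyb f \<Longrightarrow> polyb g \<Longrightarrow> polyb (\<lambda>n. f n * g n)"
proof -
  assume "polyb f" "polyb g"
  then obtain p q :: "nat poly" where "\<forall>n. f n \<le> poly p n" "\<forall>n. g n \<le> poly q n" by (auto simp: polyb_def)
  then show ?thesis by (intro polybI[where p = "p * q"]) (simp add: mult_mono)
qed

lemma polyb_comp: "polyb f \<Longrightarrow> polyb g \<Longrightarrow> polyb (\<lambda>n. f (g n))"
proof -
  assume "polyb f" "polyb g"
  then obtain p q :: "nat poly" where *: "\<forall>n. f n \<le> poly p n" "\<forall>n. g n \<le> poly q n" by (auto simp: polyb_def)
  then show ?thesis
    by (intro polybI[where p = "pcompose p q"])
      (auto simp: poly_pcompose intro: order_trans[OF spec[OF *(1)] poly_mono_nat])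
qed

lemmas polyb_intros = polyb_const polyb_id polyb_add polyb_mult

lemma polyb_gib: "polyb (\<lambda>n. gib n g)"
  by (induction g; unfold gib.simps; (assumption | rule polyb_intros)+)

lemma polyb_gtb: "polyb f \<Longrightarrow> polyb (\<lambda>n. gtb n (f n) g)"
  by (induction g; unfold gtb.simps; (assumption | rule polyb_intros)+)

text \<open>Letters are nonzero because a loop over the string will stop at the first blank.\<close>

fun gok :: "nat \<Rightarrow> gen \<Rightarrow> bool" where
  "gok G (Out a) \<longleftrightarrow> 0 < a \<and> a < G"
| "gok G (OutIdx i l) \<longleftrightarrow> set l \<subseteq> {0<..<G}"
| "gok G (a ;> b) \<longleftrightarrow> gok G a \<and> gok G b"
| "gok G (For i g) \<longleftrightarrow> gok G g"
| "gok G (IfLet i S g h) \<longleftrightarrow> gok G g \<and> gok G h"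
| "gok G (IfEq i j c g h) \<longleftrightarrow> gok G g \<and> gok G h"
| "gok G _ \<longleftrightarrow> True"

lemma set_gfor: "(\<And>p n. set (fst (f p n)) \<subseteq> A) \<Longrightarrow> set (fst (gfor f l n)) \<subseteq> A"
  by (induction l arbitrary: n) auto

lemma set_psym: "set l \<subseteq> A \<Longrightarrow> 2 \<in> A \<Longrightarrow> set (psym l) \<subseteq> A"
  by (induction l) auto

lemma gsem_letters: "gok G g \<Longrightarrow> 3 \<le> G \<Longrightarrow> set (fst (gsem w g ix n)) \<subseteq> {0<..<G}"
proof (induction g arbitrary: ix n)
  case OutCtr
  then show ?case using set_psym[OF order_trans[OF bsym_bits], of "{0<..<G}" n] by auto
next
  case (For i g)
  then show ?case unfolding gsem.simps by (intro set_gfor) auto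
next
  case (GSeq a b)
  then show ?case by simp
qed auto

lemma length_gfor: "(\<And>p n. p \<in> set l \<Longrightarrow> n \<le> N \<Longrightarrow> length (fst (f p n)) \<le> B \<and> snd (f p n) \<le> N) \<Longrightarrow>
    n \<le> N \<Longrightarrow> length (fst (gfor f l n)) \<le> length l * B \<and> snd (gfor f l n) \<le> N"
proof (induction l arbitrary: n)
  case (Cons a l)
  from Cons.prems(1)[of a n] Cons.prems(2) have a: "length (fst (f a n)) \<le> B" "snd (f a n) \<le> N" by auto
  from Cons.IH[OF _ a(2)] Cons.prems(1) have
    "length (fst (gfor f l (snd (f a n)))) \<le> length l * B" "snd (gfor f l (snd (f a n))) \<le> N" by auto
  then show ?case using a(1) by simp
qed simp

lemma length_gsem:
  assumes "\<forall>i. ix i \<le> nn" "\<forall>i. length (w i) \<le> nn" "\<forall>n. gib n g = 0" "n \<le> N"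
  shows "length (fst (gsem w g ix n)) \<le> gtb nn N g \<and> snd (gsem w g ix n) \<le> N"
  using assms
proof (induction g arbitrary: ix n)
  case OutCtr
  have "length (psym l) = 2 * length l" for l by (induction l) auto
  then show ?case using length_bsym_le[of n] OutCtr by simp
next
  case (OutIdx i l)
  have "ix i * length l \<le> (nn + 2) * (4 * length l + 10)" using OutIdx.prems(1)[rule_format, of i] by (intro mult_mono) auto
  then show ?case using OutIdx by (simp add: length_concat sum_list_replicate)
next
  case (GSeq a b)
  have "\<forall>n. gib n a = 0" "\<forall>n. gib n b = 0" using GSeq.prems(3) by auto
  then have a: "length (fst (gsem w a ix n)) \<le> gtb nn N a" "snd (gsem w a ix n) \<le> N"
    using GSeq.IH(1) GSeq.prems by auto
  with GSeq.IH(2)[of ix "snd (gsem w a ix n)"] GSeq.prems \<open>\<forall>n. gib n b = 0\<close> show ?case by simp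
next
  case (For i g)
  \<comment> \<open>\<open>n * gib n g = 0\<close> says nothing for \<open>n = 0\<close>;
    monotonicity in \<open>n\<close> closes the gap.\<close>
  have g: "gib n g = 0" for n
  proof -
    have "gib (Suc k) g = 0" for k using For.prems(3)[rule_format, of "Suc k"] by simp
    moreover have "gib n g \<le> gib (Suc n) g" for g
      by (induction g) (auto intro: add_mono trans_le_add2)
    ultimately show ?thesis using le_zero_eq by metis
  qed
  have "length (fst (gfor (\<lambda>p. gsem w g (ix(i := p))) [0..<length (w i)] n)) \<le> length [0..<length (w i)] * gtb nn N g \<and>
     snd (gfor (\<lambda>p. gsem w g (ix(i := p))) [0..<length (w i)] n) \<le> N"
  proof (rule length_gfor)
    fix p n assume p: "p \<in> set [0..<length (w i)]" and n: "n \<le> N"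
    have "p \<le> nn" using p For.prems(2)[rule_format, of i] by simp
    then have "\<forall>k. (ix(i := p)) k \<le> nn" using For.prems(1) by simp
    from For.IH[OF this For.prems(2) _ n] g
    show "length (fst (gsem w g (ix(i := p)) n)) \<le> gtb nn N g \<and> snd (gsem w g (ix(i := p)) n) \<le> N" by blast
  qed (fact For.prems)
  moreover have "length (w i) * gtb nn N g \<le> (nn + 2) * (gtb nn N g + 20)"
    using For.prems(2)[rule_format, of i] by (intro mult_mono) auto
  ultimately show ?case by (auto intro: order_trans)
next
  case (IfLet i S g h)
  have "\<forall>n. gib n g = 0" "\<forall>n. gib n h = 0" using IfLet.prems(3) by auto
  with IfLet.IH[of ix n] IfLet.prems show ?case by auto
next
  case (IfEq i j c g h)
  have "\<forall>n. gib n g = 0" "\<forall>n. gib n h = 0" using IfEq.prems(3) by auto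
  with IfEq.IH[of ix n] IfEq.prems show ?case by auto
qed auto

section \<open>Well-formed programs and stages\<close>

lemma wfc_outs: "set l \<subseteq> {..<G} \<Longrightarrow> x < k \<Longrightarrow> wfc k G (outs x l)"
  by (induction l) auto

lemma wfc_stepback: "t < k \<Longrightarrow> wfc k G (stepback t c)"
  by (induction c) auto

lemma wfc_gc:
  assumes "gok G g" "gwf V A g" "A \<subseteq> V" "\<forall>i\<in>V. 2 * i + 1 < k" "cc < k" "x < k" "4 \<le> G"
  shows "wfc k G (gc cc x g)"
  using assms
proof (induction g arbitrary: A)
  case (OutIdx i l)
  then show ?case by (auto intro!: wfc_outs)
next
  case (For i g)
  then have "wfc k G (gc cc x g)" "2 * i + 1 < k" by auto
  then show ?case using For.prems by simp
next
  case (IfLet i S g h)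
  have "2 * i + 1 < k" using IfLet.prems by auto
  then have "2 * i < k" by simp
  moreover have "wfc k G (gc cc x g)" "wfc k G (gc cc x h)"
    using IfLet.IH[of A] IfLet.prems by auto
  ultimately show ?case by simp
next
  case (IfEq i j c g h)
  have "2 * i + 1 < k" "2 * j + 1 < k" using IfEq.prems by auto
  moreover have "wfc k G (gc cc x g)" "wfc k G (gc cc x h)"
    using IfEq.IH[of A] IfEq.prems by auto
  ultimately show ?case by (simp add: Let_def wfc_stepback)
qed auto

text \<open>A loop is as long as its string, so polynomially long loops need strings of that length.
  They are produced in stages, each looping over the strings before it.\<close>

fun stg :: "nat \<Rightarrow> gen list \<Rightarrow> (nat \<Rightarrow> nat list) \<Rightarrow> nat \<Rightarrow> nat list" where
  "stg j [] w = w"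
| "stg j (g # gs) w = stg (Suc j) gs (w(j := fst (gsem w g (\<lambda>_. 0) 0)))"

fun wfs :: "nat \<Rightarrow> nat \<Rightarrow> gen list \<Rightarrow> bool" where
  "wfs G j [] \<longleftrightarrow> True"
| "wfs G j (g # gs) \<longleftrightarrow> gok G g \<and> gwf {..<j} {..<j} g \<and> (\<forall>n. gib n g = 0) \<and> wfs G (Suc j) gs"

fun stc :: "nat \<Rightarrow> nat \<Rightarrow> gen list \<Rightarrow> com \<Rightarrow> com" where
  "stc cc j [] c = c"
| "stc cc j (g # gs) c = gc cc (2 * j) g ;; (Mv (2 * j) (- 1) ;; goL (2 * j) (- {0}) ;; Mv (2 * j) 1) ;; stc cc (Suc j) gs c"

text \<open>Bounds the length of every string after the stages; by \<open>length_gsem\<close> the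
  time bound of a stage also bounds its output.\<close>

fun slen :: "gen list \<Rightarrow> nat \<Rightarrow> nat" where
  "slen [] n = n"
| "slen (g # gs) n = slen gs (n + gtb n 0 g)"

fun stime :: "gen list \<Rightarrow> nat \<Rightarrow> nat" where
  "stime [] n = 0"
| "stime (g # gs) n = 3 * gtb n 0 g + 8 + stime gs (n + gtb n 0 g)"

lemma stg_append: "stg j (a @ b) w = stg (j + length a) b (stg j a w)"
  by (induction a arbitrary: j w) auto

lemma wfs_append: "wfs G j (a @ b) \<longleftrightarrow> wfs G j a \<and> wfs G (j + length a) b"
  by (induction a arbitrary: j) auto

lemma stg_less: "i < j \<Longrightarrow> stg j gs w i = w i"
  by (induction gs arbitrary: j w) auto

lemma polyb_slen: "polyb f \<Longrightarrow> polyb (\<lambda>n. slen gs (f n))"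
proof (induction gs arbitrary: f)
  case (Cons g gs)
  have "polyb (\<lambda>n. f n + gtb (f n) 0 g)"
    using polyb_comp[OF polyb_gtb[OF polyb_const] Cons.prems] Cons.prems by (intro polyb_add) auto
  from Cons.IH[OF this] show ?case by simp
qed simp

lemma polyb_stime: "polyb f \<Longrightarrow> polyb (\<lambda>n. stime gs (f n))"
proof (induction gs arbitrary: f)
  case (Cons g gs)
  have g: "polyb (\<lambda>n. gtb (f n) 0 g)" using polyb_comp[OF polyb_gtb[OF polyb_const] Cons.prems] .
  have "polyb (\<lambda>n. f n + gtb (f n) 0 g)" using g Cons.prems by (rule polyb_add[rotated])
  from Cons.IH[OF this] g show ?case unfolding stime.simps by (intro polyb_intros)
qed (simp add: polyb_const)

text \<open>The rest \<open>c\<close> of the program is part of the statement because compiled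
  stages nest to the right; its run is required only from the memory that the stages
  produce.\<close>

lemma runs_stc:
  assumes "wfs G j gs" "4 \<le> G" "gmem {..<j} cc w (\<lambda>_. 0) 0 m"
    "\<forall>i. j \<le> i \<and> i < j + length gs \<longrightarrow> m (2 * i) = tp 0 [] \<and> m (2 * i + 1) = tp 1 [3]"
    "\<forall>i. length (w i) \<le> nn \<and> 0 \<notin> set (w i)" "2 * (j + length gs) \<le> cc"
    "\<And>m'. gmem {..<j + length gs} cc (stg j gs w) (\<lambda>_. 0) 0 m' \<Longrightarrow>
        \<forall>i \<ge> 2 * (j + length gs). m' i = m i \<Longrightarrow>
        \<forall>i. length (stg j gs w i) \<le> slen gs nn \<and> 0 \<notin> set (stg j gs w i) \<Longrightarrow> runs c m' T f (R m')"
  shows "\<exists>m'. runs (stc cc j gs c) m (stime gs nn + T) f (R m') \<and>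
     gmem {..<j + length gs} cc (stg j gs w) (\<lambda>_. 0) 0 m' \<and> (\<forall>i \<ge> 2 * (j + length gs). m' i = m i)"
  using assms
proof (induction gs arbitrary: j w m nn)
  case Nil
  then show ?case by (intro exI[of _ m]) auto
next
  case (Cons g gs)
  let ?r = "gsem w g (\<lambda>_. 0) 0" and ?x = "2 * j"
  have g: "gok G g" "gwf {..<j} {..<j} g" "\<forall>n. gib n g = 0" using Cons.prems(1) by auto
  have len: "length (fst ?r) \<le> gtb nn 0 g" "snd ?r = 0"
    using length_gsem[OF _ _ g(3), of "\<lambda>_. 0" nn w 0 0] Cons.prems(5) by auto
  have mx: "m ?x = tp 0 []" "m (?x + 1) = tp 1 [3]" using Cons.prems(4) by auto
  have cc: "2 * j + 1 < cc" using Cons.prems(6) by simp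
  let ?m1 = "gres cc ?x [] ?r m"
  have r1: "runs (gc cc ?x g) m (gtb nn 0 g) True ?m1"
  proof -
    have "runs (gc cc ?x g) m (gtb nn 0 g) True ?m1 \<and> snd ?r \<le> 0 + gib nn g"
      by (rule gc_correct[OF g(2) Cons.prems(3)])
        (use mx cc Cons.prems(5) g(3) in \<open>auto simp: less_iff_Suc_add\<close>)
    then show ?thesis ..
  qed
  have nz: "0 \<notin> set (fst ?r)" using gsem_letters[OF g(1), of w "\<lambda>_. 0" 0] Cons.prems(2) by auto
  let ?m2 = "?m1(?x := tp 0 (fst ?r))"
  have r2: "runs (Mv ?x (- 1) ;; goL ?x (- {0}) ;; Mv ?x 1) ?m1 (2 * length (fst ?r) + 6) True ?m2"
    by (rule runs_rewind[OF _ nz]) (auto simp: gres_def)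
  let ?w = "w(j := fst ?r)"
  have m2: "?m2 i = (if i = ?x then tp 0 (fst ?r) else m i)" for i
    using Cons.prems(3) len(2) by (auto simp: gres_def gmem_def)
  have mem: "gmem {..<Suc j} cc ?w (\<lambda>_. 0) 0 ?m2"
    unfolding gmem_def
  proof (intro conjI ballI)
    show "?m2 cc = tp 0 (bsym 0)" using Cons.prems(3) cc unfolding m2 by (simp add: gmem_def)
    fix i assume i: "i \<in> {..<Suc j}"
    show "?m2 (2 * i) = tp (int 0) (?w i)"
      unfolding m2 using i Cons.prems(3) by (cases "i = j") (auto simp: gmem_def)
    have "2 * i + 1 \<noteq> ?x" by presburger
    then show "?m2 (2 * i + 1) = tp (int 0 + 1) (ixs 0)"
      unfolding m2 using i Cons.prems(3) mx by (cases "i = j") (auto simp: gmem_def)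
  qed
  have "\<exists>m'. runs (stc cc (Suc j) gs c) ?m2 (stime gs (nn + gtb nn 0 g) + T) f (R m') \<and>
     gmem {..<Suc j + length gs} cc (stg (Suc j) gs ?w) (\<lambda>_. 0) 0 m' \<and> (\<forall>i \<ge> 2 * (Suc j + length gs). m' i = ?m2 i)"
  proof (rule Cons.IH[OF _ Cons.prems(2) mem])
    show "wfs G (Suc j) gs" using Cons.prems(1) by simp
    show "\<forall>i. Suc j \<le> i \<and> i < Suc j + length gs \<longrightarrow> ?m2 (2 * i) = tp 0 [] \<and> ?m2 (2 * i + 1) = tp 1 [3]"
    proof (intro allI impI)
      fix i assume i: "Suc j \<le> i \<and> i < Suc j + length gs"
      then have "2 * i \<noteq> ?x" "2 * i + 1 \<noteq> ?x" by presburger+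
      then show "?m2 (2 * i) = tp 0 [] \<and> ?m2 (2 * i + 1) = tp 1 [3]"
        unfolding m2 using Cons.prems(4)[rule_format, of i] i by simp
    qed
    show "\<forall>i. length (?w i) \<le> nn + gtb nn 0 g \<and> 0 \<notin> set (?w i)"
      using Cons.prems(5) len nz by (auto intro: le_trans trans_le_add1)
    show "2 * (Suc j + length gs) \<le> cc" using Cons.prems(6) by simp
    fix m' assume m': "gmem {..<Suc j + length gs} cc (stg (Suc j) gs ?w) (\<lambda>_. 0) 0 m'"
      "\<forall>i\<ge>2 * (Suc j + length gs). m' i = ?m2 i"
      "\<forall>i. length (stg (Suc j) gs ?w i) \<le> slen gs (nn + gtb nn 0 g) \<and> 0 \<notin> set (stg (Suc j) gs ?w i)"
    show "runs c m' T f (R m')"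
    proof (rule Cons.prems(7))
      show "\<forall>i\<ge>2 * (j + length (g # gs)). m' i = m i" using m'(2) unfolding m2 by auto
    qed (use m' in auto)
  qed
  then obtain m' where m': "runs (stc cc (Suc j) gs c) ?m2 (stime gs (nn + gtb nn 0 g) + T) f (R m')"
     "gmem {..<Suc j + length gs} cc (stg (Suc j) gs ?w) (\<lambda>_. 0) 0 m'" "\<forall>i \<ge> 2 * (Suc j + length gs). m' i = ?m2 i"
    by blast
  have "runs (stc cc j (g # gs) c) m (stime (g # gs) nn + T) f (R m')"
    unfolding stc.simps by (rule runs_Seq[OF r1 runs_Seq[OF r2 m'(1) order_refl]]) (use len in simp)
  moreover have "\<forall>i \<ge> 2 * (j + length (g # gs)). m' i = m i" using m'(3) unfolding m2 by auto
  ultimately show ?case using m'(2) by (intro exI[of _ m']) simp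
qed

fun sents :: "nat \<Rightarrow> com \<Rightarrow> com" where
  "sents 0 c = c"
| "sents (Suc j) c = Wr (2 * j + 1) 3 ;; Mv (2 * j + 1) 1 ;; sents j c"

lemma runs_sents:
  "\<forall>i<j. m (2 * i + 1) = tp 0 [] \<Longrightarrow>
   runs c (\<lambda>i. if odd i \<and> i < 2 * j then tp 1 [3] else m i) T f m' \<Longrightarrow> runs (sents j c) m (4 * j + T) f m'"
proof (induction j arbitrary: m)
  case (Suc j)
  have a: "runs (Wr (2 * j + 1) 3) m 1 True (m(2 * j + 1 := tp 0 [3]))"
    by (rule runs_Wr) (use Suc.prems(1) wr_tp_append[of 0 "[]" 3] in auto)
  have b: "runs (Mv (2 * j + 1) 1) (m(2 * j + 1 := tp 0 [3])) 1 True (m(2 * j + 1 := tp 1 [3]))"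
    by (rule runs_Mv) auto
  have "(\<lambda>i. if odd i \<and> i < 2 * j then tp 1 [3] else (m(2 * j + 1 := tp 1 [3])) i) =
      (\<lambda>i. if odd i \<and> i < 2 * Suc j then tp 1 [3] else m i)"
  proof
    fix i
    consider "i < 2 * j" | "i = 2 * j" | "i = 2 * j + 1" | "i \<ge> 2 * Suc j" by (cases "i < 2 * j"; cases "i = 2 * j"; cases "i = 2 * j + 1"; auto)
    then show "(if odd i \<and> i < 2 * j then tp 1 [3] else (m(2 * j + 1 := tp 1 [3])) i) =
      (if odd i \<and> i < 2 * Suc j then tp 1 [3] else m i)" by cases auto
  qed
  then have "runs c (\<lambda>i. if odd i \<and> i < 2 * j then tp 1 [3] else (m(2 * j + 1 := tp 1 [3])) i) T f m'"
    using Suc.prems(2) by (simp only:)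
  then have "runs (sents j c) (m(2 * j + 1 := tp 1 [3])) (4 * j + T) f m'"
    by (rule Suc.IH[rotated]) (use Suc.prems(1) in auto)
  from runs_Seq[OF a runs_Seq[OF b this order_refl]] show ?case by simp
qed simp

lemma wfc_stc: "wfs G j gs \<Longrightarrow> 4 \<le> G \<Longrightarrow> cc < k \<Longrightarrow> 2 * (j + length gs) \<le> k \<Longrightarrow> wfc k G c \<Longrightarrow> wfc k G (stc cc j gs c)"
proof (induction gs arbitrary: j)
  case (Cons g gs)
  have "wfc k G (gc cc (2 * j) g)"
    by (rule wfc_gc[where V = "{..<j}" and A = "{..<j}"]) (use Cons.prems in auto)
  then show ?case using Cons by simp
qed simp

lemma wfc_sents: "4 \<le> G \<Longrightarrow> 2 * j \<le> k \<Longrightarrow> wfc k G c \<Longrightarrow> wfc k G (sents j c)"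
  by (induction j) auto

definition inp :: "bool list \<Rightarrow> nat \<Rightarrow> nat list" where
  "inp x i = (if i = 0 then map bit_symbol x else [])"

theorem gen_polytime:
  assumes gs: "wfs G 1 gs" "4 \<le> G" "gok G g" "gwf {..length gs} {..length gs} g"
    and out: "\<And>x. fst (gsem (stg 1 gs (inp x)) g (\<lambda>_. 0) 0) = map bit_symbol (F x)"
  shows "polytime_computable 1 (\<lambda>ws. F (ws ! 0))"
proof -
  define v where "v = Suc (length gs)"
  \<comment> \<open>Each of the \<open>v\<close> loop variables takes two tapes. The counter comes
    next, and \<open>cc + 1\<close> is the last tape, hence the output.\<close>
  define cc where "cc = 2 * v"
  define c where "c = sents v (stc cc 1 gs (gc cc (cc + 1) g))"
  define N where "N n = gib (slen gs n) g" for n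
  define T where "T n = gtb (slen gs n) (N n) g" for n
  have "polyb N" unfolding N_def
    using polyb_comp[OF polyb_gib polyb_slen[OF polyb_id]] .
  moreover have "polyb (\<lambda>n. gtb (slen gs n) (gib (slen gs n) g) g)"
    using polyb_comp[OF polyb_gtb[OF polyb_gib] polyb_slen[OF polyb_id]] .
  ultimately have "polyb (\<lambda>n. 4 * v + (stime gs n + T n))" unfolding T_def N_def
    by (intro polyb_add polyb_const polyb_stime polyb_id)
  then obtain p :: "nat poly" where p: "\<forall>n. 4 * v + (stime gs n + T n) \<le> poly p n" by (auto simp: polyb_def)
  have sub: "{..length gs} = {..<v}" by (auto simp: v_def)
  show ?thesis
  proof (rule polytime_computableI[where k = "cc + 2" and G = G and c = c and p = p])
    have "wfc (cc + 2) G (gc cc (cc + 1) g)"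
      by (rule wfc_gc[OF gs(3) gs(4)]) (use gs(2) in \<open>auto simp: cc_def v_def\<close>)
    then show "wfc (cc + 2) G c" unfolding c_def
      using gs by (intro wfc_sents wfc_stc) (auto simp: cc_def v_def)
    show "1 \<le> cc + 2" "1 \<le> cc + 2" by auto
    show "G \<ge> 3" using gs(2) by simp
    fix ws :: "bool list list" assume "length ws = 1"
    then obtain x where ws: "ws = [x]" by (cases ws) auto
    let ?m = "initial_mem ws" and ?w = "inp x"
    let ?m1 = "\<lambda>i. if odd i \<and> i < 2 * v then tp 1 [3] else ?m i"
    have im: "?m i = tp 0 (?w i)" for i
      by (auto simp: initial_mem_def ws inp_def tp_def string_contents_str)
    let ?n = "length x" and ?st = "stg 1 gs ?w"
    let ?R = "\<lambda>m'. gres cc (cc + 1) [] (gsem ?st g (\<lambda>_. 0) 0) m'"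
    have "\<exists>m'. runs (stc cc 1 gs (gc cc (cc + 1) g)) ?m1 (stime gs ?n + T ?n) True (?R m') \<and>
       gmem {..<1 + length gs} cc ?st (\<lambda>_. 0) 0 m' \<and> (\<forall>i\<ge>2 * (1 + length gs). m' i = ?m1 i)"
    proof (rule runs_stc[OF gs(1,2)])
      show "gmem {..<1} cc ?w (\<lambda>_. 0) 0 ?m1"
        by (auto simp: gmem_def im v_def cc_def bsym_def binary.simps inp_def)
      show "\<forall>i. 1 \<le> i \<and> i < 1 + length gs \<longrightarrow> ?m1 (2 * i) = tp 0 [] \<and> ?m1 (2 * i + 1) = tp 1 [3]"
        by (auto simp: im v_def inp_def)
      show "\<forall>i. length (?w i) \<le> ?n \<and> 0 \<notin> set (?w i)"
        by (auto simp: inp_def bit_symbol_def)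
      show "2 * (1 + length gs) \<le> cc" by (simp add: cc_def v_def)
      fix m' assume m': "gmem {..<1 + length gs} cc ?st (\<lambda>_. 0) 0 m'" "\<forall>i\<ge>2 * (1 + length gs). m' i = ?m1 i"
        "\<forall>i. length (?st i) \<le> slen gs ?n \<and> 0 \<notin> set (?st i)"
      have "runs (gc cc (cc + 1) g) m' (gtb (slen gs ?n) (N ?n) g) True (?R m') \<and>
          snd (gsem ?st g (\<lambda>_. 0) 0) \<le> 0 + gib (slen gs ?n) g"
      proof (rule gc_correct[OF gs(4)])
        show "gmem {..length gs} cc ?st (\<lambda>_. 0) 0 m'" using m'(1) unfolding sub v_def by simp
        show "m' (cc + 1) = tp (int (length [])) []" using m'(2) by (simp add: cc_def v_def im inp_def)
        show "\<forall>i\<in>{..length gs}. cc + 1 \<noteq> 2 * i \<and> cc + 1 \<noteq> 2 * i + 1 \<and> cc \<noteq> 2 * i \<and> cc \<noteq> 2 * i + 1"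
          by (auto simp: cc_def v_def)
      qed (use m'(3) in \<open>auto simp: N_def\<close>)
      then show "runs (gc cc (cc + 1) g) m' (T ?n) True (?R m')" unfolding T_def ..
    qed
    then obtain m' where m': "runs (stc cc 1 gs (gc cc (cc + 1) g)) ?m1 (stime gs ?n + T ?n) True (?R m')" by blast
    have "runs c ?m (4 * v + (stime gs ?n + T ?n)) True (?R m')"
      unfolding c_def by (rule runs_sents[OF _ m']) (simp add: im inp_def)
    moreover have "4 * v + (stime gs ?n + T ?n) \<le> poly p (sum_list (map length ws))" using p ws by simp
    moreover have "snd (?R m' (cc + 2 - 1)) = string_contents (F (ws ! 0))"
      using out[of x] by (simp add: gres_def ws string_contents_str tp_def)
    ultimately show "\<exists>T f m. runs c ?m T f m \<and> T \<le> poly p (sum_list (map length ws)) \<and>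
      snd (m (cc + 2 - 1)) = string_contents (F (ws ! 0))" by blast
  qed
qed

section \<open>Generating the network of a tiling problem\<close>

lemma gfor_cong: "(\<And>a n. a \<in> set l \<Longrightarrow> f a n = g a n) \<Longrightarrow> gfor f l n = gfor g l n"
  by (induction l arbitrary: n) auto

lemma gfor_concat_map: "gfor h (concat (map F l)) n = gfor (\<lambda>a. gfor h (F a)) l n"
  by (induction l arbitrary: n) (auto simp: gfor_append)

lemma gfor_single [simp]: "gfor h [a] n = h a n"
  by simp

lemma gfor_map: "gfor h (map F l) n = gfor (\<lambda>a. h (F a)) l n"
  by (induction l arbitrary: n) auto

text \<open>Every constraint owns two consecutive slots, so counting by two along the list of
  constraints yields the slot numbers.\<close>

lemma gfor_enum:
  assumes "\<And>c n. h c n = (X c n, n + 2)"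
  shows "gfor h l n = (concat (map (\<lambda>q. X (l ! q) (n + 2 * q)) [0..<length l]), n + 2 * length l)"
proof (induction l arbitrary: n)
  case (Cons a l)
  have "[0..<length (a # l)] = 0 # map Suc [0..<length l]"
    by (simp add: map_Suc_upt upt_conv_Cons del: upt_Suc)
  then show ?case unfolding gfor.simps assms[of a n] fst_conv snd_conv Cons[of "n + 2"]
    by (simp add: comp_def algebra_simps del: upt_Suc)
qed simp

definition seqg :: "gen list \<Rightarrow> gen" where
  "seqg gs = foldr (;>) gs GSkip"

lemma gsem_seqg: "gsem w (seqg (map h l)) ix n = gfor (\<lambda>a. gsem w (h a) ix) l n"
  by (induction l arbitrary: n) (auto simp: seqg_def)

definition og :: "nat list \<Rightarrow> gen" where
  "og l = seqg (map Out l)"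

lemma gsem_og [simp]: "gsem w (og l) ix n = (l, n)"
  unfolding og_def gsem_seqg by (induction l) auto

definition incs :: "nat \<Rightarrow> gen" where
  "incs j = seqg (map (\<lambda>_. Inc) [0..<j])"

lemma gsem_incs [simp]: "gsem w (incs j) ix n = ([], n + j)"
  unfolding incs_def gsem_seqg by (induction j) (auto simp: gfor_append)

lemma seqg_wf:
  "gok G (seqg gs) \<longleftrightarrow> (\<forall>g\<in>set gs. gok G g)" "gwf V A (seqg gs) \<longleftrightarrow> (\<forall>g\<in>set gs. gwf V A g)"
  by (induction gs) (auto simp: seqg_def)

lemma og_wf [simp]: "gok G (og l) \<longleftrightarrow> set l \<subseteq> {0<..<G}" "gwf V A (og l)"
  by (auto simp: og_def seqg_wf)

lemma incs_wf [simp]: "gok G (incs j)" "gwf V A (incs j)"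
  by (auto simp: incs_def seqg_wf)

text \<open>A constraint \<open>(t, i, j)\<close> forbids the tuple number \<open>j\<close> in the
  window whose left upper cell is in row \<open>t\<close> and column \<open>i\<close>.\<close>

type_synonym cl = "nat \<times> nat \<times> nat"

text \<open>Binary names of the pages, without the leading digit 1.\<close>

fun pbits :: "cl nm \<Rightarrow> nat list" where
  "pbits (Ch g d) = replicate (2 * d) 2 @ 1 # bsym g"
| "pbits (Wt (t, i, j) e) = replicate (4 * prod_encode (j, e) + 1) 2 @ 1 # replicate t 2 @ 1 # replicate i 2"
| "pbits (Dn (t, i, j) e) = replicate (4 * prod_encode (j, e) + 3) 2 @ 1 # replicate t 2 @ 1 # replicate i 2"

text \<open>The length of the leading block of ones is even for chain pages, 1 modulo 4 for
  \<open>Wt\<close> and 3 modulo 4 for \<open>Dn\<close>, which separates the kinds. Positions are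
  in unary and the period of a chain is the counter, so a generator can write the digits; that the
  number itself is huge does not matter.\<close>

definition pnum :: "cl nm \<Rightarrow> nat" where
  "pnum p = lsb_val (pbits p @ [2])"

lemma set_pbits: "set (pbits p) \<subseteq> {1, 2}"
  using bsym_bits by (cases p rule: pbits.cases) auto

lemma bsym_pnum: "bsym (pnum p) = pbits p @ [2]"
  unfolding pnum_def by (rule bsym_val[OF set_pbits])

lemma unary_prefix_eq: "replicate a 2 @ 1 # x = replicate b (2::nat) @ 1 # y \<longleftrightarrow> a = b \<and> x = y"
proof (induction a arbitrary: b)
  case 0
  then show ?case by (cases b) auto
next
  case (Suc a)
  then show ?case by (cases b) auto
qed

lemma inj_pnum: "inj pnum"
proof (rule injI)
  fix p q assume "pnum p = pnum q"
  then have "pbits p @ [2] = pbits q @ [2]" unfolding bsym_pnum[symmetric] by simp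
  then have eq: "pbits p = pbits q" by simp
  have bs: "bsym a = bsym b \<Longrightarrow> a = b" for a b using lsb_val_bsym by metis
  have par: "2 * a \<noteq> Suc (4 * b)" "2 * a \<noteq> 4 * b + 3" "Suc (4 * a) \<noteq> 4 * b + 3" for a b :: nat by presburger+
  have rp: "replicate a (2::nat) = replicate b 2 \<longleftrightarrow> a = b" for a b
    by (metis length_replicate)
  show "p = q" using eq
    by (cases p rule: pbits.cases; cases q rule: pbits.cases)
      (simp_all add: unary_prefix_eq[unfolded One_nat_def] rp par par[symmetric] bs del: replicate_Suc)
qed

text \<open>\<open>T1\<close> and \<open>R1\<close> run over the row and column of a variable,
  \<open>T2\<close> and \<open>R2\<close> over those of a constraint. They are nested, which takes
  separate loop variables for equal strings.\<close>

locale gener =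
  fixes T1 R1 T2 R2 :: nat and D :: nat and Rs :: "nat list" and bad :: "nat \<Rightarrow> nat \<Rightarrow> nat list \<Rightarrow> bool"
  assumes vars: "distinct [T1, R1, T2, R2]" and D: "D \<ge> 1"
begin

definition tups :: "nat list list" where
  "tups = List.n_lists 4 [0..<D]"

lemma tups_nth: "j < length tups \<Longrightarrow> length (tups ! j) = 4 \<and> (\<forall>d\<in>set (tups ! j). d < D)"
  using nth_mem[of j tups] unfolding tups_def set_n_lists by auto

text \<open>\<open>IfLet\<close> inspects a single letter, so the relation \<open>bad\<close> is
  split into one test for each of the finitely many row letters.\<close>

definition tst :: "nat list \<Rightarrow> gen \<Rightarrow> gen" where
  "tst \<tau> g = foldr (\<lambda>a e. IfLet T2 {a} (IfLet R2 {b. bad a b \<tau>} g GSkip) e) Rs GSkip"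

definition clg :: "(nat \<Rightarrow> gen) \<Rightarrow> gen" where
  "clg g = For T2 (For R2 (seqg (map (\<lambda>j. tst (tups ! j) (g j)) [0..<length tups])))"

text \<open>The offsets are those of \<open>lits\<close>: three neighbours in the row of the window
  and the middle one in the next row. The branch taken tells which literal, if any, the current
  variable is.\<close>

definition role :: "(nat \<Rightarrow> nat \<Rightarrow> nat \<Rightarrow> gen) \<Rightarrow> nat \<Rightarrow> gen" where
  "role g j =
    (let f = (\<lambda>e. g j e (tups ! j ! e)) in
     IfEq T2 T1 0 (IfEq R2 R1 0 (f 0) (IfEq R2 R1 1 (f 1) (IfEq R2 R1 2 (f 2) GSkip)))
       (IfEq T2 T1 1 (IfEq R2 R1 1 (f 3) GSkip) GSkip))"

text \<open>The output of each operation is a parameter because the loops are run twice: the budget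
  precedes the requests in the encoding, so the pages are counted before anything is
  emitted.\<close>

definition opsg :: "(nat \<Rightarrow> gen) \<Rightarrow> gen \<Rightarrow> (nat \<Rightarrow> nat \<Rightarrow> nat \<Rightarrow> gen) \<Rightarrow> gen" where
  "opsg s a g =
    (let p = seqg (map s [1..<D]) in
     For T1 (For R1 (p ;> a ;> p ;> clg (role g))) ;> p ;> a)"

text \<open>The final \<open>[2, 2, 1]\<close> is the leading digit 1 that \<open>pnum\<close> adds,
  followed by the end mark.\<close>

definition chg :: "nat \<Rightarrow> gen" where
  "chg d = og (psym (replicate (2 * d) 2 @ [1])) ;> OutCtr ;> og [2, 2, 1]"

definition lng :: "nat \<Rightarrow> gen" where
  "lng K = og (psym (replicate K 2 @ [1])) ;> OutIdx T2 [2, 2] ;> og [2, 1] ;> OutIdx R2 [2, 2] ;> og [2, 2, 1]"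

definition wtg :: "nat \<Rightarrow> nat \<Rightarrow> gen" where
  "wtg j e = lng (4 * prod_encode (j, e) + 1)"

definition dng :: "nat \<Rightarrow> nat \<Rightarrow> gen" where
  "dng j e = lng (4 * prod_encode (j, e) + 3)"

definition anyg :: "gen \<Rightarrow> gen" where
  "anyg p = og [2, 1] ;> p"

definition nextg :: "gen \<Rightarrow> gen" where
  "nextg p = Inc ;> anyg p ;> Dec"

definition reng :: "nat list \<Rightarrow> gen" where
  "reng ds = seqg (map (\<lambda>d. anyg (chg d) ;> nextg (chg d)) ds)"

definition sw0g :: "nat \<Rightarrow> gen" where
  "sw0g d = anyg (chg 0) ;> anyg (chg d) ;> nextg (chg 0) ;> nextg (chg d) ;>
     reng (filter (\<lambda>e. e \<noteq> 0 \<and> e \<noteq> d) [0..<D]) ;> Inc"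

definition asg :: gen where
  "asg = og [2, 2] ;> chg 0 ;> og (esym 1) ;> nextg (chg 0) ;> reng (filter (\<lambda>e. e \<noteq> 0) [0..<D]) ;> Inc"

definition gateg :: "nat \<Rightarrow> nat \<Rightarrow> nat \<Rightarrow> gen" where
  "gateg j e d =
    (anyg (wtg j e) ;> anyg (chg d) ;> anyg (wtg j (Suc e)) ;> nextg (chg d) ;>
     reng (filter (\<lambda>e. e \<noteq> d) [0..<D]) ;> Inc) ;>
    (anyg (chg d) ;> anyg (dng j e) ;> nextg (chg d) ;> anyg (dng j (Suc e)) ;>
     reng (filter (\<lambda>e. e \<noteq> d) [0..<D]) ;> Inc)"

abbreviation ctrg :: "gen \<Rightarrow> gen" where
  "ctrg p \<equiv> og [2, 2] ;> p ;> OutCtr ;> Out 1"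

definition cnt :: "cl op \<Rightarrow> nat" where
  "cnt op = length (starts (evop D 0 op))"

text \<open>The counter serves in turn as \<open>k\<close>, as budget, as slot number and as period
  of the chains. The budget is counted on from \<open>k\<close>, because the initial requests start
  \<open>k\<close> pages. The first 1 of \<open>og [1, 1]\<close> ends the code of \<open>k\<close>
  and the second is the sign. Every constraint has 4 literals, so 4 is the last period of its own
  pages.\<close>

definition maing :: gen where
  "maing =
     incs D ;> clg (\<lambda>_. incs 2) ;> OutCtr ;> og [1, 1] ;>
     opsg (\<lambda>d. incs (cnt (Sw0 d))) (incs (cnt As))
       (\<lambda>j e d. incs (cnt (SwW undefined e d) + cnt (SwZ undefined e d))) ;>
     OutCtr ;> Out 1 ;> Reset ;>
     seqg (map (\<lambda>d. og [2, 2] ;> chg d ;> og (esym (Suc d))) [0..<D]) ;> incs D ;>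
     clg (\<lambda>j. Inc ;> ctrg (wtg j 0) ;> Inc ;> ctrg (dng j 0)) ;> Reset ;>
     opsg sw0g asg gateg ;>
     seqg (map (\<lambda>d. anyg (chg d)) [0..<D]) ;> Reset ;> incs D ;>
     clg (\<lambda>j. Inc ;> ctrg (dng j 4) ;> Inc ;> anyg (wtg j 4)) ;> Out 1"

lemma clg_wf:
  "T2 \<in> A \<Longrightarrow> R2 \<in> A \<Longrightarrow> A \<subseteq> V \<Longrightarrow> (\<And>j. gwf V (A - {T2} - {R2}) (g j)) \<Longrightarrow> gwf V A (clg g)"
  "(\<And>j. gok G (g j)) \<Longrightarrow> gok G (clg g)"
proof -
  have t: "T2 \<in> V \<Longrightarrow> R2 \<in> V \<Longrightarrow> gwf V B g \<Longrightarrow> gwf V B (tst \<tau> g)" "gok G g \<Longrightarrow> gok G (tst \<tau> g)" for B \<tau> g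
    unfolding tst_def by (induction Rs) auto
  show "T2 \<in> A \<Longrightarrow> R2 \<in> A \<Longrightarrow> A \<subseteq> V \<Longrightarrow> (\<And>j. gwf V (A - {T2} - {R2}) (g j)) \<Longrightarrow> gwf V A (clg g)"
    using vars by (auto simp: clg_def seqg_wf intro!: t)
  show "(\<And>j. gok G (g j)) \<Longrightarrow> gok G (clg g)"
    by (auto simp: clg_def seqg_wf intro!: t)
qed

lemma opsg_wf:
  assumes "{T1, R1, T2, R2} \<subseteq> V"
  shows "(\<And>d B. gwf V B (s d)) \<Longrightarrow> (\<And>B. gwf V B a) \<Longrightarrow> (\<And>j e d B. gwf V B (g j e d)) \<Longrightarrow> gwf V V (opsg s a g)"
    "(\<And>d. gok G (s d)) \<Longrightarrow> gok G a \<Longrightarrow> (\<And>j e d. gok G (g j e d)) \<Longrightarrow> gok G (opsg s a g)"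
proof -
  assume *: "\<And>d B. gwf V B (s d)" "\<And>B. gwf V B a" "\<And>j e d B. gwf V B (g j e d)"
  have "gwf V (V - {T1} - {R1}) (clg (role g))"
    by (rule clg_wf) (use assms vars * in \<open>auto simp: role_def Let_def\<close>)
  then show "gwf V V (opsg s a g)" using * assms vars by (auto simp: opsg_def Let_def seqg_wf)
next
  assume *: "\<And>d. gok G (s d)" "gok G a" "\<And>j e d. gok G (g j e d)"
  have "gok G (clg (role g))" by (rule clg_wf) (use * in \<open>auto simp: role_def Let_def\<close>)
  then show "gok G (opsg s a g)" using * by (auto simp: opsg_def Let_def seqg_wf)
qed

lemma psym_ok: "set l \<subseteq> {1, 2} \<Longrightarrow> 3 \<le> G \<Longrightarrow> set (psym l) \<subseteq> {0<..<G}"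
  by (rule set_psym) auto

lemma esym_ok: "3 \<le> G \<Longrightarrow> set (esym n) \<subseteq> {0<..<G}"
  unfolding esym_psym using psym_ok[OF bsym_bits] by auto

lemma prims_wf:
  assumes "{T1, R1, T2, R2} \<subseteq> V" "3 \<le> G"
  shows "gwf V B (chg d)" "gok G (chg d)" "gwf V B (wtg j e)" "gok G (wtg j e)" "gwf V B (dng j e)" "gok G (dng j e)"
proof -
  have "set (psym (replicate K 2 @ [1])) \<subseteq> {0<..<G}" for K by (rule psym_ok) (use assms in auto)
  then show "gwf V B (chg d)" "gok G (chg d)" "gwf V B (wtg j e)" "gok G (wtg j e)" "gwf V B (dng j e)" "gok G (dng j e)"
    using assms by (auto simp: chg_def lng_def wtg_def dng_def)
qed

lemma maing_wf:
  assumes "{T1, R1, T2, R2} \<subseteq> V" "3 \<le> G"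
  shows "gwf V V maing" "gok G maing"
proof -
  note p = prims_wf[OF assms]
  have any: "gwf V B p \<Longrightarrow> gwf V B (anyg p)" "gok G p \<Longrightarrow> gok G (anyg p)"
    "gwf V B p \<Longrightarrow> gwf V B (nextg p)" "gok G p \<Longrightarrow> gok G (nextg p)" for p B
    using assms(2) by (auto simp: anyg_def nextg_def)
  have ren: "gwf V B (reng ds)" "gok G (reng ds)" for ds B
    by (auto simp: reng_def seqg_wf intro!: any p)
  have ops: "gwf V B (sw0g d)" "gok G (sw0g d)" "gwf V B asg" "gok G asg" "gwf V B (gateg j e d)" "gok G (gateg j e d)" for B d j e
    using assms(2) esym_ok[OF assms(2)] by (auto simp: sw0g_def asg_def gateg_def intro!: any p ren)
  have c: "gwf V V (clg g)" if "\<And>j B. gwf V B (g j)" for g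
    by (rule clg_wf) (use that assms in auto)
  show "gwf V V maing" unfolding maing_def gwf.simps
    by (intro conjI c opsg_wf[OF assms(1)] TrueI) (auto simp: seqg_wf intro!: p any ops)
  show "gok G maing" unfolding maing_def gok.simps
    by (intro conjI clg_wf opsg_wf[OF assms(1)] TrueI) (use assms(2) esym_ok[OF assms(2)] in \<open>auto simp: seqg_wf intro!: p any ops\<close>)
qed

end

definition encs :: "cl nm ev list \<Rightarrow> nat list" where
  "encs es = enc_reqs (map (rq pnum) es)"

lemma encs_simps [simp]:
  "encs [] = []" "encs (a @ b) = encs a @ encs b"
  "encs (St p None # es) = 2 # 1 # esym (pnum p) @ encs es"
  "encs (En p None # es) = 2 # 1 # esym (pnum p) @ encs es"
  "encs (St p (Some s) # es) = 2 # 2 # esym (pnum p) @ esym s @ encs es"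
  "encs (En p (Some s) # es) = 2 # 2 # esym (pnum p) @ esym s @ encs es"
  by (auto simp: encs_def enc_reqs_def esym_def)

lemma encs_concat_map: "encs (concat (map F l)) = concat (map (\<lambda>a. encs (F a)) l)"
  by (induction l) auto

lemma gfor_encs:
  assumes "\<And>a n. a \<in> set l \<Longrightarrow> h a n = (encs (F n a), n)"
  shows "gfor h l n = (encs (concat (map (F n) l)), n)"
  using assms by (induction l) auto

text \<open>\<open>bad_inside\<close> says that only windows within the board are constrained, so
  that all literals refer to existing variables.\<close>

locale tiling = gener T1 R1 T2 R2 D Rs bad
  for T1 R1 T2 R2 D Rs bad +
  fixes tt rr :: "nat list" and w :: "nat \<Rightarrow> nat list"
  assumes w: "w T1 = tt" "w T2 = tt" "w R1 = rr" "w R2 = rr"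
    and Rs: "set tt \<subseteq> set Rs"
    and bad_inside: "\<And>t i \<tau>. t < length tt \<Longrightarrow> i < length rr \<Longrightarrow> bad (tt ! t) (rr ! i) \<tau> \<Longrightarrow>
      t + 1 < length tt \<and> i + 2 < length rr"
begin

definition cs :: "cl list" where
  "cs = concat (map (\<lambda>t. concat (map (\<lambda>i. concat (map (\<lambda>j. if bad (tt ! t) (rr ! i) (tups ! j) then [(t, i, j)] else [])
     [0..<length tups])) [0..<length rr])) [0..<length tt])"

fun lits :: "cl \<Rightarrow> ((nat \<times> nat) \<times> nat) list" where
  "lits (t, i, j) = [((t, i), tups ! j ! 0), ((t, i + 1), tups ! j ! 1), ((t, i + 2), tups ! j ! 2),
     ((t + 1, i + 1), tups ! j ! 3)]"

definition vs :: "(nat \<times> nat) list" where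
  "vs = List.product [0..<length tt] [0..<length rr]"

lemma cs_iff: "(t, i, j) \<in> set cs \<longleftrightarrow>
    t < length tt \<and> i < length rr \<and> j < length tups \<and> bad (tt ! t) (rr ! i) (tups ! j)"
  by (auto simp: cs_def split: if_splits)

lemma distinct_concat_map:
  assumes "distinct l" "\<And>a. a \<in> set l \<Longrightarrow> distinct (F a)" "\<And>a x. x \<in> set (F a) \<Longrightarrow> key x = a"
  shows "distinct (concat (map F l))"
  using assms by (induction l) (auto, metis)

lemma distinct_cs: "distinct cs"
  unfolding cs_def
  apply (rule distinct_concat_map[where key = fst], simp)
   apply (rule distinct_concat_map[where key = "\<lambda>(t, i, j). i"], simp)
    apply (rule distinct_concat_map[where key = "\<lambda>(t, i, j). j"])
      apply (auto split: if_splits)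
  done

abbreviation key :: "nat \<times> nat \<Rightarrow> nat" where
  "key \<equiv> \<lambda>(t, i). t * length rr + i"

lemma map_key_vs: "map key vs = [0..<length tt * length rr]"
proof -
  have "map key (List.product [0..<m] [0..<length rr]) = [0..<m * length rr]" for m
  proof (induction m)
    case (Suc m)
    have "map key (map (Pair m) [0..<length rr]) = [m * length rr..<Suc m * length rr]"
      using map_add_upt[of "m * length rr" "length rr"] by (simp add: comp_def add.commute)
    moreover have "List.product [0..<Suc m] [0..<length rr] =
       List.product [0..<m] [0..<length rr] @ map (Pair m) [0..<length rr]"
      by (simp add: product_concat_map)
    ultimately show ?case using Suc upt_add_eq_append[of 0 "m * length rr" "length rr"]
      by (simp add: add.commute)
  qed simp
  then show ?thesis by (simp add: vs_def)
qed

text \<open>Literals and variables both follow the reading order of the board. Numbering the cells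
  by \<open>key\<close> turns the claim into the uniqueness of a sorted list with a given
  set.\<close>

lemma lits_vs:
  assumes "c \<in> set cs"
  shows "map fst (lits c) = filter (\<lambda>v. v \<in> fst ` set (lits c)) vs"
proof -
  obtain t i j where c: "c = (t, i, j)" by (cases c)
  have b: "t + 1 < length tt" "i + 2 < length rr" using assms bad_inside cs_iff[of t i j] c by blast+
  let ?A = "map fst (lits c)" and ?B = "filter (\<lambda>v. v \<in> fst ` set (lits c)) vs"
  have dv: "distinct vs" by (simp add: vs_def distinct_product)
  have inj: "inj_on key (set vs)"
    using map_key_vs distinct_upt dv by (metis distinct_map)
  have set: "set ?A \<subseteq> set vs" "set ?B = set ?A" using b by (auto simp: c vs_def)
  have "map key ?A = map key ?B"
  proof (rule sorted_distinct_set_unique)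
    show "sorted (map key ?A)" "distinct (map key ?A)" using b by (auto simp: c)
    show "sorted (map key ?B)" by (rule sorted_filter) (simp only: map_key_vs sorted_upt)
    show "distinct (map key ?B)" using dv inj by (auto simp: distinct_map intro: inj_on_subset)
    show "set (map key ?A) = set (map key ?B)" unfolding set_map set(2) ..
  qed
  moreover have "inj_on key (set ?A \<union> set ?B)" by (rule inj_on_subset[OF inj]) (use set in auto)
  ultimately show ?thesis by (rule map_inj_on)
qed

sublocale csp D cs lits vs
proof
  show "D \<ge> 1" by (fact D)
  show "distinct cs" by (fact distinct_cs)
  show "distinct vs" by (simp add: vs_def distinct_product)
  fix c v d assume c: "c \<in> set cs" and vd: "(v, d) \<in> set (lits c)"
  obtain t i j where [simp]: "c = (t, i, j)" by (cases c)
  have "j < length tups" using c cs_iff[of t i j] by simp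
  from tups_nth[OF this] have "length (tups ! j) = 4" "\<forall>e<4. tups ! j ! e < D" by (metis nth_mem)+
  then show "d < D" using vd by auto
qed (fact lits_vs)

lemma sat_iff_tiling:
  "sat a \<longleftrightarrow> (\<forall>t<length tt. \<forall>i<length rr. a (t, i) < D) \<and>
     (\<forall>t<length tt. \<forall>i<length rr. \<not> bad (tt ! t) (rr ! i) [a (t, i), a (t, i + 1), a (t, i + 2), a (t + 1, i + 1)])"
proof -
  let ?T = "\<lambda>t i. [a (t, i), a (t, i + 1), a (t, i + 2), a (t + 1, i + 1)]"
  have "(\<forall>c\<in>set cs. \<exists>(v, d)\<in>set (lits c). a v \<noteq> d) \<longleftrightarrow> (\<forall>t<length tt. \<forall>i<length rr. \<not> bad (tt ! t) (rr ! i) (?T t i))"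
    if D: "\<forall>t<length tt. \<forall>i<length rr. a (t, i) < D"
  proof (intro iffI allI impI notI)
    fix t i assume l: "\<forall>c\<in>set cs. \<exists>(v, d)\<in>set (lits c). a v \<noteq> d" and t: "t < length tt" "i < length rr"
      and bad: "bad (tt ! t) (rr ! i) (?T t i)"
    have "t + 1 < length tt" "i + 2 < length rr" using bad_inside[OF t bad] by auto
    \<comment> \<open>Inside the board all four values are below \<open>D\<close>, so the forbidden
      tuple is among those enumerated and gives a constraint.\<close>
    then have "?T t i \<in> set tups" unfolding tups_def set_n_lists using D by auto
    then obtain j where j: "j < length tups" "tups ! j = ?T t i" by (metis in_set_conv_nth)
    then have "(t, i, j) \<in> set cs" using t bad by (simp add: cs_iff)
    from bspec[OF l this] show False using j(2) by simp
  next
    assume l: "\<forall>t<length tt. \<forall>i<length rr. \<not> bad (tt ! t) (rr ! i) (?T t i)"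
    show "\<forall>c\<in>set cs. \<exists>(v, d)\<in>set (lits c). a v \<noteq> d"
    proof
      fix c assume c: "c \<in> set cs"
      obtain t i j where [simp]: "c = (t, i, j)" by (cases c)
      have *: "t < length tt" "i < length rr" "j < length tups" "bad (tt ! t) (rr ! i) (tups ! j)"
        using c cs_iff[of t i j] by auto
      obtain d0 d1 d2 d3 where d: "tups ! j = [d0, d1, d2, d3]"
        using tups_nth[OF *(3)] by (auto simp: numeral_eq_Suc length_Suc_conv)
      have "?T t i \<noteq> tups ! j" using l * by metis
      then show "\<exists>(v, d)\<in>set (lits c). a v \<noteq> d" by (auto simp: d)
    qed
  qed
  moreover have "(\<forall>v\<in>set vs. a v < D) \<longleftrightarrow> (\<forall>t<length tt. \<forall>i<length rr. a (t, i) < D)"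
    by (auto simp: vs_def)
  ultimately show ?thesis unfolding sat_def by blast
qed

lemma neqs: "T1 \<noteq> R1" "T1 \<noteq> T2" "T1 \<noteq> R2" "R1 \<noteq> T2" "R1 \<noteq> R2" "T2 \<noteq> R2"
    "R1 \<noteq> T1" "T2 \<noteq> T1" "R2 \<noteq> T1" "T2 \<noteq> R1" "R2 \<noteq> R1" "R2 \<noteq> T2"
  using vars by auto

lemma gsem_tst:
  assumes "ix T2 < length tt" "ix R2 < length rr"
  shows "gsem w (tst \<tau> g) ix n = (if bad (tt ! ix T2) (rr ! ix R2) \<tau> then gsem w g ix n else ([], n))"
proof -
  have s: "str (w T2) (int (ix T2)) = tt ! ix T2" "str (w R2) (int (ix R2)) = rr ! ix R2"
    using assms w by (auto simp: str_def)
  have "tt ! ix T2 \<in> set Rs \<Longrightarrow> gsem w (foldr (\<lambda>a e. IfLet T2 {a} (IfLet R2 {b. bad a b \<tau>} g GSkip) e) l GSkip) ix n =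
      (if tt ! ix T2 \<in> set l \<and> bad (tt ! ix T2) (rr ! ix R2) \<tau> then gsem w g ix n else ([], n))" for l
    by (induction l) (auto simp: s)
  moreover have "tt ! ix T2 \<in> set Rs" using Rs nth_mem[OF assms(1)] by blast
  ultimately show ?thesis by (simp add: tst_def)
qed

lemma gsem_clg:
  "gsem w (clg g) ix n = gfor (\<lambda>(t, i, j). gsem w (g j) (ix(T2 := t, R2 := i))) cs n"
  unfolding clg_def gsem.simps gsem_seqg cs_def gfor_concat_map w
  by (intro gfor_cong) (simp add: gsem_tst neqs)

lemma inner_eq:
  "gl (inner (t, i) (t', i', j)) =
     (if t' = t then
        (if i' = i then [SwW (t', i', j) 0 (tups ! j ! 0), SwZ (t', i', j) 0 (tups ! j ! 0)]
         else if i' + 1 = i then [SwW (t', i', j) 1 (tups ! j ! 1), SwZ (t', i', j) 1 (tups ! j ! 1)]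
         else if i' + 2 = i then [SwW (t', i', j) 2 (tups ! j ! 2), SwZ (t', i', j) 2 (tups ! j ! 2)] else [])
      else if t' + 1 = t \<and> i' + 1 = i then [SwW (t', i', j) 3 (tups ! j ! 3), SwZ (t', i', j) 3 (tups ! j ! 3)] else [])"
proof -
  have "[0..<length (lits (t', i', j))] = [0, 1, 2, 3]" by (simp add: upt_rec)
  then show ?thesis unfolding inner_def by (auto simp: numeral_eq_Suc)
qed

text \<open>\<open>h\<close> is the effect of a single operation; it is later instantiated by
  counting pages and by emitting requests.\<close>

lemma gsem_opsg:
  assumes "\<And>d ix n. gsem w (s d) ix n = h (Sw0 d) n" "\<And>ix n. gsem w a ix n = h As n"
    "\<And>j e d ix n. d < D \<Longrightarrow> gsem w (g j e d) ix n = gfor h [SwW (ix T2, ix R2, j) e d, SwZ (ix T2, ix R2, j) e d] n"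
  shows "gsem w (opsg s a g) ix n = gfor h (ops vs) n"
proof -
  have p: "gsem w (seqg (map s [1..<D])) ix n = gfor h pass n" for ix n
    unfolding gsem_seqg pass_def gfor_map assms(1) ..
  have r: "gsem w (role g j) ix n = gfor h (gl (inner (ix T1, ix R1) (ix T2, ix R2, j))) n"
    if "j < length tups" for ix n j
  proof -
    have "\<forall>e<4. tups ! j ! e < D" using tups_nth[OF that] by (metis nth_mem)
    then show ?thesis unfolding role_def Let_def inner_eq gsem.simps
      by (simp add: assms(3) del: gfor.simps(2))
  qed
  have gg: "gl (concat (map (inner v) l)) = concat (map (\<lambda>c. gl (inner v c)) l)" for v l
    by (induction l) auto
  have c: "gsem w (clg (role g)) ix n = gfor h (gl (gates (ix T1, ix R1))) n" for ix n
    unfolding gsem_clg gates_def gg gfor_concat_map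
  proof (rule gfor_cong)
    fix c n assume "c \<in> set cs"
    moreover obtain t i j where "c = (t, i, j)" by (cases c)
    ultimately have "c = (t, i, j)" "j < length tups" using cs_iff[of t i j] by auto
    then show "(case c of (t, i, j) \<Rightarrow> gsem w (role g j) (ix(T2 := t, R2 := i))) n =
      gfor h (gl (inner (ix T1, ix R1) c)) n" by (simp add: r neqs)
  qed
  show ?thesis
    unfolding opsg_def Let_def gsem.simps p c assms(2) ops_def vs_def product_concat_map
      gfor_concat_map gfor_append w
    by (simp add: gfor_append gfor_map gfor_concat_map comp_def neqs p c assms(2) ext[OF gfor_map])
qed

lemma psym_replicate: "psym (replicate a b) = concat (replicate a [2, b])"
  by (induction a) auto

lemma gsem_chg: "gsem w (chg d) ix n = (esym (pnum (Ch n d)), n)"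
  by (simp add: chg_def esym_psym bsym_pnum)

lemma gsem_lng:
  "gsem w (wtg j e) ix n = (esym (pnum (Wt (ix T2, ix R2, j) e)), n)"
  "gsem w (dng j e) ix n = (esym (pnum (Dn (ix T2, ix R2, j) e)), n)"
  by (simp_all add: wtg_def dng_def lng_def esym_psym bsym_pnum psym_replicate)

lemma gsem_anyg: "gsem w p ix n = (esym q, n) \<Longrightarrow> gsem w (anyg p) ix n = (2 # 1 # esym q, n)"
  by (simp add: anyg_def)

lemma gsem_nextg: "gsem w p ix (Suc n) = (esym q, Suc n) \<Longrightarrow> gsem w (nextg p) ix n = (2 # 1 # esym q, n)"
  by (simp add: nextg_def gsem_anyg)

lemmas gsem_pages = gsem_anyg[OF gsem_chg] gsem_anyg[OF gsem_lng(1)] gsem_anyg[OF gsem_lng(2)]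
  gsem_nextg[OF gsem_chg]

lemma gsem_reng: "gsem w (reng ds) ix n = (encs (ren n ds), n)"
  unfolding reng_def gsem_seqg ren_def
  by (rule gfor_encs) (simp add: gsem_pages)

definition emit :: "cl op \<Rightarrow> nat \<Rightarrow> nat list \<times> nat" where
  "emit op n = (encs (evop D n op), Suc n)"

lemma gsem_emit:
  "gsem w (sw0g d) ix n = emit (Sw0 d) n" "gsem w asg ix n = emit As n"
  "gsem w (gateg j e d) ix n = gfor emit [SwW (ix T2, ix R2, j) e d, SwZ (ix T2, ix R2, j) e d] n"
  by (simp_all add: sw0g_def asg_def gateg_def emit_def gsem_pages gsem_reng gsem_chg)

lemma gfor_emit: "gfor emit os n = (encs (evops D n os), n + length os)"
  by (induction os arbitrary: n) (auto simp: emit_def)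

lemma length_starts_evop: "length (starts (evop D g op)) = cnt op"
  by (cases op) (simp_all add: cnt_def starts_ren)

text \<open>The count does not depend on the constraint, which justifies the placeholder
  \<open>undefined\<close> in \<open>maing\<close>.\<close>

lemma cnt_clause: "cnt (SwW c e d) = cnt (SwW undefined e d)" "cnt (SwZ c e d) = cnt (SwZ undefined e d)"
  by (simp_all add: cnt_def starts_ren)

lemma gfor_cnt: "gfor (\<lambda>op n. ([], n + cnt op)) os n = ([], n + length (starts (evops D g os)))"
proof (induction os arbitrary: n g)
  case (Cons a os)
  show ?case unfolding gfor.simps fst_conv snd_conv Cons[of "n + cnt a" "Suc g"] by (simp add: length_starts_evop)
qed simp

lemma length_starts_net: "length (starts (net os)) = k + length (starts (evops D 0 os))"
  unfolding net_def init_ipage final_ends by (simp add: starts_init starts_ends)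

theorem gsem_maing:
  "fst (gsem w maing (\<lambda>_. 0) 0) = map bit_symbol
     (encode_instance k (map (rq pnum) (net (ops vs))) (int (length (starts (net (ops vs))))))"
proof -
  have k: "gsem w (clg (\<lambda>_. incs 2)) ix n = ([], n + 2 * length cs)" for ix n
    unfolding gsem_clg by (subst gfor_enum[where X = "\<lambda>_ _. []"]) (auto split: prod.splits)
  have c: "gsem w (opsg (\<lambda>d. incs (cnt (Sw0 d))) (incs (cnt As))
       (\<lambda>j e d. incs (cnt (SwW undefined e d) + cnt (SwZ undefined e d)))) ix n =
      ([], n + length (starts (evops D 0 (ops vs))))" for ix n
    unfolding gfor_cnt[symmetric]
    by (rule gsem_opsg) (simp_all add: cnt_clause[of "(_, _)"])
  have i1: "gsem w (seqg (map (\<lambda>d. og [2, 2] ;> chg d ;> og (esym (Suc d))) [0..<D])) ix n =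
      (encs (concat (map (\<lambda>d. [St (Ch n d) (Some (Suc d))]) [0..<D])), n)" for ix n
    unfolding gsem_seqg by (rule gfor_encs) (simp add: gsem_chg)
  have i2: "gsem w (clg (\<lambda>j. Inc ;> ctrg (wtg j 0) ;> Inc ;> ctrg (dng j 0))) ix n =
      (encs (concat (map (\<lambda>q. [St (Wt (cs ! q) 0) (Some (n + 1 + 2 * q)), St (Dn (cs ! q) 0) (Some (n + 2 + 2 * q))])
         [0..<length cs])), n + 2 * length cs)" for ix n
    unfolding gsem_clg encs_concat_map
    by (subst gfor_enum[where X = "\<lambda>c n. encs [St (Wt c 0) (Some (n + 1)), St (Dn c 0) (Some (n + 2))]"])
      (auto simp: gsem_lng neqs esym_psym ac_simps)
  have o: "gsem w (opsg sw0g asg gateg) ix n = (encs (evops D n (ops vs)), n + length (ops vs))" for ix n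
    unfolding gfor_emit[symmetric] by (rule gsem_opsg) (rule gsem_emit)+
  have f1: "gsem w (seqg (map (\<lambda>d. anyg (chg d)) [0..<D])) ix n =
      (encs (concat (map (\<lambda>d. [En (Ch n d) None]) [0..<D])), n)" for ix n
    unfolding gsem_seqg by (rule gfor_encs) (simp add: gsem_pages)
  have f2: "gsem w (clg (\<lambda>j. Inc ;> ctrg (dng j 4) ;> Inc ;> anyg (wtg j 4))) ix n =
      (encs (concat (map (\<lambda>q. [En (Dn (cs ! q) 4) (Some (n + 1 + 2 * q)), En (Wt (cs ! q) 4) None])
         [0..<length cs])), n + 2 * length cs)" for ix n
    unfolding gsem_clg encs_concat_map
    by (subst gfor_enum[where X = "\<lambda>c n. encs [En (Dn c 4) (Some (n + 1)), En (Wt c 4) None]"])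
      (auto simp: gsem_lng gsem_pages neqs esym_psym ac_simps)
  have l4: "length (lits c) = 4" for c by (cases c) simp
  have single: "concat (map (\<lambda>d. [F d]) l) = map F l" for F :: "nat \<Rightarrow> cl nm ev" and l by (induction l) auto
  have "fst (gsem w maing (\<lambda>_. 0) 0) = esym k @ 1 # esym (length (starts (net (ops vs)))) @ encs (net (ops vs)) @ [1]"
    unfolding maing_def gsem.simps k c i1 i2 o f1 f2 gsem_og gsem_incs fst_conv snd_conv
      length_starts_net
    unfolding net_def init_def final_def k_def
    unfolding single l4 by (simp add: esym_psym)
  then show ?thesis
    by (simp add: encode_instance_def encode_int_def encode_requests_def esym_def encs_def enc_reqs_def map_concat comp_def)
qed

theorem instance_iff:
  "encode_instance k (map (rq pnum) (net (ops vs))) (int (length (starts (net (ops vs))))) \<in> All_or_One_Paging \<longleftrightarrow>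
     (\<exists>a. (\<forall>t<length tt. \<forall>i<length rr. a (t, i) < D) \<and>
       (\<forall>t<length tt. \<forall>i<length rr. \<not> bad (tt ! t) (rr ! i) [a (t, i), a (t, i + 1), a (t, i + 2), a (t + 1, i + 1)]))"
  unfolding All_or_One_Paging_iff of_nat_le_iff sat_iff_tiling[symmetric] csp_iff_feas
  by (rule misses_iff_feas[OF inj_pnum net_game(1,2)[OF wfo_ops]])

end

section \<open>Computations as tilings\<close>

text \<open>
  A row of the tiling is a configuration, with all tapes aligned at their heads. Every cell knows the
  state and the scanned symbols, so that its successor depends only on three neighbouring cells;
  \<open>cfl\<close> marks the scanned cell and \<open>cmk\<close> the origin of the last tape.
\<close>

datatype cell = Cell (cq: nat) (crd: "nat list") (cfl: bool) (csy: "nat list") (cmk: bool)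

definition pick :: "int \<Rightarrow> 'a \<Rightarrow> 'a \<Rightarrow> 'a \<Rightarrow> 'a" where
  "pick d l m r = (if d = - 1 then l else if d = 1 then r else m)"

fun view :: "tm_config \<Rightarrow> int \<Rightarrow> cell" where
  "view (q, tps) p = Cell q (map read_tape tps) (p = 0) (map (\<lambda>t. snd t (fst t + p)) tps) (fst (last tps) + p = 0)"

locale machine =
  fixes M :: tm
  assumes wf: "wf_tm M" and two: "2 \<le> num_tapes M"
begin

abbreviation "K \<equiv> num_tapes M"

text \<open>A halted machine writes back the scanned symbols and stays, so that all steps have the
  same form.\<close>

definition stp :: "nat \<Rightarrow> nat list \<Rightarrow> nat \<times> (nat \<times> int) list" where
  "stp q rd = (if q = halt_state M then (q, map (\<lambda>s. (s, 0)) rd) else delta M q rd)"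

text \<open>Offsets are relative to the heads: if a head moves by \<open>d\<close>, the new symbol
  at an offset is the old one at that offset plus \<open>d\<close>, or the written symbol if that
  was the scanned cell. The components \<open>crd\<close> and \<open>cfl\<close> are left to the
  constraints within the new row.\<close>

definition upd :: "cell \<Rightarrow> cell \<Rightarrow> cell \<Rightarrow> cell \<Rightarrow> bool" where
  "upd l m r n \<longleftrightarrow> (let (q', acts) = stp (cq m) (crd m) in
     cq n = q' \<and>
     csy n = map (\<lambda>k. let s = pick (snd (acts ! k)) l m r in if cfl s then fst (acts ! k) else csy s ! k) [0..<K] \<and>
     cmk n = cmk (pick (snd (last acts)) l m r))"

text \<open>Tape 1 is guessed: a blank is followed by blanks, and letters from 6 on, which mark
  offset \<open>L\<close>, force a blank. So its contents is a certificate of length at most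
  \<open>L\<close>. Both \<open>3 + s\<close> and \<open>6 + s\<close> prescribe the input symbol
  \<open>s\<close> on tape 0.\<close>

definition ini :: "nat \<Rightarrow> cell \<Rightarrow> cell \<Rightarrow> bool" where
  "ini b m r \<longleftrightarrow> cq m = start_state M \<and> (cmk m \<longleftrightarrow> cfl m) \<and>
     csy m ! 0 = (if b \<ge> 3 then (b - 3) mod 3 else 0) \<and> (\<forall>k. 2 \<le> k \<and> k < K \<longrightarrow> csy m ! k = 0) \<and>
     csy m ! 1 \<le> 2 \<and> (b < 3 \<or> b \<ge> 6 \<longrightarrow> csy m ! 1 = 0) \<and> (b \<ge> 3 \<and> csy m ! 1 = 0 \<longrightarrow> csy r ! 1 = 0)"

text \<open>The output is a word without blanks inside, so the cell at the origin and its right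
  neighbour decide whether it is \<open>[True]\<close>.\<close>

definition acc :: "cell \<Rightarrow> cell \<Rightarrow> bool" where
  "acc m r \<longleftrightarrow> (cmk m \<longrightarrow> csy m ! (K - 1) = 2 \<and> csy r ! (K - 1) = 0)"

text \<open>State and scanned symbols agree between neighbours, hence along a row, and the letter 2
  ties them to the actual contents under the heads.\<close>

definition ok :: "nat \<Rightarrow> nat \<Rightarrow> cell \<Rightarrow> cell \<Rightarrow> cell \<Rightarrow> cell \<Rightarrow> bool" where
  "ok a b l m r n \<longleftrightarrow> a = 4 \<or> b = 9 \<or>
     cq l = cq m \<and> cq r = cq m \<and> crd l = crd m \<and> crd r = crd m \<and> (cfl r \<longleftrightarrow> b = 2) \<and> (b = 2 \<longrightarrow> crd r = csy r) \<and>
     (a \<noteq> 3 \<longrightarrow> upd l m r n) \<and> (a = 1 \<longrightarrow> ini b m r) \<and> (a = 3 \<longrightarrow> acc m r)"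

definition syms :: "nat list set" where
  "syms = {s. set s \<subseteq> {..<num_symbols M} \<and> length s = K}"

definition cells :: "cell set" where
  "cells = {c. cq c < num_states M \<and> crd c \<in> syms \<and> csy c \<in> syms}"

lemma finite_cells: "finite cells"
proof -
  have "finite syms" unfolding syms_def by (rule finite_lists_length_eq) simp
  moreover have "cells \<subseteq> (\<lambda>(q, r, f, s, m). Cell q r f s m) `
      ({..<num_states M} \<times> syms \<times> UNIV \<times> syms \<times> UNIV)"
  proof
    fix c assume "c \<in> cells"
    then show "c \<in> (\<lambda>(q, r, f, s, m). Cell q r f s m) ` ({..<num_states M} \<times> syms \<times> UNIV \<times> syms \<times> UNIV)"
      by (intro image_eqI[of _ _ "(cq c, crd c, cfl c, csy c, cmk c)"]) (auto simp: cells_def)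
  qed
  ultimately show ?thesis by (meson finite_SigmaI finite_UNIV finite_imageI finite_lessThan finite_subset)
qed

section \<open>Rows obtained from configurations\<close>

definition good :: "tm_config \<Rightarrow> bool" where
  "good c \<longleftrightarrow> fst c < num_states M \<and> length (snd c) = K \<and> (\<forall>t\<in>set (snd c). \<forall>i. snd t i < num_symbols M)"

lemma reads_syms: "good (q, tps) \<Longrightarrow> map (\<lambda>t. snd t (fst t + p)) tps \<in> syms" "good (q, tps) \<Longrightarrow> map read_tape tps \<in> syms"
  by (auto simp: good_def syms_def read_tape_def)

lemma stp_wf:
  assumes "q < num_states M" "rd \<in> syms" "stp q rd = (q', acts)"
  shows "q' < num_states M" "length acts = K" "set acts \<subseteq> {..<num_symbols M} \<times> {-1, 0, 1}"
proof -
  have "q' < num_states M \<and> length acts = K \<and> set acts \<subseteq> {..<num_symbols M} \<times> {-1, 0, 1}"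
  proof (cases "q = halt_state M")
    case True
    then show ?thesis using assms by (auto simp: stp_def syms_def)
  next
    case False
    then have "delta M q rd = (q', acts)" using assms by (simp add: stp_def)
    moreover have "case delta M q rd of (q', acts) \<Rightarrow> q' < num_states M \<and> length acts = K \<and>
        set acts \<subseteq> {..<num_symbols M} \<times> {-1, 0, 1}"
      using wf assms(1,2) by (simp add: wf_tm_def syms_def)
    ultimately show ?thesis by simp
  qed
  then show "q' < num_states M" "length acts = K" "set acts \<subseteq> {..<num_symbols M} \<times> {-1, 0, 1}" by auto
qed

lemma tm_step_stp:
  "tm_step M (q, tps) = (case stp q (map read_tape tps) of (q', acts) \<Rightarrow> (q', map2 act_tape acts tps))"
proof -
  have "map2 act_tape (map (\<lambda>t. (read_tape t, 0)) tps) tps = tps"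
    by (rule nth_equalityI) (auto simp: act_tape_def read_tape_def)
  then show ?thesis by (auto simp: tm_step_def stp_def comp_def)
qed

lemma good_step: "good c \<Longrightarrow> good (tm_step M c)"
proof -
  assume g: "good c"
  obtain q tps where c: "c = (q, tps)" by fastforce
  obtain q' acts where s: "stp q (map read_tape tps) = (q', acts)" by fastforce
  have "q < num_states M" using g c by (simp add: good_def)
  note a = stp_wf[OF this reads_syms(2)[OF g[unfolded c]] s]
  have len: "length tps = K" using g c by (simp add: good_def)
  have "\<forall>i. snd t i < num_symbols M" if t: "t \<in> set (map2 act_tape acts tps)" for t
  proof -
    obtain k where k: "k < K" "t = act_tape (acts ! k) (tps ! k)"
      using t a(2) len by (auto simp: set_zip)
    have "acts ! k \<in> set acts" "tps ! k \<in> set tps" using k a(2) len by auto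
    then show ?thesis using a(3) g c k(2) by (auto simp: good_def act_tape_def)
  qed
  then show ?thesis using a len unfolding c tm_step_stp s by (auto simp: good_def)
qed

lemma view_step:
  assumes "good c"
  shows "upd (view c (p - 1)) (view c p) (view c (p + 1)) (view (tm_step M c) p)"
proof -
  obtain q tps where c: "c = (q, tps)" by fastforce
  obtain q' acts where s: "stp q (map read_tape tps) = (q', acts)" by fastforce
  have "q < num_states M" using assms c by (simp add: good_def)
  note a = stp_wf[OF this reads_syms(2)[OF assms[unfolded c]] s]
  have len: "length tps = K" using assms c by (simp add: good_def)
  have pk: "pick d (view c (p - 1)) (view c p) (view c (p + 1)) = view c (p + d)" if "d \<in> {-1, 0, 1}" for d
    using that by (auto simp: pick_def)
  have d: "snd (acts ! k) \<in> {-1, 0, 1}" if "k < K" for k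
  proof -
    have "acts ! k \<in> set acts" using that a(2) by simp
    then show ?thesis using a(3) by auto
  qed
  have cn: "view (tm_step M c) p = Cell q' (map read_tape (map2 act_tape acts tps)) (p = 0)
      (map (\<lambda>t. snd t (fst t + p)) (map2 act_tape acts tps)) (fst (last (map2 act_tape acts tps)) + p = 0)"
    unfolding c tm_step_stp s by simp
  have last: "last (map2 act_tape acts tps) = act_tape (last acts) (last tps)" "last acts = acts ! (K - 1)"
  proof -
    have ne: "acts \<noteq> []" "tps \<noteq> []" "map2 act_tape acts tps \<noteq> []" using len a(2) two by auto
    show "last acts = acts ! (K - 1)" using ne a(2) by (simp add: last_conv_nth)
    show "last (map2 act_tape acts tps) = act_tape (last acts) (last tps)"
      using ne len a(2) two by (simp add: last_conv_nth)
  qed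
  have "csy (view (tm_step M c) p) = map (\<lambda>k. let s = pick (snd (acts ! k)) (view c (p - 1)) (view c p) (view c (p + 1)) in
      if cfl s then fst (acts ! k) else csy s ! k) [0..<K]"
  proof (rule nth_equalityI)
    show "length (csy (view (tm_step M c) p)) = length (map (\<lambda>k. let s = pick (snd (acts ! k)) (view c (p - 1)) (view c p) (view c (p + 1)) in
      if cfl s then fst (acts ! k) else csy s ! k) [0..<K])" unfolding cn using len a(2) by simp
    fix k assume "k < length (csy (view (tm_step M c) p))"
    then have k: "k < K" unfolding cn using len a(2) by simp
    let ?v = "view c (p + snd (acts ! k))"
    have r: "map (\<lambda>k. let s = pick (snd (acts ! k)) (view c (p - 1)) (view c p) (view c (p + 1)) in
      if cfl s then fst (acts ! k) else csy s ! k) [0..<K] ! k = (if cfl ?v then fst (acts ! k) else csy ?v ! k)"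
      using k by (simp add: pk[OF d[OF k]] Let_def)
    show "csy (view (tm_step M c) p) ! k = map (\<lambda>k. let s = pick (snd (acts ! k)) (view c (p - 1)) (view c p) (view c (p + 1)) in
      if cfl s then fst (acts ! k) else csy s ! k) [0..<K] ! k"
      unfolding cn r using k len a(2) by (auto simp: c act_tape_def algebra_simps)
  qed
  moreover have "cmk (view (tm_step M c) p) = cmk (pick (snd (last acts)) (view c (p - 1)) (view c p) (view c (p + 1)))"
    unfolding cn last pk[OF d[of "K - 1", unfolded last(2)[symmetric]]]
    using two pk[OF d[of "K - 1"]] by (simp add: c act_tape_def algebra_simps)
  moreover have "cq (view (tm_step M c) p) = q'" unfolding cn by simp
  ultimately show ?thesis unfolding upd_def c by (simp add: s)
qed

text \<open>This keeps the origin of the output tape within the part of the last row that is known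
  to be a configuration.\<close>

lemma head_bound:
  assumes "good (q0, tps0)" "\<forall>t\<in>set tps0. fst t = 0" "(tm_step M ^^ n) (q0, tps0) = (q, tps)"
  shows "good (q, tps) \<and> (\<forall>t\<in>set tps. \<bar>fst t\<bar> \<le> int n)"
  using assms(3)
proof (induction n arbitrary: q tps)
  case 0
  then show ?case using assms by auto
next
  case (Suc n)
  obtain q1 tps1 where c: "(tm_step M ^^ n) (q0, tps0) = (q1, tps1)" by fastforce
  from Suc.IH[OF c] have IH: "good (q1, tps1)" "\<forall>t\<in>set tps1. \<bar>fst t\<bar> \<le> int n" by auto
  have st: "tm_step M (q1, tps1) = (q, tps)" using Suc.prems c by simp
  obtain q' acts where s: "stp q1 (map read_tape tps1) = (q', acts)" by fastforce
  have "q1 < num_states M" using IH by (simp add: good_def)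
  note a = stp_wf[OF this reads_syms(2)[OF IH(1)] s]
  have tps: "tps = map2 act_tape acts tps1" using st unfolding tm_step_stp s by simp
  have "\<bar>fst t\<bar> \<le> int (Suc n)" if t: "t \<in> set tps" for t
  proof -
    obtain z where z: "z \<in> set (zip acts tps1)" "t = act_tape (fst z) (snd z)"
      using t unfolding tps by auto
    define a' t' where "a' = fst z" and "t' = snd z"
    have t': "a' \<in> set acts" "t' \<in> set tps1" "t = act_tape a' t'"
      using z set_zip_leftD[of a' t' acts tps1] set_zip_rightD[of a' t' acts tps1] by (auto simp: a'_def t'_def)
    have "snd a' \<in> {-1, 0, 1}" using t' a(3) by auto
    moreover have "\<bar>fst t'\<bar> \<le> int n" using t' IH by blast
    ultimately show ?thesis using t'(3) by (auto simp: act_tape_def)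
  qed
  then show ?case using good_step[OF IH(1)] st by auto
qed

lemma good_init: "length ws \<le> K \<Longrightarrow> good (tm_init M ws)"
  using wf by (auto simp: good_def tm_init_def wf_tm_def string_contents_def bit_symbol_def)

end

text \<open>
  The constraints depend on the letters of the row and of the column. Rows: 1 first, 2 intermediate,
  3 last, 4 after the last. Columns: 1 left of the input, 2 two cells left of the head (so that the
  right neighbour of a window is the scanned cell), \<open>3 + s\<close> for the input symbol \<open>s\<close>, \<open>6 + s\<close> at the
  cell where the certificate must have ended, 9 unconstrained.
\<close>

definition row_letters :: "nat \<Rightarrow> nat list" where
  "row_letters T = 1 # replicate (T - 1) 2 @ [3, 4]"

definition body :: "bool list \<Rightarrow> nat \<Rightarrow> nat \<Rightarrow> nat" where
  "body x L p = (if p = L then 6 else 3) + (if p < length x then bit_symbol (x ! p) else 0)"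

definition col_letters :: "bool list \<Rightarrow> nat \<Rightarrow> nat \<Rightarrow> nat \<Rightarrow> nat list" where
  "col_letters x L T Q = replicate (2 * T) 1 @ 2 # map (body x L) [0..<Q] @ [9, 9]"

lemma length_row_letters: "1 \<le> T \<Longrightarrow> length (row_letters T) = T + 2"
  by (simp add: row_letters_def)

lemma row_letters_nth: "1 \<le> T \<Longrightarrow> t < T + 2 \<Longrightarrow>
    row_letters T ! t = (if t = 0 then 1 else if t < T then 2 else if t = T then 3 else 4)"
  by (auto simp: row_letters_def nth_Cons' nth_append)

lemma length_col_letters: "length (col_letters x L T Q) = 2 * T + Q + 3"
  by (simp add: col_letters_def)

lemma col_letters_nth: "i < 2 * T + Q + 3 \<Longrightarrow> col_letters x L T Q ! i =
    (if i < 2 * T then 1 else if i = 2 * T then 2 else if i < 2 * T + 1 + Q then body x L (i - 2 * T - 1) else 9)"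
  by (auto simp: col_letters_def nth_Cons' nth_append)

lemma body_cases: "body x L p \<in> {3..8}" "(body x L p - 3) mod 3 = (if p < length x then bit_symbol (x ! p) else 0)"
    "6 \<le> body x L p \<longleftrightarrow> p = L"
  by (auto simp: body_def bit_symbol_def)

text \<open>The reliable part of a row shrinks by one column per step on both sides, and the origin
  of the output tape drifts by at most \<open>T\<close>. Hence the margins of \<open>2 * T\<close>
  columns to the left of the head and \<open>2 * T + 2\<close> to the right.\<close>

locale tableau = machine M for M +
  fixes x :: "bool list" and L T Q :: nat and v :: "bool list \<Rightarrow> bool list"
  assumes T: "1 \<le> T" and Q: "2 * T + 2 \<le> Q" "L < Q"
    and run: "\<And>u. length u \<le> L \<Longrightarrow> computes_within M [x, u] (v u) T"
begin

abbreviation "tt \<equiv> row_letters T"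
abbreviation "rr \<equiv> col_letters x L T Q"
abbreviation "cols \<equiv> 2 * T + Q + 3"
abbreviation "mid \<equiv> 2 * T + 2"

definition tile :: "(nat \<Rightarrow> nat \<Rightarrow> cell) \<Rightarrow> bool" where
  "tile a \<longleftrightarrow> (\<forall>t<length tt. \<forall>i<length rr. a t i \<in> cells) \<and>
     (\<forall>t<length tt. \<forall>i<length rr. ok (tt ! t) (rr ! i) (a t i) (a t (i + 1)) (a t (i + 2)) (a (t + 1) (i + 1)))"

definition conf :: "bool list \<Rightarrow> nat \<Rightarrow> tm_config" where
  "conf u t = (tm_step M ^^ t) (tm_init M [x, u])"

lemma conf_Suc: "conf u (Suc t) = tm_step M (conf u t)"
  by (simp add: conf_def)

lemma good_conf: "good (conf u t)"
  unfolding conf_def using good_init[of "[x, u]"] two by (induction t) (auto intro: good_step)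

lemma view_cells: "good c \<Longrightarrow> view c p \<in> cells"
  using reads_syms(1)[of "fst c" "snd c" p] reads_syms(2)[of "fst c" "snd c"] by (cases c) (auto simp: cells_def good_def)

lemma view_init:
  "view (conf u 0) p = Cell (start_state M) (map (\<lambda>t. snd t 0) (snd (tm_init M [x, u]))) (p = 0)
     (string_contents x p # string_contents u p # replicate (K - 2) 0) (p = 0)"
proof -
  have K: "[0..<K] = 0 # 1 # [2..<K]" using two by (simp add: upt_conv_Cons numeral_2_eq_2)
  have e: "string_contents [] = (\<lambda>_. 0)" by (auto simp: string_contents_def)
  have "map (\<lambda>i. string_contents (if i < 2 then [x, u] ! i else []) p) [2..<K] = replicate (K - 2) 0"
    by (rule nth_equalityI) (auto simp: e)
  then have s: "map (\<lambda>t. snd t (fst t + p)) (snd (tm_init M [x, u])) = string_contents x p # string_contents u p # replicate (K - 2) 0"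
    by (simp add: tm_init_def K comp_def numeral_2_eq_2)
  have z: "fst t = 0" if "t \<in> set (snd (tm_init M [x, u]))" for t using that by (auto simp: tm_init_def)
  have l: "fst (last (snd (tm_init M [x, u]))) = 0" by (rule z, rule last_in_set) (use two in \<open>auto simp: tm_init_def\<close>)
  have r: "map read_tape (snd (tm_init M [x, u])) = map (\<lambda>t. snd t 0) (snd (tm_init M [x, u]))"
    using z by (auto simp: read_tape_def)
  obtain tps where t: "tm_init M [x, u] = (start_state M, tps)" by (simp add: tm_init_def)
  show ?thesis using s l r unfolding conf_def t by (simp add: t)
qed

lemma conf_final:
  assumes "length u \<le> L"
  shows "snd (last (snd (conf u T))) = string_contents (v u)"
  using run[OF assms] by (auto simp: computes_within_def conf_def split: prod.splits)

lemma view_last: "good c \<Longrightarrow> csy (view c p) ! (K - 1) = snd (last (snd c)) (fst (last (snd c)) + p)"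
proof -
  assume g: "good c"
  then have "snd c \<noteq> []" "length (snd c) = K" using two by (auto simp: good_def)
  then show ?thesis using two by (cases c) (simp add: last_conv_nth)
qed

lemma tile_complete:
  assumes u: "length u \<le> L" "v u = [True]"
  shows "tile (\<lambda>t i. view (conf u t) (int i - int mid))"
proof -
  let ?a = "\<lambda>t i. view (conf u t) (int i - int mid)"
  have "ok (tt ! t) (rr ! i) (?a t i) (?a t (i + 1)) (?a t (i + 2)) (?a (t + 1) (i + 1))"
    if ti: "t < T + 2" "i < cols" for t i
  proof (cases "tt ! t = 4 \<or> rr ! i = 9")
    case False
    let ?p = "int i - int mid + 1"
    obtain q tps where c: "conf u t = (q, tps)" by fastforce
    have p: "int (i + 1) - int mid - 1 = int i - int mid" "int (i + 1) - int mid + 1 = int (i + 2) - int mid" by auto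
    have up: "upd (?a t i) (?a t (i + 1)) (?a t (i + 2)) (?a (t + 1) (i + 1))"
      using view_step[OF good_conf[of u t], of "int (i + 1) - int mid"] unfolding p by (simp add: conf_def)
    have i2: "rr ! i = 2 \<longleftrightarrow> i = 2 * T"
      using ti(2) body_cases(1)[of x L "i - 2 * T - 1"] by (auto simp: col_letters_nth)
    have "ini (rr ! i) (?a t (i + 1)) (?a t (i + 2))" if "tt ! t = 1"
    proof -
      have t0: "t = 0"
      proof (rule ccontr)
        assume "t \<noteq> 0"
        then have "tt ! t \<noteq> 1" unfolding row_letters_nth[OF T ti(1)] by simp
        then show False using that by contradiction
      qed
      have lt: "i < 2 * T + 1 + Q"
        using False ti(2) by (intro not_le_imp_less notI) (simp add: col_letters_nth)
      show ?thesis
      proof (cases "i \<le> 2 * T")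
        case True
        then have r: "rr ! i < 3" using ti(2) by (simp add: col_letters_nth)
        have n: "string_contents y (int (i + 1) - int mid) = 0" for y using True by (simp add: string_contents_def)
        show ?thesis using r n unfolding ini_def t0 view_init
          by (auto simp: nth_Cons')
      next
        case False
        define j where "j = i - 2 * T - 1"
        have 2: "i = 2 * T + 1 + j" "j < Q" using False lt by (auto simp: j_def)
        have r: "rr ! i = body x L j" using 2 ti(2) by (auto simp: col_letters_nth)
        have pj: "int (i + 1) - int mid = int j" "int (i + 2) - int mid = int (Suc j)" using 2 by auto
        have sx: "string_contents x (int j) = (body x L j - 3) mod 3" unfolding body_cases(2) by (simp add: string_contents_def)
        have su: "string_contents u (int j) = 0 \<longleftrightarrow> j \<ge> length u" "string_contents u (int j) \<le> 2"
          "j \<ge> length u \<Longrightarrow> string_contents u (int (Suc j)) = 0"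
          by (auto simp: string_contents_def bit_symbol_def)
        have b3: "3 \<le> body x L j" using body_cases(1)[of x L j] by simp
        have b6: "6 \<le> body x L j \<Longrightarrow> j \<ge> length u" using body_cases(3)[of x L j] u(1) by simp
        show ?thesis unfolding ini_def t0 view_init r pj
          using sx su b3 b6 by (auto simp: nth_Cons')
      qed
    qed
    moreover have "acc (?a t (i + 1)) (?a t (i + 2))" if "tt ! t = 3"
    proof -
      have t: "t = T"
      proof (rule ccontr)
        assume "t \<noteq> T"
        then have "tt ! t \<noteq> 3" unfolding row_letters_nth[OF T ti(1)] by simp
        then show False using that by contradiction
      qed
      have l: "snd (last (snd (conf u T))) = string_contents [True]" using conf_final[OF u(1)] u(2) by simp
      show ?thesis unfolding acc_def t
      proof (intro impI conjI)
        assume m: "cmk (?a T (i + 1))"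
        have h: "fst (last (snd (conf u T))) + (int (i + 1) - int mid) = 0"
          using m by (cases "conf u T") simp
        then have h': "fst (last (snd (conf u T))) + (int (i + 2) - int mid) = 1" by simp
        show "csy (?a T (i + 1)) ! (K - 1) = 2" "csy (?a T (i + 2)) ! (K - 1) = 0"
          unfolding view_last[OF good_conf] l h h' by (simp_all add: string_contents_def)
      qed
    qed
    ultimately show ?thesis using up i2 unfolding ok_def c view.simps by (auto simp: read_tape_def)
  qed (auto simp: ok_def)
  then show ?thesis unfolding tile_def length_row_letters[OF T] length_col_letters
    using view_cells[OF good_conf] by blast
qed

lemma upd_unique: "upd l m r n \<Longrightarrow> upd l m r n' \<Longrightarrow> cq n = cq n' \<and> csy n = csy n' \<and> cmk n = cmk n'"
  by (auto simp: upd_def split: prod.splits)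

lemma tile_window:
  assumes "tile a" "t \<le> T" "i + 2 < cols"
  shows "crd (a t i) = crd (a t (i + 1))" "crd (a t (i + 2)) = crd (a t (i + 1))"
    "cfl (a t (i + 2)) \<longleftrightarrow> i = 2 * T" "i = 2 * T \<Longrightarrow> crd (a t (i + 2)) = csy (a t (i + 2))"
    "t < T \<Longrightarrow> upd (a t i) (a t (i + 1)) (a t (i + 2)) (a (t + 1) (i + 1))"
    "t = 0 \<Longrightarrow> ini (rr ! i) (a t (i + 1)) (a t (i + 2))" "t = T \<Longrightarrow> acc (a t (i + 1)) (a t (i + 2))"
proof -
  have t: "t < T + 2" and i: "i < cols" using assms by auto
  have o: "ok (tt ! t) (rr ! i) (a t i) (a t (i + 1)) (a t (i + 2)) (a (t + 1) (i + 1))"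
    using assms(1) t i unfolding tile_def length_row_letters[OF T] length_col_letters by blast
  have tt: "tt ! t = (if t = 0 then 1 else if t < T then 2 else if t = T then 3 else 4)"
    by (rule row_letters_nth[OF T t])
  have 4: "tt ! t \<noteq> 4" "t = 0 \<Longrightarrow> tt ! t = 1" "tt ! t = 3 \<longleftrightarrow> t = T" unfolding tt using assms(2) T by auto
  have b: "body x L p \<noteq> 9" "body x L p \<noteq> 2" for p using body_cases(1)[of x L p] by auto
  have 9: "rr ! i \<noteq> 9" "rr ! i = 2 \<longleftrightarrow> i = 2 * T" unfolding col_letters_nth[OF i] using assms(3) b by auto
  show "crd (a t i) = crd (a t (i + 1))" "crd (a t (i + 2)) = crd (a t (i + 1))"
    "cfl (a t (i + 2)) \<longleftrightarrow> i = 2 * T" "i = 2 * T \<Longrightarrow> crd (a t (i + 2)) = csy (a t (i + 2))"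
    "t < T \<Longrightarrow> upd (a t i) (a t (i + 1)) (a t (i + 2)) (a (t + 1) (i + 1))"
    "t = 0 \<Longrightarrow> ini (rr ! i) (a t (i + 1)) (a t (i + 2))" "t = T \<Longrightarrow> acc (a t (i + 1)) (a t (i + 2))"
    using o 4 9 unfolding ok_def by auto
qed

text \<open>The ends of a row are not constrained, so row \<open>t\<close> is known to be a configuration only at distance
  more than \<open>t\<close> from them.\<close>

lemma tile_sound:
  assumes tile: "tile a"
  shows "\<exists>u. length u \<le> L \<and> v u = [True]"
proof -
  note win = tile_window[OF tile]
  have len: "length (csy (a t i)) = K" if "t < T + 2" "i < cols" for t i
    using tile that unfolding tile_def length_row_letters[OF T] length_col_letters
    by (auto simp: cells_def syms_def)
  have crd0: "crd (a t i) = crd (a t 0)" if "t \<le> T" "i < cols" for t i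
    using that(2)
  proof (induction i)
    case (Suc i)
    have "crd (a t (Suc i)) = crd (a t i)"
    proof (cases "i + 2 < cols")
      case True
      then show ?thesis using win(1)[OF that(1) True] by simp
    next
      case False
      then have "i - 1 + 2 < cols" "i - 1 + 2 = Suc i" "i - 1 + 1 = i" using Suc.prems by auto
      then show ?thesis using win(2)[OF that(1), of "i - 1"] by simp
    qed
    then show ?case using Suc by simp
  qed simp
  define g where "g p = csy (a 0 (mid + p)) ! 1" for p
  have ini: "csy (a 0 (mid + p)) ! 0 = string_contents x (int p) \<and> (\<forall>k. 2 \<le> k \<and> k < K \<longrightarrow> csy (a 0 (mid + p)) ! k = 0) \<and>
      g p \<le> 2 \<and> (p = L \<longrightarrow> g p = 0) \<and> (g p = 0 \<longrightarrow> g (Suc p) = 0)" if p: "p < Q" for p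
  proof -
    let ?i = "2 * T + 1 + p"
    have "ini (rr ! ?i) (a 0 (?i + 1)) (a 0 (?i + 2))" by (rule win(6)) (use p in auto)
    moreover have "rr ! ?i = body x L p" using p by (simp add: col_letters_nth)
    moreover have "?i + 1 = mid + p" "?i + 2 = mid + Suc p" by auto
    ultimately have i: "ini (body x L p) (a 0 (mid + p)) (a 0 (mid + Suc p))" by metis
    have b: "3 \<le> body x L p" using body_cases(1)[of x L p] by simp
    show ?thesis using i b body_cases(2,3)[of x L p] unfolding ini_def g_def
      by (auto simp: string_contents_def)
  qed
  \<comment> \<open>The certificate ends at the first blank of tape 1, which exists because offset
    \<open>L\<close> is forced to be blank.\<close>
  define n where "n = (LEAST p. g p = 0)"
  have gL: "g L = 0" using ini[OF Q(2)] by blast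
  have n: "g n = 0" "n \<le> L" "\<And>p. p < n \<Longrightarrow> g p \<noteq> 0"
    unfolding n_def using LeastI[of "\<lambda>p. g p = 0", OF gL] Least_le[of "\<lambda>p. g p = 0", OF gL] not_less_Least by auto
  have zero: "g p = 0" if "n \<le> p" "p < Q" for p
    using that
  proof (induction p rule: dec_induct)
    case (step p)
    then show ?case using ini[of p] by auto
  qed (rule n(1))
  define u where "u = map (\<lambda>p. g p = 2) [0..<n]"
  have u: "length u \<le> L" using n(2) by (simp add: u_def)
  have sc: "string_contents u (int p) = g p" if p: "p < Q" for p
  proof (cases "p < n")
    case True
    have "g p \<noteq> 0" "g p \<le> 2" using n(3)[OF True] ini[OF p] by auto
    then have "g p = 1 \<or> g p = 2" by linarith
    then show ?thesis using True by (auto simp: string_contents_def u_def bit_symbol_def)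
  next
    case False
    then show ?thesis using zero[of p] p by (simp add: string_contents_def u_def)
  qed
  define R where "R t \<longleftrightarrow> (\<forall>i. 2 + t \<le> i \<and> i + t \<le> 2 * T + Q + 1 \<longrightarrow> a t i = view (conf u t) (int i - int mid))" for t
  \<comment> \<open>The other two components follow within the row: \<open>cfl\<close> is determined
    by the column, and \<open>crd\<close> is constant and equals the symbols in column
    \<open>mid\<close>.\<close>
  have full: "R t" if t: "t \<le> T" and e: "\<And>i. 2 + t \<le> i \<Longrightarrow> i + t \<le> 2 * T + Q + 1 \<Longrightarrow>
     cq (a t i) = cq (view (conf u t) (int i - int mid)) \<and> csy (a t i) = csy (view (conf u t) (int i - int mid)) \<and>
     cmk (a t i) = cmk (view (conf u t) (int i - int mid))" for t
    unfolding R_def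
  proof (intro allI impI)
    fix i assume i: "2 + t \<le> i \<and> i + t \<le> 2 * T + Q + 1"
    let ?v = "view (conf u t) (int i - int mid)"
    have ic: "i < cols" "i - 2 + 2 < cols" "i - 2 + 2 = i" using i by auto
    have "crd (a t i) = crd (a t mid)" using crd0[OF t ic(1)] crd0[OF t, of mid] Q(1) by simp
    also have "\<dots> = csy (a t mid)" using win(4)[OF t, of "2 * T"] Q(1) by simp
    also have "\<dots> = csy (view (conf u t) 0)" using e[of mid] t Q(1) by simp
    also have "\<dots> = crd ?v" by (cases "conf u t") (simp add: read_tape_def)
    finally have r: "crd (a t i) = crd ?v" .
    have "cfl (a t i) \<longleftrightarrow> i - 2 = 2 * T" using win(3)[OF t ic(2)] unfolding ic(3) .
    also have "\<dots> \<longleftrightarrow> cfl ?v" using i by (cases "conf u t") auto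
    finally have f: "cfl (a t i) = cfl ?v" .
    show "a t i = ?v" by (rule cell.expand) (use r f e[of i] i in auto)
  qed
  have R0: "R 0"
  proof (rule full)
    fix i assume i: "2 + 0 \<le> i" "i + 0 \<le> 2 * T + Q + 1"
    have ic: "i - 1 + 2 < cols" "i - 1 + 1 = i" "i - 2 + 2 < cols" "i - 2 + 2 = i" "i < cols" using i by auto
    have I: "ini (rr ! (i - 1)) (a 0 i) (a 0 (i - 1 + 2))" using win(6)[OF _ ic(1)] unfolding ic(2) by simp
    have f: "cfl (a 0 i) \<longleftrightarrow> i - 2 = 2 * T" using win(3)[OF _ ic(3), of 0] unfolding ic(4) by simp
    let ?p = "int i - int mid"
    have s: "csy (a 0 i) = string_contents x ?p # string_contents u ?p # replicate (K - 2) 0"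
    proof (rule nth_equalityI)
      show l: "length (csy (a 0 i)) = length (string_contents x ?p # string_contents u ?p # replicate (K - 2) 0)"
        using len[OF _ ic(5), of 0] two by simp
      fix k assume k: "k < length (csy (a 0 i))"
      then have kK: "k < K" using len[OF _ ic(5), of 0] by simp
      have "csy (a 0 i) ! 0 = string_contents x ?p \<and> csy (a 0 i) ! 1 = string_contents u ?p"
      proof (cases "i < mid")
        case True
        then have "rr ! (i - 1) < 3" using ic by (auto simp: col_letters_nth)
        moreover have "string_contents y ?p = 0" for y using True by (simp add: string_contents_def)
        ultimately show ?thesis using I by (simp add: ini_def)
      next
        case False
        define p where "p = i - mid"
        have p: "p < Q" "i = mid + p" using i False by (auto simp: p_def)
        have pp: "int (mid + p) - int mid = int p" by simp
        show ?thesis unfolding p(2) pp sc[OF p(1)] using ini[OF p(1)] unfolding g_def by blast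
      qed
      moreover have "2 \<le> k \<Longrightarrow> csy (a 0 i) ! k = 0" using I kK by (simp add: ini_def)
      moreover have "k = 0 \<or> k = 1 \<or> 2 \<le> k" by linarith
      ultimately show "csy (a 0 i) ! k = (string_contents x ?p # string_contents u ?p # replicate (K - 2) 0) ! k"
        using kK by (auto simp: nth_Cons')
    qed
    show "cq (a 0 i) = cq (view (conf u 0) ?p) \<and> csy (a 0 i) = csy (view (conf u 0) ?p) \<and>
       cmk (a 0 i) = cmk (view (conf u 0) ?p)"
      unfolding view_init s using I f i by (auto simp: ini_def)
  qed simp
  have RT: "R t" if "t \<le> T" for t
    using that
  proof (induction t)
    case (Suc t)
    then have IH: "R t" by simp
    show ?case
    proof (rule full)
      fix i assume i: "2 + Suc t \<le> i" "i + Suc t \<le> 2 * T + Q + 1"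
      let ?p = "int i - int mid"
      have ic: "i - 1 + 2 < cols" "i - 1 + 1 = i" "i - 1 + 2 = i + 1" "t + 1 = Suc t" using i by auto
      have i1: "2 + t \<le> i - 1 \<and> i - 1 + t \<le> 2 * T + Q + 1" using i by auto
      have "upd (a t (i - 1)) (a t i) (a t (i + 1)) (a (Suc t) i)"
        using win(5)[OF _ ic(1), of t] Suc.prems unfolding ic by simp
      moreover have "a t (i - 1) = view (conf u t) (?p - 1)" "a t i = view (conf u t) ?p" "a t (i + 1) = view (conf u t) (?p + 1)"
        using IH[unfolded R_def, rule_format, of "i - 1"] i1 IH[unfolded R_def, rule_format, of i]
          IH[unfolded R_def, rule_format, of "i + 1"] i by (auto simp: of_nat_diff algebra_simps)
      moreover have "upd (view (conf u t) (?p - 1)) (view (conf u t) ?p) (view (conf u t) (?p + 1)) (view (conf u (Suc t)) ?p)"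
        unfolding conf_Suc by (rule view_step[OF good_conf])
      ultimately show "cq (a (Suc t) i) = cq (view (conf u (Suc t)) ?p) \<and> csy (a (Suc t) i) = csy (view (conf u (Suc t)) ?p) \<and>
        cmk (a (Suc t) i) = cmk (view (conf u (Suc t)) ?p)" using upd_unique by metis
    qed (rule Suc.prems)
  qed (rule R0)
  obtain q tps where c: "conf u T = (q, tps)" by fastforce
  obtain q0 tps0 where c0: "tm_init M [x, u] = (q0, tps0)" by fastforce
  have "good (q0, tps0)" using good_init[of "[x, u]"] two c0 by simp
  moreover have "\<forall>t\<in>set tps0. fst t = 0" using c0 by (auto simp: tm_init_def)
  moreover have "(tm_step M ^^ T) (q0, tps0) = (q, tps)" using c c0 by (simp add: conf_def)
  ultimately have hb: "good (q, tps) \<and> (\<forall>t\<in>set tps. \<bar>fst t\<bar> \<le> int T)" by (rule head_bound)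
  then have "last tps \<in> set tps" using two by (intro last_in_set) (auto simp: good_def)
  then have h: "\<bar>fst (last tps)\<bar> \<le> int T" using hb by blast
  \<comment> \<open>The column of the origin of the output tape, as column \<open>mid\<close> shows
    the cell under the head.\<close>
  define i where "i = nat (int mid - fst (last tps))"
  have i: "int i = int mid - fst (last tps)" using h by (simp add: i_def)
  have r: "2 + T \<le> i" "i + 1 + T \<le> 2 * T + Q + 1" using h i Q(1) by linarith+
  have v1: "a T i = view (conf u T) (int i - int mid)" "a T (i + 1) = view (conf u T) (int (i + 1) - int mid)"
    using RT[OF order_refl, unfolded R_def, rule_format, of i] RT[OF order_refl, unfolded R_def, rule_format, of "i + 1"] r by auto
  have ic: "i - 1 + 2 < cols" "i - 1 + 1 = i" "i - 1 + 2 = i + 1" using r by auto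
  have "acc (a T i) (a T (i + 1))" using win(7)[OF order_refl ic(1) refl] unfolding ic .
  moreover have "cmk (a T i)" unfolding v1 c using i by simp
  ultimately have "csy (a T i) ! (K - 1) = 2" "csy (a T (i + 1)) ! (K - 1) = 0" by (auto simp: acc_def)
  moreover have "csy (a T i) ! (K - 1) = string_contents (v u) 0"
  proof -
    have "fst (last (snd (conf u T))) + (int i - int mid) = 0" using i c by simp
    then show ?thesis unfolding v1(1) view_last[OF good_conf] conf_final[OF u] by (rule arg_cong)
  qed
  moreover have "csy (a T (i + 1)) ! (K - 1) = string_contents (v u) 1"
  proof -
    have "fst (last (snd (conf u T))) + (int (i + 1) - int mid) = 1" using i c by simp
    then show ?thesis unfolding v1(2) view_last[OF good_conf] conf_final[OF u] by (rule arg_cong)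
  qed
  ultimately have "string_contents (v u) 0 = 2" "string_contents (v u) 1 = 0" by simp_all
  \<comment> \<open>The contents of an output has no blank before its end, so a 2 followed by a
    blank leaves only one word.\<close>
  then have "v u = [True]"
    by (cases "v u" rule: remdups_adj.cases) (auto simp: string_contents_def bit_symbol_def split: if_splits)
  then show ?thesis using u by blast
qed

theorem tile_iff: "(\<exists>a. tile a) \<longleftrightarrow> (\<exists>u. length u \<le> L \<and> v u = [True])"
  using tile_complete tile_sound by blast

end

section \<open>Generating the letters of the board\<close>

lemma gfor_const: "(\<And>a n. a \<in> set l \<Longrightarrow> f a n = (c, n)) \<Longrightarrow> gfor f l n = (concat (replicate (length l) c), n)"
  by (induction l) auto

lemma gfor_letters: "(\<And>a n. a \<in> set l \<Longrightarrow> f a n = ([h a], n)) \<Longrightarrow> gfor f l n = (map h l, n)"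
  by (induction l) auto

lemma stg_snoc: "stg 1 (gs @ [g]) w (Suc (length gs)) = fst (gsem (stg 1 gs w) g (\<lambda>_. 0) 0)"
  by (simp add: stg_append)

lemma stg_prefix: "i \<le> length gs \<Longrightarrow> stg 1 (gs @ gs') w i = stg 1 gs w i"
  by (simp add: stg_append stg_less)

lemma gib_og: "gib n (og l) = 0"
  unfolding og_def by (induction l) (auto simp: seqg_def)

text \<open>Horner's scheme in unary.\<close>

lemma unary_stages:
  fixes p :: "nat poly"
  assumes "wfs 10 1 gs0"
  shows "\<exists>gs. gs \<noteq> [] \<and> wfs 10 1 (gs0 @ gs) \<and>
    (\<forall>x. stg 1 (gs0 @ gs) (inp x) (length (gs0 @ gs)) = replicate (poly p (length x)) 1)"
proof (induction p)
  case 0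
  show ?case
    using assms stg_snoc[of gs0 GSkip] by (intro exI[of _ "[GSkip]"]) (simp add: wfs_append)
next
  case (pCons a p)
  then obtain gs where gs: "gs \<noteq> []" "wfs 10 1 (gs0 @ gs)"
    "\<forall>x. stg 1 (gs0 @ gs) (inp x) (length (gs0 @ gs)) = replicate (poly p (length x)) 1" by blast
  let ?j = "length (gs0 @ gs)"
  let ?g = "og (replicate a 1) ;> For 0 (For ?j (Out 1))"
  \<comment> \<open>\<open>gs\<close> is nonempty, so its last string is not the input itself and
    the two nested loops have different variables.\<close>
  have j: "?j \<noteq> 0" using gs(1) by simp
  have wf: "wfs 10 1 (gs0 @ gs @ [?g])"
    using gs(2) j by (auto simp: wfs_append gib_og)
  have "stg 1 (gs0 @ gs @ [?g]) (inp x) (length (gs0 @ gs @ [?g])) = replicate (poly (pCons a p) (length x)) 1" for x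
  proof -
    let ?w = "stg 1 (gs0 @ gs) (inp x)"
    have w: "?w ?j = replicate (poly p (length x)) 1" "?w 0 = map bit_symbol x"
      using gs(3) by (auto simp: stg_less inp_def)
    have i: "gsem ?w (For ?j (Out 1)) ix n = (replicate (poly p (length x)) 1, n)" for ix n
      unfolding gsem.simps w(1) by (subst gfor_letters[where h = "\<lambda>_. 1"]) (auto simp: map_replicate_const)
    have o: "gsem ?w (For 0 (For ?j (Out 1))) ix n = (replicate (length x * poly p (length x)) 1, n)" for ix n
    proof -
      have "gsem ?w (For 0 (For ?j (Out 1))) ix n =
        (concat (replicate (length [0..<length x]) (replicate (poly p (length x)) 1)), n)"
        unfolding gsem.simps(9)[of _ 0] w(2) length_map by (rule gfor_const) (rule i)
      moreover have "concat (replicate a (replicate b c)) = replicate (a * b) c" for a b and c :: nat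
        by (induction a) (auto simp: replicate_add)
      ultimately show ?thesis by simp
    qed
    have "stg 1 ((gs0 @ gs) @ [?g]) (inp x) (Suc ?j) = fst (gsem ?w ?g (\<lambda>_. 0) 0)" by (rule stg_snoc)
    also have "\<dots> = replicate a 1 @ replicate (length x * poly p (length x)) 1"
      unfolding gsem.simps(8) gsem_og fst_conv snd_conv o ..
    finally show ?thesis by (simp add: replicate_add)
  qed
  then show ?case using wf by (intro exI[of _ "gs @ [?g]"]) simp
qed

text \<open>The input padded with 3 has one letter for each column from the head on, and still shows
  the input symbols.\<close>

definition xg :: "nat \<Rightarrow> gen" where
  "xg q = For 0 (IfLet 0 {1} (Out 1) (Out 2)) ;> For q (Out 3)"

text \<open>The only 2 stands at index \<open>L\<close>, so \<open>IfEq\<close> can compare a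
  position with \<open>L\<close> when the loop has reached it.\<close>

definition lg :: "nat \<Rightarrow> gen" where
  "lg l = For l (Out 1) ;> Out 2"

definition rowg :: "nat \<Rightarrow> gen" where
  "rowg t = Out 1 ;> For t (Out 2) ;> og [3, 4]"

definition bodyg :: "nat \<Rightarrow> nat \<Rightarrow> gen" where
  "bodyg a b = IfLet a {1} (Out (b + 1)) (IfLet a {2} (Out (b + 2)) (Out b))"

text \<open>The inner loop writes exactly one letter, at the only 2 of its string. The constant
  \<open>[1, 1]\<close> after the first loop accounts for the successor in
  \<open>T = Suc (poly pT n)\<close>.\<close>

definition colg :: "nat \<Rightarrow> nat \<Rightarrow> nat \<Rightarrow> gen" where
  "colg t a b = For t (og [1, 1]) ;> og [1, 1, 2] ;>
     For a (For b (IfLet b {2} (IfEq a b 0 (bodyg a 6) (bodyg a 3)) GSkip)) ;> og [9, 9]"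

lemma gsem_For_Out: "gsem w (For i (Out c)) ix n = (replicate (length (w i)) c, n)"
  unfolding gsem.simps by (subst gfor_letters[where h = "\<lambda>_. c"]) (auto simp: map_replicate_const)

lemma gsem_xg:
  assumes "w 0 = map bit_symbol x" "length (w q) = m"
  shows "fst (gsem w (xg q) ix n) = map bit_symbol x @ replicate m 3"
proof -
  have "gsem w (For 0 (IfLet 0 {1} (Out 1) (Out 2))) ix n = (map (\<lambda>i. bit_symbol (x ! i)) [0..<length x], n)" for n
    unfolding gsem.simps assms(1) length_map
    by (rule gfor_letters) (auto simp: str_def bit_symbol_def)
  moreover have "map (\<lambda>i. bit_symbol (x ! i)) [0..<length x] = map bit_symbol x"
    by (rule nth_equalityI) auto
  ultimately show ?thesis using gsem_For_Out[of w q 3] assms(2) by (simp add: xg_def)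
qed

lemma gsem_lg: "length (w l) = m \<Longrightarrow> fst (gsem w (lg l) ix n) = replicate m 1 @ [2]"
  using gsem_For_Out[of w l 1] by (simp add: lg_def)

lemma gsem_rowg: "length (w t) = T \<Longrightarrow> fst (gsem w (rowg t) ix n) = row_letters (Suc T)"
  using gsem_For_Out[of w t 2] by (simp add: rowg_def row_letters_def)

lemma gsem_colg:
  assumes "length (w t) = T" "w a = map bit_symbol x @ replicate m 3" "w b = replicate L 1 @ [2]" "a \<noteq> b"
  shows "fst (gsem w (colg t a b) ix n) = col_letters x L (Suc T) (length x + m)"
proof -
  have l: "gsem w (For t (og [1, 1])) ix n = (replicate (2 * T) 1, n)" for ix n
  proof -
    have "gsem w (For t (og [1, 1])) ix n = (concat (replicate (length [0..<T]) [1, 1]), n)"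
      unfolding gsem.simps assms(1) by (rule gfor_const) simp
    moreover have "concat (replicate T [1, 1]) = replicate (2 * T) (1::nat)" by (induction T) auto
    ultimately show ?thesis by simp
  qed
  have body: "gsem w (bodyg a c) ix n = ([c + (if p < length x then bit_symbol (x ! p) else 0)], n)"
    if "ix a = p" "p < length x + m" for c ix n p
  proof -
    have "str (w a) (int p) = (if p < length x then bit_symbol (x ! p) else 3)"
      using that unfolding assms(2) by (auto simp: str_def nth_append)
    then show ?thesis using that by (simp add: bodyg_def bit_symbol_def)
  qed
  have inner: "gsem w (For b (IfLet b {2} (IfEq a b 0 (bodyg a 6) (bodyg a 3)) GSkip)) ix n = ([body x L p], n)"
    if p: "ix a = p" "p < length x + m" for ix n p
  proof -
    have s: "str (w b) (int i) = (if i < L then 1 else 2)" if "i \<le> L" for i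
      unfolding assms(3) using that by (auto simp: str_def nth_append)
    let ?f = "\<lambda>i. gsem w (IfLet b {2} (IfEq a b 0 (bodyg a 6) (bodyg a 3)) GSkip) (ix(b := i))"
    have 1: "gfor ?f [0..<L] n = ([], n)" for n
      by (subst gfor_const[where c = "[]"]) (use s in \<open>auto\<close>)
    have 2: "?f L n = ([body x L p], n)" for n
      using s[of L] p assms(4) body[of "ix(b := L)" p] by (simp add: body_def)
    have "length (w b) = Suc L" using assms(3) by simp
    then show ?thesis unfolding gsem.simps(9) by (simp add: gfor_append 1 2 del: gsem.simps)
  qed
  have "gsem w (For a (For b (IfLet b {2} (IfEq a b 0 (bodyg a 6) (bodyg a 3)) GSkip))) ix n =
      (map (body x L) [0..<length x + m], n)" for ix n
  proof -
    have la: "length (w a) = length x + m" using assms(2) by simp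
    show ?thesis unfolding gsem.simps(9)[of _ a] la by (rule gfor_letters) (simp add: inner del: gsem.simps)
  qed
  then show ?thesis unfolding colg_def gsem.simps(8) l gsem_og fst_conv snd_conv
    by (simp add: col_letters_def replicate_append_same[symmetric] del: gsem.simps)
qed

text \<open>Each of the two strings is written twice, because the loops for constraints run inside
  those for variables.\<close>

lemma string_stages:
  fixes pT pL pQ :: "nat poly"
  shows "\<exists>gs c. wfs 10 1 gs \<and> c + 3 \<le> length gs \<and> (\<forall>x. let w = stg 1 gs (inp x); n = length x; T = Suc (poly pT n) in
     w c = row_letters T \<and> w (c + 1) = row_letters T \<and>
     w (c + 2) = col_letters x (poly pL n) T (n + poly pQ n) \<and> w (c + 3) = col_letters x (poly pL n) T (n + poly pQ n))"
proof -
  obtain g1 where g1: "g1 \<noteq> []" "wfs 10 1 g1" "\<forall>x. stg 1 g1 (inp x) (length g1) = replicate (poly pT (length x)) 1"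
    using unary_stages[of "[]" pT] by auto
  obtain g2 where g2: "g2 \<noteq> []" "wfs 10 1 (g1 @ g2)"
    "\<forall>x. stg 1 (g1 @ g2) (inp x) (length (g1 @ g2)) = replicate (poly pL (length x)) 1"
    using unary_stages[OF g1(2), of pL] by blast
  obtain g3 where g3: "g3 \<noteq> []" "wfs 10 1 ((g1 @ g2) @ g3)"
    "\<forall>x. stg 1 ((g1 @ g2) @ g3) (inp x) (length ((g1 @ g2) @ g3)) = replicate (poly pQ (length x)) 1"
    using unary_stages[OF g2(2), of pQ] by blast
  define gs where "gs = (g1 @ g2) @ g3"
  define j1 j2 j3 where "j1 = length g1" and "j2 = length (g1 @ g2)" and "j3 = length gs"
  have j: "0 < j1" "j1 < j2" "j2 < j3" using g1(1) g2(1) g3(1) by (auto simp: j1_def j2_def j3_def gs_def)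
  let ?R = "rowg j1" and ?C = "colg j1 (j3 + 1) (j3 + 2)"
  let ?e = "[xg j3, lg j2, ?R, ?R, ?C, ?C]"
  have gib: "gib n (og l) = 0" for n l by (rule gib_og)
  have "wfs 10 (Suc j3) ?e" using j by (auto simp: xg_def lg_def rowg_def colg_def bodyg_def gib)
  moreover have "wfs 10 1 gs" using g3(2) by (simp only: gs_def)
  ultimately have wf: "wfs 10 1 (gs @ ?e)" unfolding wfs_append j3_def by simp
  have str: "let w = stg 1 (gs @ ?e) (inp x); n = length x; T = Suc (poly pT n) in
     w (j3 + 3) = row_letters T \<and> w (j3 + 3 + 1) = row_letters T \<and>
     w (j3 + 3 + 2) = col_letters x (poly pL n) T (n + poly pQ n) \<and>
     w (j3 + 3 + 3) = col_letters x (poly pL n) T (n + poly pQ n)" for x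
  proof -
    define n T' L m where "n = length x" and "T' = poly pT n" and "L = poly pL n" and "m = poly pQ n"
    define w where "w = stg 1 gs (inp x)"
    have w: "w 0 = map bit_symbol x" "length (w j1) = T'" "length (w j2) = L" "length (w j3) = m"
      using stg_prefix[of 0 "[]" gs] stg_prefix[of j1 g1 "g2 @ g3"] stg_prefix[of j2 "g1 @ g2" g3] g1(3) g2(3) g3(3)
      by (auto simp: w_def gs_def j1_def j2_def j3_def n_def T'_def L_def m_def inp_def)
    define X P where "X = map bit_symbol x @ replicate m 3" and "P = replicate L 1 @ [2::nat]"
    let ?r = "row_letters (Suc T')" and ?c = "col_letters x L (Suc T') (n + m)"
    define w1 where "w1 = w(j3 + 1 := X)"
    define w2 where "w2 = w1(j3 + 2 := P)"
    define w3 where "w3 = w2(j3 + 3 := ?r)"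
    define w4 where "w4 = w3(j3 + 4 := ?r)"
    define w5 where "w5 = w4(j3 + 5 := ?c)"
    define w6 where "w6 = w5(j3 + 6 := ?c)"
    have s1: "fst (gsem w (xg j3) ix k) = X" for ix k unfolding X_def by (rule gsem_xg) (use w in auto)
    have s2: "fst (gsem w1 (lg j2) ix k) = P" for ix k unfolding P_def by (rule gsem_lg) (use w j in \<open>auto simp: w1_def\<close>)
    have s3: "fst (gsem w2 ?R ix k) = ?r" for ix k by (rule gsem_rowg) (use w j in \<open>auto simp: w1_def w2_def\<close>)
    have s4: "fst (gsem w3 ?R ix k) = ?r" for ix k by (rule gsem_rowg) (use w j in \<open>auto simp: w1_def w2_def w3_def\<close>)
    have s5: "fst (gsem w4 ?C ix k) = ?c" for ix k unfolding n_def
      by (rule gsem_colg) (use w j in \<open>auto simp: w1_def w2_def w3_def w4_def X_def P_def\<close>)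
    have s6: "fst (gsem w5 ?C ix k) = ?c" for ix k unfolding n_def
      by (rule gsem_colg) (use w j in \<open>auto simp: w1_def w2_def w3_def w4_def w5_def X_def P_def\<close>)
    have "stg 1 (gs @ ?e) (inp x) = stg (j3 + 1) ?e w" by (simp add: stg_append w_def j3_def)
    also have "\<dots> = w6"
    proof -
      have 6: "Suc (j3 + 1) = j3 + 2" "Suc (j3 + 2) = j3 + 3" "Suc (j3 + 3) = j3 + 4" "Suc (j3 + 4) = j3 + 5"
        "Suc (j3 + 5) = j3 + 6" by auto
      show ?thesis
        unfolding stg.simps 6 s1 w1_def[symmetric] unfolding s2 w2_def[symmetric] unfolding s3 w3_def[symmetric]
        unfolding s4 w4_def[symmetric] unfolding s5 w5_def[symmetric] unfolding s6 w6_def[symmetric] ..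
    qed
    finally have e: "stg 1 (gs @ ?e) (inp x) = w6" .
    show ?thesis unfolding e Let_def n_def[symmetric] T'_def[symmetric] L_def[symmetric] m_def[symmetric]
      by (simp add: w6_def w5_def w4_def w3_def)
  qed
  show ?thesis
    by (rule exI[of _ "gs @ ?e"], rule exI[of _ "j3 + 3"], intro conjI allI)
      (use wf str in \<open>auto simp: j3_def\<close>)
qed

section \<open>The reduction\<close>

lemma computes_within_mono:
  assumes "computes_within M ws w t" "t \<le> t'"
  shows "computes_within M ws w t'"
proof -
  obtain q tps where c: "(tm_step M ^^ t) (tm_init M ws) = (q, tps)" by fastforce
  have q: "q = halt_state M" using assms(1) c by (simp add: computes_within_def)
  have "(tm_step M ^^ j) (q, tps) = (q, tps)" for j
    by (induction j) (auto simp: tm_step_def q)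
  moreover have "(tm_step M ^^ t') (tm_init M ws) = (tm_step M ^^ (t' - t)) ((tm_step M ^^ t) (tm_init M ws))"
    using fun_cong[OF funpow_add[of "t' - t" t "tm_step M"], of "tm_init M ws"] assms(2) by simp
  ultimately have "(tm_step M ^^ t') (tm_init M ws) = (q, tps)" using c by simp
  then show ?thesis using assms(1) c by (simp add: computes_within_def)
qed

theorem All_or_One_Paging_NP_hard: "NP_hard All_or_One_Paging"
  unfolding NP_hard_def
proof (intro allI impI)
  fix L' assume "in_NP L'"
  then obtain v and p2 :: "nat poly" where v: "polytime_computable 2 v"
    and L': "\<And>x. x \<in> L' \<longleftrightarrow> (\<exists>u. length u \<le> poly p2 (length x) \<and> v [x, u] = [True])"
    unfolding in_NP_def by blast
  from v obtain M and p1 :: "nat poly" where M: "wf_tm M" "2 \<le> num_tapes M"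
    and run: "\<And>ws. length ws = 2 \<Longrightarrow> computes_within M ws (v ws) (poly p1 (sum_list (map length ws)))"
    unfolding polytime_computable_def by blast
  interpret machine M by unfold_locales (fact M)+
  \<comment> \<open>The time of the verifier at the largest total length of input and certificate,
    so that one bound serves all certificates.\<close>
  define pT where "pT = pcompose p1 ([:0, 1:] + p2)"
  \<comment> \<open>The summands provide for \<open>2 * T + 2\<close>, which is
    \<open>2 * poly pT n + 4\<close>, and for more columns than \<open>L\<close>.\<close>
  define pQ where "pQ = smult 2 pT + p2 + [:5:]"
  obtain gs c where gs: "wfs 10 1 gs" "c + 3 \<le> length gs"
    and str: "\<And>x. let w = stg 1 gs (inp x); n = length x; T = Suc (poly pT n) in
     w c = row_letters T \<and> w (c + 1) = row_letters T \<and>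
     w (c + 2) = col_letters x (poly p2 n) T (n + poly pQ n) \<and> w (c + 3) = col_letters x (poly p2 n) T (n + poly pQ n)"
    using string_stages[of pT p2 pQ] by blast
  \<comment> \<open>The values of the variables are indices into a list of all cells; a cell may
    have several indices.\<close>
  obtain vals where vals: "set vals = cells" using finite_list[OF finite_cells] by blast
  define bad where "bad a b \<tau> \<longleftrightarrow> \<not> ok a b (vals ! (\<tau> ! 0)) (vals ! (\<tau> ! 1)) (vals ! (\<tau> ! 2)) (vals ! (\<tau> ! 3))" for a b \<tau>
  have "cells \<noteq> {}"
  proof -
    have "0 < num_symbols M" "start_state M < num_states M" using M(1) by (auto simp: wf_tm_def)
    then have "Cell (start_state M) (replicate K 0) True (replicate K 0) True \<in> cells"
      by (auto simp: cells_def syms_def)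
    then show ?thesis by blast
  qed
  then have D: "1 \<le> length vals" using vals by (cases vals) auto
  \<comment> \<open>The generator is fixed by the machine alone; the input enters only through the
    strings on its tapes.\<close>
  interpret gener c "c + 2" "c + 1" "c + 3" "length vals" "[1, 2, 3, 4]" bad
    by unfold_locales (use D in auto)
  have main: "\<exists>y. fst (gsem (stg 1 gs (inp x)) maing (\<lambda>_. 0) 0) = map bit_symbol y \<and>
      (y \<in> All_or_One_Paging \<longleftrightarrow> x \<in> L')" for x
  proof -
    define n L T Q where "n = length x" and "L = poly p2 n" and "T = Suc (poly pT n)" and "Q = n + poly pQ n"
    let ?w = "stg 1 gs (inp x)" and ?tt = "row_letters T" and ?rr = "col_letters x L T Q"
    interpret tableau M x L T Q "\<lambda>u. v [x, u]"
    proof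
      show "1 \<le> T" by (simp add: T_def)
      show "2 * T + 2 \<le> Q" "L < Q" by (auto simp: T_def Q_def pQ_def L_def)
      fix u :: "bool list" assume u: "length u \<le> L"
      have "poly p1 (n + length u) \<le> poly p1 (n + L)" by (rule poly_mono_nat) (use u in simp)
      also have "\<dots> \<le> T" by (simp add: T_def pT_def poly_pcompose L_def)
      finally show "computes_within M [x, u] (v [x, u]) T"
        using computes_within_mono[OF run[of "[x, u]"]] by (simp add: n_def)
    qed
    have in_range: "t + 1 < length ?tt \<and> i + 2 < length ?rr"
      if "t < length ?tt" "i < length ?rr" "?tt ! t \<noteq> 4" "?rr ! i \<noteq> 9" for t i
    proof -
      have t: "t < T + 2" and i: "i < 2 * T + Q + 3" using that(1,2) length_row_letters[OF T] by (auto simp: length_col_letters)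
      have "t \<noteq> T + 1" using that(3) row_letters_nth[OF T t] by auto
      moreover have "i < 2 * T + 1 + Q" using that(4) col_letters_nth[OF i, of x L] by (intro not_le_imp_less notI) simp
      ultimately show ?thesis using t length_row_letters[OF T] by (simp add: length_col_letters)
    qed
    interpret tiling c "c + 2" "c + 1" "c + 3" "length vals" "[1, 2, 3, 4]" bad ?tt ?rr ?w
    proof
      show "?w c = ?tt" "?w (c + 1) = ?tt" "?w (c + 2) = ?rr" "?w (c + 3) = ?rr"
        using str[of x] by (auto simp: Let_def n_def T_def L_def Q_def)
      show "set ?tt \<subseteq> set [1, 2, 3, 4]" by (auto simp: row_letters_def)
      fix t i \<tau> assume "t < length ?tt" "i < length ?rr" "bad (?tt ! t) (?rr ! i) \<tau>"
      then show "t + 1 < length ?tt \<and> i + 2 < length ?rr"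
        using in_range by (auto simp: bad_def ok_def)
    qed
    let ?y = "encode_instance k (map (rq pnum) (net (ops vs))) (int (length (starts (net (ops vs)))))"
    have *: "(\<exists>a. (\<forall>t<length ?tt. \<forall>i<length ?rr. a (t, i) < length vals) \<and>
       (\<forall>t<length ?tt. \<forall>i<length ?rr. \<not> bad (?tt ! t) (?rr ! i) [a (t, i), a (t, i + 1), a (t, i + 2), a (t + 1, i + 1)])) \<longleftrightarrow>
       (\<exists>a. tile a)" (is "?A \<longleftrightarrow> ?B")
    proof
      assume ?A
      then obtain a where a: "\<forall>t<length ?tt. \<forall>i<length ?rr. a (t, i) < length vals"
        "\<forall>t<length ?tt. \<forall>i<length ?rr. \<not> bad (?tt ! t) (?rr ! i) [a (t, i), a (t, i + 1), a (t, i + 2), a (t + 1, i + 1)]"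
        by blast
      have "tile (\<lambda>t i. vals ! a (t, i))"
        unfolding tile_def using a vals nth_mem by (auto simp: bad_def numeral_3_eq_3)
      then show ?B by blast
    next
      assume ?B
      then obtain a where a: "tile a" ..
      have "\<forall>t i. \<exists>j. t < length ?tt \<and> i < length ?rr \<longrightarrow> j < length vals \<and> vals ! j = a t i"
        using a vals unfolding tile_def by (metis in_set_conv_nth)
      then obtain b where b: "\<And>t i. t < length ?tt \<Longrightarrow> i < length ?rr \<Longrightarrow> b t i < length vals \<and> vals ! b t i = a t i"
        by metis
      have "\<not> bad (?tt ! t) (?rr ! i) [b t i, b t (i + 1), b t (i + 2), b (t + 1) (i + 1)]"
        if ti: "t < length ?tt" "i < length ?rr" for t i
      proof
        assume bd: "bad (?tt ! t) (?rr ! i) [b t i, b t (i + 1), b t (i + 2), b (t + 1) (i + 1)]"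
        \<comment> \<open>The indices \<open>b\<close> name the cells of \<open>a\<close> only on
          the board, and a forbidden tuple lies inside it.\<close>
        then have r: "t + 1 < length ?tt \<and> i + 2 < length ?rr" using bad_inside[OF ti] by blast
        have "vals ! b t i = a t i" "vals ! b t (i + 1) = a t (i + 1)" "vals ! b t (i + 2) = a t (i + 2)"
          "vals ! b (t + 1) (i + 1) = a (t + 1) (i + 1)" using b r by auto
        moreover have "ok (?tt ! t) (?rr ! i) (a t i) (a t (i + 1)) (a t (i + 2)) (a (t + 1) (i + 1))"
          using a ti unfolding tile_def by blast
        ultimately show False using bd by (simp add: bad_def numeral_3_eq_3)
      qed
      then show ?A using b by (intro exI[of _ "\<lambda>(t, i). b t i"]) auto
    qed
    have "(\<exists>u. length u \<le> L \<and> v [x, u] = [True]) \<longleftrightarrow> x \<in> L'" by (simp add: L' L_def n_def)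
    from trans[OF instance_iff trans[OF * trans[OF tile_iff this]]] show ?thesis using gsem_maing by blast
  qed
  then obtain f where f: "\<And>x. fst (gsem (stg 1 gs (inp x)) maing (\<lambda>_. 0) 0) = map bit_symbol (f x)"
    "\<And>x. f x \<in> All_or_One_Paging \<longleftrightarrow> x \<in> L'" by metis
  have V: "{c, c + 2, c + 1, c + 3} \<subseteq> {..length gs}" using gs(2) by auto
  have "polytime_computable 1 (\<lambda>ws. f (ws ! 0))"
    by (rule gen_polytime[OF gs(1) _ maing_wf(2)[OF V] maing_wf(1)[OF V] f(1)]) auto
  then show "polytime_reducible L' All_or_One_Paging"
    unfolding polytime_reducible_def using f(2) by blast
qed

theorem theorem8: "NP_complete All_or_One_Paging"
  unfolding NP_complete_def using All_or_One_Paging_in_NP All_or_One_Paging_NP_hard by blast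

end
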